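(* Let $\Omega\subseteq\mathbb{R}^2$ be convex, open and bounded with $C^{1,1}$ boundary, let $a_1,\dots,a_N\in\Omega$ be pairwise distinct points, $\sigma_1,\dots,\sigma_N>0$, and $\overline\mu:=\sum_{i=1}^N\sigma_i\delta_{a_i}$. Let $v_0$ be the unique convex solution of $\mu_{v_0}=\overline\mu$ in $\Omega$, $v_0=0$ on $\partial\Omega$, and let $$E_h(\mathbf{u},v)=\int_\Omega \left|\nabla \mathbf{u}+\nabla \mathbf{u}^T+\nabla v\otimes\nabla v-\nabla v_0\otimes\nabla v_0\right|^2+h^2|\nabla^2 v|^2\,dx .$$ Then there exists $C>0$ that only depends on $\Omega$ and $\overline\mu$ with the following property: for every $h>0$ there exists $(\mathbf{u}_h,v_h)\in W^{1,2}(\Omega;\mathbb{R}^2)\times W^{2,\infty}(\Omega)$ such that $v_h = 0$ on $\partial\Omega$ and $$E_h(\mathbf{u}_h,v_h)\leq C h^{5/3}.$$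
   Context: For a convex function $u:\Omega\to\mathbb{R}$, the subdifferential is $\partial^-u(x):=\{p\in\mathbb{R}^2: p\cdot(y-x)+u(x)\le u(y)\text{ for all }y\in\Omega\}$, and the Monge-Ampère measure of $u$ is $\mu_u(E):=\mathcal L^2(\bigcup_{x\in E}\partial^-u(x))$ for Borel sets $E\subseteq\Omega$. It is known that the problem $\mu_{v_0}=\overline\mu$ in $\Omega$, $v_0=0$ on $\partial\Omega$ has a unique convex solution $v_0\in C^0(\overline\Omega)$. Note that $v_h$ is not required to be convex. *)

theory Defs
  imports "HOL-Analysis.Analysis"
begin

section \<open>Domains of class \<open>C\<^sup>1\<^sup>,\<^sup>1\<close>\<close>

text \<open>Near each boundary point, and in a suitable orthonormal frame \<open>(e1, e2)\<close>, the domain is the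
  strict epigraph of a differentiable function with Lipschitz derivative.  Letting the function be
  defined on the whole line is no restriction, since only its values near one point matter.\<close>

definition C11_boundary :: "(real ^ 2) set \<Rightarrow> bool" where
  "C11_boundary \<Omega> \<longleftrightarrow>
     (\<forall>x\<in>frontier \<Omega>. \<exists>r>0. \<exists>e1 e2. norm e1 = 1 \<and> norm e2 = 1 \<and> e1 \<bullet> e2 = 0 \<and>
        (\<exists>\<gamma> \<gamma>' L. (\<forall>t::real. (\<gamma> has_real_derivative \<gamma>' t) (at t)) \<and> L-lipschitz_on UNIV \<gamma>' \<and>
           \<Omega> \<inter> ball x r = {y \<in> ball x r. y \<bullet> e2 > \<gamma> (y \<bullet> e1)}))"

section \<open>Monge-Ampere measure and Dirichlet problem\<close>

definition subdifferential :: "(real ^ 2) set \<Rightarrow> (real ^ 2 \<Rightarrow> real) \<Rightarrow> real ^ 2 \<Rightarrow> (real ^ 2) set" where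
  "subdifferential \<Omega> u x = {p. \<forall>y\<in>\<Omega>. p \<bullet> (y - x) + u x \<le> u y}"

text \<open>The union below need not be a Borel set for Borel \<open>E\<close>; it is Lebesgue measurable whenever
  \<open>u\<close> is convex, hence \<open>lebesgue\<close> instead of \<open>lborel\<close>.\<close>

definition monge_ampere :: "(real ^ 2) set \<Rightarrow> (real ^ 2 \<Rightarrow> real) \<Rightarrow> (real ^ 2) set \<Rightarrow> ennreal" where
  "monge_ampere \<Omega> u E = emeasure lebesgue (\<Union>x\<in>E. subdifferential \<Omega> u x)"

text \<open>The measure \<open>\<Sum>i=1..N. \<sigma> i * \<delta>_(a i)\<close>, as a set function.\<close>

definition dirac_sum :: "nat \<Rightarrow> (nat \<Rightarrow> real ^ 2) \<Rightarrow> (nat \<Rightarrow> real) \<Rightarrow> (real ^ 2) set \<Rightarrow> ennreal" where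
  "dirac_sum N a \<sigma> E = (\<Sum>i=1..N. ennreal (\<sigma> i) * indicator E (a i))"

definition monge_ampere_solution ::
    "(real ^ 2) set \<Rightarrow> ((real ^ 2) set \<Rightarrow> ennreal) \<Rightarrow> (real ^ 2 \<Rightarrow> real) \<Rightarrow> bool" where
  "monge_ampere_solution \<Omega> \<mu> v \<longleftrightarrow>
     convex_on \<Omega> v \<and> continuous_on (closure \<Omega>) v \<and>
     (\<forall>E\<in>sets borel. E \<subseteq> \<Omega> \<longrightarrow> monge_ampere \<Omega> v E = \<mu> E) \<and>
     (\<forall>x\<in>frontier \<Omega>. v x = 0)"

section \<open>Weak derivatives and Sobolev spaces\<close>

primrec C_k :: "nat \<Rightarrow> (real ^ 2 \<Rightarrow> real) \<Rightarrow> bool" where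
  "C_k 0 f \<longleftrightarrow> continuous_on UNIV f"
| "C_k (Suc k) f \<longleftrightarrow> (\<exists>g :: real ^ 2 \<Rightarrow> real ^ 2.
     (\<forall>x. (f has_derivative (\<lambda>w. g x \<bullet> w)) (at x)) \<and> (\<forall>i. C_k k (\<lambda>x. g x $ i)))"

definition test_function :: "(real ^ 2) set \<Rightarrow> (real ^ 2 \<Rightarrow> real) \<Rightarrow> bool" where
  "test_function \<Omega> \<phi> \<longleftrightarrow>
     (\<forall>k. C_k k \<phi>) \<and> compact (closure {x. \<phi> x \<noteq> 0}) \<and> closure {x. \<phi> x \<noteq> 0} \<subseteq> \<Omega>"

definition locally_integrable :: "(real ^ 2) set \<Rightarrow> (real ^ 2 \<Rightarrow> real) \<Rightarrow> bool" where
  "locally_integrable \<Omega> f \<longleftrightarrow> (\<forall>K. compact K \<longrightarrow> K \<subseteq> \<Omega> \<longrightarrow> set_integrable lebesgue K f)"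

definition has_weak_partial ::
    "(real ^ 2) set \<Rightarrow> 2 \<Rightarrow> (real ^ 2 \<Rightarrow> real) \<Rightarrow> (real ^ 2 \<Rightarrow> real) \<Rightarrow> bool" where
  "has_weak_partial \<Omega> i f g \<longleftrightarrow>
     locally_integrable \<Omega> f \<and> locally_integrable \<Omega> g \<and>
     (\<forall>\<phi>. test_function \<Omega> \<phi> \<longrightarrow>
        (LINT x:\<Omega>|lebesgue. f x * frechet_derivative \<phi> (at x) (axis i 1)) =
        - (LINT x:\<Omega>|lebesgue. g x * \<phi> x))"

text \<open>A representative of the weak partial derivative, which is unique up to a null set in \<open>\<Omega>\<close>.
  It is arbitrary if there is no weak partial derivative.\<close>

definition weak_partial :: "(real ^ 2) set \<Rightarrow> 2 \<Rightarrow> (real ^ 2 \<Rightarrow> real) \<Rightarrow> real ^ 2 \<Rightarrow> real" where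
  "weak_partial \<Omega> i f = (SOME g. has_weak_partial \<Omega> i f g)"

definition L2 :: "(real ^ 2) set \<Rightarrow> (real ^ 2 \<Rightarrow> real) \<Rightarrow> bool" where
  "L2 \<Omega> f \<longleftrightarrow>
     set_borel_measurable lebesgue \<Omega> f \<and> set_integrable lebesgue \<Omega> (\<lambda>x. (f x)\<^sup>2)"

definition Linf :: "(real ^ 2) set \<Rightarrow> (real ^ 2 \<Rightarrow> real) \<Rightarrow> bool" where
  "Linf \<Omega> f \<longleftrightarrow>
     set_borel_measurable lebesgue \<Omega> f \<and> (\<exists>M. AE x\<in>\<Omega> in lebesgue. \<bar>f x\<bar> \<le> M)"

definition W12 :: "(real ^ 2) set \<Rightarrow> (real ^ 2 \<Rightarrow> real ^ 2) set" where
  "W12 \<Omega> = {u. \<forall>i. L2 \<Omega> (\<lambda>x. u x $ i) \<and>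
     (\<forall>j. \<exists>g. has_weak_partial \<Omega> j (\<lambda>x. u x $ i) g \<and> L2 \<Omega> g)}"

definition W2inf :: "(real ^ 2) set \<Rightarrow> (real ^ 2 \<Rightarrow> real) set" where
  "W2inf \<Omega> = {v. Linf \<Omega> v \<and>
     (\<forall>i. \<exists>g. has_weak_partial \<Omega> i v g \<and> Linf \<Omega> g \<and>
        (\<forall>j. \<exists>k. has_weak_partial \<Omega> j g k \<and> Linf \<Omega> k))}"

definition grad :: "(real ^ 2) set \<Rightarrow> (real ^ 2 \<Rightarrow> real) \<Rightarrow> real ^ 2 \<Rightarrow> real ^ 2" where
  "grad \<Omega> v x = (\<chi> i. weak_partial \<Omega> i v x)"

definition hessian :: "(real ^ 2) set \<Rightarrow> (real ^ 2 \<Rightarrow> real) \<Rightarrow> real ^ 2 \<Rightarrow> real ^ 2 ^ 2" where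
  "hessian \<Omega> v x = (\<chi> i j. weak_partial \<Omega> j (weak_partial \<Omega> i v) x)"

definition vgrad :: "(real ^ 2) set \<Rightarrow> (real ^ 2 \<Rightarrow> real ^ 2) \<Rightarrow> real ^ 2 \<Rightarrow> real ^ 2 ^ 2" where
  "vgrad \<Omega> u x = (\<chi> i j. weak_partial \<Omega> j (\<lambda>y. u y $ i) x)"

section \<open>The energy\<close>

definition tensor :: "real ^ 2 \<Rightarrow> real ^ 2 \<Rightarrow> real ^ 2 ^ 2" where
  "tensor p q = (\<chi> i j. p $ i * q $ j)"

text \<open>The norm of type \<open>real ^ 2 ^ 2\<close> is the Frobenius norm.  The integral is the one of a
  nonnegative function with values in \<open>ennreal\<close>, so that a divergent integral is \<open>\<infinity>\<close> and not \<open>0\<close>.\<close>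

definition energy ::
    "(real ^ 2) set \<Rightarrow> (real ^ 2 \<Rightarrow> real) \<Rightarrow> real \<Rightarrow> (real ^ 2 \<Rightarrow> real ^ 2) \<Rightarrow> (real ^ 2 \<Rightarrow> real) \<Rightarrow> ennreal" where
  "energy \<Omega> v0 h u v =
     (\<integral>\<^sup>+x\<in>\<Omega>. ennreal (
        (norm (vgrad \<Omega> u x + transpose (vgrad \<Omega> u x)
               + tensor (grad \<Omega> v x) (grad \<Omega> v x) - tensor (grad \<Omega> v0 x) (grad \<Omega> v0 x)))\<^sup>2
        + h\<^sup>2 * (norm (hessian \<Omega> v x))\<^sup>2) \<partial>lebesgue)"

end

theory Submission
 imports Defs
begin

text \<open>
  The solution \<open>v\<close> is the convex envelope of its values at the atoms and of zero boundary values.  Every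
  contact set of a supporting plane is the convex hull of atoms and boundary points, so apart from the atoms the gradient of \<open>v\<close>
  jumps only across \<^emph>\<open>ridges\<close>, open segments between two atoms that admit several common slopes.  Off this
  singular set \<open>v\<close> is convex and touched from above by parabolas of opening \<open>C / dist(x, atoms)\<close> (the interior ball condition
  enters for contact sets that reach the boundary), hence \<open>\<bar>D\<^sup>2 v\<bar> \<le> C / dist(x, atoms)\<close>.
  Near a ridge of length \<open>L\<close>, \<open>v\<close> is affine plus \<open>\<kappa> \<bar>y\<bar>\<close> on a thin rhombus.  There \<open>\<bar>y\<bar>\<close> is replaced by
  \<open>\<delta>(s) \<phi>(y / \<delta>(s))\<close> with \<open>\<delta>(s) = h powr (1/3) * (s (L - s)) powr (2/3)\<close>, where \<open>\<phi>\<close> agrees with \<open>\<bar>\<cdot>\<bar>\<close>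
  outside \<open>[-1, 1]\<close> and \<open>\<integral> (1 - \<phi>'\<^sup>2) = 0\<close>; the in-plane displacement then cancels all strain components except
  the one along the ridge, which is of order \<open>\<delta>'\<^sup>2 + \<delta> \<bar>\<delta>''\<bar>\<close>.  Stretching and bending densities are both of order
  \<open>h powr (4/3) * (s (L - s)) powr (-4/3)\<close> on a strip of width \<open>\<delta>(s)\<close>, which integrates to \<open>C h powr (5/3)\<close>.
  On discs of radius of order \<open>h\<close> around the atoms the deformation is cut off, at cost \<open>C h\<^sup>2\<close>, and the remaining
  bending energy is at most \<open>C h\<^sup>2 \<bar>ln h\<bar>\<close>.
\<close>

text \<open>The width of the strips comes from a balance. On a strip of width \<delta> the squared
  strain is of order \<delta>'^4 and the squared bending of order h^2/\<delta>^2; equating them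
  gives \<delta> \<delta>'^2 of order h, that is \<delta> of order h^(1/3) s^(2/3) near an end. Such
  a strip fits into a rhombus of opening c s only if s exceeds a multiple of h, which is why discs
  of radius of order h must be cut out around the atoms. With \<open>h = \<eta>^3\<close> these
  scales become \<eta> s^(2/3) and \<eta>^3. The energy is formed with arbitrarily chosen weak
  derivatives, so classical bounds have to be transferred almost everywhere. The Hessian is never
  formed: pointwise Lipschitz bounds of the gradient control it. The constant must be fixed before
  the solution. A comparison principle makes the solution unique, so a constant obtained from one
  solution serves for all, and for h bounded away from 0 the zero deformation is already good
  enough.\<close>

notation scaleR (infixr "*R" 75)

section \<open>Smooth test functions supported in boxes\<close>

lemma C_k_mono: "C_k (Suc k) f ==> C_k k f"
proof (induction k arbitrary: f)
 case 0
 then obtain g :: "real^2 => real^2" where "!!x. (f has_derivative (%w. g x\<bullet>w)) (at x)" by auto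
 then show ?case by (auto intro!: has_derivative_continuous_on simp: has_derivative_at_withinI)
next
 case (Suc k)
 then obtain g :: "real^2 => real^2" where "!!x. (f has_derivative (%w. g x\<bullet>w)) (at x)"
   "!!i. C_k (Suc k) (%x. g x $ i)" unfolding C_k.simps(2)[of "Suc k"] by blast
 then show ?case by (subst C_k.simps(2)) (intro exI[of _ g] conjI allI Suc.IH)
qed

lemma C_k_add: "C_k k f ==> C_k k g ==> C_k k (%x. f x + g x)"
proof (induction k arbitrary: f g)
 case 0
 then show ?case by (simp add: continuous_on_add)
next
 case (Suc k)
 then obtain Df Dg :: "real^2 => real^2" where
  "!!x. (f has_derivative (%w. Df x\<bullet>w)) (at x)" "!!i. C_k k (%x. Df x $ i)"
  "!!x. (g has_derivative (%w. Dg x\<bullet>w)) (at x)" "!!i. C_k k (%x. Dg x $ i)"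
  unfolding C_k.simps(2) by blast
 then have "!!x. ((%x. f x + g x) has_derivative (%w. (Df x + Dg x)\<bullet>w)) (at x)"
   "!!i. C_k k (%x. (Df x + Dg x) $ i)" using Suc.IH by (auto intro!: derivative_eq_intros simp: inner_add_left)
 then show ?case by (subst C_k.simps(2)) (intro exI[of _ "%x. Df x + Dg x"] conjI allI)
qed

lemma C_k_mult: "C_k k f ==> C_k k g ==> C_k k (%x. f x*g x)"
proof (induction k arbitrary: f g)
 case 0
 then show ?case by (simp add: continuous_on_mult)
next
 case (Suc k)
 then obtain Df Dg :: "real^2 => real^2" where
  *: "!!x. (f has_derivative (%w. Df x\<bullet>w)) (at x)" "!!i. C_k k (%x. Df x $ i)"
  "!!x. (g has_derivative (%w. Dg x\<bullet>w)) (at x)" "!!i. C_k k (%x. Dg x $ i)"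
  unfolding C_k.simps(2) by blast
 have "C_k k f" "C_k k g" using Suc.prems C_k_mono by blast+
 then have "C_k k (%x. (f x *R Dg x + g x *R Df x) $ i)" for i using * by (auto intro!: C_k_add Suc.IH)
 moreover have "((%x. f x*g x) has_derivative (%w. (f x *R Dg x + g x *R Df x)\<bullet>w)) (at x)" for x
  using * by (auto intro!: derivative_eq_intros simp: inner_add_left)
 ultimately show ?case
  by (subst C_k.simps(2)) (intro exI[of _ "%x. f x *R Dg x + g x *R Df x"] conjI allI)
qed

lemma C_k_const: "C_k k (%x. c)" by (induction k arbitrary: c) (auto intro!: exI[of _ "%x. 0"])

lemma C_k_prod: "finite I ==> (!!i. i \<in> I ==> C_k k (f i)) ==> C_k k (%x. \<Prod>i\<in>I. f i x)"
proof (induction I rule: finite_induct)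
 case empty
 show ?case by (simp add: C_k_const)
qed (auto intro!: C_k_mult)

text \<open>The whole sequence of derivatives is carried along, so that the induction over
  \<open>k\<close> can pass from \<open>F n\<close> to \<open>F (Suc n)\<close>.\<close>

lemma C_k_smooth_real:
 fixes F :: "nat => real => real" assumes F: "!!n t. (F n has_real_derivative F (Suc n) t) (at t)"
 shows "C_k k (%x. F n (\<alpha>*x $ i + \<beta>))"
proof (induction k arbitrary: n)
 case 0
 have "continuous_on UNIV (F n)" using F by (meson DERIV_continuous_on has_field_derivative_at_within)
 then show ?case by (auto intro!: continuous_intros continuous_on_compose2[of UNIV "F n"])
next
 case (Suc k)
 have D: "((%x::real^2. F n (\<alpha>*x $ i + \<beta>)) has_derivative
     (%w. (F (Suc n) (\<alpha>*x $ i + \<beta>)*\<alpha>) *R axis i 1\<bullet>w)) (at x)" for x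
 proof -
  have "((%x::real^2. \<alpha>*x $ i + \<beta>) has_derivative (%w. \<alpha>*w $ i)) (at x)"
   by (auto intro!: derivative_eq_intros bounded_linear_imp_has_derivative bounded_linear_vec_nth)
  from has_derivative_compose[OF this F[of n "\<alpha>*x $ i + \<beta>", unfolded has_field_derivative_def]]
  show ?thesis by (simp add: inner_axis' mult_ac)
 qed
 have C: "C_k k (%x. ((F (Suc n) (\<alpha>*x $ i + \<beta>)*\<alpha>) *R axis i 1 :: real^2) $ j)" for j
 proof -
  have "C_k k (%x. F (Suc n) (\<alpha>*x $ i + \<beta>)*(\<alpha>*(axis i 1 :: real^2) $ j))"
   by (intro C_k_mult Suc.IH C_k_const)
  then show ?thesis by (simp add: mult_ac)
 qed
 show ?case using C D
  by (subst C_k.simps(2)) (intro exI[of _ "%x. (F (Suc n) (\<alpha>*x $ i + \<beta>)*\<alpha>) *R axis i 1"] conjI allI)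
qed

text \<open>The standard function that is flat at 0. Only its dilations
  \<open>smooth_step (real n * t)\<close> approach a step, the indicator of
  \<open>t > 0\<close>.\<close>

definition smooth_step :: "real => real" where
 "smooth_step t = (if t > 0 then exp (- 1/t) else 0)"

lemma poly_exp_tendsto_0: "((%s. poly q s*exp (- s)) \<longlongrightarrow> (0::real)) at_top"
proof -
 have "((%s. \<Sum>i\<le>degree q. coeff q i*(s^i/exp s)) \<longlongrightarrow> (\<Sum>i\<le>degree q. coeff q i*0)) at_top"
  by (intro tendsto_intros tendsto_power_div_exp_0)
 then show ?thesis by (simp add: poly_altdef sum_distrib_right exp_minus divide_inverse mult.assoc)
qed

text \<open>For t > 0 every derivative has the form P(1/t) exp(-1/t) with a polynomial P. At 0 all
  difference quotients tend to 0, because the exponential beats every polynomial.\<close>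

lemma smooth_step_derivs:
 obtains F :: "nat => real => real" where "F 0 = smooth_step"
  "!!n t. (F n has_real_derivative F (Suc n) t) (at t)"
proof -
 \<comment> \<open>With s = 1/t, differentiating P(s) exp(-s) in t produces s^2 (P(s) - P'(s))
   exp(-s).\<close>
 define P where "P = rec_nat [:1::real:] (%_ p. monom 1 2*(p - pderiv p))"
 have P: "P 0 = 1" "P (Suc n) = monom 1 2*(P n - pderiv (P n))" for n by (simp_all add: P_def one_pCons)
 define F where "F n t = (if t > 0 then poly (P n) (1/t)*exp (- (1/t)) else 0)" for n t
 have lim0: "((%t. poly q (1/t)*exp (- (1/t))) \<longlongrightarrow> 0) (at_right 0)" for q :: "real poly"
  using filterlim_compose[OF poly_exp_tendsto_0 filterlim_inverse_at_top_right, of q] by (simp add: inverse_eq_divide)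
 have "(F n has_real_derivative F (Suc n) t) (at t)" for n t
 proof (cases t "0::real" rule: linorder_cases)
  case less
  have "((%_. 0) has_real_derivative 0) (at t)" by simp
  then have "(F n has_real_derivative 0) (at t)" by (rule has_field_derivative_transform_within_open[where S = "{..<0}"])
    (use less in \<open>auto simp: F_def\<close>)
  then show ?thesis using less by (simp add: F_def)
 next
  case greater
  have "((%t. poly (P n) (1/t)*exp (- (1/t))) has_real_derivative F (Suc n) t) (at t)" using greater
   by (auto intro!: derivative_eq_intros simp: F_def P poly_monom divide_simps power2_eq_square)
    (simp add: algebra_simps)
  then show ?thesis by (rule has_field_derivative_transform_within_open[where S = "{0<..}"])
    (use greater in \<open>auto simp: F_def\<close>)
 next
  case equal
  have "((%h. F n h/h) \<longlongrightarrow> 0) (at 0)"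
  proof (rule filterlim_split_at_real)
   show "((%h. F n h/h) \<longlongrightarrow> 0) (at_left 0)"
    by (rule tendsto_eventually) (auto simp: F_def eventually_at_left_field intro: exI[of _ "-1"])
   have "\<forall>\<^sub>F h in at_right 0. poly (monom 1 1*P n) (1/h)*exp (- (1/h)) = F n h/h"
    by (auto simp: F_def eventually_at_right_field poly_monom intro!: exI[of _ 1])
   then show "((%h. F n h/h) \<longlongrightarrow> 0) (at_right 0)"
    using lim0 by (rule Lim_transform_eventually[rotated])
  qed
  then show ?thesis using equal by (simp add: DERIV_def F_def)
 qed
 moreover have "F 0 = smooth_step" by (auto simp: F_def smooth_step_def P fun_eq_iff)
 ultimately show thesis using that by blast
qed

lemma smooth_step_bounds: "0 <= smooth_step t" "smooth_step t <= 1" by (auto simp: smooth_step_def)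

text \<open>Smooth, zero outside the box, and increasing to its indicator as \<open>n\<close> grows.
  This makes indicators of boxes dominated limits of test functions.\<close>

definition box_bump :: "nat => real^2 => real^2 => real^2 => real" where
 "box_bump n a b x = (\<Prod>i\<in>UNIV. smooth_step (real n*(x $ i - a $ i)) * smooth_step (real n*(b $ i - x $ i)))"

lemma C_k_box_bump: "C_k k (box_bump n a b)"
proof -
 obtain F where F: "F 0 = smooth_step" "!!n t. (F n has_real_derivative F (Suc n) t) (at t)" using smooth_step_derivs by blast
 have *: "C_k k (%x. smooth_step (real n*(x $ i - a $ i)))" for i
  using C_k_smooth_real[where F = F, OF F(2), of k 0 "real n" i "- real n*a $ i"] F(1) by (simp add: algebra_simps)
 have **: "C_k k (%x. smooth_step (real n*(b $ i - x $ i)))" for i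
  using C_k_smooth_real[where F = F, OF F(2), of k 0 "- real n" i "real n*b $ i"] F(1) by (simp add: algebra_simps)
 show ?thesis unfolding box_bump_def[abs_def] by (intro C_k_prod C_k_mult * **) auto
qed

lemma box_bump_nonzero: "box_bump n a b x ~= 0 ==> x \<in> box a b"
 by (auto simp: box_bump_def smooth_step_def mem_box_cart zero_less_mult_iff split: if_splits)

lemma box_bump_bounds: "0 <= box_bump n a b x" "box_bump n a b x <= 1" unfolding box_bump_def
 by (auto intro!: prod_nonneg prod_le_1 mult_nonneg_nonneg mult_le_one smooth_step_bounds)

lemma test_function_box_bump: assumes "cbox a b \<subseteq> \<Omega>" shows "test_function \<Omega> (box_bump n a b)"
proof -
 have sub: "closure {x. box_bump n a b x ~= 0} \<subseteq> cbox a b"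
  by (rule closure_minimal) (use box_bump_nonzero box_subset_cbox in blast)+
 then show ?thesis using assms C_k_box_bump bounded_subset[OF bounded_cbox sub]
  by (auto simp: test_function_def compact_eq_bounded_closed)
qed

lemma box_bump_tendsto: "(%n. box_bump n a b x) \<longlonglongrightarrow> indicator (box a b) x"
proof (cases "x \<in> box a b")
 case True
 have s: "(%n. smooth_step (real n*c)) \<longlonglongrightarrow> 1" if "c > 0" for c
 proof -
  have "(%n. exp (- (1/c)*(1/real n))) \<longlonglongrightarrow> exp (- (1/c)*0)"
   by (intro tendsto_intros lim_1_over_n)
  moreover have "\<forall>\<^sub>F n in sequentially. exp (- (1/c)*(1/real n)) = smooth_step (real n*c)"
   using eventually_gt_at_top[of 0] by eventually_elim (use that in \<open>auto simp: smooth_step_def field_simps\<close>)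
  ultimately show ?thesis by (simp add: tendsto_cong)
 qed
 have "(%n. box_bump n a b x) \<longlonglongrightarrow> (\<Prod>i\<in>(UNIV::2 set). 1*1)"
  unfolding box_bump_def using True by (intro tendsto_intros s) (auto simp: mem_box_cart)
 then show ?thesis using True by simp
next
 case False
 then have "box_bump n a b x = 0" for n using box_bump_nonzero by blast
 then show ?thesis using False by simp
qed

section \<open>Uniqueness of weak derivatives\<close>

text \<open>Boxes form an intersection-stable generator of the Borel sets, so the vanishing of the
  integrals spreads by Dynkin's argument. The whole space comes first, as a limit of boxes, because
  the complement step needs it.\<close>

lemma AE_zero_if_box_integrals_zero:
 fixes g :: "'a::euclidean_space => real" assumes g: "integrable lborel g" and box0: "!!a b. (LINT x:box a b|lborel. g x) = 0"
 shows "AE x in lborel. g x = 0"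
proof (rule sigma_finite_measure.density_zero[OF sigma_finite_lborel g])
 fix A :: "'a set" assume "A \<in> sets lborel"
 then have A: "A \<in> sigma_sets UNIV (range (%(a, b). box a b))" by (simp add: borel_eq_box)
 have meas: "A \<in> sigma_sets UNIV (range (%(a, b). box a b)) ==> A \<in> sets lborel" for A :: "'a set"
  by (simp add: borel_eq_box)
 have int: "set_integrable lborel A g" if "A \<in> sets lborel" for A
  using integrable_mult_indicator[of A lborel g] g that by (simp add: set_integrable_def)
 have UN: "(\<Union>n::nat. box (- (real n *R One)) (real n *R One)) = (UNIV :: 'a set)" by (rule UN_box_eq_UNIV)
 have "(%n::nat. LINT x:box (- (real n *R One)) (real n *R One)|lborel. g x) \<longlonglongrightarrow>
     (LINT x:(\<Union>n::nat. box (- (real n *R One)) (real n *R One))|lborel. g x)"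
 proof (rule set_integral_cont_up)
  show "incseq (%n::nat. box (- (real n *R One)) (real n *R One :: 'a))"
   by (auto simp: incseq_def subset_eq mem_box) (smt (verit, ccfv_SIG) of_nat_mono)+
 qed (auto intro!: int)
 then have UNIV0: "(LINT x:UNIV|lborel. g x) = 0" unfolding UN using box0 by (simp add: LIMSEQ_const_iff)
 have "Int_stable (range (%(a, b). box a b :: 'a set))" by (auto simp: Int_stable_def box_Int_box)
 then show "(LINT x:A|lborel. g x) = 0"
  using subset_UNIV[of "range (%(a, b). box a b :: 'a set)", unfolded Pow_UNIV[symmetric]] A
 proof (induction rule: sigma_sets_induct_disjoint)
  case (basic A)
  then show ?case using box0 by auto
 next
  case empty
  show ?case by (simp add: set_lebesgue_integral_def)
 next
  case (compl A)
  have "(LINT x:UNIV|lborel. g x) = (LINT x:A|lborel. g x) + (LINT x:UNIV - A|lborel. g x)"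
   using set_integral_Un[of A "UNIV - A" lborel g] meas[OF compl(1)] int by auto
  then show ?case using compl UNIV0 by simp
 next
  case (union A)
  have Ai: "A i \<in> sets lborel" for i using union(2) meas by blast
  then have "(\<Union>i. A i) \<in> sets lborel" by blast
  then have "(LINT x:(\<Union>i. A i)|lborel. g x) = (\<Sum>i. LINT x:A i|lborel. g x)"
   using union(1) Ai by (intro lebesgue_integral_countable_add int)
    (auto simp: disjoint_family_on_def)
  then show ?case using union by simp
 qed
qed

lemma test_function_properties: assumes "test_function \<Omega> \<phi>"
 shows "continuous_on UNIV \<phi>" and "\<phi> \<in> borel_measurable lebesgue" (is ?B)
  and "\<exists>B>0. \<forall>x. \<bar>\<phi> x\<bar> <= B" (is ?C)
  and "\<exists>g. continuous_on UNIV g \<and> (\<forall>x. (\<phi> has_derivative (%w. g x\<bullet>w)) (at x))" (is ?D)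
proof -
 have C: "C_k k \<phi>" for k using assms by (simp add: test_function_def)
 from C[of 0] show cont: "continuous_on UNIV \<phi>" by simp
 then show ?B by (intro measurable_completion) (simp add: borel_measurable_continuous_onI)
 have "compact (closure {x. \<phi> x ~= 0})" using assms by (simp add: test_function_def)
 then have "bounded (\<phi> ` closure {x. \<phi> x ~= 0})"
  using cont by (intro compact_imp_bounded compact_continuous_image) (auto intro: continuous_on_subset)
 then obtain B where B: "!!x. x \<in> closure {x. \<phi> x ~= 0} ==> \<bar>\<phi> x\<bar> <= B" "B > 0"
  unfolding bounded_pos by (metis image_eqI real_norm_def)
 have "\<bar>\<phi> x\<bar> <= B" for x using B closure_subset[of "{x. \<phi> x ~= 0}"] by (cases "\<phi> x = 0") auto
 then show ?C using B(2) by blast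
 from C[of "Suc (Suc 0)"] obtain g :: "real^2 => real^2" where
  g: "!!x. (\<phi> has_derivative (%w. g x\<bullet>w)) (at x)" "!!i. C_k (Suc 0) (%x. g x $ i)"
  unfolding C_k.simps(2)[of "Suc 0"] by blast
 then have "continuous_on UNIV (%x. g x $ i)" for i using C_k_mono[OF g(2)] by simp
 then have "continuous_on UNIV g" using continuous_on_vec_lambda[of UNIV "%i x. g x $ i"] by simp
 with g show ?D by blast
qed

lemma locally_integrable_mult_test_function: assumes "locally_integrable \<Omega> g" "test_function \<Omega> \<phi>"
 shows "set_integrable lebesgue \<Omega> (%x. g x*\<phi> x)"
proof -
 let ?K = "closure {x. \<phi> x ~= 0}"
 have K: "compact ?K" "?K \<subseteq> \<Omega>" using assms(2) by (auto simp: test_function_def)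
 then have "set_integrable lebesgue ?K g" using assms(1) by (simp add: locally_integrable_def)
 obtain B where B: "!!x. \<bar>\<phi> x\<bar> <= B" "B > 0" using test_function_properties(3)[OF assms(2)] by blast
 have gK: "integrable lebesgue (%x. indicator ?K x *R g x)"
  using \<open>set_integrable lebesgue ?K g\<close> by (simp add: set_integrable_def)
 then have "integrable lebesgue (%x. B*(indicator ?K x *R g x))" by simp
 then have "integrable lebesgue (%x. \<phi> x*(indicator ?K x *R g x))"
 proof (rule Bochner_Integration.integrable_bound)
  show "(%x. \<phi> x*(indicator ?K x *R g x)) \<in> borel_measurable lebesgue"
   using test_function_properties(2)[OF assms(2)] gK by (intro borel_measurable_times) auto
 qed (use B in \<open>auto simp: abs_mult indicator_def intro!: mult_right_mono\<close>)
 also have "(%x. \<phi> x*(indicator ?K x *R g x)) = (%x. indicator \<Omega> x *R (g x*\<phi> x))"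
  using K(2) closure_subset[of "{x. \<phi> x ~= 0}"] by (auto simp: fun_eq_iff indicator_def)
 finally show ?thesis by (simp add: set_integrable_def)
qed

text \<open>Fundamental lemma of the calculus of variations. Bumps that converge to the indicator of
  a box make all box integrals of \<open>g\<close> vanish, and countably many rational boxes exhaust
  the open set.\<close>

lemma test_function_integrals_zero_imp_AE_zero: assumes "open \<Omega>" and g: "locally_integrable \<Omega> g"
  and zero: "!!\<phi>. test_function \<Omega> \<phi> ==> (LINT x:\<Omega>|lebesgue. g x*\<phi> x) = 0"
 shows "AE x\<in>\<Omega> in lebesgue. g x = 0"
proof -
 have box: "AE x in lebesgue. x \<in> cbox c d --> g x = 0" if cd: "cbox c d \<subseteq> \<Omega>" for c d
 proof -
  define h where "h x = indicator (box c d) x*g x" for x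
  have gi: "set_integrable lebesgue (cbox c d) g" using g cd by (simp add: locally_integrable_def)
  have h: "integrable lebesgue h" using set_integrable_subset[OF gi, of "box c d"] box_subset_cbox[of c d]
   by (simp add: set_integrable_def h_def[abs_def])
  \<comment> \<open>The box criterion is about \<open>lborel\<close>, so the Lebesgue measurable
    \<open>h\<close> is replaced by a Borel representative.\<close>
  then obtain h' where h': "h' \<in> borel_measurable lborel" "AE x in lborel. h x = h' x"
   using completion_ex_borel_measurable_real[of h lborel] by auto
  have hh': "AE x in lebesgue. h x = h' x" using h'(2) by (rule AE_completion)
  have ih': "integrable lborel h'"
  proof -
   have "integrable lebesgue h'" using h'(1) hh' by (intro integrable_cong_AE_imp[OF h] measurable_completion) auto
   then show ?thesis using h'(1) by (simp add: integrable_completion)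
  qed
  have "(LINT x:box a b|lborel. h' x) = 0" for a b
  proof -
   have "box a b \<inter> box c d \<subseteq> box c d" by simp
   obtain a' b' where ab': "box a b \<inter> box c d = box a' b'" by (simp add: box_Int_box)
   have sub: "cbox a' b' \<subseteq> cbox c d" if "box a' b' ~= {}" using that ab' closure_box[of a' b'] closure_box[of c d]
    by (metis box_eq_empty(1) closure_box closure_mono inf_le2 subset_empty)
   have lim0: "(LINT x:box a' b'|lebesgue. g x) = 0"
   proof (cases "box a' b' = {}")
    case False
    then have s: "cbox a' b' \<subseteq> \<Omega>" using sub cd by blast
    have "(%n. LINT x|lebesgue. indicator \<Omega> x *R (g x*box_bump n a' b' x)) \<longlonglongrightarrow>
         (LINT x|lebesgue. indicator (box a' b') x *R g x)"
    proof (rule integral_dominated_convergence)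
     show "integrable lebesgue (%x. indicator (cbox c d) x *R \<bar>g x\<bar>)"
      using set_integrable_abs[OF gi] by (simp add: set_integrable_def)
     show "AE x in lebesgue. (%i. indicator \<Omega> x *R (g x*box_bump i a' b' x)) \<longlonglongrightarrow> indicator (box a' b') x *R g x"
     proof (intro AE_I2)
      fix x
      have "(%i. indicator \<Omega> x *R (g x*box_bump i a' b' x)) \<longlonglongrightarrow> indicator \<Omega> x *R (g x*indicator (box a' b') x)"
       by (intro tendsto_intros box_bump_tendsto)
      then show "(%i. indicator \<Omega> x *R (g x*box_bump i a' b' x)) \<longlonglongrightarrow> indicator (box a' b') x *R g x"
       using s box_subset_cbox[of a' b'] by (auto simp: indicator_def split: if_splits)
     qed
     show "AE x in lebesgue. norm (indicator \<Omega> x *R (g x*box_bump n a' b' x)) <= indicator (cbox c d) x *R \<bar>g x\<bar>" for n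
     proof (intro AE_I2)
      fix x
      show "norm (indicator \<Omega> x *R (g x*box_bump n a' b' x)) <= indicator (cbox c d) x *R \<bar>g x\<bar>"
       using box_bump_nonzero[of n a' b' x] box_bump_bounds[of n a' b' x] sub[OF False] box_subset_cbox[of a' b']
       by (cases "box_bump n a' b' x = 0")
         (auto simp: indicator_def abs_mult mult_left_le)
     qed
     show "(%x. indicator (box a' b') x *R g x) \<in> borel_measurable lebesgue"
      using set_integrable_subset[OF gi, of "box a' b'"] sub[OF False] box_subset_cbox[of a' b']
      by (auto simp: set_integrable_def)
     show "(%x. indicator \<Omega> x *R (g x*box_bump n a' b' x)) \<in> borel_measurable lebesgue" for n
      using locally_integrable_mult_test_function[OF g test_function_box_bump[OF s], of n] by (auto simp: set_integrable_def)
    qed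
    moreover have "(LINT x|lebesgue. indicator \<Omega> x *R (g x*box_bump n a' b' x)) = 0" for n
     using zero[OF test_function_box_bump[OF s]] by (simp add: set_lebesgue_integral_def)
    ultimately show ?thesis by (simp add: set_lebesgue_integral_def LIMSEQ_const_iff)
   qed (simp add: set_lebesgue_integral_def)
   have "(LINT x:box a b|lborel. h' x) = (LINT x:box a b|lebesgue. h' x)"
    using h'(1) by (simp add: set_lebesgue_integral_def integral_completion)
   also have "\<dots> = (LINT x:box a b|lebesgue. h x)" unfolding set_lebesgue_integral_def
    using hh' borel_measurable_integrable[OF h] measurable_completion[OF h'(1)]
    by (intro integral_cong_AE borel_measurable_scaleR borel_measurable_indicator) auto
   also have "\<dots> = (LINT x:box a' b'|lebesgue. g x)" unfolding set_lebesgue_integral_def h_def ab'[symmetric]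
    by (intro Bochner_Integration.integral_cong) (auto simp: indicator_def)
   finally show ?thesis using lim0 by simp
  qed
  then have "AE x in lborel. h' x = 0" using ih' by (intro AE_zero_if_box_integrals_zero)
  then have "AE x in lebesgue. h' x = 0" by (rule AE_completion)
  moreover have "AE x in lebesgue. x \<notin> cbox c d - box c d"
   using negligible_frontier_interval[of c d] by (intro AE_not_in) (simp add: negligible_iff_null_sets)
  ultimately show ?thesis using hh' by eventually_elim (auto simp: h_def indicator_def)
 qed
 obtain D where D: "countable D" "!!X. X \<in> D ==> X \<subseteq> \<Omega>" "!!X. X \<in> D ==> \<exists>a b. X = cbox a b" "\<Union>D = \<Omega>"
 proof -
  define I where "I = {f \<in> Basis \<rightarrow>\<^sub>E \<rat> \<times> \<rat>. cbox (\<Sum>i\<in>Basis. fst (f i) *R i) (\<Sum>i\<in>Basis. snd (f i) *R i) \<subseteq> \<Omega>}"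
  show ?thesis
  proof (rule that)
   show "countable ((%f. cbox (\<Sum>i\<in>Basis. fst (f i) *R i) (\<Sum>i\<in>Basis. snd (f i) *R i)) ` I)"
    unfolding I_def by (intro countable_image countable_subset[OF _ countable_PiE[of Basis "%_. \<rat> \<times> \<rat>"]])
     (auto intro: countable_rat)
   show "\<Union>((%f. cbox (\<Sum>i\<in>Basis. fst (f i) *R i) (\<Sum>i\<in>Basis. snd (f i) *R i)) ` I) = \<Omega>"
    using open_UNION_cbox[OF \<open>open \<Omega>\<close>] by (simp add: I_def)
  qed (auto simp: I_def)
 qed
 have "AE x in lebesgue. \<forall>X\<in>D. x \<in> X --> g x = 0" unfolding AE_ball_countable[OF D(1)]
 proof
  fix X assume "X \<in> D"
  then show "AE x\<in>X in lebesgue. g x = 0" using D(2,3)[of X] box by metis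
 qed
 then show ?thesis using D(4) by (auto elim!: eventually_mono)
qed

lemma has_weak_partial_unique: assumes "open \<Omega>" "has_weak_partial \<Omega> i f g" "has_weak_partial \<Omega> i f k"
 shows "AE x\<in>\<Omega> in lebesgue. g x = k x"
proof -
 have l: "locally_integrable \<Omega> g" "locally_integrable \<Omega> k" using assms by (auto simp: has_weak_partial_def)
 have "AE x\<in>\<Omega> in lebesgue. g x - k x = 0"
 proof (rule test_function_integrals_zero_imp_AE_zero[OF \<open>open \<Omega>\<close>])
  show "locally_integrable \<Omega> (%x. g x - k x)"
   using l by (auto simp: locally_integrable_def intro!: set_integral_diff)
  fix \<phi> assume \<phi>: "test_function \<Omega> \<phi>"
  then have "(LINT x:\<Omega>|lebesgue. g x*\<phi> x) = (LINT x:\<Omega>|lebesgue. k x*\<phi> x)"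
   using assms by (simp add: has_weak_partial_def)
  then show "(LINT x:\<Omega>|lebesgue. (g x - k x)*\<phi> x) = 0"
   using l by (simp add: left_diff_distrib set_integral_diff locally_integrable_mult_test_function \<phi>)
 qed
 then show ?thesis by (auto elim!: eventually_mono)
qed

section \<open>Weak derivatives of Lipschitz functions\<close>

text \<open>Dyadic convex combinations of the tail \<open>D n, D (Suc n), ...\<close>. Midpoints are
  the only combinations that the parallelogram identity asks for.\<close>

inductive_set midhull :: "(nat => 'a => real) => nat => ('a => real) set"
 for D :: "nat => 'a => real" and n :: nat where
 base: "n <= m ==> D m \<in> midhull D n"
| mid: "f \<in> midhull D n ==> g \<in> midhull D n ==> (%x. (f x + g x)/2) \<in> midhull D n"

lemma midhull_interval: assumes "f \<in> midhull D n" and "!!m. n <= m ==> D m x \<in> {lo..hi}" shows "f x \<in> {lo..hi}"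
 using assms by (induction rule: midhull.induct) fastforce+

lemma midhull_mono: assumes "n <= m" "f \<in> midhull D m" shows "f \<in> midhull D n"
 using assms(2,1) by (induction rule: midhull.induct) (auto intro: midhull.intros)

lemma midhull_measurable: assumes "f \<in> midhull D n" and "!!m. D m \<in> borel_measurable M"
 shows "f \<in> borel_measurable M" using assms by (induction rule: midhull.induct) auto

text \<open>Midpoint combinations of the tails that nearly minimise the \<open>L^2\<close> norm form a Cauchy sequence
 by the parallelogram identity; this replaces weak compactness of bounded sets in \<open>L^2\<close>.\<close>

lemma midhull_AE_convergent:
 fixes D :: "nat => 'a => real"
 assumes meas: "!!m. D m \<in> borel_measurable M" and A: "A \<in> sets M" "emeasure M A < \<infinity>"
  and bound: "!!m x. \<bar>D m x\<bar> <= L*indicator A x" and "L >= 0"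
 obtains f g where "!!n. f n \<in> midhull D n" "g \<in> borel_measurable M"
  "!!x. \<bar>g x\<bar> <= L*indicator A x" "AE x in M. (%n. f n x) \<longlonglongrightarrow> g x"
proof -
 define Q where "Q f = (LINT x|M. (f x)^2)" for f :: "'a => real"
 have hb: "\<bar>f x\<bar> <= L*indicator A x" if "f \<in> midhull D n" for f n x
 proof -
  have "D m x \<in> {- (L*indicator A x)..L*indicator A x}" for m using bound[of m x] by (auto simp: abs_le_iff)
  then show ?thesis using midhull_interval[OF that] by (fastforce simp: abs_le_iff)
 qed
 have hm: "f \<in> borel_measurable M" if "f \<in> midhull D n" for f n using midhull_measurable[OF that meas] .
 have iA: "integrable M (%x. c*indicator A x)" for c :: real using A by (intro integrable_mult_right) auto
 have int: "integrable M f" "integrable M (%x. (f x)^2)" if "f \<in> midhull D n" for f n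
 proof -
  show "integrable M f" using hb[OF that] order_trans[OF _ abs_ge_self]
   by (intro Bochner_Integration.integrable_bound[OF iA[of L] hm[OF that]]) (auto simp only: real_norm_def)
  have "(f x)^2 <= L^2*indicator A x" for x
   using power_mono[OF hb[OF that, of x], of 2] by (auto simp: indicator_def split: if_splits)
  then show "integrable M (%x. (f x)^2)"
   by (intro Bochner_Integration.integrable_bound[OF iA[of "L^2"]] borel_measurable_power hm[OF that]) auto
 qed
 have Q_bound: "0 <= Q f" "Q f <= L^2*measure M A" if "f \<in> midhull D n" for f n
 proof -
  show "0 <= Q f" by (simp add: Q_def)
  have "(f x)^2 <= L^2*indicator A x" for x
   using power_mono[OF hb[OF that, of x], of 2] by (auto simp: indicator_def split: if_splits)
  then have "Q f <= (LINT x|M. L^2*indicator A x)" unfolding Q_def by (intro integral_mono int[OF that] iA) auto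
  then show "Q f <= L^2*measure M A" using A by simp
 qed
 define I where "I n = Inf (Q ` midhull D n)" for n
 have ne: "Q ` midhull D n ~= {}" for n using midhull.base[of n n D] by blast
 have bdd: "bdd_below (Q ` midhull D n)" for n using Q_bound by (intro bdd_belowI[of _ 0]) auto
 have I_le: "I n <= Q f" if "f \<in> midhull D n" for f n unfolding I_def using that bdd by (intro cInf_lower) auto
 have "incseq I"
  unfolding I_def by (intro incseq_SucI cInf_superset_mono ne bdd image_mono) (auto intro: midhull_mono[OF le_SucI[OF order_refl]])
 have I_bd: "I n <= L^2*measure M A" for n
  using I_le[OF midhull.base[of n n]] Q_bound(2)[OF midhull.base[of n n]] by (meson order.refl order_trans)
 obtain S where S: "I \<longlonglongrightarrow> S" "!!n. I n <= S"
  using incseq_convergent[OF \<open>incseq I\<close>, of "L^2*measure M A"] I_bd by auto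
 have "\<exists>f. f \<in> midhull D n \<and> Q f < I n + 1/real (Suc n)" for n
  using cInf_lessD[OF ne[of n], of "I n + 1/real (Suc n)"] unfolding I_def by auto
 then obtain f where f: "!!n. f n \<in> midhull D n" "!!n. Q (f n) < I n + 1/real (Suc n)" by metis
 \<comment> \<open>The midpoint of two members of the tail hull stays in it, so its squared norm is
   at least the infimum \<open>I N\<close>; the parallelogram identity then bounds the distance of
   two near-minimisers.\<close>
 have key: "(LINT x|M. ((f i x - f j x)/2)^2) <= S - I N + 1/real (Suc N)" if "N <= i" "N <= j" for i j N
 proof -
  have fi: "f i \<in> midhull D N" "f j \<in> midhull D N" using f(1) midhull_mono that by blast+
  have mid: "(%x. (f i x + f j x)/2) \<in> midhull D N" using midhull.mid[OF fi] .
  have "(LINT x|M. ((f i x - f j x)/2)^2)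
    = (LINT x|M. (f i x)^2/2 + (f j x)^2/2 - ((f i x + f j x)/2)^2)"
   by (intro Bochner_Integration.integral_cong) (auto simp: power2_eq_square field_simps)
  also have "\<dots> = Q (f i)/2 + Q (f j)/2 - Q (%x. (f i x + f j x)/2)"
   unfolding Q_def using int(2)[OF fi(1)] int(2)[OF fi(2)] int(2)[OF mid] by simp
  also have "\<dots> <= S - I N + 1/real (Suc N)"
  proof -
   have "1/real (Suc i) <= 1/real (Suc N)" "1/real (Suc j) <= 1/real (Suc N)"
    using that by (auto intro!: divide_left_mono)
   then show ?thesis using f(2)[of i] f(2)[of j] S(2)[of i] S(2)[of j] I_le[OF mid] by linarith
  qed
  finally show ?thesis .
 qed
 have small: "\<exists>N. \<forall>i\<ge>N. \<forall>j\<ge>N. (LINT x|M. norm (f i x - f j x)) < e" if "e > 0" for e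
 proof -
  define m where "m = measure M A"
  \<comment> \<open>Balances the final estimate: \<eta> m + \<eta>^2/\<eta> = \<eta> (m + 1) =
    e/2.\<close>
  define \<eta> where "\<eta> = e/(2*(m + 1))"
  have m: "m >= 0" by (simp add: m_def)
  then have \<eta>: "\<eta> > 0" using that by (simp add: \<eta>_def)
  have "(%N. S - I N + 1/real (Suc N)) \<longlonglongrightarrow> S - S + 0"
   by (intro tendsto_intros S LIMSEQ_Suc[OF lim_1_over_n])
  then have "\<forall>\<^sub>F N in sequentially. S - I N + 1/real (Suc N) < \<eta>^2"
   using \<eta> by (intro order_tendstoD(2)) auto
  then obtain N where N: "S - I N + 1/real (Suc N) < \<eta>^2" using eventually_happens by force
  have "(LINT x|M. norm (f i x - f j x)) < e" if ij: "i >= N" "j >= N" for i j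
  proof -
   have fi: "f i \<in> midhull D N" "f j \<in> midhull D N" using f(1) midhull_mono that by blast+
   have sq: "integrable M (%x. ((f i x - f j x)/2)^2)"
   proof -
    have "integrable M (%x. (f i x)^2/2 + (f j x)^2/2 - ((f i x + f j x)/2)^2)"
     using int(2)[OF fi(1)] int(2)[OF fi(2)] int(2)[OF midhull.mid[OF fi]] by simp
    also have "(%x. (f i x)^2/2 + (f j x)^2/2 - ((f i x + f j x)/2)^2) = (%x. ((f i x - f j x)/2)^2)"
     by (auto simp: power2_eq_square field_simps)
    finally show ?thesis .
   qed
   \<comment> \<open>Young's inequality with weight \<eta> turns smallness in L^2 into smallness in
     L^1 on the set \<open>A\<close> of finite measure; off \<open>A\<close> everything
     vanishes.\<close>
   have pt: "norm (f i x - f j x) <= \<eta>*indicator A x + (1/\<eta>)*((f i x - f j x)/2)^2" for x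
   proof (cases "x \<in> A")
    case True
    have "0 <= (\<eta> - \<bar>(f i x - f j x)/2\<bar>)^2" by simp
    also have "\<dots> = \<eta>^2 - \<eta>*\<bar>f i x - f j x\<bar> + ((f i x - f j x)/2)^2"
     by (simp add: power2_diff power_divide)
    finally have "\<eta>*\<bar>f i x - f j x\<bar> <= \<eta>*(\<eta> + (1/\<eta>)*((f i x - f j x)/2)^2)"
     using \<eta> by (simp add: algebra_simps power2_eq_square)
    then show ?thesis using \<eta> True by simp
   next
    case False
    then show ?thesis using hb[OF fi(1), of x] hb[OF fi(2), of x] by simp
   qed
   have "(LINT x|M. norm (f i x - f j x)) <= (LINT x|M. \<eta>*indicator A x + (1/\<eta>)*((f i x - f j x)/2)^2)"
    using int(1)[OF fi(1)] int(1)[OF fi(2)] iA sq pt by (intro integral_mono) auto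
   also have "\<dots> = \<eta>*m + (1/\<eta>)*(LINT x|M. ((f i x - f j x)/2)^2)"
   proof -
    have "(LINT x|M. \<eta>*indicator A x + (1/\<eta>)*((f i x - f j x)/2)^2) =
     (LINT x|M. \<eta>*indicator A x) + (LINT x|M. (1/\<eta>)*((f i x - f j x)/2)^2)"
     by (intro Bochner_Integration.integral_add iA integrable_mult_right sq)
    then show ?thesis using A by (simp add: m_def)
   qed
   also have "\<dots> <= \<eta>*m + (1/\<eta>)*\<eta>^2"
    using key[OF ij] N \<eta> by (intro add_left_mono mult_left_mono) auto
   also have "\<dots> = \<eta>*(m + 1)" using \<eta> by (simp add: power2_eq_square algebra_simps)
   also have "\<dots> = e/2" using m by (simp add: \<eta>_def divide_simps)
   also have "\<dots> < e" using \<open>e > 0\<close> by simp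
   finally show ?thesis .
  qed
  then show ?thesis by blast
 qed
 obtain r where r: "strict_mono r" "AE x in M. Cauchy (%i. f (r i) x)"
  using cauchy_L1_AE_cauchy_subseq[of M f] int(1)[OF f(1)] small by metis
 \<comment> \<open>Where the subsequence diverges, the default 0 keeps the bound valid at every
   point and not only almost everywhere.\<close>
 define g where "g x = (if Cauchy (%i. f (r i) x) then lim (%i. f (r i) x) else 0)" for x
 have conv: "(%i. f (r i) x) \<longlonglongrightarrow> g x" if "Cauchy (%i. f (r i) x)" for x
  using that by (simp add: g_def Cauchy_convergent_iff convergent_LIMSEQ_iff)
 show thesis
 proof
  show "f (r n) \<in> midhull D n" for n using f(1) midhull_mono seq_suble[OF r(1)] by blast
  show "AE x in M. (%n. f (r n) x) \<longlonglongrightarrow> g x" using r(2) conv by (auto elim!: eventually_mono)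
  show "g \<in> borel_measurable M" unfolding g_def[abs_def] using hm[OF f(1)] by measurable
  show "\<bar>g x\<bar> <= L*indicator A x" for x
  proof (cases "Cauchy (%i. f (r i) x)")
   case True
   show ?thesis using hb[OF f(1)] by (intro LIMSEQ_le_const2[OF tendsto_rabs[OF conv[OF True]]]) auto
  next
   case False
   then show ?thesis using \<open>L >= 0\<close> by (simp add: g_def)
  qed
 qed
qed

lemma integral_lborel_translation:
 fixes f :: "'a::euclidean_space => real" assumes "f \<in> borel_measurable borel"
 shows "(LINT x|lborel. f (c + x)) = (LINT x|lborel. f x)"
proof -
 have "(LINT x|lborel. f x) = (LINT x|distr lborel borel ((+) c). f x)" by (simp add: lborel_distr_plus)
 also have "\<dots> = (LINT x|lborel. f (c + x))" using assms by (subst integral_distr) auto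
 finally show ?thesis by simp
qed

text \<open>The difference quotients are bounded by \<open>L\<close>. Midpoint combinations of them
  converge almost everywhere, and discrete integration by parts identifies the limit as a weak
  derivative. Intervals are convex and closed, so an interval that finally contains the quotients at
  \<open>x\<close> also contains the limit. This links weak and classical derivatives and bypasses
  Rademacher's theorem.\<close>

lemma exists_weak_partial_lipschitz: assumes "open \<Omega>" "bounded \<Omega>" and lip: "L-lipschitz_on \<Omega> F"
 obtains g where "has_weak_partial \<Omega> i F g" "g \<in> borel_measurable borel" "!!x. \<bar>g x\<bar> <= L"
  "AE x\<in>\<Omega> in lebesgue. (\<forall>lo hi.
    (\<forall>\<^sub>F t in at_right 0. (F (x + t *R axis i 1) - F x)/t \<in> {lo..hi}) --> g x \<in> {lo..hi})"
proof -
 have L0: "L >= 0" using lip by (rule lipschitz_on_nonneg)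
 define e :: "real^2" where "e = axis i 1"
 have ne: "norm e = 1" by (simp add: e_def norm_axis_1)
 define t where "t m = 1/real (Suc m)" for m
 have t: "t m > 0" for m by (simp add: t_def)
 have t0: "t \<longlonglongrightarrow> 0" unfolding t_def[abs_def] by (rule LIMSEQ_Suc[OF lim_1_over_n])
 have \<Omega>m[measurable]: "\<Omega> \<in> sets borel" using \<open>open \<Omega>\<close> by simp
 have \<Omega>fin: "emeasure lborel \<Omega> < \<infinity>" using emeasure_bounded_finite[OF \<open>bounded \<Omega>\<close>] by simp
 have Fcont: "continuous_on \<Omega> F" using lip by (rule lipschitz_on_continuous_on)
 define FF where "FF x = indicator \<Omega> x*F x" for x
 have FFm[measurable]: "FF \<in> borel_measurable borel"
  using borel_measurable_continuous_on_indicator[OF \<Omega>m Fcont] by (simp add: FF_def[abs_def])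
 obtain BF where BF: "!!x. \<bar>FF x\<bar> <= BF" "BF >= 0"
 proof (cases "\<Omega> = {}")
  case True
  show ?thesis by (rule that[of 0]) (auto simp: FF_def True)
 next
  case False
  then obtain x0 where x0: "x0 \<in> \<Omega>" by blast
  have "bounded (F ` \<Omega>)"
   using lip \<open>bounded \<Omega>\<close> lipschitz_on_uniformly_continuous bounded_uniformly_continuous_image by blast
  then obtain B where "!!x. x \<in> \<Omega> ==> \<bar>F x\<bar> <= B" "B > 0"
   unfolding bounded_pos by (metis image_eqI real_norm_def)
  then show ?thesis by (intro that[of B]) (auto simp: FF_def indicator_def)
 qed
 \<comment> \<open>The quotient is dropped as soon as one of its two points leaves \<Omega>, where
   \<open>FF\<close> jumps to 0; this is what makes the bound by \<open>L\<close> hold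
   everywhere.\<close>
 define D where "D m x = indicator \<Omega> x*indicator \<Omega> (x + t m *R e)*((FF (x + t m *R e) - FF x)/t m)" for m x
 have Dm: "D m \<in> borel_measurable lborel" for m unfolding D_def[abs_def] by measurable
 have Db: "\<bar>D m x\<bar> <= L*indicator \<Omega> x" for m x
 proof (cases "x \<in> \<Omega> \<and> x + t m *R e \<in> \<Omega>")
  case True
  then have "\<bar>F (x + t m *R e) - F x\<bar> <= L*t m"
   using lipschitz_onD[OF lip, of "x + t m *R e" x] t[of m] ne by (simp add: dist_norm)
  then show ?thesis using True t[of m] by (simp add: D_def FF_def divide_le_eq)
 qed (use L0 in \<open>auto simp: D_def\<close>)
 obtain f g where f: "!!n. f n \<in> midhull D n" and g: "g \<in> borel_measurable lborel"
  "!!x. \<bar>g x\<bar> <= L*indicator \<Omega> x" and conv: "AE x in lborel. (%n. f n x) \<longlonglongrightarrow> g x"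
  using midhull_AE_convergent[of D lborel \<Omega> L, OF Dm _ \<Omega>fin Db L0] by auto
 have gm[measurable]: "g \<in> borel_measurable borel" using g(1) by simp
 have gL: "\<bar>g x\<bar> <= L" for x using g(2)[of x] L0 by (cases "x \<in> \<Omega>") auto
 have fb: "\<bar>f x\<bar> <= L*indicator \<Omega> x" if "f \<in> midhull D n" for f n x
 proof -
  have "D m x \<in> {- (L*indicator \<Omega> x)..L*indicator \<Omega> x}" for m using Db[of m x] by (auto simp: abs_le_iff)
  then show ?thesis using midhull_interval[OF that] by (fastforce simp: abs_le_iff)
 qed
 have pointwise: "AE x in lborel. x \<in> \<Omega> --> (\<forall>lo hi.
    (\<forall>\<^sub>F t in at_right 0. (F (x + t *R e) - F x)/t \<in> {lo..hi}) --> g x \<in> {lo..hi})" using conv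
 proof (eventually_elim, intro impI allI)
  fix x lo hi
  assume x: "(%n. f n x) \<longlonglongrightarrow> g x" "x \<in> \<Omega>"
   and ev: "\<forall>\<^sub>F t in at_right 0. (F (x + t *R e) - F x)/t \<in> {lo..hi}"
  have tr: "filterlim t (at_right 0) sequentially" using t0 t by (intro tendsto_imp_filterlim_at_right) auto
  have "(%m. x + t m *R e) \<longlonglongrightarrow> x + 0 *R e" by (intro tendsto_intros t0)
  then have "\<forall>\<^sub>F m in sequentially. x + t m *R e \<in> \<Omega>"
   using \<open>open \<Omega>\<close> x(2) by (auto dest!: topological_tendstoD)
  moreover have "\<forall>\<^sub>F m in sequentially. (F (x + t m *R e) - F x)/t m \<in> {lo..hi}"
   using ev tr by (rule eventually_compose_filterlim)
  ultimately have "\<forall>\<^sub>F m in sequentially. D m x \<in> {lo..hi}"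
   by eventually_elim (use x(2) in \<open>simp add: D_def FF_def\<close>)
  then obtain n where n: "!!m. m >= n ==> D m x \<in> {lo..hi}" by (auto simp: eventually_sequentially)
  have "f k x \<in> {lo..hi}" if "k >= n" for k using midhull_interval[OF f[of k], of x lo hi] n that by force
  then have "\<forall>\<^sub>F k in sequentially. f k x \<in> {lo..hi}" unfolding eventually_sequentially by blast
  then show "g x \<in> {lo..hi}" by (rule Lim_in_closed_set[OF closed_atLeastAtMost _ sequentially_bot x(1)])
 qed
 have loc: "locally_integrable \<Omega> h"
  if hm: "(%x. indicator \<Omega> x*h x) \<in> borel_measurable borel" and hb: "!!x. \<bar>indicator \<Omega> x*h x\<bar> <= B" for h :: "real^2 => real" and B
  unfolding locally_integrable_def
 proof (intro allI impI)
  fix K :: "(real^2) set" assume K: "compact K" "K \<subseteq> \<Omega>"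
  then have Km: "K \<in> sets borel" "emeasure lborel K < \<infinity>"
   using emeasure_bounded_finite[OF compact_imp_bounded[OF K(1)]] by (auto simp: compact_imp_closed)
  have "integrable lborel (%x. indicator K x*(indicator \<Omega> x*h x))"
  proof (rule Bochner_Integration.integrable_bound)
   show "integrable lborel (%x. B*indicator K x)" using Km by (intro integrable_mult_right) auto
   show "(%x. indicator K x*(indicator \<Omega> x*h x)) \<in> borel_measurable lborel" using Km hm by auto
   show "AE x in lborel. norm (indicator K x*(indicator \<Omega> x*h x)) <= norm (B*indicator K x)"
    using order_trans[OF hb abs_ge_self] by (intro AE_I2) (simp add: abs_mult indicator_def)
  qed
  then have "integrable lebesgue (%x. indicator K x*(indicator \<Omega> x*h x))"
   using integrable_completion[of "%x. indicator K x*(indicator \<Omega> x*h x)" lborel] borel_measurable_integrable by blast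
  also have "(%x. indicator K x*(indicator \<Omega> x*h x)) = (%x. indicator K x *R h x)"
   using K(2) by (auto simp: indicator_def fun_eq_iff)
  finally show "set_integrable lebesgue K h" by (simp add: set_integrable_def)
 qed
 have "has_weak_partial \<Omega> i F g" unfolding has_weak_partial_def
 proof (intro conjI allI impI)
  show "locally_integrable \<Omega> F" using FFm BF(1) by (intro loc[where B = BF]) (auto simp: FF_def[abs_def])
  show "locally_integrable \<Omega> g" using gL L0 by (intro loc[where B = L]) (auto simp: indicator_def)
  fix \<phi> assume \<phi>: "test_function \<Omega> \<phi>"
  let ?K = "closure {x. \<phi> x ~= 0}"
  have K: "compact ?K" "?K \<subseteq> \<Omega>" using \<phi> by (auto simp: test_function_def)
  note \<phi>cont = test_function_properties(1)[OF \<phi>]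
  have \<phi>m[measurable]: "\<phi> \<in> borel_measurable borel" using \<phi>cont by (rule borel_measurable_continuous_onI)
  obtain B where B: "!!x. \<bar>\<phi> x\<bar> <= B" "B > 0" using test_function_properties(3)[OF \<phi>] by blast
  obtain d\<phi> where d\<phi>: "continuous_on UNIV d\<phi>" "!!x. (\<phi> has_derivative (%w. d\<phi> x\<bullet>w)) (at x)"
   using test_function_properties(4)[OF \<phi>] by blast
  have d\<phi>0: "d\<phi> x = 0" if "x \<notin> ?K" for x
  proof -
   have "((%x. 0) has_derivative (%w. d\<phi> x\<bullet>w)) (at x)"
    by (rule has_derivative_transform_within_open[OF d\<phi>(2)[of x], of "- ?K"])
     (use that closure_subset[of "{x. \<phi> x ~= 0}"] in auto)
   then have "(%w. d\<phi> x\<bullet>w) = (%w. 0)" by (intro has_derivative_unique) auto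
   then show ?thesis by (metis inner_eq_zero_iff)
  qed
  have "bounded (d\<phi> ` ?K)"
   using K d\<phi>(1) by (intro compact_imp_bounded compact_continuous_image) (auto intro: continuous_on_subset)
  then obtain B' where B': "!!x. x \<in> ?K ==> norm (d\<phi> x) <= B'" "B' > 0" unfolding bounded_pos by (metis image_eqI)
  have d\<phi>B: "norm (d\<phi> x) <= B'" for x using B' d\<phi>0 by (cases "x \<in> ?K") auto
  have \<phi>lip: "\<bar>\<phi> y - \<phi> x\<bar> <= B' * norm (y - x)" for x y
  proof -
   have "norm (\<phi> y - \<phi> x) <= B' * norm (y - x)"
   proof (rule differentiable_bound[of UNIV])
    show "onorm (%w. d\<phi> x\<bullet>w) <= B'" for x
    proof (rule onorm_le)
     fix w
     show "norm (d\<phi> x\<bullet>w) <= B' * norm w"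
      using Cauchy_Schwarz_ineq2[of "d\<phi> x" w] mult_right_mono[OF d\<phi>B[of x], of "norm w"] by simp
    qed
   qed (use d\<phi>(2) in auto)
   then show ?thesis by simp
  qed
  define l where "l = (LINT x|lborel. FF x*(d\<phi> x\<bullet>e))"
  obtain \<rho> where \<rho>: "\<rho> > 0" "(\<Union>x\<in>?K. cball x \<rho>) \<subseteq> \<Omega>"
   using compact_subset_open_imp_cball_epsilon_subset[OF K(1) \<open>open \<Omega>\<close> K(2)] by blast
  have dmeas[measurable]: "(%x. d\<phi> x\<bullet>e) \<in> borel_measurable borel"
   using d\<phi>(1) by (intro borel_measurable_continuous_onI continuous_intros)
  have Dlim: "(%m. LINT x|lborel. D m x*\<phi> x) \<longlonglongrightarrow> - l"
  proof -
   have "(%m. LINT x|lborel. FF x*((\<phi> (x - t m *R e) - \<phi> x)/t m)) \<longlonglongrightarrow> (LINT x|lborel. FF x*(- (d\<phi> x\<bullet>e)))"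
   proof (rule integral_dominated_convergence[where w = "%x. BF*B' * indicator \<Omega> x"])
    show "integrable lborel (%x. BF*B' * indicator \<Omega> x)"
     using \<Omega>fin by (intro integrable_mult_right) auto
    show "AE x in lborel. (%m. FF x*((\<phi> (x - t m *R e) - \<phi> x)/t m)) \<longlonglongrightarrow> FF x * - (d\<phi> x\<bullet>e)"
    proof (intro AE_I2 tendsto_mult tendsto_const)
     fix x
     have "((%s. \<phi> (x - s *R e)) has_derivative (%h. d\<phi> x\<bullet>(- (h *R e)))) (at 0)"
      by (rule has_derivative_compose[where g = \<phi> and g' = "%w. d\<phi> x\<bullet>w"])
       (use d\<phi>(2)[of x] in \<open>auto intro!: derivative_eq_intros\<close>)
     then have "((%s. \<phi> (x - s *R e)) has_real_derivative - (d\<phi> x\<bullet>e)) (at 0)"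
      unfolding has_field_derivative_def by (rule has_derivative_eq_rhs) (simp add: fun_eq_iff)
     then have "((%h. (\<phi> (x - h *R e) - \<phi> x)/h) \<longlongrightarrow> - (d\<phi> x\<bullet>e)) (at 0)"
      by (simp add: DERIV_def)
     then show "(%m. (\<phi> (x - t m *R e) - \<phi> x)/t m) \<longlonglongrightarrow> - (d\<phi> x\<bullet>e)"
      by (rule filterlim_compose) (use t0 t[THEN less_imp_neq, THEN not_sym] in \<open>auto simp: filterlim_at\<close>)
    qed
    fix m
    show "AE x in lborel. norm (FF x*((\<phi> (x - t m *R e) - \<phi> x)/t m)) <= BF*B' * indicator \<Omega> x"
    proof (intro AE_I2)
     fix x
     have "\<bar>(\<phi> (x - t m *R e) - \<phi> x)/t m\<bar> <= B'"
      using \<phi>lip[of "x - t m *R e" x] t[of m] ne by (simp add: divide_le_eq)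
     then have "\<bar>FF x\<bar>*\<bar>(\<phi> (x - t m *R e) - \<phi> x)/t m\<bar> <= BF*B'"
      using BF by (intro mult_mono) auto
     then show "norm (FF x*((\<phi> (x - t m *R e) - \<phi> x)/t m)) <= BF*B' * indicator \<Omega> x"
      by (cases "x \<in> \<Omega>") (auto simp: abs_mult FF_def)
    qed
   qed measurable
   \<comment> \<open>Discrete integration by parts. It holds once the step is shorter than \<rho>,
     so that both indicators in \<open>D\<close> are 1 wherever \<phi> is not 0.\<close>
   moreover have "\<forall>\<^sub>F m in sequentially. (LINT x|lborel. FF x*((\<phi> (x - t m *R e) - \<phi> x)/t m)) = (LINT x|lborel. D m x*\<phi> x)"
   proof -
    have "\<forall>\<^sub>F m in sequentially. t m < \<rho>" using t0 \<rho>(1) by (rule order_tendstoD)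
    then show ?thesis
    proof eventually_elim
     case (elim m)
     have in\<Omega>: "x \<in> \<Omega>" "x + t m *R e \<in> \<Omega>" if "\<phi> x ~= 0" for x
     proof -
      have "x \<in> ?K" using that closure_subset[of "{x. \<phi> x ~= 0}"] by auto
      moreover have "x + t m *R e \<in> cball x \<rho>" using elim t[of m] ne by (simp add: dist_norm)
      ultimately show "x \<in> \<Omega>" "x + t m *R e \<in> \<Omega>" using \<rho>(2) K(2) by blast+
     qed
     have i1: "integrable lborel (%x. FF x*\<phi> (x + c)/t m)" for c
     proof (rule Bochner_Integration.integrable_bound)
      show "integrable lborel (%x. BF*B/t m*indicator \<Omega> x)"
       using \<Omega>fin by (intro integrable_mult_right) auto
      show "AE x in lborel. norm (FF x*\<phi> (x + c)/t m) <= norm (BF*B/t m*indicator \<Omega> x)"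
      proof (intro AE_I2)
       fix x
       have "\<bar>FF x\<bar>*\<bar>\<phi> (x + c)\<bar> <= BF*B" using BF B by (intro mult_mono) auto
       then show "norm (FF x*\<phi> (x + c)/t m) <= norm (BF*B/t m*indicator \<Omega> x)"
        using t[of m] BF(2) B(2) by (cases "x \<in> \<Omega>") (auto simp: abs_mult FF_def divide_right_mono)
      qed
     qed measurable
     have tr: "(LINT x|lborel. FF (t m *R e + x)*\<phi> ((t m *R e + x) - t m *R e)/t m) = (LINT x|lborel. FF x*\<phi> (x - t m *R e)/t m)"
      by (rule integral_lborel_translation[where f = "%x. FF x*\<phi> (x - t m *R e)/t m"]) measurable
     have i2: "integrable lborel (%x. FF (t m *R e + x)*\<phi> x/t m)"
     proof -
      have "integrable (distr lborel borel ((+) (t m *R e))) (%x. FF x*\<phi> (x + - (t m *R e))/t m)"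
       using i1[of "- (t m *R e)"] by (simp add: lborel_distr_plus)
      then show ?thesis by (subst (asm) integrable_distr_eq) (auto simp: add_ac)
     qed
     have "(LINT x|lborel. D m x*\<phi> x) = (LINT x|lborel. FF (t m *R e + x)*\<phi> x/t m - FF x*\<phi> x/t m)"
     proof (intro Bochner_Integration.integral_cong refl)
      fix x
      show "D m x*\<phi> x = FF (t m *R e + x)*\<phi> x/t m - FF x*\<phi> x/t m"
       using in\<Omega>[of x] by (cases "\<phi> x = 0") (auto simp: D_def add.commute diff_divide_distrib algebra_simps)
     qed
     also have "\<dots> = (LINT x|lborel. FF (t m *R e + x)*\<phi> x/t m) - (LINT x|lborel. FF x*\<phi> x/t m)"
      using i2 i1[of 0] by simp
     also have "\<dots> = (LINT x|lborel. FF x*\<phi> (x - t m *R e)/t m) - (LINT x|lborel. FF x*\<phi> x/t m)"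
      using tr by simp
     also have "\<dots> = (LINT x|lborel. FF x*\<phi> (x - t m *R e)/t m - FF x*\<phi> x/t m)"
      using i1[of 0] i1[of "- (t m *R e)"] by simp
     also have "\<dots> = (LINT x|lborel. FF x*((\<phi> (x - t m *R e) - \<phi> x)/t m))"
      by (intro Bochner_Integration.integral_cong refl) (simp add: diff_divide_distrib right_diff_distrib)
     finally show ?case by simp
    qed
   qed
   ultimately show ?thesis by (simp add: l_def tendsto_cong)
  qed
  have fi: "integrable lborel (%x. f x*\<phi> x)" if "f \<in> midhull D n" for f n
  proof (rule Bochner_Integration.integrable_bound)
   show "integrable lborel (%x. L*B*indicator \<Omega> x)" using \<Omega>fin by (intro integrable_mult_right) auto
   show "AE x in lborel. norm (f x*\<phi> x) <= norm (L*B*indicator \<Omega> x)"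
   proof (intro AE_I2)
    fix x
    have "\<bar>f x\<bar>*\<bar>\<phi> x\<bar> <= (L*indicator \<Omega> x)*B" using fb[OF that, of x] B L0 by (intro mult_mono) auto
    then show "norm (f x*\<phi> x) <= norm (L*B*indicator \<Omega> x)" using L0 B(2) by (simp add: abs_mult mult_ac)
   qed
   show "(%x. f x*\<phi> x) \<in> borel_measurable lborel" using midhull_measurable[OF that Dm] by simp
  qed
  \<comment> \<open>The pairing with \<phi> is linear, so closeness to \<open>- l\<close> passes
    from the quotients to their midpoint combinations.\<close>
  have close: "\<bar>(LINT x|lborel. f x*\<phi> x) - (- l)\<bar> <= \<epsilon>"
   if "f \<in> midhull D n" "!!m. m >= n ==> \<bar>(LINT x|lborel. D m x*\<phi> x) - (- l)\<bar> <= \<epsilon>" for f n \<epsilon>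
   using that(1)
  proof (induction rule: midhull.induct)
   case (base m)
   then show ?case using that(2) by blast
  next
   case (mid f g)
   have "(LINT x|lborel. (f x + g x)/2*\<phi> x) = (LINT x|lborel. (f x*\<phi> x)/2 + (g x*\<phi> x)/2)"
    by (intro Bochner_Integration.integral_cong refl) (simp add: field_simps)
   also have "\<dots> = ((LINT x|lborel. f x*\<phi> x) + (LINT x|lborel. g x*\<phi> x))/2"
    using fi[OF mid(1)] fi[OF mid(2)] by simp
   finally show ?case using mid.IH by (simp add: abs_le_iff field_simps)
  qed
  have "(%n. LINT x|lborel. f n x*\<phi> x) \<longlonglongrightarrow> - l"
  proof (rule LIMSEQ_I)
   fix \<epsilon> :: real assume "\<epsilon> > 0"
   then have "\<forall>\<^sub>F m in sequentially. \<bar>(LINT x|lborel. D m x*\<phi> x) - (- l)\<bar> <= \<epsilon>/2"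
    using tendstoD[OF Dlim, of "\<epsilon>/2"] by (auto simp: dist_real_def elim!: eventually_mono)
   then obtain n where n: "!!m. m >= n ==> \<bar>(LINT x|lborel. D m x*\<phi> x) - (- l)\<bar> <= \<epsilon>/2"
    by (auto simp: eventually_sequentially)
   have "\<bar>(LINT x|lborel. f k x*\<phi> x) - (- l)\<bar> <= \<epsilon>/2" if "k >= n" for k
    by (rule close[OF f[of k]]) (use n that in auto)
   then show "\<exists>no. \<forall>k\<ge>no. norm ((LINT x|lborel. f k x*\<phi> x) - - l) < \<epsilon>"
    using \<open>\<epsilon> > 0\<close> by (intro exI[of _ n]) fastforce
  qed
  moreover have "(%n. LINT x|lborel. f n x*\<phi> x) \<longlonglongrightarrow> (LINT x|lborel. g x*\<phi> x)"
  proof (rule integral_dominated_convergence[where w = "%x. L*B*indicator \<Omega> x"])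
   show "integrable lborel (%x. L*B*indicator \<Omega> x)" using \<Omega>fin by (intro integrable_mult_right) auto
   show "AE x in lborel. norm (f n x*\<phi> x) <= L*B*indicator \<Omega> x" for n
   proof (intro AE_I2)
    fix x
    have "\<bar>f n x\<bar>*\<bar>\<phi> x\<bar> <= (L*indicator \<Omega> x)*B" using fb[OF f, of n x] B L0 by (intro mult_mono) auto
    then show "norm (f n x*\<phi> x) <= L*B*indicator \<Omega> x" by (simp add: abs_mult mult_ac)
   qed
   show "AE x in lborel. (%n. f n x*\<phi> x) \<longlonglongrightarrow> g x*\<phi> x"
    using conv by eventually_elim (intro tendsto_intros)
  qed (use midhull_measurable[OF f Dm] in auto)
  ultimately have eq: "(LINT x|lborel. g x*\<phi> x) = - l" using LIMSEQ_unique by blast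
  have "(LINT x:\<Omega>|lebesgue. F x*frechet_derivative \<phi> (at x) (axis i 1)) = (LINT x|lebesgue. FF x*(d\<phi> x\<bullet>e))"
   unfolding set_lebesgue_integral_def by (intro Bochner_Integration.integral_cong refl)
    (simp add: FF_def frechet_derivative_at[OF d\<phi>(2), symmetric] e_def mult_ac)
  also have "\<dots> = l" unfolding l_def by (intro integral_completion) measurable
  also have "\<dots> = - (LINT x|lborel. g x*\<phi> x)" using eq by simp
  also have "(LINT x|lborel. g x*\<phi> x) = (LINT x|lebesgue. g x*\<phi> x)"
   by (intro integral_completion[symmetric]) measurable
  also have "\<dots> = (LINT x:\<Omega>|lebesgue. g x*\<phi> x)" unfolding set_lebesgue_integral_def
   by (intro Bochner_Integration.integral_cong refl) (use K(2) closure_subset[of "{x. \<phi> x ~= 0}"] in \<open>auto simp: indicator_def\<close>)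
  finally show "(LINT x:\<Omega>|lebesgue. F x*frechet_derivative \<phi> (at x) (axis i 1)) = - (LINT x:\<Omega>|lebesgue. g x*\<phi> x)" .
 qed
 then show thesis using that gm gL AE_completion[OF pointwise] by (simp add: e_def)
qed

text \<open>Uniqueness up to null sets transfers the interval property from the constructed
  derivative to the representative picked by \<open>SOME\<close>.\<close>

lemma weak_partial_lipschitz: assumes "open \<Omega>" "bounded \<Omega>" "L-lipschitz_on \<Omega> F"
 shows "has_weak_partial \<Omega> i F (weak_partial \<Omega> i F)" (is ?A)
  and "AE x\<in>\<Omega> in lebesgue. (\<forall>lo hi.
    (\<forall>\<^sub>F t in at_right 0. (F (x + t *R axis i 1) - F x)/t \<in> {lo..hi}) --> weak_partial \<Omega> i F x \<in> {lo..hi})" (is ?B)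
proof -
 obtain g where g: "has_weak_partial \<Omega> i F g"
  "AE x\<in>\<Omega> in lebesgue. (\<forall>lo hi.
    (\<forall>\<^sub>F t in at_right 0. (F (x + t *R axis i 1) - F x)/t \<in> {lo..hi}) --> g x \<in> {lo..hi})"
  using exists_weak_partial_lipschitz[OF assms, of i] by blast
 show *: ?A using someI[of "has_weak_partial \<Omega> i F", OF g(1)] by (simp add: weak_partial_def)
 show ?B using g(2) has_weak_partial_unique[OF assms(1) g(1) *]
 proof (eventually_elim, intro impI)
  fix x assume "x \<in> \<Omega> --> g x = weak_partial \<Omega> i F x" "x \<in> \<Omega>"
   and H: "x \<in> \<Omega> --> (\<forall>lo hi.
    (\<forall>\<^sub>F t in at_right 0. (F (x + t *R axis i 1) - F x)/t \<in> {lo..hi}) --> g x \<in> {lo..hi})"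
  then have eq: "g x = weak_partial \<Omega> i F x" by blast
  show "\<forall>lo hi. (\<forall>\<^sub>F t in at_right 0. (F (x + t *R axis i 1) - F x)/t \<in> {lo..hi}) -->
    weak_partial \<Omega> i F x \<in> {lo..hi}" unfolding eq[symmetric] using H \<open>x \<in> \<Omega>\<close> by blast
 qed
qed

text \<open>At a point of differentiability the quotients are finally in every interval around the
  derivative. One null set serves all intervals, because \<open>lo\<close> and \<open>hi\<close> are
  quantified inside the almost-everywhere statement.\<close>

lemma weak_partial_eq_derivative: assumes "open \<Omega>" "bounded \<Omega>" "L-lipschitz_on \<Omega> F"
 shows "AE x\<in>\<Omega> in lebesgue. (\<forall>D. (F has_derivative D) (at x) --> weak_partial \<Omega> i F x = D (axis i 1))"
 using weak_partial_lipschitz(2)[OF assms, of i]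
proof (eventually_elim, intro impI allI)
 fix x D
 assume H: "x \<in> \<Omega> --> (\<forall>lo hi.
    (\<forall>\<^sub>F t in at_right 0. (F (x + t *R axis i 1) - F x)/t \<in> {lo..hi}) --> weak_partial \<Omega> i F x \<in> {lo..hi})"
  and x: "x \<in> \<Omega>" and D: "(F has_derivative D) (at x)"
 let ?d = "D (axis i 1)"
 have sc: "D (h *R axis i 1) = h * ?d" for h using linear_scale[OF has_derivative_linear[OF D]] by simp
 have "((%t. F (x + t *R axis i 1)) has_derivative (%h. D (h *R axis i 1))) (at 0)"
  by (rule has_derivative_compose[where g = F and g' = D]) (use D in \<open>auto intro!: derivative_eq_intros\<close>)
 then have "((%t. F (x + t *R axis i 1)) has_real_derivative ?d) (at 0)"
  unfolding has_field_derivative_def by (rule has_derivative_eq_rhs) (simp add: fun_eq_iff sc)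
 then have "((%t. (F (x + t *R axis i 1) - F x)/t) \<longlongrightarrow> ?d) (at 0)" by (simp add: DERIV_def)
 then have lim: "((%t. (F (x + t *R axis i 1) - F x)/t) \<longlongrightarrow> ?d) (at_right 0)"
  by (rule filterlim_mono) (auto simp: at_le)
 have "\<bar>weak_partial \<Omega> i F x - ?d\<bar> <= \<epsilon>" if "\<epsilon> > 0" for \<epsilon>
 proof -
  have "\<forall>\<^sub>F t in at_right 0. (F (x + t *R axis i 1) - F x)/t \<in> {?d - \<epsilon>..?d + \<epsilon>}"
   using tendstoD[OF lim that] by eventually_elim (auto simp: dist_real_def abs_if split: if_splits)
  then have "weak_partial \<Omega> i F x \<in> {?d - \<epsilon>..?d + \<epsilon>}" using H x by blast
  then show ?thesis by (auto simp: abs_le_iff)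
 qed
 then show "weak_partial \<Omega> i F x = ?d"
  using field_le_epsilon[of "\<bar>weak_partial \<Omega> i F x - ?d\<bar>" 0] by simp
qed

section \<open>Energy bounds from classical derivatives\<close>

text \<open>A pointwise stand-in for a derivative bound. It makes sense for gradients that are
  merely Lipschitz, so that Hessians can be estimated without being formed.\<close>

definition lip_at :: "('a::real_normed_vector => 'b::real_normed_vector) => 'a => real => bool" where
 "lip_at F x M \<longleftrightarrow> (\<forall>\<^sub>F y in nhds x. norm (F y - F x) <= M*norm (y - x))"

lemma weak_partial_bound: assumes "open \<Omega>" "bounded \<Omega>" "L-lipschitz_on \<Omega> F"
 shows "AE x\<in>\<Omega> in lebesgue. (\<forall>M. lip_at F x M --> \<bar>weak_partial \<Omega> i F x\<bar> <= M)"
 using weak_partial_lipschitz(2)[OF assms, of i]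
proof (eventually_elim, intro impI allI)
 fix x M
 assume H: "x \<in> \<Omega> --> (\<forall>lo hi.
    (\<forall>\<^sub>F t in at_right 0. (F (x + t *R axis i 1) - F x)/t \<in> {lo..hi}) --> weak_partial \<Omega> i F x \<in> {lo..hi})"
  and x: "x \<in> \<Omega>" and M: "lip_at F x M"
 have "((%t. x + t *R axis i 1) \<longlongrightarrow> x + 0 *R axis i 1) (at_right 0)"
  by (intro tendsto_intros)
 then have "filterlim (%t. x + t *R axis i 1) (nhds x) (at_right 0)" by simp
 from eventually_compose_filterlim[OF M[unfolded lip_at_def] this]
 have "\<forall>\<^sub>F t in at_right 0. norm (F (x + t *R axis i 1) - F x) <= M*norm (x + t *R axis i 1 - x)" .
 then have "\<forall>\<^sub>F t in at_right 0. (F (x + t *R axis i 1) - F x)/t \<in> {- M..M}"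
  using eventually_at_right_less[of 0]
 proof eventually_elim
  case (elim t)
  then have "\<bar>F (x + t *R axis i 1) - F x\<bar> <= M*t" by (simp add: norm_axis_1)
  moreover define c where "c = (F (x + t *R axis i 1) - F x)/t"
  ultimately have "\<bar>c\<bar> <= M" using elim(2) by (simp add: divide_le_eq)
  then have "c \<in> {- M..M}" by (auto simp: abs_le_iff)
  then show ?case by (simp only: c_def)
 qed
 then have "weak_partial \<Omega> i F x \<in> {- M..M}" using H x by blast
 then show "\<bar>weak_partial \<Omega> i F x\<bar> <= M" by (auto simp: abs_le_iff)
qed

text \<open>Needed because the Hessian in the energy differentiates a chosen representative of the
  gradient.\<close>

lemma has_weak_partial_AE_cong: assumes wp: "has_weak_partial \<Omega> i f g" and "open \<Omega>"
  and f: "AE x\<in>\<Omega> in lebesgue. f x = f' x" "locally_integrable \<Omega> f'"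
  and g: "AE x\<in>\<Omega> in lebesgue. g x = g' x" "locally_integrable \<Omega> g'" shows "has_weak_partial \<Omega> i f' g'"
 unfolding has_weak_partial_def
proof (intro conjI allI impI f g)
 fix \<phi> assume \<phi>: "test_function \<Omega> \<phi>"
 let ?K = "closure {x. \<phi> x ~= 0}"
 have K: "compact ?K" "?K \<subseteq> \<Omega>" using \<phi> by (auto simp: test_function_def)
 have fl: "locally_integrable \<Omega> f" "locally_integrable \<Omega> g" using wp by (auto simp: has_weak_partial_def)
 obtain d\<phi> where d\<phi>: "continuous_on UNIV d\<phi>" "!!x. (\<phi> has_derivative (%w. d\<phi> x\<bullet>w)) (at x)"
  using test_function_properties(4)[OF \<phi>] by blast
 have d\<phi>0: "d\<phi> x = 0" if "x \<notin> ?K" for x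
 proof -
  have "((%x. 0) has_derivative (%w. d\<phi> x\<bullet>w)) (at x)"
   by (rule has_derivative_transform_within_open[OF d\<phi>(2)[of x], of "- ?K"])
    (use that closure_subset[of "{x. \<phi> x ~= 0}"] in auto)
  then have "(%w. d\<phi> x\<bullet>w) = (%w. 0)" by (intro has_derivative_unique) auto
  then show ?thesis by (metis inner_eq_zero_iff)
 qed
 have frd: "frechet_derivative \<phi> (at x) (axis i 1) = d\<phi> x\<bullet>axis i 1" for x
  by (simp add: frechet_derivative_at[OF d\<phi>(2), symmetric])
 have m: "(%x. indicator \<Omega> x *R (k x*frechet_derivative \<phi> (at x) (axis i 1))) \<in> borel_measurable lebesgue"
  if "locally_integrable \<Omega> k" for k
 proof -
  have "(%x. indicator ?K x *R k x) \<in> borel_measurable lebesgue"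
   using that K unfolding locally_integrable_def set_integrable_def by (blast intro: borel_measurable_integrable)
  moreover have "(%x. d\<phi> x\<bullet>axis i 1) \<in> borel_measurable lebesgue"
   using d\<phi>(1) by (intro measurable_completion) (auto intro!: borel_measurable_continuous_onI continuous_intros)
  ultimately have "(%x. (indicator ?K x *R k x)*(d\<phi> x\<bullet>axis i 1)) \<in> borel_measurable lebesgue"
   by (rule borel_measurable_times)
  also have "(%x. (indicator ?K x *R k x)*(d\<phi> x\<bullet>axis i 1)) =
    (%x. indicator \<Omega> x *R (k x*frechet_derivative \<phi> (at x) (axis i 1)))"
  proof
   fix x
   show "(indicator ?K x *R k x)*(d\<phi> x\<bullet>axis i 1) = indicator \<Omega> x *R (k x*frechet_derivative \<phi> (at x) (axis i 1))"
    using K(2) d\<phi>0[of x] by (cases "x \<in> ?K") (auto simp: frd)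
  qed
  finally show ?thesis .
 qed
 have "(LINT x:\<Omega>|lebesgue. f' x*frechet_derivative \<phi> (at x) (axis i 1)) =
   (LINT x:\<Omega>|lebesgue. f x*frechet_derivative \<phi> (at x) (axis i 1))" unfolding set_lebesgue_integral_def
 proof (rule integral_cong_AE[OF m[OF f(2)] m[OF fl(1)]])
  show "AE x in lebesgue. indicator \<Omega> x *R (f' x*frechet_derivative \<phi> (at x) (axis i 1)) =
    indicator \<Omega> x *R (f x*frechet_derivative \<phi> (at x) (axis i 1))"
   using f(1) by eventually_elim (auto simp: indicator_def)
 qed
 also have "\<dots> = - (LINT x:\<Omega>|lebesgue. g x*\<phi> x)" using wp \<phi> by (simp add: has_weak_partial_def)
 also have "(LINT x:\<Omega>|lebesgue. g x*\<phi> x) = (LINT x:\<Omega>|lebesgue. g' x*\<phi> x)"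
  unfolding set_lebesgue_integral_def
 proof (rule integral_cong_AE)
  show "(%x. indicator \<Omega> x *R (g x*\<phi> x)) \<in> borel_measurable lebesgue"
   "(%x. indicator \<Omega> x *R (g' x*\<phi> x)) \<in> borel_measurable lebesgue"
   using locally_integrable_mult_test_function[OF fl(2) \<phi>] locally_integrable_mult_test_function[OF g(2) \<phi>]
   by (auto simp: set_integrable_def)
  show "AE x in lebesgue. indicator \<Omega> x *R (g x*\<phi> x) = indicator \<Omega> x *R (g' x*\<phi> x)"
   using g(1) by eventually_elim (auto simp: indicator_def)
 qed
 finally show "(LINT x:\<Omega>|lebesgue. f' x*frechet_derivative \<phi> (at x) (axis i 1)) = - (LINT x:\<Omega>|lebesgue. g' x*\<phi> x)" .
qed

lemma bounded_measurable_spaces: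
 fixes h :: "real^2 => real"
 assumes "open \<Omega>" "bounded \<Omega>" and hm: "set_borel_measurable lebesgue \<Omega> h" and hb: "!!x. x \<in> \<Omega> ==> \<bar>h x\<bar> <= B"
 shows "Linf \<Omega> h" "L2 \<Omega> h" "locally_integrable \<Omega> h" (is ?C)
proof -
 have \<Omega>: "\<Omega> \<in> sets lebesgue" "emeasure lebesgue \<Omega> < \<infinity>"
  using assms(1) emeasure_bounded_finite[OF assms(2)] by auto
 show "Linf \<Omega> h" unfolding Linf_def using hm hb by (intro conjI exI[of _ B] AE_I2) auto
 have int: "integrable lebesgue (%x. c*indicator \<Omega> x)" for c :: real
  using \<Omega> by (intro integrable_mult_right) auto
 have hm': "(%x. indicator \<Omega> x*h x) \<in> borel_measurable lebesgue"
  using hm by (simp add: set_borel_measurable_def)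
 have "set_integrable lebesgue \<Omega> (%x. (h x)^2)" unfolding set_integrable_def
 proof (rule Bochner_Integration.integrable_bound[OF int[of "B^2"]])
  have "(%x. (indicator \<Omega> x*h x)^2) \<in> borel_measurable lebesgue" using hm' by (rule borel_measurable_power)
  also have "(%x. (indicator \<Omega> x*h x)^2) = (%x. indicator \<Omega> x *R (h x)^2)"
   by (auto simp: fun_eq_iff indicator_def)
  finally show "(%x. indicator \<Omega> x *R (h x)^2) \<in> borel_measurable lebesgue" .
  have "(h x)^2 <= B^2" if "x \<in> \<Omega>" for x using power_mono[OF hb[OF that], of 2] by simp
  then show "AE x in lebesgue. norm (indicator \<Omega> x *R (h x)^2) <= norm (B^2*indicator \<Omega> x)"
   by (intro AE_I2) (auto simp: indicator_def)
 qed
 then show "L2 \<Omega> h" using hm by (simp add: L2_def)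
 show ?C unfolding locally_integrable_def set_integrable_def
 proof (intro allI impI)
  fix K assume K: "compact K" "K \<subseteq> \<Omega>"
  then have Km: "K \<in> sets lebesgue" by (simp add: compact_imp_closed borel_closed)
  show "integrable lebesgue (%x. indicator K x *R h x)"
  proof (rule Bochner_Integration.integrable_bound[OF int[of B]])
   have "(%x. indicator K x*(indicator \<Omega> x*h x)) \<in> borel_measurable lebesgue"
    using borel_measurable_times[OF borel_measurable_indicator[OF Km] hm'] .
   also have "(%x. indicator K x*(indicator \<Omega> x*h x)) = (%x. indicator K x *R h x)"
    using K(2) by (auto simp: fun_eq_iff indicator_def)
   finally show "(%x. indicator K x *R h x) \<in> borel_measurable lebesgue" .
   show "AE x in lebesgue. norm (indicator K x *R h x) <= norm (B*indicator \<Omega> x)"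
    using K(2) order_trans[OF hb abs_ge_self] by (intro AE_I2) (auto simp: indicator_def)
  qed
 qed
qed

lemma lipschitz_on_spaces:
 fixes h :: "real^2 => real" assumes "open \<Omega>" "bounded \<Omega>" "L-lipschitz_on \<Omega> h"
 shows "Linf \<Omega> h" "L2 \<Omega> h" "locally_integrable \<Omega> h" (is ?C)
proof -
 have "set_borel_measurable lebesgue \<Omega> h" unfolding set_borel_measurable_def
  using borel_measurable_continuous_on_indicator[OF _ lipschitz_on_continuous_on[OF assms(3)]] assms(1)
  by (intro measurable_completion) simp
 moreover have "bounded (h ` \<Omega>)"
  using assms lipschitz_on_uniformly_continuous bounded_uniformly_continuous_image by blast
 then obtain B where "!!x. x \<in> \<Omega> ==> \<bar>h x\<bar> <= B" unfolding bounded_pos by (metis image_eqI real_norm_def)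
 ultimately show "Linf \<Omega> h" "L2 \<Omega> h" ?C using bounded_measurable_spaces[OF assms(1,2)] by blast+
qed

lemma lipschitz_on_nth:
 fixes F :: "'a::metric_space => real ^ 'n" assumes "L-lipschitz_on S F" shows "L-lipschitz_on S (%x. F x $ i)"
proof (rule lipschitz_onI)
 fix x y assume "x \<in> S" "y \<in> S"
 then have "dist (F x) (F y) <= L*dist x y" by (rule lipschitz_onD[OF assms])
 then show "dist (F x $ i) (F y $ i) <= L*dist x y" using dist_vec_nth_le order_trans by blast
qed (rule lipschitz_on_nonneg[OF assms])

lemma W12_lipschitz: assumes "open \<Omega>" "bounded \<Omega>" "L-lipschitz_on \<Omega> u" shows "u \<in> W12 \<Omega>"
proof -
 have "L2 \<Omega> (%x. u x $ i) \<and> (\<exists>g. has_weak_partial \<Omega> j (%x. u x $ i) g \<and> L2 \<Omega> g)" for i j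
 proof -
  note L = lipschitz_on_nth[OF assms(3), of i]
  obtain g where "has_weak_partial \<Omega> j (%x. u x $ i) g" "g \<in> borel_measurable borel" "!!x. \<bar>g x\<bar> <= L"
   using exists_weak_partial_lipschitz[OF assms(1,2) L, of j] by blast
  then have "L2 \<Omega> g" using assms(1,2) by (intro bounded_measurable_spaces(2)[where B = L])
    (auto simp: set_borel_measurable_def intro!: measurable_completion)
  then show ?thesis using lipschitz_on_spaces(2)[OF assms(1,2) L] \<open>has_weak_partial _ _ _ g\<close> by blast
 qed
 then show ?thesis by (auto simp: W12_def)
qed

lemma norm_vec_sq: "(norm (v :: 'b::real_normed_vector ^ 'k))^2 = (\<Sum>i\<in>UNIV. (norm (v $ i))^2)"
 unfolding norm_vec_def L2_set_def by (rule real_sqrt_pow2) (rule sum_nonneg, rule zero_le_power2)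

lemma norm_matrix_sq: "(norm (A :: real ^ 'n ^ 'm))^2 = (\<Sum>i\<in>UNIV. \<Sum>j\<in>UNIV. (A $ i $ j)^2)"
 apply (subst norm_vec_sq)
 apply (rule sum.cong[OF refl])
 apply (subst norm_vec_sq)
 apply (rule sum.cong[OF refl])
 apply (unfold real_norm_def)
 apply (rule power2_abs)
 done

text \<open>The interface between measure theory and construction. The factor 4 counts the entries
  of the Hessian, each of which is at most \<open>M x\<close> in modulus.\<close>

proposition energy_le_of_classical_bounds:
 fixes \<Omega> :: "(real^2) set" assumes \<Omega>: "open \<Omega>" "bounded \<Omega>"
  and v0: "L0-lipschitz_on \<Omega> v0"
   "AE x\<in>\<Omega> in lebesgue. (v0 has_derivative (%w. G0 x\<bullet>w)) (at x)"
  and v: "L1-lipschitz_on \<Omega> v" "!!x. x \<in> \<Omega> ==> (v has_derivative (%w. G x\<bullet>w)) (at x)"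
   "LG-lipschitz_on \<Omega> G" "!!x. x \<in> \<Omega> ==> lip_at G x (M x)"
  and u: "L3-lipschitz_on \<Omega> u" "AE x\<in>\<Omega> in lebesgue. (u has_derivative (%w. U x *v w)) (at x)"
  and S: "AE x in lebesgue. x \<in> \<Omega> -->
   norm (U x + transpose (U x) + tensor (G x) (G x) - tensor (G0 x) (G0 x)) <= S x" shows "v \<in> W2inf \<Omega>"
  and "energy \<Omega> v0 h u v <= (\<integral>\<^sup>+x\<in>\<Omega>. ennreal ((S x)^2 + h^2*(4*(M x)^2)) \<partial>lebesgue)" (is ?B)
proof -
 note Gi = lipschitz_on_nth[OF v(3)]
 have wpG: "AE x\<in>\<Omega> in lebesgue. weak_partial \<Omega> i v x = G x $ i" for i
  using weak_partial_eq_derivative[OF \<Omega> v(1), of i]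
 proof eventually_elim
  case (elim x)
  then show ?case using v(2)[of x] by (auto simp: inner_axis)
 qed
 have hwp: "has_weak_partial \<Omega> i v (%x. G x $ i)" for i
  by (rule has_weak_partial_AE_cong[OF weak_partial_lipschitz(1)[OF \<Omega> v(1)] \<Omega>(1) _
     lipschitz_on_spaces(3)[OF \<Omega> v(1)] wpG lipschitz_on_spaces(3)[OF \<Omega> Gi]]) simp
 show "v \<in> W2inf \<Omega>"
 proof -
  have "\<exists>k. has_weak_partial \<Omega> j (%x. G x $ i) k \<and> Linf \<Omega> k" for i j
  proof -
   obtain g where "has_weak_partial \<Omega> j (%x. G x $ i) g" "g \<in> borel_measurable borel" "!!x. \<bar>g x\<bar> <= LG"
    using exists_weak_partial_lipschitz[OF \<Omega> Gi[of i], of j] by blast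
   then have "Linf \<Omega> g" using \<Omega> by (intro bounded_measurable_spaces(1)[where B = LG])
     (auto simp: set_borel_measurable_def intro!: measurable_completion)
   then show ?thesis using \<open>has_weak_partial _ _ _ g\<close> by blast
  qed
  then show ?thesis
   unfolding W2inf_def using lipschitz_on_spaces(1)[OF \<Omega> v(1)] lipschitz_on_spaces(1)[OF \<Omega> Gi] hwp by blast
 qed
 \<comment> \<open>Functions that agree almost everywhere have the same weak derivatives, so both
   \<open>SOME\<close> expressions choose from the same predicate and coincide as functions.\<close>
 have wp_inner: "weak_partial \<Omega> j (weak_partial \<Omega> i v) = weak_partial \<Omega> j (%x. G x $ i)" for i j
 proof -
  have l: "locally_integrable \<Omega> (weak_partial \<Omega> i v)"
   using weak_partial_lipschitz(1)[OF \<Omega> v(1), of i] by (simp add: has_weak_partial_def)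
  have "has_weak_partial \<Omega> j (weak_partial \<Omega> i v) k \<longleftrightarrow> has_weak_partial \<Omega> j (%x. G x $ i) k" for k
  proof
   assume a: "has_weak_partial \<Omega> j (weak_partial \<Omega> i v) k"
   show "has_weak_partial \<Omega> j (%x. G x $ i) k"
    by (rule has_weak_partial_AE_cong[OF a \<Omega>(1) wpG lipschitz_on_spaces(3)[OF \<Omega> Gi]])
     (use a in \<open>auto simp: has_weak_partial_def\<close>)
  next
   assume a: "has_weak_partial \<Omega> j (%x. G x $ i) k"
   show "has_weak_partial \<Omega> j (weak_partial \<Omega> i v) k" by (rule has_weak_partial_AE_cong[OF a \<Omega>(1) _ l])
     (use a wpG[of i] in \<open>auto simp: has_weak_partial_def elim!: eventually_mono\<close>)
  qed
  then show ?thesis unfolding weak_partial_def[of \<Omega> j] by presburger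
 qed
 have hess: "AE x\<in>\<Omega> in lebesgue. \<bar>weak_partial \<Omega> j (weak_partial \<Omega> i v) x\<bar> <= M x" for i j
  unfolding wp_inner using weak_partial_bound[OF \<Omega> Gi[of i], of j]
 proof (eventually_elim, intro impI)
  fix x assume a: "x \<in> \<Omega> --> (\<forall>M. lip_at (%x. G x $ i) x M --> \<bar>weak_partial \<Omega> j (%x. G x $ i) x\<bar> <= M)"
   and x: "x \<in> \<Omega>"
  have "lip_at (%x. G x $ i) x (M x)" using v(4)[OF x] unfolding lip_at_def
   by eventually_elim (metis component_le_norm_cart order_trans real_norm_def vector_minus_component)
  then show "\<bar>weak_partial \<Omega> j (%x. G x $ i) x\<bar> <= M x" using a x by blast
 qed
 have wpu: "AE x\<in>\<Omega> in lebesgue. weak_partial \<Omega> j (%y. u y $ i) x = U x $ i $ j" for i j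
  using weak_partial_eq_derivative[OF \<Omega> lipschitz_on_nth[OF u(1), of i], of j] u(2)
 proof (eventually_elim, intro impI)
  fix x assume a: "x \<in> \<Omega> --> (\<forall>D. ((%y. u y $ i) has_derivative D) (at x) --> weak_partial \<Omega> j (%y. u y $ i) x = D (axis j 1))"
   "x \<in> \<Omega> --> (u has_derivative (%w. U x *v w)) (at x)" and x: "x \<in> \<Omega>"
  have "((%y. u y $ i) has_derivative (%w. (U x *v w) $ i)) (at x)"
   using a(2) x by (intro bounded_linear.has_derivative[OF bounded_linear_vec_nth]) auto
  then have "weak_partial \<Omega> j (%y. u y $ i) x = (U x *v axis j 1) $ i" using a(1) x by blast
  then show "weak_partial \<Omega> j (%y. u y $ i) x = U x $ i $ j" by (simp add: matrix_vector_mult_basis column_def)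
 qed
 have wpv0: "AE x\<in>\<Omega> in lebesgue. weak_partial \<Omega> i v0 x = G0 x $ i" for i
  using weak_partial_eq_derivative[OF \<Omega> v0(1), of i] v0(2) by eventually_elim (auto simp: inner_axis)
 have all2: "AE x in lebesgue. \<forall>i::2. P i x" if "!!i. AE x in lebesgue. P i x" for P :: "2 => real^2 => bool"
  using that AE_all_countable[of P lebesgue] by blast
 have "AE x in lebesgue. \<forall>i. x \<in> \<Omega> --> weak_partial \<Omega> i v x = G x $ i" by (intro all2 wpG)
 moreover have "AE x in lebesgue. \<forall>i. x \<in> \<Omega> --> weak_partial \<Omega> i v0 x = G0 x $ i" by (intro all2 wpv0)
 moreover have "AE x in lebesgue. \<forall>i. \<forall>j. x \<in> \<Omega> --> weak_partial \<Omega> j (%y. u y $ i) x = U x $ i $ j"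
  by (intro all2 wpu)
 moreover have "AE x in lebesgue. \<forall>i. \<forall>j. x \<in> \<Omega> --> \<bar>weak_partial \<Omega> j (weak_partial \<Omega> i v) x\<bar> <= M x"
  by (intro all2 hess)
 ultimately have "AE x in lebesgue.
   ennreal ((norm (vgrad \<Omega> u x + transpose (vgrad \<Omega> u x)
        + tensor (grad \<Omega> v x) (grad \<Omega> v x) - tensor (grad \<Omega> v0 x) (grad \<Omega> v0 x)))^2
    + h^2*(norm (hessian \<Omega> v x))^2)*indicator \<Omega> x
   <= ennreal ((S x)^2 + h^2*(4*(M x)^2))*indicator \<Omega> x" using S
 proof eventually_elim
  case (elim x)
  show ?case
  proof (cases "x \<in> \<Omega>")
   case True
   have e: "vgrad \<Omega> u x = U x" "grad \<Omega> v x = G x" "grad \<Omega> v0 x = G0 x"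
    using elim True by (auto simp: vgrad_def grad_def vec_eq_iff)
   have "(norm (hessian \<Omega> v x))^2 <= (\<Sum>i\<in>(UNIV::2 set). \<Sum>j\<in>(UNIV::2 set). (M x)^2)"
    unfolding norm_matrix_sq
   proof (intro sum_mono)
    fix i j
    have "\<bar>hessian \<Omega> v x $ i $ j\<bar> <= M x" using elim(4) True by (simp add: hessian_def)
    then show "(hessian \<Omega> v x $ i $ j)^2 <= (M x)^2" by (metis abs_ge_zero power2_abs power_mono)
   qed
   then have H: "(norm (hessian \<Omega> v x))^2 <= 4*(M x)^2" by simp
   have "(norm (U x + transpose (U x) + tensor (G x) (G x) - tensor (G0 x) (G0 x)))^2 <= (S x)^2"
    using elim(5) True by (intro power_mono) auto
   then show ?thesis using True H unfolding e by (auto intro!: ennreal_leI add_mono mult_left_mono)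
  qed simp
 qed
 then show ?B unfolding energy_def by (rule nn_integral_mono_AE)
qed

section \<open>Calculus of pointwise Lipschitz bounds\<close>

lemma lip_at_mono: "lip_at F x M ==> M <= M' ==> lip_at F x M'"
 unfolding lip_at_def by (erule eventually_mono) (meson mult_right_mono norm_ge_zero order_trans)

lemma lip_at_const: "lip_at (%_. c) x 0" by (simp add: lip_at_def)

lemma lip_at_cong: assumes "lip_at F x M" and eq: "\<forall>\<^sub>F y in nhds x. F y = G y" shows "lip_at G x M"
 using assms(1) eq eventually_nhds_x_imp_x[OF eq] unfolding lip_at_def by (auto elim: eventually_elim2)

lemma lip_at_add: "lip_at F x A ==> lip_at G x B ==> lip_at (%y. F y + G y) x (A + B)" unfolding lip_at_def
proof (erule (1) eventually_elim2)
 fix y assume "norm (F y - F x) <= A*norm (y - x)" "norm (G y - G x) <= B*norm (y - x)"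
 then show "norm (F y + G y - (F x + G x)) <= (A + B)*norm (y - x)"
  using norm_triangle_ineq[of "F y - F x" "G y - G x"] by (simp add: algebra_simps)
qed

lemma lip_at_uminus: "lip_at F x A ==> lip_at (%y. - F y) x A" unfolding lip_at_def by (simp add: norm_minus_commute)

lemma lip_at_diff: "lip_at F x A ==> lip_at G x B ==> lip_at (%y. F y - G y) x (A + B)"
 using lip_at_add[of F x A "%y. - G y" B] lip_at_uminus[of G x B] by simp

lemma lip_at_tendsto: assumes "lip_at F x M" shows "filterlim F (nhds (F x)) (nhds x)"
proof -
 have "((%y. M*norm (y - x)) \<longlongrightarrow> M*norm (x - x)) (nhds x)"
  by (intro tendsto_intros filterlim_ident)
 then have "((%y. F y - F x) \<longlongrightarrow> 0) (nhds x)"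
  using assms unfolding lip_at_def by (intro Lim_null_comparison[of "%y. F y - F x" "%y. M*norm (y - x)"]) auto
 then show ?thesis by (rule Lim_null[THEN iffD2])
qed

text \<open>The strict bound on \<open>f x\<close> leaves room for \<open>f\<close> to vary near
  \<open>x\<close>.\<close>

lemma lip_at_scaleR:
 assumes f: "lip_at f x A" and G: "lip_at G x B" and "\<bar>f x\<bar> < a" "norm (G x) <= b" "A >= 0" "B >= 0"
 shows "lip_at (%y. f y *R G y) x (a*B + A*b)"
proof -
 have "((%y. \<bar>f y\<bar>) \<longlongrightarrow> \<bar>f x\<bar>) (nhds x)"
  using lip_at_tendsto[OF f] by (rule tendsto_rabs)
 then have "\<forall>\<^sub>F y in nhds x. \<bar>f y\<bar> < a" using assms(3) by (rule order_tendstoD)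
 then show ?thesis using f G unfolding lip_at_def
 proof eventually_elim
  case (elim y)
  have "f y *R G y - f x *R G x = f y *R (G y - G x) + (f y - f x) *R G x"
   by (simp add: algebra_simps)
  then have "norm (f y *R G y - f x *R G x) <= \<bar>f y\<bar>*norm (G y - G x) + \<bar>f y - f x\<bar>*norm (G x)"
   by (metis norm_triangle_ineq norm_scaleR)
  also have "\<dots> <= a*(B*norm (y - x)) + (A*norm (y - x))*b" using elim assms by (intro add_mono mult_mono) auto
  finally show ?case by (simp add: algebra_simps)
 qed
qed

lemma lip_at_mult:
 fixes f G :: "'a::real_normed_vector => real"
 assumes "lip_at f x A" "lip_at G x B" and "\<bar>f x\<bar> < a" "\<bar>G x\<bar> <= b" "A >= 0" "B >= 0"
 shows "lip_at (%y. f y*G y) x (a*B + A*b)" using lip_at_scaleR[of f x A G B a b] assms by simp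

lemma lip_at_cmult: assumes "lip_at G x B" shows "lip_at (%y. c *R G y) x (\<bar>c\<bar>*B)"
 using assms unfolding lip_at_def
proof eventually_elim
 case (elim y)
 then have "\<bar>c\<bar>*norm (G y - G x) <= \<bar>c\<bar>*(B*norm (y - x))" by (intro mult_left_mono) auto
 then show ?case by (simp add: scaleR_diff_right[symmetric] mult.assoc)
qed

lemma lip_at_scaleR_const: assumes "lip_at f x B" shows "lip_at (%y. f y *R c) x (B*norm c)"
 using assms unfolding lip_at_def
proof eventually_elim
 case (elim y)
 then have "norm (f y - f x)*norm c <= (B*norm (y - x))*norm c" by (intro mult_right_mono) auto
 then show ?case by (simp add: scaleR_diff_left[symmetric] mult_ac)
qed

lemma lip_at_compose: assumes G: "lip_at G x M" and F: "lip_at F (G x) K" and "K >= 0"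
 shows "lip_at (%y. F (G y)) x (K*M)"
proof -
 have "\<forall>\<^sub>F y in nhds x. norm (F (G y) - F (G x)) <= K*norm (G y - G x)"
  using F lip_at_tendsto[OF G] unfolding lip_at_def by (rule eventually_compose_filterlim)
 then show ?thesis using G unfolding lip_at_def
 proof eventually_elim
  case (elim y)
  then have "K*norm (G y - G x) <= K*(M*norm (y - x))" using \<open>K >= 0\<close> by (intro mult_left_mono) auto
  then show ?case using elim by (simp add: mult.assoc)
 qed
qed

lemma lip_at_lipschitz_on: assumes "K-lipschitz_on S F" "open S" "x \<in> S" shows "lip_at F x K" unfolding lip_at_def
proof (rule eventually_mono[OF eventually_nhds_in_open[OF assms(2,3)]])
 fix y assume "y \<in> S"
 then show "norm (F y - F x) <= K*norm (y - x)" using lipschitz_onD[OF assms(1), of y x] assms(3) by (simp add: dist_norm)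
qed

text \<open>The gap between \<open>m\<close> and \<open>M\<close> absorbs the remainder of the
  linearisation.\<close>

lemma lip_at_has_derivative: assumes D: "(F has_derivative F') (at x)" and b: "!!w. norm (F' w) <= m*norm w" and "m < M"
 shows "lip_at F x M"
proof -
 have "\<forall>e>0. \<exists>d>0. \<forall>y. norm (y - x) < d --> norm (F y - F x - F' (y - x)) <= e*norm (y - x)"
  using D unfolding has_derivative_at_alt by blast
 then obtain d where d: "d > 0" "!!y. norm (y - x) < d ==> norm (F y - F x - F' (y - x)) <= (M - m)*norm (y - x)"
  using \<open>m < M\<close> by (metis diff_gt_0_iff_gt)
 show ?thesis unfolding lip_at_def eventually_nhds_metric
 proof (intro exI[of _ d] conjI allI impI d(1))
  fix y assume "dist y x < d"
  then have "norm (F y - F x - F' (y - x)) <= (M - m)*norm (y - x)" using d(2) by (simp add: dist_norm)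
  then show "norm (F y - F x) <= M*norm (y - x)"
   using b[of "y - x"] norm_triangle_ineq[of "F y - F x - F' (y - x)" "F' (y - x)"] by (simp add: algebra_simps)
 qed
qed

text \<open>A continuity argument along the segment from \<open>x\<close> to \<open>y\<close>: the
  parameters at which the estimate holds form a compact set, and the local bound pushes its maximum
  beyond every value below 1.\<close>

lemma lipschitz_on_if_lip_at:
 fixes F :: "'a::real_normed_vector => 'b::real_normed_vector"
 assumes "convex S" and lip: "!!x. x \<in> S ==> lip_at F x M" and "M >= 0" shows "M-lipschitz_on S F"
proof (rule lipschitz_onI)
 fix x y assume xy: "x \<in> S" "y \<in> S"
 define \<gamma> where "\<gamma> t = x + t *R (y - x)" for t :: real
 have \<gamma>S: "\<gamma> t \<in> S" if "t \<in> {0..1}" for t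
 proof -
  have "\<gamma> t = (1 - t) *R x + t *R y" by (simp add: \<gamma>_def algebra_simps)
  then show ?thesis using convexD[OF assms(1) xy(1) xy(2), of "1 - t" t] that by simp
 qed
 define f where "f t = F (\<gamma> t)" for t
 define K where "K = M*norm (y - x)"
 have tend: "filterlim \<gamma> (nhds (\<gamma> t)) (nhds t)" for t
  unfolding \<gamma>_def[abs_def] by (intro tendsto_intros filterlim_ident)
 have loc: "\<forall>\<^sub>F s in nhds t. norm (f s - f t) <= K*\<bar>s - t\<bar>" if "t \<in> {0..1}" for t
  using eventually_compose_filterlim[OF lip[OF \<gamma>S[OF that], unfolded lip_at_def] tend]
 proof eventually_elim
  case (elim s)
  have "\<gamma> s - \<gamma> t = (s - t) *R (y - x)" by (simp add: \<gamma>_def algebra_simps)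
  then show ?case using elim by (simp add: f_def K_def mult_ac)
 qed
 have cont: "continuous_on {0..1} f"
 proof -
  have "filterlim f (nhds (f t)) (nhds t)" if "t \<in> {0..1}" for t
   unfolding f_def by (rule filterlim_compose[OF lip_at_tendsto[OF lip[OF \<gamma>S[OF that]]] tend])
  then have "isCont f t" if "t \<in> {0..1}" for t using that by (simp add: isCont_def tendsto_at_iff_tendsto_nhds)
  then show ?thesis by (simp add: continuous_at_imp_continuous_on)
 qed
 define T where "T = {t \<in> {0..1}. norm (f t - f 0) - K*t <= 0}"
 have "closed T" unfolding T_def by (rule continuous_on_closed_Collect_le) (intro continuous_intros cont, simp_all)
 then have "compact T" by (auto simp: compact_eq_bounded_closed T_def intro: bounded_subset[of "{0..1}"])
 moreover have "0 \<in> T" by (simp add: T_def)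
 ultimately obtain t where t: "t \<in> T" "!!s. s \<in> T ==> s <= t" using compact_attains_sup[of T] by blast
 have "t = 1"
 proof (rule ccontr)
  assume "t ~= 1"
  then have t1: "0 <= t" "t < 1" using t(1) by (auto simp: T_def)
  obtain d where d: "d > 0" "!!s. \<bar>s - t\<bar> < d ==> norm (f s - f t) <= K*\<bar>s - t\<bar>"
   using loc[of t] t1 unfolding eventually_nhds_metric dist_real_def by auto
  define s where "s = min 1 (t + d/2)"
  have s: "t < s" "s <= 1" "\<bar>s - t\<bar> < d" using t1 d(1) by (auto simp: s_def min_def)
  have "norm (f s - f 0) <= norm (f s - f t) + norm (f t - f 0)" using norm_triangle_ineq[of "f s - f t" "f t - f 0"] by simp
  also have "\<dots> <= K*(s - t) + K*t" using d(2)[OF s(3)] s(1) t(1) by (auto simp: T_def)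
  finally have "s \<in> T" using s t1 by (simp add: T_def algebra_simps)
  then show False using t(2)[of s] s(1) by simp
 qed
 then show "dist (F x) (F y) <= M*dist x y"
  using t(1) by (simp add: T_def f_def \<gamma>_def K_def dist_norm norm_minus_commute)
qed (rule assms)

section \<open>Gradient regularity from semiconcavity\<close>

text \<open>The pointwise quadratic bounds from above hold on neighbourhoods whose size depends on the point.
 A minimum principle for the second differences still yields a uniform bound.\<close>

lemma second_difference_bound:
 fixes v :: "'a::euclidean_space => real" assumes cont: "continuous_on B v" and "convex B"
  and quad: "!!x. x \<in> B ==> \<exists>p. \<forall>\<^sub>F y in nhds x. v y <= v x + p\<bullet>(y - x) + M*(norm (y - x))^2"
  and x: "x + z \<in> B" "x - z \<in> B" shows "v (x + z) + v (x - z) - 2 * v x <= 2*M*(norm z)^2"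
proof (rule ccontr)
 assume neg: "\<not> ?thesis"
 define Q where "Q = v (x + z) + v (x - z) - 2 * v x"
 have z: "z ~= 0" using neg by auto
 \<comment> \<open>The mean of \<open>M\<close> and \<open>Q / (2 * (norm z)^2)\<close>: larger than
   the opening of the local parabolas, but still too small for the second difference
   \<open>Q\<close>.\<close>
 define M' where "M' = M + (Q - 2*M*(norm z)^2)/(4*(norm z)^2)"
 have M': "M < M'" using neg z by (simp add: M'_def Q_def)
 have M'z: "2*M' * (norm z)^2 = (Q + 2*M*(norm z)^2)/2" using z by (simp add: M'_def field_simps)
 then have QM': "2*M' * (norm z)^2 < Q" using neg by (simp add: Q_def)
 \<comment> \<open>Deviation from the chord minus a parabola of opening \<open>M'\<close>. It
   vanishes at both ends and is negative at 0, hence has an interior minimum, which a local upper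
   parabola of smaller opening forbids.\<close>
 define \<psi> where "\<psi> t = v (x + t *R z) - ((1 + t)/2 * v (x + z) + (1 - t)/2 * v (x - z))
   - M' * (norm z)^2*(t^2 - 1)" for t
 have inB: "x + t *R z \<in> B" if "t \<in> {-1..1}" for t
 proof -
  have "x + t *R z = ((1 + t)/2) *R (x + z) + ((1 - t)/2) *R (x - z)"
   by (rule euclidean_eqI) (simp add: inner_simps field_simps)
  then show ?thesis
   using convexD[OF \<open>convex B\<close> x, of "(1 + t)/2" "(1 - t)/2"] that by (simp only:) (simp add: field_simps)
 qed
 have "continuous_on {-1..1} \<psi>" unfolding \<psi>_def
  by (intro continuous_intros continuous_on_compose2[OF cont]) (use inB in auto)
 then obtain t where t: "t \<in> {-1..1}" "!!s. s \<in> {-1..1} ==> \<psi> t <= \<psi> s"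
  using continuous_attains_inf[of "{-1..1}" \<psi>] by auto
 have "\<psi> 0 < 0" using QM' by (simp add: \<psi>_def Q_def field_simps)
 then have "\<psi> t < 0" using t(2)[of 0] by simp
 moreover have "\<psi> 1 = 0" "\<psi> (-1) = 0" by (simp_all add: \<psi>_def)
 ultimately have t1: "-1 < t" "t < 1" using t(1) by (auto simp: order_less_le)
 obtain p where p: "\<forall>\<^sub>F y in nhds (x + t *R z). v y <= v (x + t *R z) + p\<bullet>(y - (x + t *R z)) + M*(norm (y - (x + t *R z)))^2"
  using quad[OF inB[OF t(1)]] by blast
 then obtain d where d: "d > 0" "!!y. dist y (x + t *R z) < d ==>
   v y <= v (x + t *R z) + p\<bullet>(y - (x + t *R z)) + M*(norm (y - (x + t *R z)))^2"
  unfolding eventually_nhds_metric by blast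
 define s where "s = min (min (1 - t) (1 + t)) (d/(2*norm z))"
 have s0: "s > 0" using t1 d(1) z by (simp add: s_def)
 have "s*norm z <= d/(2*norm z)*norm z" unfolding s_def by (intro mult_right_mono) auto
 then have s1: "s*norm z < d" using d(1) z by simp
 have s2: "t + s \<in> {-1..1}" "t - s \<in> {-1..1}" using s0 by (auto simp: s_def min_def split: if_splits)
 have e1: "v (x + (t + s) *R z) <= v (x + t *R z) + s*(p\<bullet>z) + M*(s*norm z)^2"
  using d(2)[of "x + (t + s) *R z"] s0 s1 by (simp add: dist_norm algebra_simps)
 have e2: "v (x + (t - s) *R z) <= v (x + t *R z) - s*(p\<bullet>z) + M*(s*norm z)^2"
  using d(2)[of "x + (t - s) *R z"] s0 s1 by (simp add: dist_norm algebra_simps)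
 have "0 <= \<psi> (t + s) + \<psi> (t - s) - 2*\<psi> t" using t(2)[OF s2(1)] t(2)[OF s2(2)] by simp
 also have "\<dots> = v (x + (t + s) *R z) + v (x + (t - s) *R z) - 2 * v (x + t *R z) - 2*M' * (norm z)^2 * s^2"
  by (simp add: \<psi>_def field_simps power2_eq_square)
 also have "\<dots> <= 2*M*(s*norm z)^2 - 2*M' * (norm z)^2 * s^2" using e1 e2 by simp
 also have "\<dots> = 2*(M - M')*(s*norm z)^2" by (simp add: power_mult_distrib algebra_simps)
 also have "\<dots> < 0" using M' s0 z by (simp add: mult_less_0_iff)
 finally show False by simp
qed

text \<open>Planes from below and parabolas from above squeeze \<open>v\<close>, which gives
  differentiability. For the Lipschitz bound, the plane at \<open>y\<close> is compared with the
  parabola at \<open>x\<close> in a third point \<open>z\<close> at distance at most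
  \<open>2*d\<close> from \<open>x\<close>; this is where \<open>8*M = 2*M*2^2\<close> comes
  from.\<close>

lemma semiconcave_imp_lip_gradient:
 fixes v :: "'a::euclidean_space => real" assumes cont: "continuous_on (ball x r) v" and "r > 0" "M >= 0"
  and quad: "!!y. y \<in> ball x r ==> \<exists>p. \<forall>\<^sub>F z in nhds y. v z <= v y + p\<bullet>(z - y) + M*(norm (z - y))^2"
  and sub: "!!y z. y \<in> ball x r ==> z \<in> ball x r ==> v y + G y\<bullet>(z - y) <= v z"
 shows "(v has_derivative (%w. G x\<bullet>w)) (at x)" (is ?A) and "lip_at G x (8*M)"
proof -
 have up: "v z <= v x + G x\<bullet>(z - x) + 2*M*(norm (z - x))^2" if "norm (z - x) < r" for z
 proof -
  have in1: "x + (z - x) \<in> ball x r" "x - (z - x) \<in> ball x r" using that by (simp_all add: dist_norm norm_minus_commute)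
  have "v (x + (z - x)) + v (x - (z - x)) - 2 * v x <= 2*M*(norm (z - x))^2"
   by (rule second_difference_bound[OF cont convex_ball quad in1])
  moreover have "v x + G x\<bullet>((x - (z - x)) - x) <= v (x - (z - x))"
   using sub in1(2) \<open>r > 0\<close> by (intro sub) auto
  ultimately show ?thesis by (simp add: inner_diff_right algebra_simps)
 qed
 show ?A
 proof (rule has_derivativeI_sandwich[OF \<open>r > 0\<close> bounded_linear_inner_right])
  fix y assume y: "y ~= x" "dist y x < r"
  have "0 <= v y - v x - G x\<bullet>(y - x)" using sub[of x y] y \<open>r > 0\<close> by (simp add: dist_commute)
  moreover have "v y - v x - G x\<bullet>(y - x) <= 2*M*(norm (y - x))^2" using up[of y] y by (simp add: dist_norm)
  ultimately show "norm (v y - v x - G x\<bullet>(y - x))/norm (y - x) <= 2*M*norm (y - x)"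
   using y by (simp add: divide_le_eq power2_eq_square mult.assoc)
 next
  have "((%y. 2*M*norm (y - x)) \<longlongrightarrow> 2*M*norm (x - x)) (at x)" by (intro tendsto_intros)
  then show "((%y. 2*M*norm (y - x)) \<longlongrightarrow> 0) (at x)" by simp
 qed
 show "lip_at G x (8*M)" unfolding lip_at_def eventually_nhds_metric
 proof (intro exI[of _ "r/4"] conjI allI impI)
  show "0 < r/4" using \<open>r > 0\<close> by simp
  fix y assume y: "dist y x < r/4"
  define d where "d = norm (y - x)"
  define q where "q = G y - G x"
  show "norm (G y - G x) <= 8*M*norm (y - x)"
  proof (cases "q = 0 \<or> d = 0")
   case True
   then show ?thesis using \<open>M >= 0\<close> by (auto simp: q_def d_def)
  next
   case False
   then have d0: "d > 0" and nq: "norm q > 0" by (auto simp: d_def)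
   \<comment> \<open>Leaves \<open>y\<close> in the direction of the slope difference
     \<open>q\<close>, so that \<open>q\<close> shows at full strength, by the distance from
     \<open>x\<close> to \<open>y\<close>.\<close>
   define z where "z = y + (d/norm q) *R q"
   have zy: "norm (z - y) = d" using nq d0 by (simp add: z_def)
   have zx: "norm (z - x) <= 2*d" using norm_triangle_ineq[of "z - y" "y - x"] zy by (simp add: d_def)
   have dr: "d < r/4" using y by (simp add: d_def dist_norm)
   have "v z <= v x + G x\<bullet>(z - x) + 2*M*(norm (z - x))^2" using zx dr \<open>r > 0\<close> by (intro up) simp
   also have "2*M*(norm (z - x))^2 <= 2*M*(2*d)^2"
    using zx \<open>M >= 0\<close> by (intro mult_left_mono power_mono) auto
   finally have 1: "v z <= v x + G x\<bullet>(z - x) + 8*M*d^2" by (simp add: power2_eq_square)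
   have 2: "v y + G y\<bullet>(z - y) <= v z"
    using y zx dr \<open>r > 0\<close> by (intro sub) (auto simp: dist_norm norm_minus_commute)
   have 3: "v x + G x\<bullet>(y - x) <= v y"
    using y \<open>r > 0\<close> by (intro sub) (auto simp: dist_norm norm_minus_commute)
   have "q\<bullet>(z - y) <= 8*M*d^2" using 1 2 3 by (simp add: q_def inner_diff_left inner_diff_right)
   moreover have "q\<bullet>(z - y) = d*norm q" using nq by (simp add: z_def dot_square_norm power2_eq_square)
   ultimately have "norm q <= 8*M*d" using d0 by (simp add: power2_eq_square)
   then show ?thesis by (simp add: q_def d_def)
  qed
 qed
qed

section \<open>Subgradients of convex functions\<close>

lemma convex_on_closure:
 fixes f :: "'a::real_normed_vector => real" assumes "convex_on S f" "continuous_on (closure S) f"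
 shows "convex_on (closure S) f"
proof (rule convex_onI)
 show "convex (closure S)" using assms(1) by (simp add: convex_on_def convex_closure)
 fix t x y assume t: "(0::real) < t" "t < 1" and x: "x \<in> closure S" and y: "y \<in> closure S"
 obtain X where X: "!!n. X n \<in> S" "X \<longlonglongrightarrow> x" using x by (auto simp: closure_sequential)
 obtain Y where Y: "!!n. Y n \<in> S" "Y \<longlonglongrightarrow> y" using y by (auto simp: closure_sequential)
 define Z where "Z n = (1 - t) *R X n + t *R Y n" for n
 have ZS: "Z n \<in> S" for n using assms(1) X(1) Y(1) t by (auto simp: Z_def convex_on_def intro!: convexD)
 have zc: "(1 - t) *R x + t *R y \<in> closure S"
  using convexD[OF convex_closure x y, of "1 - t" t] assms(1) t by (simp add: convex_on_def)
 have lim: "(%n. f (W n)) \<longlonglongrightarrow> f w" if "!!n. W n \<in> S" "W \<longlonglongrightarrow> w" "w \<in> closure S" for W w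
  using continuous_on_tendsto_compose[OF assms(2) that(2,3)] that(1) closure_subset by (auto intro: always_eventually)
 have "Z \<longlonglongrightarrow> (1 - t) *R x + t *R y" unfolding Z_def by (intro tendsto_intros X Y)
 then have "(%n. f (Z n)) \<longlonglongrightarrow> f ((1 - t) *R x + t *R y)" by (rule lim[OF ZS _ zc])
 moreover have "(%n. (1 - t)*f (X n) + t*f (Y n)) \<longlonglongrightarrow> (1 - t)*f x + t*f y"
  by (intro tendsto_intros lim[OF X x] lim[OF Y y])
 moreover have "f (Z n) <= (1 - t)*f (X n) + t*f (Y n)" for n
  using convex_onD[OF assms(1), of t "X n" "Y n"] t X(1) Y(1) by (simp add: Z_def)
 ultimately show "f ((1 - t) *R x + t *R y) <= (1 - t)*f x + t*f y" by (intro LIMSEQ_le) auto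
qed

text \<open>Separates the point of the graph from the strict epigraph. The separating hyperplane
  cannot be vertical, since \<open>S\<close> is open.\<close>

lemma exists_subgradient:
 fixes f :: "'a::euclidean_space => real" assumes "convex_on S f" "open S" "x \<in> S"
 shows "\<exists>p. \<forall>y\<in>S. p\<bullet>(y - x) + f x <= f y"
proof -
 define epi where "epi = {(y, t). y \<in> S \<and> f y < t}"
 have cepi: "convex epi"
 proof (rule convexI)
  fix P Q u w assume PQ: "P \<in> epi" "Q \<in> epi" and uw: "(0::real) <= u" "0 <= w" "u + w = 1"
  obtain y s z t where e: "P = (y, s)" "Q = (z, t)" "y \<in> S" "z \<in> S" "f y < s" "f z < t" using PQ by (auto simp: epi_def)
  have "f (u *R y + w *R z) <= u*f y + w*f z"
   using convex_onD[OF assms(1), of w y z] e uw by (simp add: eq_diff_eq[symmetric])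
  also have "\<dots> < u * s + w*t"
  proof (cases "u = 0")
   case True
   then show ?thesis using e uw by simp
  next
   case False
   then show ?thesis using e uw by (intro add_less_le_mono) (auto intro: mult_left_mono)
  qed
  finally show "u *R P + w *R Q \<in> epi"
   using e uw convexD[of S y z u w] assms(1) by (auto simp: epi_def convex_on_def)
 qed
 have "(x, f x) \<notin> epi" by (simp add: epi_def)
 then have "{(x, f x)} \<inter> epi = {}" by blast
 moreover have "epi ~= {}" using assms(3) by (auto simp: epi_def intro!: exI[of _ "f x + 1"])
 ultimately obtain P b where P: "P ~= 0" "\<forall>z\<in>{(x, f x)}. P\<bullet>z <= b" "\<forall>z\<in>epi. b <= P\<bullet>z"
  using separating_hyperplane_sets[of "{(x, f x)}" epi] cepi by auto
 obtain q c where Pq: "P = (q, c)" by (cases P)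
 have ineq: "q\<bullet>x + c*f x <= q\<bullet>y + c*t" if "y \<in> S" "f y < t" for y t
  using P(2,3) that by (fastforce simp: Pq epi_def)
 have "c >= 0"
 proof (rule ccontr)
  assume "\<not> c >= 0"
  then show False using ineq[of x "f x + 1"] assms(3) by (simp add: algebra_simps)
 qed
 moreover have "c ~= 0"
 proof
  assume c0: "c = 0"
  then have "q ~= 0" using P(1) Pq by (auto simp: zero_prod_def)
  obtain d where d: "d > 0" "ball x d \<subseteq> S" using assms(2,3) openE by blast
  define y where "y = x - (d/(2*norm q)) *R q"
  have "y \<in> S" using d \<open>q ~= 0\<close> by (auto simp: y_def dist_norm intro!: subsetD[OF d(2)])
  then have "q\<bullet>x <= q\<bullet>y" using ineq[of y "f y + 1"] c0 by simp
  then have "(d/(2*norm q))*(q\<bullet>q) <= 0" by (simp add: y_def inner_diff_right)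
  moreover have "(d/(2*norm q))*(q\<bullet>q) > 0" using d(1) \<open>q ~= 0\<close> by (intro mult_pos_pos) auto
  ultimately show False by linarith
 qed
 ultimately have c: "c > 0" by simp
 have "- (1/c) *R q\<bullet>(y - x) + f x <= f y" if "y \<in> S" for y
 proof (rule field_le_epsilon)
  fix \<epsilon> :: real assume "\<epsilon> > 0"
  then have "q\<bullet>x + c*f x <= q\<bullet>y + c*(f y + \<epsilon>)" using ineq[OF that, of "f y + \<epsilon>"] by simp
  then have "- (q\<bullet>(y - x)) + c*f x <= c*(f y + \<epsilon>)" by (simp add: inner_diff_right)
  then have "(- (q\<bullet>(y - x)) + c*f x)/c <= f y + \<epsilon>" using c by (simp add: divide_le_eq mult.commute)
  then show "- (1/c) *R q\<bullet>(y - x) + f x <= f y + \<epsilon>" using c by (simp add: diff_divide_distrib)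
 qed
 then show ?thesis by blast
qed

text \<open>A convex function lies below its chords, so the inequality at a point close to
  \<open>x\<close> on the segment can be scaled up to \<open>y\<close>.\<close>

lemma local_subgradient_global:
 fixes f :: "'a::euclidean_space => real"
 assumes "convex_on S f" "x \<in> S" and loc: "\<forall>\<^sub>F y in nhds x. f x + p\<bullet>(y - x) <= f y" and "y \<in> S"
 shows "f x + p\<bullet>(y - x) <= f y"
proof -
 have "filterlim (%t. x + t *R (y - x)) (nhds (x + 0 *R (y - x))) (at_right 0)" by (intro tendsto_intros)
 then have "filterlim (%t. x + t *R (y - x)) (nhds x) (at_right 0)" by simp
 from eventually_compose_filterlim[OF loc this]
 have "\<forall>\<^sub>F t in at_right 0. f x + p\<bullet>(x + t *R (y - x) - x) <= f (x + t *R (y - x))" .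
 moreover have "\<forall>\<^sub>F t in at_right (0::real). 0 < t \<and> t < 1"
  by (simp add: eventually_at_right_field) (use zero_less_one in blast)
 ultimately have "\<forall>\<^sub>F t in at_right (0::real). f x + p\<bullet>(y - x) <= f y"
 proof eventually_elim
  case (elim t)
  have "x + t *R (y - x) = (1 - t) *R x + t *R y" by (simp add: algebra_simps)
  then have "f (x + t *R (y - x)) <= (1 - t)*f x + t*f y"
   using convex_onD[OF assms(1), of t x y] assms(2,4) elim by simp
  then have "t*(f x + p\<bullet>(y - x)) <= t*f y" using elim by (simp add: algebra_simps)
  then show ?case using elim by simp
 qed
 then show ?thesis by (simp add: eventually_False trivial_limit_at_right_real)
qed

section \<open>Slopes of the Dirichlet solution\<close>

locale dirichlet_solution =
 fixes \<Omega> :: "(real^2) set" and N :: nat and a :: "nat => real^2" and \<sigma> :: "nat => real"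
  and v :: "real^2 => real"
 assumes convex_\<Omega>: "convex \<Omega>" and open_\<Omega>: "open \<Omega>" and bounded_\<Omega>: "bounded \<Omega>"
  and a_in: "!!i. i \<in> {1..N} ==> a i \<in> \<Omega>" and inj_a: "inj_on a {1..N}"
  and \<sigma>_pos: "!!i. i \<in> {1..N} ==> \<sigma> i > 0"
  and sol: "monge_ampere_solution \<Omega> (dirac_sum N a \<sigma>) v"
begin

abbreviation "sub \<equiv> subdifferential \<Omega> v"

lemma convex_v: "convex_on \<Omega> v" and cont_v: "continuous_on (closure \<Omega>) v"
 and MA: "!!E. E \<in> sets borel ==> E \<subseteq> \<Omega> ==> monge_ampere \<Omega> v E = dirac_sum N a \<sigma> E"
 and bdry: "!!x. x \<in> frontier \<Omega> ==> v x = 0" using sol by (auto simp: monge_ampere_solution_def)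

lemma convex_v_closure: "convex_on (closure \<Omega>) v" using convex_v cont_v by (rule convex_on_closure)

lemma compact_closure_\<Omega>: "compact (closure \<Omega>)" using bounded_\<Omega> by (simp add: compact_closure)

lemma closure_\<Omega>_cases: "x \<in> closure \<Omega> ==> x \<in> \<Omega> \<or> x \<in> frontier \<Omega>"
 using open_\<Omega> by (auto simp: frontier_def interior_open)

lemma frontier_not_in: "x \<in> frontier \<Omega> ==> x \<notin> \<Omega>"
 using open_\<Omega> by (auto simp: frontier_def interior_open)

text \<open>A compact convex set is the hull of its frontier, where \<open>v\<close>
  vanishes.\<close>

lemma v_nonpos: assumes "x \<in> closure \<Omega>" shows "v x <= 0"
proof -
 have hull: "closure \<Omega> = convex hull (frontier (closure \<Omega>))"
  using Krein_Milman_frontier[of "closure \<Omega>"] convex_\<Omega> compact_closure_\<Omega> by (simp add: convex_closure)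
 have "\<forall>y\<in>convex hull (frontier (closure \<Omega>)). v y <= 0"
 proof (rule convex_on_convex_hull_bound)
  show "convex_on (convex hull (frontier (closure \<Omega>))) v" using convex_v_closure hull by simp
  have "frontier (closure \<Omega>) \<subseteq> frontier \<Omega>"
   using interior_mono[OF closure_subset[of \<Omega>]] by (auto simp: frontier_def)
  then show "\<forall>x\<in>frontier (closure \<Omega>). v x <= 0" using bdry by auto
 qed
 then show ?thesis using assms hull by blast
qed

lemma sub_closure: assumes "p \<in> sub x" "y \<in> closure \<Omega>" shows "v x + p\<bullet>(y - x) <= v y"
proof -
 obtain Y where Y: "!!n. Y n \<in> \<Omega>" "Y \<longlonglongrightarrow> y" using assms(2) by (auto simp: closure_sequential)
 have "(%n. v (Y n)) \<longlonglongrightarrow> v y"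
  using continuous_on_tendsto_compose[OF cont_v Y(2) assms(2)] Y(1) closure_subset by (auto intro: always_eventually)
 moreover have "(%n. v x + p\<bullet>(Y n - x)) \<longlonglongrightarrow> v x + p\<bullet>(y - x)" by (intro tendsto_intros Y)
 moreover have "v x + p\<bullet>(Y n - x) <= v (Y n)" for n
  using assms(1) Y(1) by (auto simp: subdifferential_def add.commute)
 ultimately show ?thesis by (intro LIMSEQ_le) auto
qed

lemma sub_nonempty: "x \<in> \<Omega> ==> \<exists>p. p \<in> sub x"
 using exists_subgradient[OF convex_v open_\<Omega>] by (auto simp: subdifferential_def)

lemma subI: "x \<in> \<Omega> ==> (!!y. y \<in> \<Omega> ==> v x + p\<bullet>(y - x) <= v y) ==> p \<in> sub x"
 by (auto simp: subdifferential_def add.commute)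

text \<open>Slopes and their base points can be followed to a limit along a subsequence. Closedness
  over compact sets makes the slope images of open sets measurable.\<close>

lemma closed_sub_image: assumes "compact K" "K \<subseteq> \<Omega>" shows "closed (\<Union>x\<in>K. sub x)"
 unfolding closed_sequential_limits
proof (intro allI impI, elim conjE)
 fix P p assume P: "\<forall>n. P n \<in> (\<Union>x\<in>K. sub x)" "P \<longlonglongrightarrow> p"
 then have "\<forall>n. \<exists>x. x \<in> K \<and> P n \<in> sub x" by blast
 then obtain X where X: "!!n. X n \<in> K" "!!n. P n \<in> sub (X n)" by metis
 obtain x r where x: "x \<in> K" "strict_mono r" "(X \<circ> r) \<longlonglongrightarrow> x"
  using assms(1) X(1) unfolding compact_def by metis
 have xO: "x \<in> \<Omega>" using x assms by blast
 have "p \<in> sub x"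
 proof (rule subI[OF xO])
  fix y assume y: "y \<in> \<Omega>"
  have "(%n. v ((X \<circ> r) n)) \<longlonglongrightarrow> v x"
   using continuous_on_tendsto_compose[OF cont_v x(3)] xO X(1) assms(2) closure_subset by (auto intro!: always_eventually)
  moreover have "(P \<circ> r) \<longlonglongrightarrow> p" using P(2) x(2) by (rule LIMSEQ_subseq_LIMSEQ)
  ultimately have "(%n. v ((X \<circ> r) n) + (P \<circ> r) n\<bullet>(y - (X \<circ> r) n)) \<longlonglongrightarrow> v x + p\<bullet>(y - x)"
   by (intro tendsto_intros x(3))
  moreover have "v ((X \<circ> r) n) + (P \<circ> r) n\<bullet>(y - (X \<circ> r) n) <= v y" for n
   using X(2)[of "r n"] y by (auto simp: subdifferential_def add.commute)
  ultimately show "v x + p\<bullet>(y - x) <= v y" by (intro LIMSEQ_le_const2) auto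
 qed
 then show "p \<in> (\<Union>x\<in>K. sub x)" using x(1) by blast
qed

lemma sub_image_sets: assumes "open D" "D \<subseteq> \<Omega>" shows "(\<Union>x\<in>D. sub x) \<in> sets lebesgue"
proof -
 obtain K :: "nat => (real^2) set" where K: "!!n. compact (K n)" "!!n. K n \<subseteq> D" "\<Union>(range K) = D"
  using open_Union_compact_subsets[OF assms(1)] by metis
 have "(\<Union>x\<in>D. sub x) = (\<Union>n. \<Union>x\<in>K n. sub x)" using K(3) by blast
 moreover have "(\<Union>x\<in>K n. sub x) \<in> sets lebesgue" for n
 proof -
  have "closed (\<Union>x\<in>K n. sub x)" using closed_sub_image[OF K(1)] order_trans[OF K(2) assms(2)] by blast
  then show ?thesis by (simp add: borel_closed)
 qed
 ultimately show ?thesis by auto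
qed

lemma emeasure_sub_image:
 assumes "open D" "D \<subseteq> \<Omega>" shows "emeasure lebesgue (\<Union>x\<in>D. sub x) = dirac_sum N a \<sigma> D"
 using MA[of D] assms by (simp add: monge_ampere_def)

text \<open>A negative value of \<open>v\<close> makes every sufficiently small vector a subgradient.\<close>

lemma zero_if_no_atoms: assumes N: "N = 0" and x0: "x0 \<in> \<Omega>" shows "v x0 = 0"
proof (rule ccontr)
 assume "v x0 ~= 0"
 then have neg: "v x0 < 0" using v_nonpos[of x0] closure_subset x0 by force
 obtain B where B: "B > 0" "!!y. y \<in> closure \<Omega> ==> norm y <= B"
  using compact_imp_bounded[OF compact_closure_\<Omega>] unfolding bounded_pos by blast
 define R where "R = B + norm x0"
 have R: "R > 0" using B(1) norm_ge_zero[of x0] unfolding R_def by linarith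
 have RB: "norm (y - x0) <= R" if "y \<in> closure \<Omega>" for y
  using B(2)[OF that] norm_triangle_ineq4[of y x0] unfolding R_def by linarith
 \<comment> \<open>A plane through the graph at \<open>x0\<close> with slope below \<epsilon> stays
   under v x0 / 2 < 0 on the closure, so \<open>v\<close> minus the plane has its minimum in the
   interior.\<close>
 define \<epsilon> where "\<epsilon> = - v x0/(2 * R)"
 have \<epsilon>: "\<epsilon> > 0" "\<epsilon> * R = - v x0/2" using neg R by (simp_all add: \<epsilon>_def divide_neg_pos)
 have "ball 0 \<epsilon> \<subseteq> (\<Union>x\<in>\<Omega>. sub x)"
 proof
  fix p :: "real^2" assume "p \<in> ball 0 \<epsilon>"
  then have p: "norm p < \<epsilon>" by simp
  have "x0 \<in> closure \<Omega>" using x0 closure_subset by blast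
  then have ne: "closure \<Omega> ~= {}" by auto
  have "continuous_on (closure \<Omega>) (%y. v y - p\<bullet>(y - x0))" by (intro continuous_intros cont_v)
  from continuous_attains_inf[OF compact_closure_\<Omega> ne this]
  obtain z where z: "z \<in> closure \<Omega>" "!!y. y \<in> closure \<Omega> ==> v z - p\<bullet>(z - x0) <= v y - p\<bullet>(y - x0)" by blast
  have "z \<notin> frontier \<Omega>"
  proof
   assume "z \<in> frontier \<Omega>"
   then have "- (p\<bullet>(z - x0)) <= v x0" using z(2)[OF \<open>x0 \<in> closure \<Omega>\<close>] bdry by simp
   moreover have "\<bar>p\<bullet>(z - x0)\<bar> <= \<epsilon> * R"
    by (rule order_trans[OF Cauchy_Schwarz_ineq2]) (use p RB[OF z(1)] \<epsilon>(1) in \<open>intro mult_mono; simp\<close>)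
   ultimately show False using \<epsilon>(2) neg by linarith
  qed
  then have zO: "z \<in> \<Omega>" using closure_\<Omega>_cases[OF z(1)] by blast
  have "p \<in> sub z"
  proof (rule subI[OF zO])
   fix y assume "y \<in> \<Omega>"
   then have "v z - p\<bullet>(z - x0) <= v y - p\<bullet>(y - x0)" using z(2) closure_subset by blast
   then show "v z + p\<bullet>(y - z) <= v y" by (simp add: inner_diff_right)
  qed
  then show "p \<in> (\<Union>x\<in>\<Omega>. sub x)" using zO by blast
 qed
 then have "emeasure lebesgue (ball (0 :: real^2) \<epsilon>) <= emeasure lebesgue (\<Union>x\<in>\<Omega>. sub x)"
  by (rule emeasure_mono) (rule sub_image_sets[OF open_\<Omega> order_refl])
 also have "\<dots> = 0" unfolding emeasure_sub_image[OF open_\<Omega> order_refl] using N by (simp add: dirac_sum_def)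
 finally have "ball (0 :: real^2) \<epsilon> \<in> null_sets lebesgue" by (simp add: null_sets_def)
 then have "negligible (ball (0 :: real^2) \<epsilon>)" by (simp add: negligible_iff_null_sets)
 then show False using open_not_negligible[of "ball (0 :: real^2) \<epsilon>"] \<epsilon>(1) by auto
qed

end

section \<open>Contact sets of supporting planes\<close>

locale ma_solution = dirichlet_solution + assumes N_pos: "N >= 1"
begin

definition vertices :: "(real^2) set" where "vertices = a ` {1..N}"

lemma vertices_props: "finite vertices" "vertices \<subseteq> \<Omega>" "vertices ~= {}"
 using a_in N_pos by (auto simp: vertices_def)

lemma emeasure_sub_avoiding_vertices: assumes "closed K" "K \<subseteq> \<Omega>" "K \<inter> vertices = {}"
 shows "emeasure lebesgue (\<Union>x\<in>K. sub x) = 0"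
proof -
 have "monge_ampere \<Omega> v K = dirac_sum N a \<sigma> K" using assms by (intro MA) auto
 also have "\<dots> = 0" using assms(3) by (auto simp: dirac_sum_def vertices_def indicator_def)
 finally show ?thesis by (simp add: monge_ampere_def)
qed

lemma not_negligible_sub_vertex: assumes "x \<in> vertices" shows "\<not> negligible (sub x)"
proof
 assume neg: "negligible (sub x)"
 obtain i where i: "i \<in> {1..N}" "x = a i" using assms by (auto simp: vertices_def)
 have "ennreal (\<sigma> i)*indicator {x} (a i) <= dirac_sum N a \<sigma> {x}"
  unfolding dirac_sum_def by (rule member_le_sum) (use i in auto)
 also have "\<dots> = monge_ampere \<Omega> v {x}" using i a_in by (intro MA[symmetric]) auto
 also have "\<dots> = emeasure lebesgue (sub x)" by (simp add: monge_ampere_def)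
 also have "\<dots> = 0" using neg negligible_iff_null_sets null_setsD1 by blast
 finally show False using \<sigma>_pos[OF i(1)] i(2) by simp
qed

definition contact :: "real^2 => real^2 => (real^2) set" where
 "contact x p = {y \<in> closure \<Omega>. v y = v x + p\<bullet>(y - x)}"

lemma compact_contact: "compact (contact x p)"
proof -
 have "continuous_on (closure \<Omega>) (%y. v y - (v x + p\<bullet>(y - x)))" by (intro continuous_intros cont_v)
 from continuous_closed_preimage_constant[OF this closed_closure, of 0]
 have "closed (contact x p)" by (simp add: contact_def)
 then show ?thesis using compact_closure_\<Omega> unfolding contact_def
  by (auto simp: compact_eq_bounded_closed intro: bounded_subset)
qed

lemma contact_sub: assumes "p \<in> sub x" "y \<in> contact x p" "y \<in> \<Omega>"
 shows "p \<in> sub y" "contact y p = contact x p"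
proof -
 have y: "v y = v x + p\<bullet>(y - x)" using assms(2) by (simp add: contact_def)
 show "p \<in> sub y" using assms(1,3) y by (auto simp: subdifferential_def inner_diff_right algebra_simps)
 show "contact y p = contact x p" by (auto simp: contact_def y inner_diff_right)
qed

lemma convex_contact: assumes "p \<in> sub x" shows "convex (contact x p)"
proof (rule convexI)
 fix y z u w assume yz: "y \<in> contact x p" "z \<in> contact x p" and uw: "(0::real) <= u" "0 <= w" "u + w = 1"
 have yz': "y \<in> closure \<Omega>" "z \<in> closure \<Omega>" using yz by (auto simp: contact_def)
 have c: "u *R y + w *R z \<in> closure \<Omega>" using convexD[OF convex_closure[OF convex_\<Omega>] yz' uw] .
 have "v (u *R y + w *R z) <= u * v y + w * v z"
  using convex_onD[OF convex_v_closure, of w y z] yz' uw by (simp add: eq_diff_eq[symmetric])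
 also have "\<dots> = (u + w) * v x + p\<bullet>(u *R y + w *R z - (u + w) *R x)"
 proof -
  have e: "v y = v x + (p\<bullet>y - p\<bullet>x)" "v z = v x + (p\<bullet>z - p\<bullet>x)"
   using yz by (auto simp: contact_def inner_diff_right)
  show ?thesis unfolding e by (simp add: inner_simps algebra_simps)
 qed
 also have "\<dots> = v x + p\<bullet>(u *R y + w *R z - x)" using uw by simp
 finally show "u *R y + w *R z \<in> contact x p" using sub_closure[OF assms c] c by (simp add: contact_def)
qed

text \<open>The farthest point of a contact set from a suitable centre is strongly exposed. If it were neither
 a vertex nor on the boundary, all slopes near a tilted support would occur near it, although these
 slopes have measure zero.\<close>

lemma contact_hull: assumes x: "x \<in> \<Omega>" and p: "p \<in> sub x"
 shows "x \<in> convex hull (contact x p \<inter> (vertices \<union> frontier \<Omega>))"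
proof (rule ccontr)
 let ?K = "contact x p" and ?E = "vertices \<union> frontier \<Omega>"
 define H where "H = convex hull (?K \<inter> ?E)"
 assume "x \<notin> convex hull (?K \<inter> ?E)"
 then have xH: "x \<notin> H" by (simp add: H_def)
 have "closed ?E" using vertices_props(1) by (intro closed_Un finite_imp_closed frontier_closed)
 then have "compact H" unfolding H_def using compact_contact by (intro compact_convex_hull compact_Int_closed)
 then have "closed H" "convex H" "bounded H" by (auto simp: H_def compact_imp_closed compact_imp_bounded)
 obtain q b where qb: "q\<bullet>x < b" "!!y. y \<in> H ==> q\<bullet>y > b"
  using separating_hyperplane_closed_point[OF \<open>convex H\<close> \<open>closed H\<close> xH] by auto
 obtain B where B: "!!y. y \<in> H ==> norm (y - x) <= B" "B > 0"
 proof -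
  have "bounded ((%y. y - x) ` H)" using \<open>bounded H\<close> bounded_translation_minus by blast
  then show ?thesis using that unfolding bounded_pos by auto
 qed
 define m where "m = b - q\<bullet>x"
 have m: "m > 0" using qb(1) by (simp add: m_def)
 \<comment> \<open>With the centre moved this far in direction \<open>q\<close>, the ball around
   \<open>c\<close> through \<open>x\<close> contains \<open>H\<close> in its interior.\<close>
 define s where "s = B^2/m"
 define c where "c = x + s *R q"
 have farH: "norm (y - c) < norm (x - c)" if "y \<in> H" for y
 proof -
  have "q\<bullet>(y - x) > m" using qb(2)[OF that] by (simp add: m_def inner_diff_right)
  then have "s*(q\<bullet>(y - x)) > s*m" using B(2) m by (intro mult_strict_left_mono) (auto simp: s_def)
  then have "2*(s*(q\<bullet>(y - x))) > 2*B^2" using m by (simp add: s_def)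
  moreover have "(norm (y - x))^2 <= B^2" using B(1)[OF that] by (intro power_mono) auto
  moreover have "0 < B^2" using B(2) by simp
  moreover have "(norm (y - c))^2 = (norm (y - x))^2 - 2*(s*(q\<bullet>(y - x))) + (norm (x - c))^2"
   unfolding c_def power2_norm_eq_inner by (simp add: inner_simps algebra_simps inner_commute)
  ultimately have "(norm (y - c))^2 < (norm (x - c))^2" by linarith
  then show ?thesis by (rule power2_less_imp_less) simp
 qed
 have xK: "x \<in> ?K" using x closure_subset by (auto simp: contact_def)
 obtain e where e: "e \<in> ?K" "!!y. y \<in> ?K ==> norm (y - c) <= norm (e - c)"
 proof -
  have "continuous_on ?K (%y. norm (y - c))" by (intro continuous_intros)
  then show ?thesis using continuous_attains_sup[OF compact_contact, of x p "%y. norm (y - c)"] xK that by blast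
 qed
 have "e \<notin> H" using farH[of e] e(2)[OF xK] by auto
 then have eE: "e \<notin> ?E" using e(1) hull_subset[of "?K \<inter> ?E" convex] by (auto simp: H_def)
 then have eO: "e \<in> \<Omega>" using e(1) closure_\<Omega>_cases by (auto simp: contact_def)
 define n where "n = e - c"
 \<comment> \<open>Farthest points are strongly exposed: \<open>n\<close> separates \<open>e\<close>
   from the other contact points with a quadratic margin.\<close>
 have nK: "n\<bullet>(y - e) <= - (norm (y - e))\<^sup>2/2" if "y \<in> ?K" for y
 proof -
  have "(norm (y - c))^2 <= (norm (e - c))^2" using e(2)[OF that] by (intro power_mono) auto
  moreover have "(norm (y - c))^2 = (norm (y - e))^2 + 2*(n\<bullet>(y - e)) + (norm (e - c))^2"
   unfolding n_def power2_norm_eq_inner by (simp add: inner_simps algebra_simps inner_commute)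
  ultimately show ?thesis by simp
 qed
 have "open (\<Omega> - vertices)" using open_\<Omega> vertices_props(1) by (simp add: open_Diff finite_imp_closed)
 then obtain r where r: "r > 0" "cball e r \<subseteq> \<Omega> - vertices"
  using eO eE open_contains_cball[of "\<Omega> - vertices"] by auto
 have pe: "p \<in> sub e" "contact e p = ?K" using contact_sub[OF p e(1) eO] by auto
 define g where "g y = v y - (v e + p\<bullet>(y - e))" for y
 have cballO: "cball e r \<subseteq> closure \<Omega>" using r(2) closure_subset by blast
 have g0: "g y >= 0" if "y \<in> cball e r" for y using sub_closure[OF pe(1), of y] that cballO by (auto simp: g_def)
 have gcont: "continuous_on (cball e r) g" unfolding g_def by (intro continuous_intros continuous_on_subset[OF cont_v cballO])
 define T where "T = sphere e r"
 have TB: "T \<subseteq> cball e r" "compact T" by (auto simp: T_def)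
 \<comment> \<open>On the sphere either \<open>n\<close> decreases by a definite amount, and the
   tilt helps, or the point is no contact point and \<open>g\<close> is positive. Compactness of the
   second set leaves room for a small tilt.\<close>
 obtain \<epsilon> where \<epsilon>: "\<epsilon> > 0" "!!y. y \<in> T ==> g y - \<epsilon>*(n\<bullet>(y - e)) > 0"
 proof -
  define T' where "T' = {y \<in> T. - r\<^sup>2/4 <= n\<bullet>(y - e)}"
  have "closed T'" unfolding T'_def
   by (rule continuous_on_closed_Collect_le) (use TB in \<open>auto intro!: continuous_intros simp: compact_imp_closed\<close>)
  then have cT': "compact T'" using TB(2) unfolding T'_def by (auto simp: compact_eq_bounded_closed intro: bounded_subset)
  have gT': "g y > 0" if "y \<in> T'" for y
  proof -
   have y: "y \<in> cball e r" "norm (y - e) = r" using that TB by (auto simp: T'_def T_def dist_norm norm_minus_commute)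
   have "y \<notin> ?K"
   proof
    assume "y \<in> ?K"
    then have "n\<bullet>(y - e) <= - r\<^sup>2/2" using nK[of y] y(2) by simp
    moreover have "- r\<^sup>2/4 <= n\<bullet>(y - e)" using that by (simp add: T'_def)
    moreover have "r^2 > 0" using r(1) by simp
    ultimately show False by linarith
   qed
   then have "g y ~= 0" using y(1) cballO unfolding pe(2)[symmetric] by (auto simp: contact_def g_def)
   then show ?thesis using g0[OF y(1)] by simp
  qed
  have neg: "g y - \<epsilon>*(n\<bullet>(y - e)) > 0" if "y \<in> T" "y \<notin> T'" "\<epsilon> > 0" for y \<epsilon>
  proof -
   have "n\<bullet>(y - e) < - r\<^sup>2/4" using that(1,2) by (auto simp: T'_def)
   then have "n\<bullet>(y - e) < 0" using r(1) by (smt (verit) divide_nonpos_pos zero_le_power2)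
   then have "\<epsilon>*(n\<bullet>(y - e)) < 0" using \<open>\<epsilon> > 0\<close> by (simp add: mult_pos_neg)
   then show ?thesis using g0[of y] that(1) TB(1) by force
  qed
  show ?thesis
  proof (cases "T' = {}")
   case True
   then show ?thesis using neg[of _ 1] that[of 1] by auto
  next
   case False
   have "continuous_on T' g" by (rule continuous_on_subset[OF gcont]) (use TB(1) in \<open>auto simp: T'_def\<close>)
   then obtain y0 where y0: "y0 \<in> T'" "!!y. y \<in> T' ==> g y0 <= g y" using continuous_attains_inf[OF cT' False] by blast
   define D where "D = norm n*r + 1"
   define \<epsilon> where "\<epsilon> = g y0/(2*D)"
   have pos: "D > 0" using r(1) by (simp add: D_def add_nonneg_pos)
   have \<epsilon>0: "\<epsilon> > 0" using gT'[OF y0(1)] pos by (simp add: \<epsilon>_def)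
   have "g y - \<epsilon>*(n\<bullet>(y - e)) > 0" if "y \<in> T'" for y
   proof -
    have "norm (y - e) = r" using that by (auto simp: T'_def T_def dist_norm norm_minus_commute)
    then have "n\<bullet>(y - e) <= D" using norm_cauchy_schwarz[of n "y - e"] by (simp add: D_def)
    then have "\<epsilon>*(n\<bullet>(y - e)) <= \<epsilon>*D" using \<epsilon>0 by (intro mult_left_mono) auto
    also have "\<dots> = g y0/2" using pos by (simp add: \<epsilon>_def)
    also have "\<dots> < g y" using y0(2)[OF that] gT'[OF y0(1)] by simp
    finally show ?thesis by simp
   qed
   then show ?thesis using neg[OF _ _ \<epsilon>0] that[OF \<epsilon>0] by blast
  qed
 qed
 have "T ~= {}" using r(1) by (simp add: T_def)
 moreover have "continuous_on T (%y. g y - \<epsilon>*(n\<bullet>(y - e)))"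
  by (intro continuous_intros continuous_on_subset[OF gcont TB(1)])
 ultimately obtain y0 where y0: "y0 \<in> T" "!!y. y \<in> T ==> g y0 - \<epsilon>*(n\<bullet>(y0 - e)) <= g y - \<epsilon>*(n\<bullet>(y - e))"
  using continuous_attains_inf[OF TB(2)] by blast
 define m2 where "m2 = g y0 - \<epsilon>*(n\<bullet>(y0 - e))"
 have m2: "m2 > 0" using \<epsilon>(2)[OF y0(1)] by (simp add: m2_def)
 \<comment> \<open>For slopes near the tilted one the minimum over the closed ball around
   \<open>e\<close> is attained inside, so an open set of slopes comes from a region without
   atoms.\<close>
 have "ball (p + \<epsilon> *R n) (m2/r) \<subseteq> (\<Union>y\<in>cball e r. sub y)"
 proof
  fix p' assume p': "p' \<in> ball (p + \<epsilon> *R n) (m2/r)"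
  define w where "w = p' - (p + \<epsilon> *R n)"
  have w: "norm w*r < m2" using p' r(1) by (simp add: w_def dist_norm norm_minus_commute less_divide_eq)
  have "continuous_on (cball e r) (%y. v y - p'\<bullet>y)"
   by (intro continuous_intros continuous_on_subset[OF cont_v cballO])
  then obtain x' where x': "x' \<in> cball e r" "!!y. y \<in> cball e r ==> v x' - p'\<bullet>x' <= v y - p'\<bullet>y"
   using continuous_attains_inf[OF compact_cball, of e r] r(1) by force
  have "x' \<notin> T"
  proof
   assume xT: "x' \<in> T"
   then have nx: "norm (x' - e) = r" by (auto simp: T_def dist_norm norm_minus_commute)
   have "m2 <= g x' - \<epsilon>*(n\<bullet>(x' - e))" using y0(2)[OF xT] by (simp add: m2_def)
   moreover have "w\<bullet>(x' - e) <= norm w*r" using norm_cauchy_schwarz[of w "x' - e"] nx by simp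
   ultimately have "v x' - v e - p'\<bullet>(x' - e) > 0" using w by (simp add: g_def w_def inner_simps algebra_simps)
   moreover have "v x' - p'\<bullet>x' <= v e - p'\<bullet>e" using x'(2)[of e] r(1) by simp
   ultimately show False by (simp add: inner_diff_right)
  qed
  then have x'b: "x' \<in> ball e r" using x'(1) by (auto simp: T_def)
  have "p' \<in> sub x'"
  proof (rule subI)
   show "x' \<in> \<Omega>" using x'(1) r(2) by blast
   fix y assume "y \<in> \<Omega>"
   have "\<forall>\<^sub>F y in nhds x'. y \<in> ball e r" using x'b by (intro eventually_nhds_in_open) auto
   then have "\<forall>\<^sub>F y in nhds x'. v x' + p'\<bullet>(y - x') <= v y"
   proof eventually_elim
    case (elim y)
    then show ?case using x'(2)[of y] by (simp add: inner_diff_right)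
   qed
   then show "v x' + p'\<bullet>(y - x') <= v y"
    using local_subgradient_global[OF convex_v \<open>x' \<in> \<Omega>\<close> _ \<open>y \<in> \<Omega>\<close>] by blast
  qed
  then show "p' \<in> (\<Union>y\<in>cball e r. sub y)" using x'(1) by blast
 qed
 moreover have cl: "closed (\<Union>y\<in>cball e r. sub y)" using r(2) by (intro closed_sub_image) auto
 moreover have "emeasure lebesgue (\<Union>y\<in>cball e r. sub y) = 0"
  using r(2) by (intro emeasure_sub_avoiding_vertices) auto
 then have "negligible (\<Union>y\<in>cball e r. sub y)" using cl by (auto simp: negligible_iff_null_sets null_sets_def)
 ultimately have "negligible (ball (p + \<epsilon> *R n) (m2/r))" using negligible_subset by blast
 moreover have "m2/r > 0" using m2 r(1) by simp
 ultimately show False using open_not_negligible[of "ball (p + \<epsilon> *R n) (m2/r)"]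
  by (metis ball_eq_empty not_le open_ball)
qed

end

section \<open>Interior balls of C^{1,1} domains\<close>

lemma C11_boundaryE: assumes C11: "C11_boundary \<Omega>" and x0: "x0 \<in> frontier \<Omega>"
 obtains r0 e1 e2 \<gamma> \<gamma>' L where "r0 > 0" "norm e1 = 1" "norm e2 = 1" "e1\<bullet>e2 = 0"
  "!!t::real. (\<gamma> has_real_derivative \<gamma>' t) (at t)" "L-lipschitz_on UNIV \<gamma>'"
  "\<Omega> \<inter> ball x0 r0 = {y \<in> ball x0 r0. y\<bullet>e2 > \<gamma> (y\<bullet>e1)}"
proof -
 from bspec[OF C11[unfolded C11_boundary_def] x0] obtain r0 where 1: "r0 > 0 \<and> (\<exists>e1 e2. norm e1 = 1 \<and> norm e2 = 1 \<and> e1\<bullet>e2 = 0 \<and>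
    (\<exists>\<gamma> \<gamma>' L. (\<forall>t::real. (\<gamma> has_real_derivative \<gamma>' t) (at t)) \<and> L-lipschitz_on UNIV \<gamma>' \<and>
      \<Omega> \<inter> ball x0 r0 = {y \<in> ball x0 r0. y\<bullet>e2 > \<gamma> (y\<bullet>e1)}))" by (rule exE)
 from conjunct2[OF 1] obtain e1 where "\<exists>e2. norm e1 = 1 \<and> norm e2 = 1 \<and> e1\<bullet>e2 = 0 \<and>
    (\<exists>\<gamma> \<gamma>' L. (\<forall>t::real. (\<gamma> has_real_derivative \<gamma>' t) (at t)) \<and> L-lipschitz_on UNIV \<gamma>' \<and>
      \<Omega> \<inter> ball x0 r0 = {y \<in> ball x0 r0. y\<bullet>e2 > \<gamma> (y\<bullet>e1)})" by (rule exE)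
 then obtain e2 where 2: "norm e1 = 1 \<and> norm e2 = 1 \<and> e1\<bullet>e2 = 0 \<and>
    (\<exists>\<gamma> \<gamma>' L. (\<forall>t::real. (\<gamma> has_real_derivative \<gamma>' t) (at t)) \<and> L-lipschitz_on UNIV \<gamma>' \<and>
      \<Omega> \<inter> ball x0 r0 = {y \<in> ball x0 r0. y\<bullet>e2 > \<gamma> (y\<bullet>e1)})" by (rule exE)
 then have "\<exists>\<gamma> \<gamma>' L. (\<forall>t::real. (\<gamma> has_real_derivative \<gamma>' t) (at t)) \<and> L-lipschitz_on UNIV \<gamma>' \<and>
      \<Omega> \<inter> ball x0 r0 = {y \<in> ball x0 r0. y\<bullet>e2 > \<gamma> (y\<bullet>e1)}" by (elim conjE)
 then obtain \<gamma> \<gamma>' L where 3: "(\<forall>t::real. (\<gamma> has_real_derivative \<gamma>' t) (at t)) \<and> L-lipschitz_on UNIV \<gamma>' \<and>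
      \<Omega> \<inter> ball x0 r0 = {y \<in> ball x0 r0. y\<bullet>e2 > \<gamma> (y\<bullet>e1)}" by (elim exE)
 show thesis by (rule that[OF conjunct1[OF 1] conjunct1[OF 2] conjunct1[OF conjunct2[OF 2]]
     conjunct1[OF conjunct2[OF conjunct2[OF 2]]] spec[OF conjunct1[OF 3]]
     conjunct1[OF conjunct2[OF 3]] conjunct2[OF conjunct2[OF 3]]])
qed

text \<open>The Lipschitz bound on \<gamma>' puts the graph of \<gamma> below a parabola at each of
  its points, and a small ball touching the graph from above stays above that parabola.\<close>

lemma C11_interior_ball_local: assumes C11: "C11_boundary \<Omega>" and x0: "x0 \<in> frontier \<Omega>" and op: "open \<Omega>"
 shows "\<exists>s>0. \<exists>r>0. \<forall>b\<in>frontier \<Omega> \<inter> ball x0 s. \<exists>\<nu>. norm \<nu> = 1 \<and> cball (b - r *R \<nu>) r \<subseteq> closure \<Omega>"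
proof (rule C11_boundaryE[OF C11 x0])
 fix r0 e1 e2 \<gamma> \<gamma>' L
 assume r0: "r0 > 0" and e: "norm e1 = 1" "norm e2 = 1" "e1\<bullet>e2 = 0"
  and \<gamma>: "!!t::real. (\<gamma> has_real_derivative \<gamma>' t) (at t)" and L: "L-lipschitz_on UNIV \<gamma>'"
  and \<Omega>: "\<Omega> \<inter> ball x0 r0 = {y \<in> ball x0 r0. y\<bullet>e2 > \<gamma> (y\<bullet>e1)}"
 have L0: "L >= 0" using L by (rule lipschitz_on_nonneg)
 \<comment> \<open>The first term keeps the ball inside the chart, the second beats the curvature;
   \<open>L + 1\<close> instead of \<open>L\<close> makes the inequality strict even for
   \<open>L = 0\<close>.\<close>
 define r where "r = min (r0/8) (1/(2*(L + 1)))"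
 have r: "r > 0" "r <= r0/8" "r <= 1/(2*(L + 1))" using r0 L0 by (auto simp: r_def)
 have \<gamma>cont: "continuous_on UNIV \<gamma>" by (rule DERIV_continuous_on) (rule has_field_derivative_at_within[OF \<gamma>])
 have "\<exists>\<nu>. norm \<nu> = 1 \<and> cball (b - r *R \<nu>) r \<subseteq> closure \<Omega>" if b: "b \<in> frontier \<Omega>" "b \<in> ball x0 (r0/2)" for b
 proof -
  have bb: "b \<in> ball x0 r0" using b(2) r0 by auto
  have "b \<notin> \<Omega>" using b(1) op by (simp add: frontier_def interior_open)
  then have "b \<notin> \<Omega> \<inter> ball x0 r0" by blast
  then have b1: "b\<bullet>e2 <= \<gamma> (b\<bullet>e1)" unfolding \<Omega> using bb by simp
  have b2: "b\<bullet>e2 >= \<gamma> (b\<bullet>e1)"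
  proof (rule ccontr)
   assume "\<not> ?thesis"
   then have "b \<in> {y. y\<bullet>e2 < \<gamma> (y\<bullet>e1)} \<inter> ball x0 r0" using bb by simp
   moreover have "open ({y. y\<bullet>e2 < \<gamma> (y\<bullet>e1)} \<inter> ball x0 r0)"
    by (intro open_Int open_Collect_less continuous_intros continuous_on_compose2[OF \<gamma>cont]) auto
   moreover have "b \<in> closure \<Omega>" using b(1) by (simp add: frontier_def)
   ultimately obtain y where "y \<in> \<Omega>" "y \<in> ball x0 r0" "y\<bullet>e2 < \<gamma> (y\<bullet>e1)"
    using open_Int_closure_eq_empty[of "{y. y\<bullet>e2 < \<gamma> (y\<bullet>e1)} \<inter> ball x0 r0" \<Omega>] by blast
   then have "y \<in> \<Omega> \<inter> ball x0 r0" by blast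
   then show False using \<open>y\<bullet>e2 < \<gamma> (y\<bullet>e1)\<close> unfolding \<Omega> by simp
  qed
  define m where "m = \<gamma>' (b\<bullet>e1)"
  define k where "k = sqrt (1 + m^2)"
  have k: "k >= 1" "k^2 = 1 + m^2" by (auto simp: k_def)
  \<comment> \<open>The outer unit normal of the graph at \<open>b\<close>.\<close>
  define \<nu> where "\<nu> = (1/k) *R (m *R e1 - e2)"
  have ee: "e1\<bullet>e1 = 1" "e2\<bullet>e2 = 1" "e2\<bullet>e1 = 0"
   using e by (simp_all add: dot_square_norm inner_commute)
  have "(norm (m *R e1 - e2))^2 = k^2"
   unfolding power2_norm_eq_inner k(2) by (simp add: inner_simps ee e power2_eq_square)
  then have "norm (m *R e1 - e2) = k" using k(1) power2_eq_iff_nonneg[of "norm (m *R e1 - e2)" k] by simp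
  then have n\<nu>: "norm \<nu> = 1" using k(1) by (simp add: \<nu>_def)
  have "cball (b - r *R \<nu>) r \<subseteq> closure \<Omega>"
  proof
   fix y assume y: "y \<in> cball (b - r *R \<nu>) r"
   define h where "h = y - b"
   have "norm (h + r *R \<nu>) <= r" using y by (simp add: h_def dist_norm norm_minus_commute algebra_simps)
   then have "(norm (h + r *R \<nu>))^2 <= r^2" by (intro power_mono) auto
   moreover have "(norm (h + r *R \<nu>))^2 = (norm h)^2 + 2*r*(h\<bullet>\<nu>) + r^2"
   proof -
    have "\<nu>\<bullet>\<nu> = 1" using n\<nu> by (simp add: dot_square_norm)
    then show ?thesis unfolding power2_norm_eq_inner by (simp add: inner_simps inner_commute power2_eq_square algebra_simps)
   qed
   ultimately have h1: "(norm h)^2 <= 2*r*(- (h\<bullet>\<nu>))" by simp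
   have "h\<bullet>\<nu> = (m*(h\<bullet>e1) - h\<bullet>e2)/k" by (simp add: \<nu>_def inner_simps)
   then have h\<nu>: "- (h\<bullet>\<nu>) = (h\<bullet>e2 - m*(h\<bullet>e1))/k" by (simp add: minus_divide_left)
   have pos: "h\<bullet>e2 - m*(h\<bullet>e1) >= 0"
   proof -
    have "0 <= 2*r*(- (h\<bullet>\<nu>))" using h1 zero_le_power2[of "norm h"] by linarith
    then have "0 <= - (h\<bullet>\<nu>)" using r(1) by (simp add: zero_le_mult_iff mult_le_0_iff)
    then have "0 <= (h\<bullet>e2 - m*(h\<bullet>e1))/k" unfolding h\<nu> .
    then show ?thesis using k(1) by (simp add: zero_le_divide_iff)
   qed
   have "(h\<bullet>e2 - m*(h\<bullet>e1))/k <= h\<bullet>e2 - m*(h\<bullet>e1)"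
    using pos k(1) by (simp add: divide_le_eq mult_left_le) (simp add: mult_le_cancel_left1)
   then have h2: "(norm h)^2 <= 2*r*(h\<bullet>e2 - m*(h\<bullet>e1))"
    using h1 r(1) unfolding h\<nu> by (smt (verit) mult_left_mono)
   show "y \<in> closure \<Omega>"
   proof (cases "h = 0")
    case True
    then show ?thesis using b(1) by (simp add: h_def frontier_def)
   next
    case False
    have "norm h <= norm (h + r *R \<nu>) + norm (r *R \<nu>)" by (metis add_diff_cancel_right' norm_triangle_ineq4)
    then have "norm h <= 2*r" using \<open>norm (h + r *R \<nu>) <= r\<close> n\<nu> r(1) by simp
    then have yb: "y \<in> ball x0 r0"
     using b(2) r(2) r0 dist_triangle[of x0 y b] by (simp add: h_def dist_norm norm_minus_commute)
    have hn: "(norm h)^2 > 0" using False by simp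
    have he1: "\<bar>h\<bullet>e1\<bar> <= norm h" using Cauchy_Schwarz_ineq2[of h e1] e by simp
    have taylor: "\<gamma> (y\<bullet>e1) <= \<gamma> (b\<bullet>e1) + m*(h\<bullet>e1) + L*(norm h)^2"
    proof -
     define g where "g t = \<gamma> (b\<bullet>e1 + t*(h\<bullet>e1))" for t
     have g: "(g has_real_derivative \<gamma>' (b\<bullet>e1 + t*(h\<bullet>e1))*(h\<bullet>e1)) (at t)" for t
      unfolding g_def by (rule DERIV_chain2[OF \<gamma>]) (auto intro!: derivative_eq_intros)
     obtain t where t: "0 < t" "t < 1" "g 1 - g 0 = (1 - 0)*(\<gamma>' (b\<bullet>e1 + t*(h\<bullet>e1))*(h\<bullet>e1))"
      using MVT2[of 0 1 g "%t. \<gamma>' (b\<bullet>e1 + t*(h\<bullet>e1))*(h\<bullet>e1)"] g by auto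
     have "\<bar>\<gamma>' (b\<bullet>e1 + t*(h\<bullet>e1)) - m\<bar> <= L*\<bar>t*(h\<bullet>e1)\<bar>"
      using lipschitz_onD[OF L, of "b\<bullet>e1 + t*(h\<bullet>e1)" "b\<bullet>e1"] by (simp add: m_def dist_real_def)
     also have "\<dots> <= L*norm h"
      using t he1 L0 by (intro mult_left_mono) (auto simp: abs_mult intro: order_trans[OF mult_left_le_one_le])
     finally have "\<bar>(\<gamma>' (b\<bullet>e1 + t*(h\<bullet>e1)) - m)*(h\<bullet>e1)\<bar> <= (L*norm h)*norm h"
      unfolding abs_mult using he1 by (intro mult_mono) auto
     then have "(\<gamma>' (b\<bullet>e1 + t*(h\<bullet>e1)) - m)*(h\<bullet>e1) <= L*(norm h)^2"
      by (simp add: power2_eq_square mult.assoc)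
     moreover have "g 1 = \<gamma> (y\<bullet>e1)" "g 0 = \<gamma> (b\<bullet>e1)" by (simp_all add: g_def h_def inner_diff_left)
     ultimately show ?thesis using t(3) by (simp add: algebra_simps)
    qed
    have "L*(norm h)^2 < (L + 1)*(norm h)^2" using hn by simp
    also have "\<dots> <= (L + 1)*(2*r*(h\<bullet>e2 - m*(h\<bullet>e1)))" using h2 L0 by (intro mult_left_mono) auto
    also have "\<dots> = (2*(L + 1)*r)*(h\<bullet>e2 - m*(h\<bullet>e1))" by (simp add: algebra_simps)
    also have "\<dots> <= 1*(h\<bullet>e2 - m*(h\<bullet>e1))"
     using r(3) L0 pos by (intro mult_right_mono) (auto simp: field_simps)
    finally have "L*(norm h)^2 < h\<bullet>e2 - m*(h\<bullet>e1)" by simp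
    then have "\<gamma> (y\<bullet>e1) < \<gamma> (b\<bullet>e1) + h\<bullet>e2" using taylor by linarith
    also have "\<dots> <= y\<bullet>e2" using b2 by (simp add: h_def inner_diff_left)
    finally have "y \<in> \<Omega> \<inter> ball x0 r0" unfolding \<Omega> using yb by simp
    then have "y \<in> \<Omega>" by blast
    then show ?thesis using closure_subset by blast
   qed
  qed
  then show ?thesis using n\<nu> by blast
 qed
 then show ?thesis using r0 r(1) by (intro exI[of _ "r0/2"] conjI exI[of _ r]) auto
qed

text \<open>The frontier is compact, and a touching ball contains all smaller balls that touch at
  the same point with the same normal; so finitely many local radii have a common one.\<close>

lemma C11_interior_ball: assumes C11: "C11_boundary \<Omega>" and op: "open \<Omega>" and bd: "bounded \<Omega>"
 obtains r where "r > 0" "!!b. b \<in> frontier \<Omega> ==> \<exists>\<nu>. norm \<nu> = 1 \<and> cball (b - r *R \<nu>) r \<subseteq> closure \<Omega>"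
proof -
 have "\<forall>x\<in>frontier \<Omega>. \<exists>s r. s > 0 \<and> r > 0 \<and> (\<forall>b\<in>frontier \<Omega> \<inter> ball x s. \<exists>\<nu>. norm \<nu> = 1 \<and> cball (b - r *R \<nu>) r \<subseteq> closure \<Omega>)"
  using C11_interior_ball_local[OF C11 _ op] by blast
 then obtain s r where sr: "!!x. x \<in> frontier \<Omega> ==> s x > 0" "!!x. x \<in> frontier \<Omega> ==> r x > 0"
  "!!x b. x \<in> frontier \<Omega> ==> b \<in> frontier \<Omega> \<inter> ball x (s x) ==> \<exists>\<nu>. norm \<nu> = 1 \<and> cball (b - r x *R \<nu>) (r x) \<subseteq> closure \<Omega>"
  by metis
 have "compact (frontier \<Omega>)" using bd by (simp add: compact_frontier_bounded)
 moreover have "frontier \<Omega> \<subseteq> (\<Union>x\<in>frontier \<Omega>. ball x (s x))" using sr(1) by force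
 ultimately obtain C where C: "C \<subseteq> frontier \<Omega>" "finite C" "frontier \<Omega> \<subseteq> (\<Union>x\<in>C. ball x (s x))"
  using compactE_image[of "frontier \<Omega>" "frontier \<Omega>" "%x. ball x (s x)"] by auto
 define r' where "r' = Min (insert 1 (r ` C))"
 have r': "r' > 0" "!!x. x \<in> C ==> r' <= r x" using C sr(2) by (auto simp: r'_def)
 have "\<exists>\<nu>. norm \<nu> = 1 \<and> cball (b - r' *R \<nu>) r' \<subseteq> closure \<Omega>" if b: "b \<in> frontier \<Omega>" for b
 proof -
  obtain x where x: "x \<in> C" "b \<in> ball x (s x)" using C(3) b by blast
  then obtain \<nu> where \<nu>: "norm \<nu> = 1" "cball (b - r x *R \<nu>) (r x) \<subseteq> closure \<Omega>"
   using sr(3)[of x b] C(1) b by blast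
  have "cball (b - r' *R \<nu>) r' \<subseteq> cball (b - r x *R \<nu>) (r x)"
  proof
   fix y assume "y \<in> cball (b - r' *R \<nu>) r'"
   moreover have "dist (b - r x *R \<nu>) (b - r' *R \<nu>) = r x - r'"
   proof -
    have "(b - r x *R \<nu>) - (b - r' *R \<nu>) = (r' - r x) *R \<nu>" by (simp add: algebra_simps)
    then show ?thesis using r'(2)[OF x(1)] \<nu>(1) by (simp add: dist_norm)
   qed
   ultimately show "y \<in> cball (b - r x *R \<nu>) (r x)"
    using dist_triangle[of "b - r x *R \<nu>" y "b - r' *R \<nu>"] by simp
  qed
  then show ?thesis using \<nu> by blast
 qed
 then show thesis using that r'(1) by blast
qed

section \<open>Slope bounds and the barrier at the boundary\<close>

context ma_solution
begin

text \<open>At the distance \<rho> uphill from \<open>x\<close> the supporting plane must still lie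
  below \<open>v\<close>, which is at most 0.\<close>

lemma sub_norm_bound: assumes p: "p \<in> sub x" and "cball x \<rho> \<subseteq> closure \<Omega>" "\<rho> >= 0"
 shows "norm p*\<rho> <= - v x"
proof (cases "p = 0")
 case True
 have "x \<in> closure \<Omega>" using assms(2,3) by auto
 then show ?thesis using True v_nonpos by simp
next
 case False
 define y where "y = x + (\<rho>/norm p) *R p"
 have y: "y \<in> closure \<Omega>" using assms(2,3) False by (auto simp: y_def dist_norm)
 have "v x + p\<bullet>(y - x) <= 0" using sub_closure[OF p y] v_nonpos[OF y] by simp
 moreover have "p\<bullet>(y - x) = norm p*\<rho>" using False by (simp add: y_def dot_square_norm power2_eq_square)
 ultimately show ?thesis by simp
qed

text \<open>An interior zero would be a maximum of a convex function, so \<open>v\<close> would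
  vanish identically. Then 0 would be the only slope at an atom, although the slopes there have
  positive measure.\<close>

lemma v_neg: assumes x: "x \<in> \<Omega>" shows "v x < 0"
proof (rule ccontr)
 assume "\<not> v x < 0"
 then have vx: "v x = 0" using v_nonpos[of x] x closure_subset[of \<Omega>] by force
 have v0: "v y = 0" if y: "y \<in> \<Omega>" for y
 proof -
  obtain d where d: "d > 0" "ball x d \<subseteq> \<Omega>" using open_\<Omega> x openE by blast
  define s where "s = d/(2*(norm (x - y) + 1))"
  have s: "s > 0" using d(1) by (simp add: s_def add_nonneg_pos)
  define z where "z = x + s *R (x - y)"
  have "s*norm (x - y) < d"
  proof -
   have "s*norm (x - y) <= s*(norm (x - y) + 1)" using s by (intro mult_left_mono) auto
   also have "\<dots> = d/2"
   proof -
    define D where "D = norm (x - y) + 1"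
    have "D ~= 0" using norm_ge_zero[of "x - y"] unfolding D_def by linarith
    then show ?thesis unfolding s_def D_def[symmetric] by simp
   qed
   finally show ?thesis using d(1) by simp
  qed
  then have z: "z \<in> \<Omega>" using d(2) s by (auto simp: z_def dist_norm intro!: subsetD[OF d(2)])
  define t where "t = s/(1 + s)"
  have t: "0 < t" "t < 1" using s by (auto simp: t_def)
  have "x = (1 - t) *R z + t *R y"
  proof -
   have ts: "(1 - t) * s = t" using s by (simp add: t_def field_simps)
   have "(1 - t) *R z + t *R y = (1 - t) *R x + ((1 - t) * s) *R (x - y) + t *R y"
    by (simp add: z_def algebra_simps)
   also have "\<dots> = x" unfolding ts by (simp add: algebra_simps)
   finally show ?thesis by simp
  qed
  then have "v x <= (1 - t) * v z + t * v y" using convex_onD[OF convex_v, of t z y] t z y by simp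
  moreover have "(1 - t) * v z <= 0" using v_nonpos[of z] z closure_subset[of \<Omega>] t by (intro mult_nonneg_nonpos) auto
  ultimately have "0 <= t * v y" using vx by simp
  then have "0 <= v y" using t by (simp add: zero_le_mult_iff)
  then show ?thesis using v_nonpos[of y] y closure_subset[of \<Omega>] by force
 qed
 obtain w where w: "w \<in> vertices" using vertices_props by blast
 then have wO: "w \<in> \<Omega>" using vertices_props by blast
 then obtain d where d: "d > 0" "cball w d \<subseteq> \<Omega>" using open_\<Omega> open_contains_cball by blast
 have "sub w \<subseteq> {0}"
 proof
  fix p assume "p \<in> sub w"
  then have "norm p*d <= 0" using sub_norm_bound[of p w d] d v0[OF wO] closure_subset[of \<Omega>] by auto
  then show "p \<in> {0}" using d(1) by (simp add: mult_le_0_iff)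
 qed
 then have "negligible (sub w)" using negligible_subset negligible_sing by blast
 then show False using not_negligible_sub_vertex[OF w] by blast
qed

text \<open>If the graph touches a chord at \<open>w\<close>, all slopes at \<open>w\<close> lie on
  one line, a null set, although the slopes at an atom have positive measure.\<close>

lemma vertex_not_inside: assumes w: "w \<in> vertices" and y: "y1 \<in> closure \<Omega>" "y2 \<in> closure \<Omega>" "y1 ~= y2"
  and t: "0 < t" "t < 1" "w = (1 - t) *R y1 + t *R y2" and vw: "v w = (1 - t) * v y1 + t * v y2" shows False
proof -
 define d where "d = y2 - y1"
 have d: "d ~= 0" using y(3) by (simp add: d_def)
 have w1: "y1 - w = - t *R d" "y2 - w = (1 - t) *R d" by (simp_all add: t d_def algebra_simps)
 have "sub w \<subseteq> {p. d\<bullet>p = v y2 - v y1}"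
 proof
  fix p assume p: "p \<in> sub w"
  have "t*(v y2 - v y1) <= t*(p\<bullet>d)" using sub_closure[OF p y(1)] w1(1) vw by (simp add: algebra_simps)
  moreover have "(1 - t)*(p\<bullet>d) <= (1 - t)*(v y2 - v y1)"
   using sub_closure[OF p y(2)] w1(2) vw by (simp add: algebra_simps)
  ultimately show "p \<in> {p. d\<bullet>p = v y2 - v y1}" using t by (simp add: inner_commute)
 qed
 moreover have "negligible {p. d\<bullet>p = v y2 - v y1}" using d by (intro negligible_hyperplane) simp
 ultimately show False using not_negligible_sub_vertex[OF w] negligible_subset by blast
qed

text \<open>Otherwise the contact points that span \<open>x\<close> would all lie on the frontier,
  where the plane vanishes, and \<open>v x\<close> would be 0.\<close>

lemma contact_vertex: assumes x: "x \<in> \<Omega>" and p: "p \<in> sub x"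
 obtains w where "w \<in> vertices" "w \<in> contact x p" "p \<in> sub w"
proof -
 have "\<exists>w\<in>vertices. w \<in> contact x p"
 proof (rule ccontr)
  assume "\<not> ?thesis"
  then have sub0: "contact x p \<inter> (vertices \<union> frontier \<Omega>) \<subseteq> {y. p\<bullet>y = p\<bullet>x - v x}"
   using bdry by (auto simp: contact_def inner_diff_right)
  have "convex hull (contact x p \<inter> (vertices \<union> frontier \<Omega>)) \<subseteq> {y. p\<bullet>y = p\<bullet>x - v x}"
   by (rule hull_minimal[OF sub0]) (rule convex_hyperplane)
  then have "v x = 0" using contact_hull[OF x p] by auto
  then show False using v_neg[OF x] by simp
 qed
 then show thesis using that contact_sub(1)[OF p] vertices_props(2) by blast
qed

lemma vertex_radius:
 obtains \<rho> where "\<rho> > 0" "!!w. w \<in> vertices ==> cball w \<rho> \<subseteq> \<Omega>"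
proof -
 obtain \<rho> where "\<rho> > 0" "(\<Union>w\<in>vertices. cball w \<rho>) \<subseteq> \<Omega>"
  using compact_subset_open_imp_cball_epsilon_subset[OF finite_imp_compact[OF vertices_props(1)] open_\<Omega> vertices_props(2)]
  by blast
 then show thesis using that by blast
qed

text \<open>Every slope is also a slope at some atom, and finitely many atoms have a common distance
  from the frontier.\<close>

lemma slope_bound:
 obtains \<Lambda> where "\<Lambda> > 0" "!!x p. x \<in> \<Omega> ==> p \<in> sub x ==> norm p <= \<Lambda>"
proof -
 obtain \<rho> where \<rho>: "\<rho> > 0" "!!w. w \<in> vertices ==> cball w \<rho> \<subseteq> \<Omega>" using vertex_radius by blast
 define S where "S = (\<Sum>w\<in>vertices. - v w)"
 have vS: "- v w <= S" if "w \<in> vertices" for w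
  unfolding S_def using v_neg vertices_props that by (intro member_le_sum) (auto simp: less_imp_le)
 have "norm p <= S/\<rho> + 1" if "x \<in> \<Omega>" "p \<in> sub x" for x p
 proof -
  obtain w where w: "w \<in> vertices" "p \<in> sub w" using contact_vertex[OF \<open>x \<in> \<Omega>\<close> \<open>p \<in> sub x\<close>] by blast
  have "norm p*\<rho> <= S"
   using sub_norm_bound[OF w(2), of \<rho>] \<rho>(2)[OF w(1)] \<rho>(1) closure_subset[of \<Omega>] vS[OF w(1)] by fastforce
  then have "norm p <= S/\<rho>" using \<rho>(1) by (simp add: le_divide_eq)
  then show ?thesis by simp
 qed
 moreover have "S >= 0" using v_neg vertices_props by (auto simp: S_def less_imp_le intro!: sum_nonneg)
 then have "S/\<rho> + 1 > 0" using \<rho>(1) by (simp add: add_nonneg_pos)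
 ultimately show thesis using that by blast
qed

text \<open>The upper barrier comes from the cone with apex \<open>(w, v w)\<close> over the interior ball at \<open>b\<close>.\<close>

lemma quadratic_bound_boundary:
 assumes r: "r > 0" "norm \<nu> = 1" "cball (b - r *R \<nu>) r \<subseteq> closure \<Omega>" and b: "b \<in> frontier \<Omega>"
  and w: "w \<in> vertices" and p: "p \<in> sub w" and pb: "v w + p\<bullet>(b - w) = 0"
  and x: "x = (1 - t) *R w + t *R b" "0 < t" "t < 1"
  and \<rho>: "\<rho> > 0" "cball w \<rho> \<subseteq> \<Omega>" and \<Delta>: "norm (b - w) <= \<Delta>"
 shows "\<forall>\<^sub>F y in nhds x. v y <= v x + p\<bullet>(y - x) +
   ((2 + 4*\<Delta>/\<rho>)^2/r*\<Delta>*(- v w)/\<rho>)/norm (x - w)*(norm (y - x))^2"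
proof -
 have wO: "w \<in> \<Omega>" using w vertices_props(2) by blast
 have vw: "v w < 0" using v_neg[OF wO] .
 have bw: "b ~= w" using frontier_not_in[OF b] wO by blast
 have bcl: "b \<in> closure \<Omega>" using b by (simp add: frontier_def)
 define P where "P = norm p"
 have p0: "p ~= 0" using pb vw by auto
 then have P0: "P > 0" by (simp add: P_def)
 have n\<nu>: "\<nu>\<bullet>\<nu> = 1" using r(2) by (simp add: dot_square_norm)
 have pp: "p\<bullet>p = P^2" by (simp add: P_def dot_square_norm)
 \<comment> \<open>The plane is at most 0 on the closure and vanishes at \<open>b\<close>, so it
   attains its maximum over the touching ball at \<open>b\<close>, and its gradient is normal
   there.\<close>
 have pdir: "p = P *R \<nu>"
 proof -
  define y where "y = b - r *R \<nu> + (r/P) *R p"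
  have "y \<in> cball (b - r *R \<nu>) r" using P0 r(1) by (simp add: y_def dist_norm P_def)
  then have y: "y \<in> closure \<Omega>" using r(3) by blast
  have "v w + p\<bullet>(y - w) <= 0" using sub_closure[OF p y] v_nonpos[OF y] by simp
  then have "p\<bullet>(y - b) <= 0" using pb by (simp add: inner_diff_right)
  then have "r*(P - p\<bullet>\<nu>) <= 0"
   using P0 by (simp add: y_def inner_simps dot_square_norm P_def[symmetric] power2_eq_square algebra_simps)
  then have pn: "P <= p\<bullet>\<nu>" using r(1) by (simp add: mult_le_0_iff)
  have "(norm (p - P *R \<nu>))^2 = P^2 - 2*P*(p\<bullet>\<nu>) + P^2" unfolding power2_norm_eq_inner
   by (simp add: inner_simps n\<nu> pp inner_commute power2_eq_square)
  also have "\<dots> <= 0" using mult_left_mono[OF pn, of "2*P"] P0 by (simp add: power2_eq_square)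
  finally show ?thesis by simp
 qed
 define d where "d = (b - w)\<bullet>\<nu>"
 have Pd: "P*d = - v w" using pb by (simp add: pdir d_def inner_commute)
 have "norm p*\<rho> <= - v w" using sub_norm_bound[OF p, of \<rho>] \<rho> closure_subset by fastforce
 then have P\<rho>: "P*\<rho> <= - v w" by (simp add: P_def)
 then have d\<rho>: "\<rho> <= d" using Pd P0 by (metis mult_le_cancel_left_pos)
 then have d0: "d > 0" using \<rho>(1) by simp
 have \<Delta>0: "\<Delta> > 0" using \<Delta> bw by (meson less_le_trans zero_less_norm_iff right_minus_eq)
 \<comment> \<open>\<open>c\<close> bounds norm (q - b) / norm \<zeta> for the point
   \<open>q\<close> found below. At depth \<open>K * (norm \<zeta>)^2\<close> behind the tangent, a
   point that close to \<open>b\<close> lies in the ball of radius \<open>r\<close>.\<close>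
 define c where "c = 2 + 4*\<Delta>/\<rho>"
 define K where "K = c^2/(2*r)"
 have c0: "c > 0" using \<Delta>0 \<rho>(1) by (simp add: c_def add_pos_pos)
 have K0: "K > 0" using c0 r(1) by (simp add: K_def)
 \<comment> \<open>The three terms ensure \<open>D >= d/2\<close>,
   \<open>K * norm \<zeta> <= 1\<close> and |\<mu>| <= (1 - t)/4; the last one gives
   \<open>s < 1\<close>.\<close>
 define \<eta> where "\<eta> = min (min (d/2) (1/K)) (d*(1 - t)/16)"
 have \<eta>: "\<eta> > 0" "\<eta> <= d/2" "\<eta> <= 1/K" "\<eta> <= d*(1 - t)/16" using d0 K0 x by (auto simp: \<eta>_def)
 have vx: "v x = v w + p\<bullet>(x - w)"
 proof (rule antisym)
  have "v x <= (1 - t) * v w + t * v b"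
   using convex_onD[OF convex_v_closure, of t w b] x wO bcl closure_subset[of \<Omega>] by auto
  also have "\<dots> = v w + t*(p\<bullet>(b - w))"
  proof -
   have "p\<bullet>(b - w) = - v w" using pb by simp
   then show ?thesis using bdry[OF b] by (simp only:) (simp add: algebra_simps)
  qed
  also have "t*(p\<bullet>(b - w)) = p\<bullet>(x - w)" by (simp add: x(1) inner_simps algebra_simps)
  finally show "v x <= v w + p\<bullet>(x - w)" .
  have "x \<in> closure \<Omega>"
   using convexD[OF convex_closure[OF convex_\<Omega>], of w b "1 - t" t] wO bcl closure_subset[of \<Omega>] x by auto
  then show "v w + p\<bullet>(x - w) <= v x" by (rule sub_closure[OF p])
 qed
 have nx: "norm (x - w) = t*norm (b - w)"
 proof -
  have "x - w = t *R (b - w)" by (simp add: x(1) algebra_simps)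
  then show ?thesis using x(2) by simp
 qed
 show ?thesis unfolding eventually_nhds_metric
 proof (intro exI[of _ "t*\<eta>"] conjI allI impI)
  show "0 < t*\<eta>" using x \<eta> by simp
  fix y assume y: "dist y x < t*\<eta>"
  \<comment> \<open>The displacement of \<open>y\<close>, magnified from the apex \<open>w\<close>
    to the boundary point \<open>b\<close>.\<close>
  define \<zeta> where "\<zeta> = (1/t) *R (y - x)"
  have \<zeta>n: "norm \<zeta> = norm (y - x)/t" using x(2) by (simp add: \<zeta>_def)
  have \<zeta>: "norm \<zeta> < \<eta>" using y x(2) by (simp add: \<zeta>n dist_norm divide_less_eq mult.commute)
  define \<alpha> where "\<alpha> = \<zeta>\<bullet>\<nu>"
  have \<alpha>: "\<bar>\<alpha>\<bar> <= norm \<zeta>" using Cauchy_Schwarz_ineq2[of \<zeta> \<nu>] r(2) by (simp add: \<alpha>_def)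
  define D where "D = d + \<alpha>"
  have D: "D >= d/2" using \<alpha> \<zeta> \<eta>(2) by (simp add: D_def)
  then have D0: "D > 0" using d0 by simp
  define \<mu> where "\<mu> = (\<alpha> + K*(norm \<zeta>)^2)/D"
  have "K*norm \<zeta> <= 1"
  proof -
   have "norm \<zeta> <= 1/K" using \<zeta> \<eta>(3) by simp
   then show ?thesis using K0 by (simp add: le_divide_eq mult.commute)
  qed
  then have "K*(norm \<zeta>)^2 <= norm \<zeta>"
   using mult_right_mono[of "K*norm \<zeta>" 1 "norm \<zeta>"] by (simp add: power2_eq_square mult.assoc)
  then have "\<bar>\<alpha> + K*(norm \<zeta>)^2\<bar> <= 2*norm \<zeta>"
   using \<alpha> K0 abs_triangle_ineq[of \<alpha> "K*(norm \<zeta>)^2"] by (simp add: abs_mult)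
  then have "\<bar>\<mu>\<bar> <= 2*norm \<zeta>/D" using D0 by (simp add: \<mu>_def divide_right_mono)
  also have "\<dots> <= 2*norm \<zeta>/(d/2)" using D d0 by (intro divide_left_mono) auto
  finally have \<mu>1: "\<bar>\<mu>\<bar> <= 4*norm \<zeta>/d" by simp
  have "4*norm \<zeta>/d <= 4*(d*(1 - t)/16)/d"
   using \<zeta> \<eta>(4) d0 by (intro divide_right_mono mult_left_mono) auto
  also have "\<dots> = (1 - t)/4" using d0 by simp
  finally have \<mu>2: "\<bar>\<mu>\<bar> <= (1 - t)/4" using \<mu>1 by simp
  then have \<mu>3: "\<bar>\<mu>\<bar> <= 1/4" using x by simp
  \<comment> \<open>A point on the ray from \<open>w\<close> through \<open>y\<close>. The factor 1
    - \<mu> pulls the magnified point back towards \<open>w\<close> until it lies at the depth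
    required for the touching ball.\<close>
  define q where "q = b + (1 - \<mu>) *R \<zeta> - \<mu> *R (b - w)"
  have q\<nu>: "(q - b)\<bullet>\<nu> = - K*(norm \<zeta>)^2"
  proof -
   have "(q - b)\<bullet>\<nu> = \<alpha> - \<mu>*D" by (simp add: q_def inner_simps \<alpha>_def d_def D_def algebra_simps)
   also have "\<mu>*D = \<alpha> + K*(norm \<zeta>)^2" using D0 by (simp add: \<mu>_def)
   finally show ?thesis by simp
  qed
  have qb: "norm (q - b) <= c*norm \<zeta>"
  proof -
   have "q - b = (1 - \<mu>) *R \<zeta> - \<mu> *R (b - w)" by (simp add: q_def)
   then have "norm (q - b) <= \<bar>1 - \<mu>\<bar>*norm \<zeta> + \<bar>\<mu>\<bar>*norm (b - w)"
    by (metis norm_scaleR norm_triangle_ineq4)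
   also have "\<dots> <= 2*norm \<zeta> + (4*norm \<zeta>/d)*\<Delta>"
    using \<mu>1 \<mu>3 \<Delta> by (intro add_mono mult_mono) auto
   also have "(4*norm \<zeta>/d)*\<Delta> <= (4*norm \<zeta>/\<rho>)*\<Delta>"
    using d\<rho> \<rho>(1) \<Delta>0 d0 by (intro mult_right_mono divide_left_mono) auto
   finally show ?thesis by (simp add: c_def algebra_simps)
  qed
  have "(norm (q - b + r *R \<nu>))^2 = (norm (q - b))^2 + 2*r*((q - b)\<bullet>\<nu>) + r^2"
   unfolding power2_norm_eq_inner using n\<nu> by (simp add: inner_simps inner_commute power2_eq_square algebra_simps)
  also have "\<dots> <= r^2"
  proof -
   have "(norm (q - b))^2 <= (c*norm \<zeta>)^2" using qb by (intro power_mono) auto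
   also have "\<dots> = 2*r*(K*(norm \<zeta>)^2)" using r(1) by (simp add: K_def power_mult_distrib)
   finally show ?thesis unfolding q\<nu> by simp
  qed
  finally have "norm (q - b + r *R \<nu>) <= r" using r(1) by (simp add: power2_le_iff_abs_le)
  then have "q \<in> cball (b - r *R \<nu>) r" by (simp add: dist_norm norm_minus_commute algebra_simps)
  then have qcl: "q \<in> closure \<Omega>" using r(3) by blast
  define s where "s = t/(1 - \<mu>)"
  have s: "0 < s" "s < 1" "s <= 2*t"
  proof -
   have m: "1 - \<mu> > t" "1 - \<mu> >= 1/2" using \<mu>2 \<mu>3 x by (auto simp: abs_le_iff)
   show "0 < s" using x m by (simp add: s_def)
   show "s < 1" using x m by (simp add: s_def)
   have "t/(1 - \<mu>) <= t/(1/2)" using x m by (intro divide_left_mono) auto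
   then show "s <= 2*t" by (simp add: s_def)
  qed
  have sm: "s*(1 - \<mu>) = t" using \<mu>3 by (simp add: s_def)
  have yq: "y = (1 - s) *R w + s *R q"
  proof -
   have "q - w = (1 - \<mu>) *R (b + \<zeta> - w)" by (simp add: q_def algebra_simps)
   then have "s *R (q - w) = t *R (b + \<zeta> - w)" using sm by simp
   also have "\<dots> = t *R (b - w) + (y - x)" using x(2) by (simp add: \<zeta>_def algebra_simps)
   also have "\<dots> = y - w" by (simp add: x(1) algebra_simps)
   finally show ?thesis by (simp add: algebra_simps)
  qed
  have "v y <= (1 - s) * v w + s * v q"
   unfolding yq using convex_onD[OF convex_v_closure, of s w q] s wO qcl closure_subset[of \<Omega>] by auto
  also have "\<dots> <= (1 - s) * v w" using s v_nonpos[OF qcl] by (simp add: mult_nonneg_nonpos)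
  also have "(1 - s) * v w = (v w + p\<bullet>(y - w)) - s*(v w + p\<bullet>(q - w))"
   by (simp add: yq inner_simps algebra_simps)
  also have "v w + p\<bullet>(q - w) = - (P*(K*(norm \<zeta>)^2))"
  proof -
   have "v w + p\<bullet>(q - w) = p\<bullet>(q - b)" using pb by (simp add: inner_diff_right)
   also have "\<dots> = P*((q - b)\<bullet>\<nu>)" by (simp add: pdir inner_commute)
   finally show ?thesis unfolding q\<nu> by simp
  qed
  also have "(v w + p\<bullet>(y - w)) - s*(- (P*(K*(norm \<zeta>)^2))) <= (v w + p\<bullet>(y - w)) + (2*t)*(P*(K*(norm \<zeta>)^2))"
   using s(3) P0 K0 by (simp add: mult_right_mono)
  also have "v w + p\<bullet>(y - w) = v x + p\<bullet>(y - x)" using vx by (simp add: inner_diff_right)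
  also have "(2*t)*(P*(K*(norm \<zeta>)^2)) = (2*K*P/t)*(norm (y - x))^2"
   using x(2) by (simp add: \<zeta>n power2_eq_square)
  also have "v x + p\<bullet>(y - x) + (2*K*P/t)*(norm (y - x))^2 <=
    v x + p\<bullet>(y - x) + (c^2/r*\<Delta>*(- v w)/\<rho>)/norm (x - w)*(norm (y - x))^2"
  proof (intro add_left_mono mult_right_mono)
   have nb: "norm (b - w) > 0" using bw by simp
   have "P <= - v w/\<rho>" using P\<rho> \<rho>(1) by (simp only: pos_le_divide_eq)
   then have "2*K*P/t <= 2*K*(- v w/\<rho>)/t" using K0 x(2) by (intro divide_right_mono mult_left_mono) auto
   also have "\<dots> = (c^2/r*norm (b - w)*(- v w)/\<rho>)/norm (x - w)" using nb x(2) r(1) by (simp add: nx K_def)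
   also have "\<dots> <= (c^2/r*\<Delta>*(- v w)/\<rho>)/norm (x - w)"
    using \<Delta> vw r(1) \<rho>(1) by (intro divide_right_mono mult_right_mono mult_left_mono) auto
   finally show "2*K*P/t <= (c^2/r*\<Delta>*(- v w)/\<rho>)/norm (x - w)" .
  qed simp
  finally show "v y <= v x + p\<bullet>(y - x) +
   ((2 + 4*\<Delta>/\<rho>)^2/r*\<Delta>*(- v w)/\<rho>)/norm (x - w)*(norm (y - x))^2" by (simp add: c_def)
 qed
qed

end

section \<open>Position in the contact set and extreme slopes of edges\<close>

text \<open>The points of \<open>S\<close> on the supporting line span a face of dimension at most
  one that contains \<open>x\<close>; by Caratheodory two of them suffice.\<close>

lemma convex_hull_hyperplane_face:
 fixes S :: "(real^2) set"
 assumes "compact S" "x \<in> convex hull S" and n: "n ~= 0" "!!y. y \<in> S ==> n\<bullet>x <= n\<bullet>y"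
 obtains y1 y2 where "y1 \<in> S" "y2 \<in> S" "x \<in> closed_segment y1 y2"
proof -
 have ge: "n\<bullet>x <= n\<bullet>y" if "y \<in> convex hull S" for y
 proof -
  have "convex hull S \<subseteq> {y. n\<bullet>y >= n\<bullet>x}" using n(2) by (intro hull_minimal convex_halfspace_ge) auto
  then show ?thesis using that by blast
 qed
 define T where "T = convex hull S \<inter> {y. n\<bullet>y = n\<bullet>x}"
 have "T face_of convex hull S" unfolding T_def using ge by (intro face_of_Int_supporting_hyperplane_ge convex_convex_hull)
 then obtain s where s: "s \<subseteq> S" "T = convex hull s" using face_of_convex_hull_subset[OF assms(1)] by metis
 have "x \<in> convex hull s" using assms(2) s(2) by (auto simp: T_def)
 then obtain S' where S': "finite S'" "S' \<subseteq> s" "int (card S') <= aff_dim s + 1" "x \<in> convex hull S'"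
  unfolding caratheodory_aff_dim[of s] by blast
 have "s \<subseteq> {y. n\<bullet>y = n\<bullet>x}" using s(2) hull_subset[of s convex] by (auto simp: T_def)
 then have "aff_dim s <= aff_dim {y. n\<bullet>y = n\<bullet>x}" by (rule aff_dim_subset)
 also have "\<dots> = 1" using n(1) by (simp add: aff_dim_hyperplane)
 finally have "card S' <= 2" using S'(3) by simp
 moreover have "S' ~= {}" using S'(4) by auto
 ultimately have "card S' = 1 \<or> card S' = 2" using S'(1) card_0_eq[of S'] by linarith
 then obtain y1 y2 where "S' = {y1, y2}" by (metis card_1_singletonE card_2_iff insert_absorb2)
 then show thesis using that[of y1 y2] S'(2,4) s(1) by (auto simp: segment_convex_hull)
qed

context ma_solution
begin

text \<open>If \<open>x\<close> is not interior to its contact set, there is a supporting line at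
  \<open>x\<close>, so \<open>x\<close> lies on a segment between two contact points that are atoms
  or boundary points. Two boundary points are excluded by \<open>v x < 0\<close>.\<close>

lemma contact_cases: assumes x: "x \<in> \<Omega>" and p: "p \<in> sub x"
 obtains (interior) "x \<in> interior (contact x p)"
  | (boundary) w b t where "w \<in> vertices" "b \<in> frontier \<Omega>" "x = (1 - t) *R w + t *R b" "0 < t" "t < 1"
    "p \<in> sub w" "v w + p\<bullet>(b - w) = 0"
  | (edge) w w' where "w \<in> vertices" "w' \<in> vertices" "x \<in> open_segment w w'" "p \<in> sub w" "p \<in> sub w'"
  | (vertex) "x \<in> vertices"
proof (cases "x \<in> interior (contact x p)")
 case False
 let ?K = "contact x p" and ?E = "vertices \<union> frontier \<Omega>"
 have xK: "x \<in> ?K" using x closure_subset by (auto simp: contact_def)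
 have cK: "convex ?K" using p by (rule convex_contact)
 obtain n where n: "n ~= 0" "!!y. y \<in> ?K ==> n\<bullet>x <= n\<bullet>y"
 proof (cases "interior ?K = {}")
  case True
  then obtain n c where "n ~= 0" "?K \<subseteq> {y. n\<bullet>y = c}" using empty_interior_subset_hyperplane[OF cK] by metis
  then have "n\<bullet>y = c" if "y \<in> ?K" for y using that by blast
  then have "n\<bullet>x <= n\<bullet>y" if "y \<in> ?K" for y using that xK by simp
  then show ?thesis using that[of n] \<open>n ~= 0\<close> by blast
 next
  case ne: False
  then have "x \<notin> rel_interior ?K" using False rel_interior_nonempty_interior by metis
  then show ?thesis using supporting_hyperplane_rel_boundary[OF cK xK] that by metis
 qed
 have "closed ?E" using vertices_props(1) by (intro closed_Un finite_imp_closed frontier_closed)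
 then have comp: "compact (?K \<inter> ?E)" using compact_contact by (intro compact_Int_closed)
 obtain y1 y2 where y: "y1 \<in> ?K \<inter> ?E" "y2 \<in> ?K \<inter> ?E" "x \<in> closed_segment y1 y2"
  using convex_hull_hyperplane_face[OF comp contact_hull[OF x p] n(1)] n(2) by blast
 show thesis
 proof (cases "x \<in> vertices")
  case True
  then show ?thesis by (rule vertex)
 next
  case xv: False
  then have "x \<notin> ?E" using x frontier_not_in by blast
  then have "x ~= y1" "x ~= y2" using y by blast+
  then have os: "x \<in> open_segment y1 y2" using y(3) by (simp add: open_segment_def)
  have b: thesis if w: "w \<in> vertices" and b: "b \<in> frontier \<Omega>" and wb: "w \<in> ?K" "b \<in> ?K" and os: "x \<in> open_segment w b" for w b
  proof -
   obtain t where t: "0 < t" "t < 1" "x = (1 - t) *R w + t *R b" using os by (auto simp: in_segment)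
   have wO: "w \<in> \<Omega>" using w vertices_props by blast
   have "b \<in> contact w p" using contact_sub(2)[OF p wb(1) wO] wb(2) by simp
   then have "v w + p\<bullet>(b - w) = 0" using bdry[OF b] by (simp add: contact_def)
   then show thesis using boundary[OF w b t(3,1,2) contact_sub(1)[OF p wb(1) wO]] by blast
  qed
  consider "y1 \<in> vertices" "y2 \<in> vertices" | "y1 \<in> vertices" "y2 \<in> frontier \<Omega>" | "y1 \<in> frontier \<Omega>" "y2 \<in> vertices"
   | "y1 \<in> frontier \<Omega>" "y2 \<in> frontier \<Omega>" using y by blast
  then show thesis
  proof cases
   case 1
   then show thesis using edge[of y1 y2] os y contact_sub(1)[OF p] vertices_props(2) by blast
  next
   case 2
   then show thesis using b[of y1 y2] y os by blast
  next
   case 3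
   then show thesis using b[of y2 y1] y os by (simp add: open_segment_commute)
  next
   case 4
   obtain t where t: "x = (1 - t) *R y1 + t *R y2" using os by (auto simp: in_segment)
   have "v x + p\<bullet>(y1 - x) = 0" "v x + p\<bullet>(y2 - x) = 0" using y 4 bdry by (auto simp: contact_def)
   then have "(1 - t)*(v x + p\<bullet>(y1 - x)) + t*(v x + p\<bullet>(y2 - x)) = 0" by simp
   also have "(1 - t)*(v x + p\<bullet>(y1 - x)) + t*(v x + p\<bullet>(y2 - x)) = v x + p\<bullet>((1 - t) *R y1 + t *R y2 - x)"
    by (simp add: inner_simps algebra_simps)
   also have "\<dots> = v x" using t by simp
   finally show thesis using v_neg[OF x] by simp
  qed
 qed
qed (rule interior)

lemma common_slope_contact: assumes "p \<in> sub w" "p \<in> sub w'" "w \<in> \<Omega>" "w' \<in> \<Omega>"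
 shows "v w' = v w + p\<bullet>(w' - w)"
proof -
 have "v w + p\<bullet>(w' - w) <= v w'" "v w' + p\<bullet>(w - w') <= v w"
  using sub_closure assms closure_subset[of \<Omega>] by blast+
 then show ?thesis by (simp add: inner_diff_right)
qed

text \<open>Each point of \<Omega> is a convex combination of atoms and boundary points in one of
  its contact sets, on which \<open>v\<close> is affine; so an affine lower bound needs to be tested
  only there.\<close>

lemma subI_vertices_frontier:
 assumes x: "x \<in> \<Omega>" and E: "!!e. e \<in> vertices \<union> frontier \<Omega> ==> v x + p\<bullet>(e - x) <= v e"
 shows "p \<in> sub x"
proof (rule subI[OF x])
 fix y assume y: "y \<in> \<Omega>"
 obtain q where q: "q \<in> sub y" using sub_nonempty[OF y] by blast
 have "contact y q \<inter> (vertices \<union> frontier \<Omega>) \<subseteq> {e. (p - q)\<bullet>e <= v y - q\<bullet>y - v x + p\<bullet>x}"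
 proof
  fix e assume "e \<in> contact y q \<inter> (vertices \<union> frontier \<Omega>)"
  then show "e \<in> {e. (p - q)\<bullet>e <= v y - q\<bullet>y - v x + p\<bullet>x}"
   using E[of e] by (auto simp: contact_def inner_simps)
 qed
 then have "convex hull (contact y q \<inter> (vertices \<union> frontier \<Omega>)) \<subseteq> {e. (p - q)\<bullet>e <= v y - q\<bullet>y - v x + p\<bullet>x}"
  by (rule hull_minimal) (rule convex_halfspace_le)
 then have "(p - q)\<bullet>y <= v y - q\<bullet>y - v x + p\<bullet>x" using contact_hull[OF y q] by blast
 then show "v x + p\<bullet>(y - x) <= v y" by (simp add: inner_simps)
qed

text \<open>According to the position of \<open>e\<close> on the line, one of the two atoms would
  touch a chord of the graph from inside, or \<open>e\<close> would lie in \<Omega>.\<close>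

lemma no_frontier_contact_on_edge_line:
 assumes w: "w \<in> vertices" "w' \<in> vertices" "w ~= w'" and p: "p \<in> sub w" "p \<in> sub w'"
  and e: "e \<in> frontier \<Omega>" "e = w + c *R (w' - w)" and con: "v e = v w + p\<bullet>(e - w)" shows False
proof -
 have wO: "w \<in> \<Omega>" "w' \<in> \<Omega>" using w vertices_props by auto
 have wcl: "w \<in> closure \<Omega>" "w' \<in> closure \<Omega>" using wO closure_subset by auto
 have ecl: "e \<in> closure \<Omega>" using e(1) by (simp add: frontier_def)
 have vw': "v w' = v w + p\<bullet>(w' - w)" using common_slope_contact[OF p wO] .
 have ve: "v e = v w + c*(p\<bullet>(w' - w))" using con e(2) by simp
 consider "c < 0" | "0 <= c" "c <= 1" | "c > 1" by linarith
 then show False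
 proof cases
  case 1
  define t where "t = 1/(1 - c)"
  have t: "0 < 1 - t" "1 - t < 1" using 1 by (auto simp: t_def)
  have tc: "t*(1 - c) = 1" using 1 by (simp add: t_def)
  then have c': "t*c = t - 1" by (simp add: algebra_simps)
  have "w = (1 - (1 - t)) *R e + (1 - t) *R w'"
  proof -
   have "t *R e + (1 - t) *R w' = t *R w + (t*c) *R (w' - w) + (1 - t) *R w'"
    by (simp add: e(2) algebra_simps)
   also have "\<dots> = w" unfolding c' by (simp add: algebra_simps)
   finally show ?thesis by simp
  qed
  moreover have "v w = (1 - (1 - t)) * v e + (1 - t) * v w'"
  proof -
   have "t * v e + (1 - t) * v w' = t * v w + (t*c)*(p\<bullet>(w' - w)) + (1 - t)*(v w + p\<bullet>(w' - w))"
    unfolding ve vw' by (simp add: algebra_simps)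
   also have "\<dots> = v w" unfolding c' by (simp add: algebra_simps)
   finally show ?thesis by simp
  qed
  moreover have "e ~= w'" using frontier_not_in[OF e(1)] wO by blast
  ultimately show False using vertex_not_inside[OF w(1) ecl wcl(2) _ t] by blast
 next
  case 2
  have "e \<in> \<Omega>"
  proof -
   have "e = (1 - c) *R w + c *R w'" by (simp add: e(2) algebra_simps)
   then show ?thesis using convexD[OF convex_\<Omega> wO, of "1 - c" c] 2 by simp
  qed
  then show False using frontier_not_in[OF e(1)] by blast
 next
  case 3
  define t where "t = 1/c"
  have t: "0 < t" "t < 1" using 3 by (auto simp: t_def)
  have tc: "t*c = 1" using 3 by (simp add: t_def)
  have "w' = (1 - t) *R w + t *R e"
  proof -
   have "(1 - t) *R w + t *R e = w + (t*c) *R (w' - w)" by (simp add: e(2) algebra_simps)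
   then show ?thesis unfolding tc by simp
  qed
  moreover have "v w' = (1 - t) * v w + t * v e"
  proof -
   have "(1 - t) * v w + t * v e = v w + (t*c)*(p\<bullet>(w' - w))" unfolding ve by (simp add: algebra_simps)
   then show ?thesis unfolding tc vw' by simp
  qed
  moreover have "w ~= e" using frontier_not_in[OF e(1)] wO by blast
  ultimately show False using vertex_not_inside[OF w(2) wcl(1) ecl _ t] by blast
 qed
qed

text \<open>Among the slopes common to the end points of an edge, the extreme one in the normal direction
 touches the graph on that side: otherwise it could be tilted further.\<close>

lemma extreme_edge_slope: assumes w: "w \<in> vertices" "w' \<in> vertices" "w ~= w'" and p0: "p0 \<in> sub w" "p0 \<in> sub w'"
  and n: "n\<bullet>(w' - w) = 0" "n ~= 0" and span: "!!z. n\<bullet>z = 0 ==> \<exists>c. z = c *R (w' - w)"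
 obtains p e where "p \<in> sub w" "p \<in> sub w'" "n\<bullet>p0 <= n\<bullet>p" "e \<in> closure \<Omega>" "n\<bullet>(e - w) > 0" "v e = v w + p\<bullet>(e - w)"
proof -
 have wO: "w \<in> \<Omega>" "w' \<in> \<Omega>" using w vertices_props by auto
 define Q where "Q = sub w \<inter> sub w'"
 have cl: "closed (sub x)" if "x \<in> \<Omega>" for x using closed_sub_image[of "{x}"] that by simp
 obtain \<Lambda> where \<Lambda>: "\<Lambda> > 0" "!!x p. x \<in> \<Omega> ==> p \<in> sub x ==> norm p <= \<Lambda>" using slope_bound by blast
 have "bounded Q" unfolding bounded_iff Q_def using \<Lambda>(2) wO by blast
 then have "compact Q" using cl wO by (auto simp: compact_eq_bounded_closed Q_def)
 moreover have "Q ~= {}" using p0 by (auto simp: Q_def)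
 moreover have "continuous_on Q (%p. n\<bullet>p)" by (intro continuous_intros)
 ultimately obtain p where p: "p \<in> Q" "!!q. q \<in> Q ==> n\<bullet>q <= n\<bullet>p"
  using continuous_attains_sup[of Q "%p. n\<bullet>p"] by blast
 have pw: "p \<in> sub w" "p \<in> sub w'" using p(1) by (auto simp: Q_def)
 have vw': "v w' = v w + p\<bullet>(w' - w)" using common_slope_contact[OF pw wO] .
 have "\<exists>e\<in>closure \<Omega>. n\<bullet>(e - w) > 0 \<and> v e = v w + p\<bullet>(e - w)"
 proof (rule ccontr)
  assume none: "\<not> ?thesis"
  define g where "g e = v e - (v w + p\<bullet>(e - w))" for e
  have g0: "g e >= 0" if "e \<in> closure \<Omega>" for e using sub_closure[OF pw(1) that] by (simp add: g_def)
  have gpos: "g e > 0" if "e \<in> closure \<Omega>" "n\<bullet>(e - w) > 0" for e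
   using none g0[OF that(1)] that by (force simp: g_def)
  have fc: "frontier \<Omega> \<subseteq> closure \<Omega>" by (auto simp: frontier_def)
  obtain D where D: "D > 0" "!!e. e \<in> closure \<Omega> ==> n\<bullet>(e - w) <= D"
  proof -
   have "compact ((%e. n\<bullet>(e - w)) ` closure \<Omega>)"
    by (intro compact_continuous_image continuous_intros compact_closure_\<Omega>)
   then have "bounded ((%e. n\<bullet>(e - w)) ` closure \<Omega>)" by (rule compact_imp_bounded)
   then obtain D where "D > 0" "!!z. z \<in> (%e. n\<bullet>(e - w)) ` closure \<Omega> ==> norm z <= D"
    unfolding bounded_pos by blast
   then show ?thesis using that[of D] by (auto simp: abs_le_iff)
  qed
  \<comment> \<open>The gap is positive also at boundary points on the edge line itself, by
    \<open>no_frontier_contact_on_edge_line\<close>; compactness makes it uniform.\<close>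
  obtain m1 where m1: "m1 > 0" "!!e. e \<in> frontier \<Omega> ==> n\<bullet>(e - w) >= 0 ==> g e >= m1"
  proof -
   define F where "F = {e \<in> frontier \<Omega>. 0 <= n\<bullet>(e - w)}"
   have "closed F" unfolding F_def by (rule continuous_on_closed_Collect_le) (auto intro!: continuous_intros)
   then have cF: "compact F" using compact_frontier_bounded[OF bounded_\<Omega>]
    by (auto simp: F_def compact_eq_bounded_closed intro: bounded_subset)
   have gF: "g e > 0" if "e \<in> F" for e
   proof (cases "n\<bullet>(e - w) > 0")
    case True
    then show ?thesis using gpos that fc by (auto simp: F_def)
   next
    case False
    then have "n\<bullet>(e - w) = 0" using that by (simp add: F_def)
    then obtain c where "e - w = c *R (w' - w)" using span by blast
    then have "e = w + c *R (w' - w)" by (simp add: algebra_simps)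
    then have "g e ~= 0" using no_frontier_contact_on_edge_line[OF w pw, of e c] that by (auto simp: F_def g_def)
    moreover have "g e >= 0" using g0 that fc by (auto simp: F_def)
    ultimately show ?thesis by simp
   qed
   show ?thesis
   proof (cases "F = {}")
    case True
    then show ?thesis using that[of 1] by (auto simp: F_def)
   next
    case False
    have "continuous_on F g" unfolding g_def
     by (intro continuous_intros continuous_on_subset[OF cont_v]) (use fc in \<open>auto simp: F_def\<close>)
    then obtain e0 where "e0 \<in> F" "!!e. e \<in> F ==> g e0 <= g e" using continuous_attains_inf[OF cF False] by blast
    then show ?thesis using that[of "g e0"] gF by (auto simp: F_def)
   qed
  qed
  define V where "V = {u \<in> vertices. n\<bullet>(u - w) > 0}"
  have fV: "finite V" using vertices_props by (simp add: V_def)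
  define m2 where "m2 = Min (insert m1 (g ` V))"
  have m2: "m2 > 0" "m2 <= m1" "!!u. u \<in> V ==> m2 <= g u"
   using fV m1(1) gpos vertices_props(2) closure_subset[of \<Omega>] by (auto simp: m2_def V_def)
  \<comment> \<open>Tilting by \<epsilon> raises the plane by at most \<open>m2\<close> on the
    closure, which all gaps on the side of \<open>n\<close> can afford.\<close>
  define \<epsilon> where "\<epsilon> = m2/D"
  have \<epsilon>: "\<epsilon> > 0" using m2 D by (simp add: \<epsilon>_def)
  have key: "\<epsilon>*(n\<bullet>(e - w)) <= g e" if e: "e \<in> vertices \<union> frontier \<Omega>" for e
  proof (cases "n\<bullet>(e - w) > 0")
   case True
   have ecl: "e \<in> closure \<Omega>" using e fc vertices_props(2) closure_subset by blast
   have "\<epsilon>*(n\<bullet>(e - w)) <= \<epsilon>*D" using \<epsilon> D(2)[OF ecl] by (intro mult_left_mono) auto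
   also have "\<dots> = m2" using D by (simp add: \<epsilon>_def)
   also have "\<dots> <= g e" using e m2(2,3) m1(2)[of e] True by (fastforce simp: V_def)
   finally show ?thesis .
  next
   case False
   then have "\<epsilon>*(n\<bullet>(e - w)) <= 0" using \<epsilon> by (simp add: mult_le_0_iff)
   moreover have "g e >= 0" using e fc vertices_props(2) closure_subset g0 by blast
   ultimately show ?thesis by simp
  qed
  define p' where "p' = p + \<epsilon> *R n"
  have p'w: "p' \<in> sub w"
  proof (rule subI_vertices_frontier[OF wO(1)])
   fix e assume "e \<in> vertices \<union> frontier \<Omega>"
   from key[OF this] show "v w + p'\<bullet>(e - w) <= v e" by (simp add: p'_def g_def inner_add_left)
  qed
  have "p'\<bullet>(w' - w) = p\<bullet>(w' - w)" using n(1) by (simp add: p'_def inner_add_left)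
  then have "w' \<in> contact w p'" using vw' wO closure_subset by (auto simp: contact_def)
  then have "p' \<in> Q" using p'w contact_sub(1)[OF p'w _ wO(2)] by (simp add: Q_def)
  then have "n\<bullet>p' <= n\<bullet>p" by (rule p(2))
  moreover have "n\<bullet>p' = n\<bullet>p + \<epsilon>*(n\<bullet>n)" by (simp add: p'_def inner_add_right)
  moreover have "\<epsilon>*(n\<bullet>n) > 0" using \<epsilon> n(2) by simp
  ultimately show False by linarith
 qed
 moreover have "n\<bullet>p0 <= n\<bullet>p" using p(2) p0 by (simp add: Q_def)
 ultimately show thesis using that pw by blast
qed

end

section \<open>Orthonormal frames and tapered neighbourhoods of segments\<close>

definition perp :: "real^2 => real^2" where
 "perp d = (\<chi> i. if i = 1 then - d $ 2 else d $ 1)"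

lemma perp_simps [simp]: "perp d $ 1 = - d $ 2" "perp d $ 2 = d $ 1" by (simp_all add: perp_def)

lemma perp_inner: "perp d\<bullet>d = 0" "d\<bullet>perp d = 0" "perp d\<bullet>perp d = d\<bullet>d"
 by (simp_all add: inner_vec_def sum_2)

lemma norm_perp: "norm (perp d) = norm d" by (simp add: norm_eq_sqrt_inner perp_inner)

lemma orthonormal_decomposition: assumes "norm d = 1"
 shows "z = (z\<bullet>d) *R d + (z\<bullet>perp d) *R perp d"
proof -
 have "d\<bullet>d = 1" using assms by (simp add: dot_square_norm)
 then have 1: "d $ 1*d $ 1 + d $ 2*d $ 2 = 1" by (simp add: inner_vec_def sum_2)
 have "(z $ 1*d $ 1 + z $ 2*d $ 2)*d $ 1 + (z $ 1*(- d $ 2) + z $ 2*d $ 1)*(- d $ 2)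
   = z $ 1*(d $ 1*d $ 1 + d $ 2*d $ 2)"
  "(z $ 1*d $ 1 + z $ 2*d $ 2)*d $ 2 + (z $ 1*(- d $ 2) + z $ 2*d $ 1)*d $ 1
   = z $ 2*(d $ 1*d $ 1 + d $ 2*d $ 2)" by (simp_all add: algebra_simps)
 then show ?thesis using 1 by (simp add: vec_eq_iff forall_2 inner_vec_def sum_2)
qed

text \<open>The width shrinks linearly towards both ends, so that segments with a common end can
  have disjoint neighbourhoods.\<close>

definition fat :: "real => 'a::real_inner => 'a => 'a set" where
 "fat c w w' = {x. \<exists>z\<in>open_segment w w'. norm (x - z) <= c*min (norm (z - w)) (norm (z - w'))}"

lemma fat_commute: "fat c w w' = fat c w' w" by (simp add: fat_def open_segment_commute min.commute)

lemma fat_mono: "c <= c' ==> fat c w w' \<subseteq> fat c' w w'"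
 unfolding fat_def by (smt (verit, best) Collect_mono_iff min_def mult_right_mono norm_ge_zero)

text \<open>A common point would bring the two axis points closer together than \<delta> allows,
  since each side contributes at most half of its share.\<close>

lemma fat_disjoint_aux:
 assumes \<delta>: "\<delta> > 0" "!!z1 z2. z1 \<in> open_segment w1 w1' ==> z2 \<in> open_segment w2 w2' ==>
   \<delta>*(min (norm (z1 - w1)) (norm (z1 - w1')) + min (norm (z2 - w2)) (norm (z2 - w2'))) <= norm (z1 - z2)"
 shows "fat (\<delta>/2) w1 w1' \<inter> fat (\<delta>/2) w2 w2' = {}"
proof (rule ccontr)
 assume "\<not> ?thesis"
 then obtain x z1 z2 where z: "z1 \<in> open_segment w1 w1'" "z2 \<in> open_segment w2 w2'"
  and x: "norm (x - z1) <= \<delta>/2*min (norm (z1 - w1)) (norm (z1 - w1'))"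
   "norm (x - z2) <= \<delta>/2*min (norm (z2 - w2)) (norm (z2 - w2'))" by (auto simp: fat_def)
 let ?m1 = "min (norm (z1 - w1)) (norm (z1 - w1'))" and ?m2 = "min (norm (z2 - w2)) (norm (z2 - w2'))"
 have m: "?m1 > 0" "?m2 > 0" using z by (auto simp: open_segment_def)
 have "norm (z1 - z2) <= norm (x - z1) + norm (x - z2)" using norm_triangle_ineq4[of "x - z2" "x - z1"] by simp
 also have "\<dots> <= \<delta>/2*(?m1 + ?m2)" using x by (simp add: algebra_simps)
 also have "\<dots> < \<delta>*(?m1 + ?m2)" using m \<delta>(1) by (simp add: add_pos_pos)
 finally show False using \<delta>(2)[OF z] by simp
qed

lemma fat_disjoint_apart:
 fixes w1 :: "'a::euclidean_space" assumes "closed_segment w1 w1' \<inter> closed_segment w2 w2' = {}"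
 shows "\<exists>c>0. fat c w1 w1' \<inter> fat c w2 w2' = {}"
proof -
 obtain d where d: "d > 0" "!!x y. x \<in> closed_segment w1 w1' ==> y \<in> closed_segment w2 w2' ==> d <= dist x y"
  using separate_compact_closed[OF compact_segment closed_segment assms] by blast
 define B where "B = norm (w1' - w1) + norm (w2' - w2) + 1"
 have B: "B > 0" by (simp add: B_def add_nonneg_pos)
 have "fat (d/B/2) w1 w1' \<inter> fat (d/B/2) w2 w2' = {}"
 proof (rule fat_disjoint_aux)
  show "d/B > 0" using d(1) B by simp
  fix z1 z2 assume z: "z1 \<in> open_segment w1 w1'" "z2 \<in> open_segment w2 w2'"
  have "norm (z1 - w1) <= norm (w1' - w1)" "norm (z2 - w2) <= norm (w2' - w2)"
   using z segment_bound by (auto simp: open_segment_def)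
  then have "min (norm (z1 - w1)) (norm (z1 - w1')) + min (norm (z2 - w2)) (norm (z2 - w2')) <= B" by (simp add: B_def)
  then have "d/B*(min (norm (z1 - w1)) (norm (z1 - w1')) + min (norm (z2 - w2)) (norm (z2 - w2'))) <= d/B*B"
   using d(1) B by (intro mult_left_mono) auto
  also have "\<dots> = d" using B by simp
  also have "\<dots> <= norm (z1 - z2)" using d(2)[of z1 z2] z by (simp add: open_segment_def dist_norm)
  finally show "d/B*(min (norm (z1 - w1)) (norm (z1 - w1')) + min (norm (z2 - w2)) (norm (z2 - w2'))) <= norm (z1 - z2)" .
 qed
 then show ?thesis using d(1) B by (intro exI[of _ "d/B/2"]) auto
qed

text \<open>On two different rays from \<open>w\<close> the distance of two points is at least a
  fixed multiple of the sum of their distances from \<open>w\<close>.\<close>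

lemma fat_disjoint_shared:
 fixes w :: "'a::euclidean_space" assumes "w ~= w1" "w ~= w2" and disj: "open_segment w w1 \<inter> open_segment w w2 = {}"
 shows "\<exists>c>0. fat c w w1 \<inter> fat c w w2 = {}"
proof -
 define L1 where "L1 = norm (w1 - w)"
 define L2 where "L2 = norm (w2 - w)"
 define \<tau>1 where "\<tau>1 = (1/L1) *R (w1 - w)"
 define \<tau>2 where "\<tau>2 = (1/L2) *R (w2 - w)"
 have L: "L1 > 0" "L2 > 0" using assms by (auto simp: L1_def L2_def)
 have n: "norm \<tau>1 = 1" "norm \<tau>2 = 1" using L by (auto simp: \<tau>1_def \<tau>2_def L1_def L2_def)
 then have i: "\<tau>1\<bullet>\<tau>1 = 1" "\<tau>2\<bullet>\<tau>2 = 1" by (auto simp: dot_square_norm)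
 have "\<tau>1 ~= \<tau>2"
 proof
  assume eq: "\<tau>1 = \<tau>2"
  define m where "m = min L1 L2/2"
  have m: "0 < m" "m < L1" "m < L2" using L by (auto simp: m_def)
  have 1: "w + m *R \<tau>1 \<in> open_segment w w1" unfolding in_segment using m L assms(1)
   by (intro conjI exI[of _ "m/L1"]) (auto simp: \<tau>1_def algebra_simps)
  have 2: "w + m *R \<tau>2 \<in> open_segment w w2" unfolding in_segment using m L assms(2)
   by (intro conjI exI[of _ "m/L2"]) (auto simp: \<tau>2_def algebra_simps)
  show False using 1 2 eq disj by auto
 qed
 define k where "k = \<tau>1\<bullet>\<tau>2"
 have "(norm (\<tau>1 - \<tau>2))^2 = 2 - 2*k" unfolding power2_norm_eq_inner k_def by (simp add: inner_simps i inner_commute)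
 moreover have "(norm (\<tau>1 - \<tau>2))^2 > 0" using \<open>\<tau>1 ~= \<tau>2\<close> by simp
 ultimately have k1: "k < 1" by simp
 have k2: "k >= -1" using Cauchy_Schwarz_ineq2[of \<tau>1 \<tau>2] n by (auto simp: k_def abs_le_iff)
 \<comment> \<open>With \<open>k\<close> the cosine of the angle at \<open>w\<close>, this is the
   sine of half the angle.\<close>
 define \<delta> where "\<delta> = sqrt ((1 - k)/2)"
 have \<delta>: "\<delta> > 0" using k1 by (simp add: \<delta>_def)
 have "fat (\<delta>/2) w w1 \<inter> fat (\<delta>/2) w w2 = {}"
 proof (rule fat_disjoint_aux[OF \<delta>])
  fix z1 z2 assume z: "z1 \<in> open_segment w w1" "z2 \<in> open_segment w w2"
  obtain t1 where t1: "0 < t1" "z1 = (1 - t1) *R w + t1 *R w1" using z by (auto simp: in_segment)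
  obtain t2 where t2: "0 < t2" "z2 = (1 - t2) *R w + t2 *R w2" using z by (auto simp: in_segment)
  define s1 where "s1 = t1*L1"
  define s2 where "s2 = t2*L2"
  have s: "s1 > 0" "s2 > 0" using t1 t2 L by (auto simp: s1_def s2_def)
  have z1: "z1 - w = s1 *R \<tau>1" and z2: "z2 - w = s2 *R \<tau>2"
   using t1 t2 L by (auto simp: s1_def s2_def \<tau>1_def \<tau>2_def algebra_simps)
  have "(norm (z1 - z2))^2 = s1^2 + s2^2 - 2*k*(s1 * s2)"
  proof -
   have eq: "z1 - z2 = s1 *R \<tau>1 - s2 *R \<tau>2" using z1 z2 by (simp add: algebra_simps)
   show ?thesis unfolding eq power2_norm_eq_inner k_def
    by (simp add: inner_simps i inner_commute power2_eq_square algebra_simps)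
  qed
  moreover have "s1^2 + s2^2 - 2*k*(s1 * s2) - (1 - k)/2*(s1 + s2)^2 = (1 + k)/2*(s1 - s2)^2"
   by (simp add: power2_eq_square field_simps)
  moreover have "(1 + k)/2*(s1 - s2)^2 >= 0" using k2 by simp
  ultimately have "(1 - k)/2*(s1 + s2)^2 <= (norm (z1 - z2))^2" by linarith
  moreover have "(\<delta>*(s1 + s2))^2 = (1 - k)/2*(s1 + s2)^2" using k1 by (simp add: \<delta>_def power_mult_distrib)
  ultimately have le: "\<delta>*(s1 + s2) <= norm (z1 - z2)" by (intro power2_le_imp_le[OF _ norm_ge_zero]) linarith
  have nz: "norm (z1 - w) = s1" "norm (z2 - w) = s2" unfolding z1 z2 using n s by simp_all
  have "\<delta>*(min (norm (z1 - w)) (norm (z1 - w1)) + min (norm (z2 - w)) (norm (z2 - w2)))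
    <= \<delta>*(norm (z1 - w) + norm (z2 - w))"
   by (rule mult_left_mono[OF add_mono[OF min.cobounded1 min.cobounded1] less_imp_le[OF \<delta>]])
  also have "\<dots> = \<delta>*(s1 + s2)" by (simp only: nz)
  also note le
  finally show "\<delta>*(min (norm (z1 - w)) (norm (z1 - w1)) + min (norm (z2 - w)) (norm (z2 - w2))) <= norm (z1 - z2)" .
 qed
 then show ?thesis using \<delta> by (intro exI[of _ "\<delta>/2"]) auto
qed

lemma fat_disjoint:
 fixes w1 :: "'a::euclidean_space" assumes ne: "w1 ~= w1'" "w2 ~= w2'" and diff: "{w1, w1'} ~= {w2, w2'}"
  and int: "closed_segment w1 w1' \<inter> closed_segment w2 w2' \<subseteq> {w1, w1'} \<inter> {w2, w2'}"
 shows "\<exists>c>0. fat c w1 w1' \<inter> fat c w2 w2' = {}"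
proof (cases "closed_segment w1 w1' \<inter> closed_segment w2 w2' = {}")
 case True
 then show ?thesis by (rule fat_disjoint_apart)
next
 case False
 have disj: "open_segment w1 w1' \<inter> open_segment w2 w2' = {}" using int by (auto simp: open_segment_def)
 have "w1 = w2 \<or> w1 = w2' \<or> w1' = w2 \<or> w1' = w2'" using False int by auto
 then consider "w1 = w2" | "w1 = w2'" | "w1' = w2" | "w1' = w2'" by blast
 then show ?thesis
 proof cases
  case 1
  then show ?thesis using fat_disjoint_shared[of w1 w1' w2'] ne disj by simp
 next
  case 2
  then show ?thesis using fat_disjoint_shared[of w1 w1' w2] ne disj
   by (simp add: fat_commute[of _ w2] open_segment_commute[of w2])
 next
  case 3
  then show ?thesis using fat_disjoint_shared[of w1' w1 w2'] ne disj
   by (simp add: fat_commute[of _ w1] open_segment_commute[of w1])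
 next
  case 4
  then show ?thesis using fat_disjoint_shared[of w1' w1 w2] ne disj
   by (simp add: fat_commute[of _ w1] open_segment_commute[of w1] fat_commute[of _ w2] open_segment_commute[of w2])
 qed
qed

section \<open>Rhombi along edges and the position of ridges\<close>

context ma_solution
begin

text \<open>The extreme slope towards \<open>n\<close> touches the graph at a point \<open>e\<close>
  on that side. So \<open>v\<close> is affine on the triangle \<open>w w' e\<close>, which contains
  a thin triangle over the edge.\<close>

lemma half_rhombus: assumes w: "w \<in> vertices" "w' \<in> vertices" "w ~= w'" and p0: "p0 \<in> sub w" "p0 \<in> sub w'"
  and L: "w' - w = L *R \<tau>" "L > 0" and n: "n\<bullet>n = 1" "n\<bullet>\<tau> = 0" "\<tau>\<bullet>\<tau> = 1"
  and dec: "!!z. z = (z\<bullet>\<tau>) *R \<tau> + (z\<bullet>n) *R n"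
 obtains p c where "p \<in> sub w" "p \<in> sub w'" "n\<bullet>p0 <= n\<bullet>p" "c > 0"
  "!!s y. 0 <= s ==> s <= L ==> 0 <= y ==> y <= c*min s (L - s) ==>
    w + s *R \<tau> + y *R n \<in> \<Omega> \<and> v (w + s *R \<tau> + y *R n) = v w + p\<bullet>(s *R \<tau> + y *R n)"
proof -
 have wO: "w \<in> \<Omega>" "w' \<in> \<Omega>" using w vertices_props by auto
 have span: "\<exists>c. z = c *R (w' - w)" if "n\<bullet>z = 0" for z
 proof -
  have "z = (z\<bullet>\<tau>) *R \<tau>" using dec[of z] that by (simp add: inner_commute)
  also have "\<dots> = ((z\<bullet>\<tau>)/L) *R (w' - w)" using L by simp
  finally show ?thesis by blast
 qed
 have "n ~= 0" using n(1) by auto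
 moreover have "n\<bullet>(w' - w) = 0" using L n(2) by simp
 ultimately obtain p e where p: "p \<in> sub w" "p \<in> sub w'" "n\<bullet>p0 <= n\<bullet>p"
  and e: "e \<in> closure \<Omega>" "n\<bullet>(e - w) > 0" "v e = v w + p\<bullet>(e - w)"
  using extreme_edge_slope[OF w p0 _ _ span] by blast
 define h where "h = n\<bullet>(e - w)"
 define sc where "sc = (e - w)\<bullet>\<tau>"
 have ew: "e - w = sc *R \<tau> + h *R n" using dec[of "e - w"] by (simp add: h_def sc_def inner_commute)
 \<comment> \<open>Large enough for the barycentric coordinates in the triangle to be nonnegative;
   the summand 1 keeps the weight of \<open>e\<close> below 1.\<close>
 define B where "B = \<bar>sc\<bar> + \<bar>L - sc\<bar> + 1"
 define c where "c = h/B"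
 have B: "B > 0" by (simp add: B_def add_nonneg_pos)
 have h: "h > 0" using e(2) by (simp add: h_def)
 have c: "c > 0" using h B by (simp add: c_def)
 have vw': "v w' = v w + p\<bullet>(w' - w)" using common_slope_contact[OF p(1,2) wO] .
 have K: "w \<in> contact w p" "w' \<in> contact w p" "e \<in> contact w p"
  using wO vw' e closure_subset by (auto simp: contact_def)
 show thesis
 proof (rule that[OF p c])
  fix s y assume s: "0 <= s" "s <= L" and y: "0 <= y" "y <= c*min s (L - s)"
  define \<gamma> where "\<gamma> = y/h"
  have \<gamma>0: "\<gamma> >= 0" using y h by (simp add: \<gamma>_def)
  have "\<gamma> <= c*min s (L - s)/h" using y h by (simp add: \<gamma>_def divide_right_mono)
  also have "\<dots> = min s (L - s)/B" using h by (simp add: c_def)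
  finally have \<gamma>B: "\<gamma>*B <= min s (L - s)" using B by (simp add: le_divide_eq)
  have g1: "\<gamma> * sc <= s"
  proof -
   have "\<gamma> * sc <= \<gamma>*B" using \<gamma>0 by (intro mult_left_mono) (auto simp: B_def)
   then show ?thesis using \<gamma>B by simp
  qed
  have g2: "\<gamma>*(L - sc) <= L - s"
  proof -
   have "\<gamma>*(L - sc) <= \<gamma>*B" using \<gamma>0 by (intro mult_left_mono) (auto simp: B_def)
   then show ?thesis using \<gamma>B by simp
  qed
  have g3: "\<gamma> < 1"
  proof -
   have "\<gamma>*B <= L" using \<gamma>B s by simp
   also have "L < B" by (simp add: B_def)
   finally show ?thesis using B by simp
  qed
  define \<beta> where "\<beta> = (s - \<gamma> * sc)/L"
  define \<alpha> where "\<alpha> = 1 - \<beta> - \<gamma>"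
  have \<beta>0: "\<beta> >= 0" using g1 L by (simp add: \<beta>_def)
  have \<beta>L: "\<beta>*L = s - \<gamma> * sc" using L by (simp add: \<beta>_def)
  have \<alpha>0: "\<alpha> >= 0"
  proof -
   have "\<alpha>*L = L - s - \<gamma>*(L - sc)" using \<beta>L by (simp add: \<alpha>_def algebra_simps)
   then have "\<alpha>*L >= 0" using g2 by simp
   then show ?thesis using L by (simp add: zero_le_mult_iff)
  qed
  define x where "x = w + s *R \<tau> + y *R n"
  have xabc: "x = \<alpha> *R w + \<beta> *R w' + \<gamma> *R e"
  proof -
   have "\<alpha> *R w + \<beta> *R w' + \<gamma> *R e = w + \<beta> *R (w' - w) + \<gamma> *R (e - w)" by (simp add: \<alpha>_def algebra_simps)
   also have "\<dots> = w + (\<beta>*L + \<gamma> * sc) *R \<tau> + (\<gamma>*h) *R n" unfolding ew L(1) by (simp add: algebra_simps)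
   also have "\<dots> = x" using \<beta>L h by (simp add: x_def \<gamma>_def)
   finally show ?thesis by simp
  qed
  have "x \<in> convex hull {w, w', e}"
  proof -
   have "\<alpha> + \<beta> + \<gamma> = 1" by (simp add: \<alpha>_def)
   then show ?thesis unfolding convex_hull_3 mem_Collect_eq using \<alpha>0 \<beta>0 \<gamma>0 xabc
    by (intro exI[of _ \<alpha>] exI[of _ \<beta>] exI[of _ \<gamma>]) simp
  qed
  moreover have "convex hull {w, w', e} \<subseteq> contact w p" using K by (intro hull_minimal convex_contact[OF p(1)]) auto
  ultimately have xK: "x \<in> contact w p" by blast
  \<comment> \<open>\<open>e\<close> may be a boundary point; since its weight is below 1, the point
    still lies in the open set \<Omega>.\<close>
  have xO: "x \<in> \<Omega>"
  proof -
   define z where "z = (\<alpha>/(1 - \<gamma>)) *R w + (\<beta>/(1 - \<gamma>)) *R w'"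
   have "\<alpha>/(1 - \<gamma>) + \<beta>/(1 - \<gamma>) = 1" using g3 by (simp add: \<alpha>_def add_divide_distrib[symmetric])
   then have z: "z \<in> \<Omega>" unfolding z_def using \<alpha>0 \<beta>0 g3 wO by (intro convexD[OF convex_\<Omega>]) auto
   have xz: "x = (1 - \<gamma>) *R z + \<gamma> *R e" using g3 by (simp add: xabc z_def scaleR_add_right)
   show ?thesis
   proof (cases "\<gamma> = 0 \<or> z = e")
    case True
    then have "x = z" using xz by (auto simp: algebra_simps)
    then show ?thesis using z by simp
   next
    case False
    then have "x \<in> open_segment z e" unfolding in_segment using xz \<gamma>0 g3 by (intro conjI exI[of _ \<gamma>]) auto
    then show ?thesis
     using in_interior_closure_convex_segment[OF convex_\<Omega>, of z e] z e(1) open_\<Omega> by (auto simp: interior_open)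
   qed
  qed
  then show "w + s *R \<tau> + y *R n \<in> \<Omega> \<and> v (w + s *R \<tau> + y *R n) = v w + p\<bullet>(s *R \<tau> + y *R n)"
   using xK by (simp add: x_def contact_def)
 qed
qed

text \<open>The extreme slopes of the two sides agree along the edge, hence differ by a normal
  vector. Their mean is \<open>pm\<close>, and half their jump is the \<kappa> of the roof
  term.\<close>

lemma edge_rhombus:
 assumes w: "w \<in> vertices" "w' \<in> vertices" "w ~= w'" and p: "p \<in> sub w" "p \<in> sub w'" and q: "q \<in> sub w" "q \<in> sub w'"
  and L: "w' - w = L *R \<tau>" "L > 0" and \<tau>: "norm \<tau> = 1"
 obtains pm \<kappa> c where "pm + \<kappa> *R perp \<tau> \<in> sub w \<inter> sub w'" "pm - \<kappa> *R perp \<tau> \<in> sub w \<inter> sub w'" "\<kappa> >= 0" "perp \<tau>\<bullet>(p - q) <= 2*\<kappa>" "c > 0"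
  "!!s y. 0 <= s ==> s <= L ==> \<bar>y\<bar> <= c*min s (L - s) ==>
    w + s *R \<tau> + y *R perp \<tau> \<in> \<Omega> \<and>
    v (w + s *R \<tau> + y *R perp \<tau>) = v w + pm\<bullet>(s *R \<tau> + y *R perp \<tau>) + \<kappa>*\<bar>y\<bar>"
proof -
 define n where "n = perp \<tau>"
 have wO: "w \<in> \<Omega>" "w' \<in> \<Omega>" using w vertices_props by auto
 have \<tau>\<tau>: "\<tau>\<bullet>\<tau> = 1" using \<tau> by (simp add: dot_square_norm)
 have n: "n\<bullet>n = 1" "n\<bullet>\<tau> = 0" by (simp_all add: n_def perp_inner \<tau>\<tau>)
 have dec: "z = (z\<bullet>\<tau>) *R \<tau> + (z\<bullet>n) *R n" for z
  unfolding n_def by (rule orthonormal_decomposition[OF \<tau>])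
 define p0 where "p0 = (if n\<bullet>q <= n\<bullet>p then p else q)"
 define q0 where "q0 = (if n\<bullet>q <= n\<bullet>p then q else p)"
 have p0: "p0 \<in> sub w" "p0 \<in> sub w'" "q0 \<in> sub w" "q0 \<in> sub w'" using p q by (auto simp: p0_def q0_def)
 obtain P c1 where P: "P \<in> sub w" "P \<in> sub w'" "n\<bullet>p0 <= n\<bullet>P" "c1 > 0"
  "!!s y. 0 <= s ==> s <= L ==> 0 <= y ==> y <= c1*min s (L - s) ==>
    w + s *R \<tau> + y *R n \<in> \<Omega> \<and> v (w + s *R \<tau> + y *R n) = v w + P\<bullet>(s *R \<tau> + y *R n)"
  using half_rhombus[OF w p0(1,2) L n \<tau>\<tau> dec] by metis
 have n': "- n \<bullet> - n = 1" "- n\<bullet>\<tau> = 0" using n by simp_all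
 have dec': "z = (z\<bullet>\<tau>) *R \<tau> + (z \<bullet> - n) *R - n" for z using dec[of z] by simp
 obtain Q c2 where Q: "Q \<in> sub w" "Q \<in> sub w'" "- n\<bullet>q0 <= - n\<bullet>Q" "c2 > 0"
  "!!s y. 0 <= s ==> s <= L ==> 0 <= y ==> y <= c2*min s (L - s) ==>
    w + s *R \<tau> + y *R - n \<in> \<Omega> \<and> v (w + s *R \<tau> + y *R - n) = v w + Q\<bullet>(s *R \<tau> + y *R - n)"
  using half_rhombus[OF w p0(3,4) L n' \<tau>\<tau> dec'] by metis
 define \<kappa> where "\<kappa> = n\<bullet>(P - Q)/2"
 define pm where "pm = (1/2) *R (P + Q)"
 have "P\<bullet>(w' - w) = Q\<bullet>(w' - w)"
  using common_slope_contact[OF P(1,2) wO] common_slope_contact[OF Q(1,2) wO] by simp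
 then have PQ: "(P - Q)\<bullet>\<tau> = 0" using L by (simp add: inner_diff_left)
 have PQn: "P - Q = (2*\<kappa>) *R n" using dec[of "P - Q"] PQ by (simp add: \<kappa>_def inner_commute)
 have P': "P = pm + \<kappa> *R n"
 proof -
  have "pm + \<kappa> *R n = pm + (1/2) *R (P - Q)" unfolding PQn by simp
  also have "\<dots> = P" by (simp add: pm_def flip: scaleR_add_right)
  finally show ?thesis by simp
 qed
 have Q': "Q = pm - \<kappa> *R n"
 proof -
  have "Q = P - (2*\<kappa>) *R n" using PQn by (simp add: algebra_simps)
  then show ?thesis unfolding P' by (simp only: mult_2 scaleR_add_left) simp
 qed
 have k1: "n\<bullet>(p - q) <= 2*\<kappa>" "\<kappa> >= 0"
  using P(3) Q(3) by (auto simp: \<kappa>_def p0_def q0_def inner_diff_right split: if_splits)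
 show thesis
 proof (rule that[of pm \<kappa> "min c1 c2"])
  show "pm + \<kappa> *R perp \<tau> \<in> sub w \<inter> sub w'" "pm - \<kappa> *R perp \<tau> \<in> sub w \<inter> sub w'"
   using P Q P' Q' by (auto simp: n_def)
  show "\<kappa> >= 0" "perp \<tau>\<bullet>(p - q) <= 2*\<kappa>" using k1 by (auto simp: n_def)
  show "min c1 c2 > 0" using P Q by simp
  fix s y assume s: "0 <= s" "s <= L" and y: "\<bar>y\<bar> <= min c1 c2*min s (L - s)"
  have m: "0 <= min s (L - s)" using s by simp
  have b1: "\<bar>y\<bar> <= c1*min s (L - s)" using y mult_right_mono[OF min.cobounded1[of c1 c2] m] by linarith
  have b2: "\<bar>y\<bar> <= c2*min s (L - s)" using y mult_right_mono[OF min.cobounded2[of c1 c2] m] by linarith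
  show "w + s *R \<tau> + y *R perp \<tau> \<in> \<Omega> \<and>
    v (w + s *R \<tau> + y *R perp \<tau>) = v w + pm\<bullet>(s *R \<tau> + y *R perp \<tau>) + \<kappa>*\<bar>y\<bar>"
  proof (cases "y >= 0")
   case True
   then show ?thesis using P(5)[OF s, of y] b1 unfolding P' n_def[symmetric] by (simp add: inner_simps n algebra_simps)
  next
   case False
   then show ?thesis using Q(5)[OF s, of "- y"] b2 unfolding Q' n_def[symmetric] by (simp add: inner_simps n algebra_simps)
  qed
 qed
qed

lemma edge_affine: assumes "p \<in> sub w" "p \<in> sub w'" "w \<in> \<Omega>" "w' \<in> \<Omega>" "0 <= t" "t <= 1"
 shows "v ((1 - t) *R w + t *R w') = (1 - t) * v w + t * v w'"
  and "(1 - t) *R w + t *R w' \<in> contact w p"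
proof -
 let ?x = "(1 - t) *R w + t *R w'"
 have vw': "v w' = v w + p\<bullet>(w' - w)" using common_slope_contact[OF assms(1-4)] .
 have "?x \<in> closed_segment w w'" using assms(5,6) unfolding in_segment by (intro exI[of _ t] conjI refl)
 then have "?x \<in> convex hull {w, w'}" unfolding segment_convex_hull .
 moreover have "convex hull {w, w'} \<subseteq> contact w p"
 proof (rule hull_minimal)
  show "convex (contact w p)" using assms(1) by (rule convex_contact)
  show "{w, w'} \<subseteq> contact w p" using assms(3,4) vw' closure_subset[of \<Omega>] by (auto simp: contact_def)
 qed
 ultimately show "?x \<in> contact w p" by (rule subsetD[rotated])
 then have "v ?x = v w + p\<bullet>(?x - w)" by (simp add: contact_def)
 also have "?x - w = t *R (w' - w)" by (simp add: algebra_simps)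
 finally show "v ?x = (1 - t) * v w + t * v w'" unfolding vw' by (simp add: algebra_simps)
qed

definition ridge :: "real^2 => real^2 => bool" where
 "ridge w w' \<longleftrightarrow> w \<in> vertices \<and> w' \<in> vertices \<and> w ~= w' \<and>
   (\<exists>p q. p ~= q \<and> p \<in> sub w \<and> p \<in> sub w' \<and> q \<in> sub w \<and> q \<in> sub w')"

lemma ridge_commute: "ridge w w' \<longleftrightarrow> ridge w' w" unfolding ridge_def by blast

lemma vertex_not_in_ridge: assumes "ridge w w'" "u \<in> vertices" shows "u \<notin> open_segment w w'"
proof
 assume "u \<in> open_segment w w'"
 then obtain t where t: "0 < t" "t < 1" "u = (1 - t) *R w + t *R w'" by (auto simp: in_segment)
 obtain p where p: "p \<in> sub w" "p \<in> sub w'" and w: "w \<in> \<Omega>" "w' \<in> \<Omega>" "w ~= w'"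
  using assms(1) vertices_props(2) by (auto simp: ridge_def)
 have "v u = (1 - t) * v w + t * v w'" using edge_affine(1)[OF p w(1,2), of t] t by simp
 then show False using vertex_not_inside[OF assms(2) _ _ w(3) t] w closure_subset[of \<Omega>] by auto
qed

text \<open>If overlapping segments on one line have different ends, an end of one lies inside the
  other, which is impossible for an atom.\<close>

lemma parallel_ridges_aux: assumes R: "ridge w w'" "ridge u u'" and d: "u' - u = c *R (w' - w)" "c > 0"
  and x: "x \<in> open_segment w w'" "x \<in> open_segment u u'" shows "w = u \<and> w' = u'"
proof -
 have ne: "w ~= w'" "u ~= u'" and V: "w \<in> vertices" "w' \<in> vertices" "u \<in> vertices" "u' \<in> vertices"
  using R by (auto simp: ridge_def)
 define D where "D = w' - w"
 have D: "D ~= 0" using ne by (simp add: D_def)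
 obtain \<alpha> where \<alpha>: "0 < \<alpha>" "\<alpha> < 1" "x = (1 - \<alpha>) *R w + \<alpha> *R w'" using x(1) by (auto simp: in_segment)
 obtain \<beta> where \<beta>: "0 < \<beta>" "\<beta> < 1" "x = (1 - \<beta>) *R u + \<beta> *R u'" using x(2) by (auto simp: in_segment)
 have xw: "x = w + \<alpha> *R D" using \<alpha> by (simp add: D_def algebra_simps)
 have xu: "x = u + (\<beta>*c) *R D"
 proof -
  have "x = u + \<beta> *R (u' - u)" using \<beta> by (simp add: algebra_simps)
  then show ?thesis unfolding d(1) D_def[symmetric] by simp
 qed
 have uw: "u = w + (\<alpha> - \<beta>*c) *R D" using xw xu by (simp add: algebra_simps)
 have inw: "w + t *R D \<in> open_segment w w'" if "0 < t" "t < 1" for t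
 proof -
  have "w + t *R D = (1 - t) *R w + t *R w'" by (simp add: D_def algebra_simps)
  then show ?thesis unfolding in_segment using that ne by (intro conjI exI[of _ t]) simp_all
 qed
 have inu: "u + t *R D \<in> open_segment u u'" if "0 < t" "t < c" for t
 proof -
  have "u + t *R D = (1 - t/c) *R u + (t/c) *R u'"
  proof -
   have "(1 - t/c) *R u + (t/c) *R u' = u + (t/c) *R (u' - u)" by (simp add: algebra_simps)
   then show ?thesis unfolding d(1) D_def[symmetric] using d(2) by simp
  qed
  then show ?thesis unfolding in_segment using that d(2) ne by (intro conjI exI[of _ "t/c"]) simp_all
 qed
 have bc: "0 < \<beta>*c" "\<beta>*c < c" using \<beta> d(2) by auto
 have "\<alpha> = \<beta>*c"
 proof (rule ccontr)
  assume "\<alpha> ~= \<beta>*c"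
  then consider "\<alpha> > \<beta>*c" | "\<alpha> < \<beta>*c" by linarith
  then show False
  proof cases
   case 1
   then have "u \<in> open_segment w w'" using inw[of "\<alpha> - \<beta>*c"] uw \<alpha> bc by simp
   then show False using vertex_not_in_ridge[OF R(1) V(3)] by blast
  next
   case 2
   have "w = u + (\<beta>*c - \<alpha>) *R D" using uw by (simp add: algebra_simps)
   then have "w \<in> open_segment u u'" using inu[of "\<beta>*c - \<alpha>"] 2 \<alpha> bc by simp
   then show False using vertex_not_in_ridge[OF R(2) V(1)] by blast
  qed
 qed
 then have uw': "u = w" using uw by simp
 have u': "u' = w + c *R D" using d(1) uw' by (simp add: D_def algebra_simps)
 have "c = 1"
 proof (rule ccontr)
  assume "c ~= 1"
  then consider "c < 1" | "c > 1" by linarith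
  then show False
  proof cases
   case 1
   then show False using inw[of c] u' d(2) vertex_not_in_ridge[OF R(1) V(4)] by simp
  next
   case 2
   have "w' = u + 1 *R D" using uw' by (simp add: D_def)
   then show False using inu[of 1] 2 vertex_not_in_ridge[OF R(2) V(2)] by simp
  qed
 qed
 then show ?thesis using uw' u' by (simp add: D_def)
qed

text \<open>At the crossing point every slope common to \<open>w\<close> and \<open>w'\<close> is a
  slope, and \<open>v\<close> is affine along the other ridge, which fixes the component of the
  slope in that direction. So the difference of two such slopes is normal to both ridges, and these
  are parallel.\<close>

lemma ridges_cross: assumes R: "ridge w w'" "ridge u u'" and x: "x \<in> open_segment w w'" "x \<in> open_segment u u'"
 shows "{w, w'} = {u, u'}"
proof -
 obtain p q where pq: "p ~= q" "p \<in> sub w" "p \<in> sub w'" "q \<in> sub w" "q \<in> sub w'" using R(1) by (auto simp: ridge_def)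
 obtain p2 where p2: "p2 \<in> sub u" "p2 \<in> sub u'" using R(2) by (auto simp: ridge_def)
 have ne: "w ~= w'" "u ~= u'" and O: "w \<in> \<Omega>" "w' \<in> \<Omega>" "u \<in> \<Omega>" "u' \<in> \<Omega>"
  using R vertices_props(2) by (auto simp: ridge_def)
 have ucl: "u \<in> closure \<Omega>" "u' \<in> closure \<Omega>" using O closure_subset by auto
 obtain \<alpha> where \<alpha>: "0 < \<alpha>" "\<alpha> < 1" "x = (1 - \<alpha>) *R w + \<alpha> *R w'" using x(1) by (auto simp: in_segment)
 obtain \<beta> where \<beta>: "0 < \<beta>" "\<beta> < 1" "x = (1 - \<beta>) *R u + \<beta> *R u'" using x(2) by (auto simp: in_segment)
 have xO: "x \<in> \<Omega>" using convexD[OF convex_\<Omega> O(1,2), of "1 - \<alpha>" \<alpha>] \<alpha> by simp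
 have vx: "v x = (1 - \<beta>) * v u + \<beta> * v u'" using edge_affine(1)[OF p2 O(3,4), of \<beta>] \<beta> by simp
 have *: "p\<bullet>(u' - u) = v u' - v u" if "p \<in> sub w" "p \<in> sub w'" for p
 proof -
  have "x \<in> contact w p" using edge_affine(2)[OF that O(1,2), of \<alpha>] \<alpha> by simp
  then have "p \<in> sub x" using contact_sub(1)[OF that(1) _ xO] by blast
  then have 1: "v x + p\<bullet>(u - x) <= v u" "v x + p\<bullet>(u' - x) <= v u'" using sub_closure ucl by blast+
  have e: "u - x = - \<beta> *R (u' - u)" "u' - x = (1 - \<beta>) *R (u' - u)" using \<beta>(3) by (simp_all add: algebra_simps)
  define Q where "Q = p\<bullet>(u' - u)"
  have eq: "p\<bullet>(u - x) = - \<beta>*Q" "p\<bullet>(u' - x) = (1 - \<beta>)*Q" unfolding e Q_def by simp_all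
  have "\<beta>*(v u' - v u) <= \<beta>*Q" "(1 - \<beta>)*Q <= (1 - \<beta>)*(v u' - v u)"
   using 1[unfolded eq] vx by (simp_all add: algebra_simps)
  then show ?thesis using \<beta> by (simp add: Q_def)
 qed
 define L where "L = norm (w' - w)"
 define \<tau> where "\<tau> = (1/L) *R (w' - w)"
 have L: "L > 0" using ne by (simp add: L_def)
 have \<tau>: "norm \<tau> = 1" using L by (simp add: \<tau>_def L_def)
 have d1: "(p - q)\<bullet>(w' - w) = 0"
  using common_slope_contact[OF pq(2,3) O(1,2)] common_slope_contact[OF pq(4,5) O(1,2)] by (simp add: inner_diff_left)
 have d2: "(p - q)\<bullet>(u' - u) = 0" using *[OF pq(2,3)] *[OF pq(4,5)] by (simp add: inner_diff_left)
 have "(p - q)\<bullet>\<tau> = 0" using d1 by (simp add: \<tau>_def)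
 then have pq': "p - q = ((p - q)\<bullet>perp \<tau>) *R perp \<tau>" using orthonormal_decomposition[OF \<tau>, of "p - q"] by simp
 then have "(p - q)\<bullet>perp \<tau> ~= 0" using pq(1) by auto
 moreover have "((p - q)\<bullet>perp \<tau>)*(perp \<tau>\<bullet>(u' - u)) = 0" using d2 pq' by (metis inner_scaleR_left)
 ultimately have "(u' - u)\<bullet>perp \<tau> = 0" by (simp add: inner_commute)
 then have "u' - u = ((u' - u)\<bullet>\<tau>) *R \<tau>" using orthonormal_decomposition[OF \<tau>, of "u' - u"] by simp
 then obtain c where c: "u' - u = c *R (w' - w)" unfolding \<tau>_def by (metis scaleR_scaleR)
 then have "c ~= 0" using ne by auto
 then consider "c > 0" | "c < 0" by linarith
 then show ?thesis
 proof cases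
  case 1
  then show ?thesis using parallel_ridges_aux[OF R c _ x] by simp
 next
  case 2
  have "u - u' = (- c) *R (w' - w)" using c by (simp add: algebra_simps)
  then show ?thesis using parallel_ridges_aux[OF R(1) _ _ _ x(1), of u' u "- c"] R(2) 2 x(2)
   by (auto simp: ridge_commute open_segment_commute)
 qed
qed

lemma ridges_fat_disjoint: assumes R: "ridge w w'" "ridge u u'" and ne: "{w, w'} ~= {u, u'}"
 shows "\<exists>c>0. fat c w w' \<inter> fat c u u' = {}"
proof (rule fat_disjoint)
 show "w ~= w'" "u ~= u'" using R by (auto simp: ridge_def)
 have V: "w \<in> vertices" "w' \<in> vertices" "u \<in> vertices" "u' \<in> vertices" using R by (auto simp: ridge_def)
 show "closed_segment w w' \<inter> closed_segment u u' \<subseteq> {w, w'} \<inter> {u, u'}"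
 proof
  fix x assume x: "x \<in> closed_segment w w' \<inter> closed_segment u u'"
  have "x \<in> {w, w'} \<union> open_segment w w'" "x \<in> {u, u'} \<union> open_segment u u'"
   using x by (auto simp: open_segment_def)
  moreover have "\<not> (x \<in> open_segment w w' \<and> x \<in> open_segment u u')" using ridges_cross[OF R] ne by blast
  moreover have "\<not> (x \<in> open_segment w w' \<and> x \<in> {u, u'})" "\<not> (x \<in> open_segment u u' \<and> x \<in> {w, w'})"
   using vertex_not_in_ridge[OF R(1)] vertex_not_in_ridge[OF R(2)] V by blast+
  ultimately show "x \<in> {w, w'} \<inter> {u, u'}" by blast
 qed
qed (rule ne)

end

section \<open>Regularity off the singular set\<close>

context ma_solution
begin

text \<open>An arbitrary choice where there are several slopes; off the singular set it is the
  gradient.\<close>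

definition slope :: "real^2 => real^2" where
 "slope x = (SOME p. p \<in> sub x)"

lemma slope_sub: "x \<in> \<Omega> ==> slope x \<in> sub x" unfolding slope_def using sub_nonempty someI_ex by metis

lemma lipschitz_if_slopes_bounded:
 assumes C: "!!x p. x \<in> \<Omega> ==> p \<in> sub x ==> norm p <= C" and xy: "x \<in> \<Omega>" "y \<in> \<Omega>"
 shows "\<bar>v x - v y\<bar> <= C*norm (x - y)"
proof -
 have 1: "v a - v b <= C*norm (a - b)" if "a \<in> \<Omega>" "b \<in> \<Omega>" for a b
 proof -
  have "slope a\<bullet>(b - a) + v a <= v b" using slope_sub[OF that(1)] that(2) by (simp add: subdifferential_def)
  moreover have "\<bar>slope a\<bullet>(b - a)\<bar> <= C*norm (b - a)"
   by (rule order_trans[OF Cauchy_Schwarz_ineq2 mult_right_mono[OF C[OF that(1) slope_sub[OF that(1)]] norm_ge_zero]])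
  ultimately show ?thesis by (simp add: norm_minus_commute)
 qed
 show ?thesis using 1[OF xy] 1[OF xy(2,1)] by (simp add: norm_minus_commute)
qed

definition ridges :: "(real^2) set" where
 "ridges = \<Union>{open_segment w w' | w w'. ridge w w'}"

definition singular_set :: "(real^2) set" where
 "singular_set = vertices \<union> \<Union>{closed_segment w w' | w w'. ridge w w'}"

lemma singular_set_eq: "singular_set = vertices \<union> ridges"
proof (intro set_eqI iffI)
 fix x assume "x \<in> singular_set"
 then consider "x \<in> vertices" | w w' where "ridge w w'" "x \<in> closed_segment w w'" by (auto simp: singular_set_def)
 then show "x \<in> vertices \<union> ridges"
 proof cases
  case (2 w w')
  then have "w \<in> vertices" "w' \<in> vertices" by (auto simp: ridge_def)
  then show ?thesis using 2 by (auto simp: ridges_def open_segment_def)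
 qed simp
next
 fix x assume "x \<in> vertices \<union> ridges"
 then consider "x \<in> vertices" | w w' where "ridge w w'" "x \<in> open_segment w w'" by (auto simp: ridges_def)
 then show "x \<in> singular_set"
 proof cases
  case (2 w w')
  then show ?thesis using open_closed_segment unfolding singular_set_def by blast
 qed (simp add: singular_set_def)
qed

lemma finite_ridge_segments: "finite {f w w' | w w'. ridge w w'}"
proof -
 have "{f w w' | w w'. ridge w w'} \<subseteq> (%(w, w'). f w w') ` (vertices \<times> vertices)"
  by (auto simp: ridge_def)
 then show ?thesis using vertices_props(1) finite_subset by blast
qed

lemma closed_singular_set: "closed singular_set" unfolding singular_set_def
 by (intro closed_Un finite_imp_closed vertices_props closed_Union finite_ridge_segments) auto

lemma negligible_singular_set: "negligible singular_set"
proof -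
 have "negligible (closed_segment w w')" for w w' :: "real^2"
  using interior_closed_segment_ge2[of w w'] negligible_convex_interior[of "closed_segment w w'"] by simp
 then have "negligible (\<Union>{closed_segment w w' | w w'. ridge w w'})"
  by (intro negligible_Union finite_ridge_segments) blast
 then show ?thesis unfolding singular_set_def by (rule negligible_Un[OF negligible_finite[OF vertices_props(1)]])
qed

lemma infdist_vertex_le: "w \<in> vertices ==> infdist x vertices <= norm (x - w)"
 using infdist_le[of w vertices x] by (simp add: dist_norm)

lemma infdist_vertices_pos: "x \<notin> vertices ==> infdist x vertices > 0"
 using vertices_props infdist_pos_not_in_closed[OF finite_imp_closed] by blast

text \<open>With a single common slope \<kappa> is 0, so \<open>v\<close> is affine on a rhombus
  around \<open>x\<close>.\<close>

lemma non_ridge_edge: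
 assumes w: "w \<in> vertices" "w' \<in> vertices" and x: "x \<in> open_segment w w'" and p: "p \<in> sub w" "p \<in> sub w'"
  and "\<not> ridge w w'" shows "\<exists>q. \<forall>\<^sub>F y in nhds x. v y = v x + q\<bullet>(y - x)"
proof -
 have ne: "w ~= w'" using x by auto
 define L where "L = norm (w' - w)"
 define \<tau> where "\<tau> = (1/L) *R (w' - w)"
 define n where "n = perp \<tau>"
 have L: "L > 0" using ne by (simp add: L_def)
 have \<tau>: "norm \<tau> = 1" using L by (simp add: \<tau>_def L_def)
 have \<tau>\<tau>: "\<tau>\<bullet>\<tau> = 1" using \<tau> by (simp add: dot_square_norm)
 have wL: "w' - w = L *R \<tau>" using L by (simp add: \<tau>_def)
 obtain pm \<kappa> c where R: "pm + \<kappa> *R perp \<tau> \<in> sub w \<inter> sub w'" "pm - \<kappa> *R perp \<tau> \<in> sub w \<inter> sub w'" "c > 0"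
  "!!s y. 0 <= s ==> s <= L ==> \<bar>y\<bar> <= c*min s (L - s) ==>
    w + s *R \<tau> + y *R perp \<tau> \<in> \<Omega> \<and>
    v (w + s *R \<tau> + y *R perp \<tau>) = v w + pm\<bullet>(s *R \<tau> + y *R perp \<tau>) + \<kappa>*\<bar>y\<bar>"
  using edge_rhombus[OF w ne p p wL L \<tau>] by metis
 have "pm + \<kappa> *R perp \<tau> = pm - \<kappa> *R perp \<tau>"
  using R(1,2) assms(6) w ne unfolding ridge_def by blast
 then have "(2*\<kappa>) *R perp \<tau> = 0" by (simp only: mult_2 scaleR_add_left) (simp add: algebra_simps)
 moreover have "perp \<tau> ~= 0" using norm_perp[of \<tau>] \<tau> by auto
 ultimately have \<kappa>: "\<kappa> = 0" by simp
 define U where "U = {y. 0 < (y - w)\<bullet>\<tau>} \<inter> {y. (y - w)\<bullet>\<tau> < L} \<inter>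
   {y. \<bar>(y - w)\<bullet>n\<bar> < c*min ((y - w)\<bullet>\<tau>) (L - (y - w)\<bullet>\<tau>)}"
 have "open U" unfolding U_def by (intro open_Int open_Collect_less continuous_intros)
 obtain t where t: "0 < t" "t < 1" "x = (1 - t) *R w + t *R w'" using x by (auto simp: in_segment)
 have xw: "x - w = (t*L) *R \<tau>"
 proof -
  have "x - w = t *R (w' - w)" using t(3) by (simp add: algebra_simps)
  then show ?thesis using wL by simp
 qed
 have "x \<in> U" using t(1,2) L R(3) by (auto simp: U_def xw \<tau>\<tau> n_def perp_inner)
 have vU: "v y = v w + pm\<bullet>(y - w)" if y: "y \<in> U" for y
 proof -
  have "\<bar>(y - w)\<bullet>n\<bar> <= c*min ((y - w)\<bullet>\<tau>) (L - (y - w)\<bullet>\<tau>)" "0 <= (y - w)\<bullet>\<tau>" "(y - w)\<bullet>\<tau> <= L"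
   using y by (auto simp: U_def)
  from R(4)[OF this(2,3,1)] \<kappa>
  have "v (w + ((y - w)\<bullet>\<tau>) *R \<tau> + ((y - w)\<bullet>n) *R n) = v w + pm\<bullet>(((y - w)\<bullet>\<tau>) *R \<tau> + ((y - w)\<bullet>n) *R n)"
   by (simp add: n_def)
  moreover have e: "((y - w)\<bullet>\<tau>) *R \<tau> + ((y - w)\<bullet>n) *R n = y - w"
   unfolding n_def by (rule orthonormal_decomposition[OF \<tau>, symmetric])
  moreover have "w + ((y - w)\<bullet>\<tau>) *R \<tau> + ((y - w)\<bullet>n) *R n = y"
   by (simp only: add.assoc e) simp
  ultimately show ?thesis by (simp only:)
 qed
 have "\<forall>\<^sub>F y in nhds x. y \<in> U" using \<open>open U\<close> \<open>x \<in> U\<close> by (rule eventually_nhds_in_open)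
 then have "\<forall>\<^sub>F y in nhds x. v y = v x + pm\<bullet>(y - x)"
  by eventually_elim (simp add: vU \<open>x \<in> U\<close> inner_diff_right)
 then show ?thesis by blast
qed

text \<open>Only a contact segment from an atom to the frontier calls for a genuine parabola, which
  the interior ball provides. In the other cases \<open>v\<close> is affine near \<open>x\<close>,
  or \<open>x\<close> belongs to the singular set.\<close>

lemma quadratic_bound:
 assumes r: "r > 0" "!!b. b \<in> frontier \<Omega> ==> \<exists>\<nu>. norm \<nu> = 1 \<and> cball (b - r *R \<nu>) r \<subseteq> closure \<Omega>"
 obtains C where "C > 0" "!!x. x \<in> \<Omega> ==> x \<notin> singular_set ==>
   \<exists>p. \<forall>\<^sub>F y in nhds x. v y <= v x + p\<bullet>(y - x) + C/infdist x vertices*(norm (y - x))^2"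
proof -
 obtain \<rho> where \<rho>: "\<rho> > 0" "!!w. w \<in> vertices ==> cball w \<rho> \<subseteq> \<Omega>" using vertex_radius by blast
 obtain B where B: "B > 0" "!!x. x \<in> closure \<Omega> ==> norm x <= B"
  using bounded_closure[OF bounded_\<Omega>] unfolding bounded_pos by blast
 define \<Delta> where "\<Delta> = 2*B"
 define S where "S = (\<Sum>w\<in>vertices. - v w)"
 have vS: "- v w <= S" if "w \<in> vertices" for w
  unfolding S_def using v_neg vertices_props that by (intro member_le_sum) (auto simp: less_imp_le)
 define C0 where "C0 = (2 + 4*\<Delta>/\<rho>)^2/r*\<Delta>*S/\<rho>"
 obtain w0 where w0: "w0 \<in> vertices" using vertices_props by blast
 have S0: "S > 0" using vS[OF w0] v_neg[of w0] w0 vertices_props by force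
 have C0: "C0 > 0"
 proof -
  have "2 + 4*\<Delta>/\<rho> > 0" using B \<rho> by (simp add: \<Delta>_def add_pos_pos)
  then show ?thesis unfolding C0_def using B \<rho> r(1) S0 by (simp add: \<Delta>_def)
 qed
 show thesis
 proof (rule that[OF C0])
  fix x assume x: "x \<in> \<Omega>" "x \<notin> singular_set"
  have xv: "x \<notin> vertices" using x(2) by (simp add: singular_set_def)
  have D: "infdist x vertices > 0" using infdist_vertices_pos[OF xv] .
  have affine_case: "\<exists>p. \<forall>\<^sub>F y in nhds x. v y <= v x + p\<bullet>(y - x) + C0/infdist x vertices*(norm (y - x))^2"
   if ev: "\<forall>\<^sub>F y in nhds x. v y = v x + q\<bullet>(y - x)" for q
  proof (intro exI[of _ q])
   show "\<forall>\<^sub>F y in nhds x. v y <= v x + q\<bullet>(y - x) + C0/infdist x vertices*(norm (y - x))^2"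
    using ev by eventually_elim (use C0 D in simp)
  qed
  show "\<exists>p. \<forall>\<^sub>F y in nhds x. v y <= v x + p\<bullet>(y - x) + C0/infdist x vertices*(norm (y - x))^2"
   using x(1) slope_sub[OF x(1)]
  proof (cases rule: contact_cases)
   case interior
   have "\<forall>\<^sub>F y in nhds x. y \<in> interior (contact x (slope x))"
    using interior by (intro eventually_nhds_in_open open_interior)
   then have "\<forall>\<^sub>F y in nhds x. v y = v x + slope x\<bullet>(y - x)"
    by eventually_elim (use interior_subset in \<open>fastforce simp: contact_def\<close>)
   then show ?thesis by (rule affine_case)
  next
   case (boundary w b t)
   obtain \<nu> where \<nu>: "norm \<nu> = 1" "cball (b - r *R \<nu>) r \<subseteq> closure \<Omega>" using r(2)[OF boundary(2)] by blast
   have "norm b <= B" "norm w <= B" using B boundary vertices_props(2) closure_subset by (auto simp: frontier_def)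
   then have bw: "norm (b - w) <= \<Delta>" using norm_triangle_ineq4[of b w] by (simp add: \<Delta>_def)
   have nx: "norm (x - w) > 0" using xv boundary(1) by auto
   have "(2 + 4*\<Delta>/\<rho>)^2/r*\<Delta>*(- v w)/\<rho>/norm (x - w) <= C0/norm (x - w)"
    unfolding C0_def using vS[OF boundary(1)] r(1) \<rho>(1) B(1)
    by (intro divide_right_mono mult_left_mono) (auto simp: \<Delta>_def)
   also have "\<dots> <= C0/infdist x vertices"
    using infdist_vertex_le[OF boundary(1), of x] C0 D nx by (intro divide_left_mono) auto
   finally have cmp: "(2 + 4*\<Delta>/\<rho>)^2/r*\<Delta>*(- v w)/\<rho>/norm (x - w) <= C0/infdist x vertices" .
   have "\<forall>\<^sub>F y in nhds x. v y <= v x + slope x\<bullet>(y - x) + C0/infdist x vertices*(norm (y - x))^2"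
    using quadratic_bound_boundary[OF r(1) \<nu> boundary(2,1,6,7,3,4,5) \<rho>(1) \<rho>(2)[OF boundary(1)] bw]
   proof eventually_elim
    case (elim y)
    show ?case using elim mult_right_mono[OF cmp, of "(norm (y - x))^2"] by simp
   qed
   then show ?thesis by blast
  next
   case (edge w w')
   have "\<not> ridge w w'" using x(2) edge(3) by (auto simp: singular_set_eq ridges_def)
   then show ?thesis using non_ridge_edge[OF edge] affine_case by blast
  next
   case vertex
   then show ?thesis using xv by simp
  qed
 qed
qed

text \<open>Within half the distance to the atoms the bound \<open>C/infdist\<close> at most
  doubles, so it is uniform on a ball; 16 is 2 times the factor 8 of the gradient estimate.\<close>

lemma slope_regularity:
 assumes r: "r > 0" "!!b. b \<in> frontier \<Omega> ==> \<exists>\<nu>. norm \<nu> = 1 \<and> cball (b - r *R \<nu>) r \<subseteq> closure \<Omega>"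
 obtains C where "C > 0" "!!x. x \<in> \<Omega> ==> x \<notin> singular_set ==> (v has_derivative (%w. slope x\<bullet>w)) (at x)"
  "!!x. x \<in> \<Omega> ==> x \<notin> singular_set ==> lip_at slope x (C/infdist x vertices)"
proof -
 obtain C where C: "C > 0" "!!x. x \<in> \<Omega> ==> x \<notin> singular_set ==>
   \<exists>p. \<forall>\<^sub>F y in nhds x. v y <= v x + p\<bullet>(y - x) + C/infdist x vertices*(norm (y - x))^2"
  using quadratic_bound[OF r] by blast
 have reg: "(v has_derivative (%w. slope x\<bullet>w)) (at x) \<and> lip_at slope x (16*C/infdist x vertices)"
  if x: "x \<in> \<Omega>" "x \<notin> singular_set" for x
 proof -
  have "open (\<Omega> - singular_set)" using open_\<Omega> closed_singular_set by (rule open_Diff)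
  then obtain d where d: "d > 0" "ball x d \<subseteq> \<Omega> - singular_set" using x openE[of "\<Omega> - singular_set" x] by blast
  have "x \<notin> vertices" using x(2) by (simp add: singular_set_def)
  then have D: "infdist x vertices > 0" by (rule infdist_vertices_pos)
  define \<epsilon> where "\<epsilon> = min d (infdist x vertices/2)"
  have \<epsilon>: "\<epsilon> > 0" using d D by (simp add: \<epsilon>_def)
  have \<epsilon>b: "ball x \<epsilon> \<subseteq> \<Omega> - singular_set" using d(2) by (auto simp: \<epsilon>_def)
  define M where "M = 2*C/infdist x vertices"
  have M: "M >= 0" using C D by (simp add: M_def)
  have cont: "continuous_on (ball x \<epsilon>) v"
   by (rule continuous_on_subset[OF cont_v]) (use \<epsilon>b closure_subset in blast)
  have quad: "\<exists>p. \<forall>\<^sub>F z in nhds y. v z <= v y + p\<bullet>(z - y) + M*(norm (z - y))^2" if y: "y \<in> ball x \<epsilon>" for y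
  proof -
   have "infdist x vertices <= infdist y vertices + dist x y" by (rule infdist_triangle)
   moreover have "dist x y < infdist x vertices/2" using y by (simp add: \<epsilon>_def)
   ultimately have Dy: "infdist y vertices >= infdist x vertices/2" by simp
   have "C/infdist y vertices <= C/(infdist x vertices/2)" using Dy D C(1) by (intro divide_left_mono) auto
   then have CM: "C/infdist y vertices <= M" by (simp add: M_def mult.commute)
   obtain p where p: "\<forall>\<^sub>F z in nhds y. v z <= v y + p\<bullet>(z - y) + C/infdist y vertices*(norm (z - y))^2"
    using C(2)[of y] \<epsilon>b y by blast
   have "\<forall>\<^sub>F z in nhds y. v z <= v y + p\<bullet>(z - y) + M*(norm (z - y))^2" using p
   proof eventually_elim
    case (elim z)
    show ?case using elim mult_right_mono[OF CM, of "(norm (z - y))^2"] by simp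
   qed
   then show ?thesis by blast
  qed
  have sub: "v y + slope y\<bullet>(z - y) <= v z" if "y \<in> ball x \<epsilon>" "z \<in> ball x \<epsilon>" for y z
   using sub_closure[OF slope_sub] that \<epsilon>b closure_subset by blast
  show ?thesis using semiconcave_imp_lip_gradient[OF cont \<epsilon> M quad sub] by (simp add: M_def)
 qed
 show thesis by (rule that[of "16*C"]) (use C reg in auto)
qed

end

section \<open>Comparison principle and uniqueness\<close>

text \<open>If \<open>w\<close> exceeds \<open>v\<close> at \<open>x0\<close>, so does
  \<open>(1 + \<epsilon>) * w\<close> on an open set \<open>D\<close> around \<open>x0\<close>, and
  every slope of the stretched function over \<open>D\<close> is a slope of \<open>v\<close> over
  \<open>D\<close>. Stretching multiplies the area of the slopes by (1 + \<epsilon>)^2, while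
  \<open>v\<close> and \<open>w\<close> have the same mass on \<open>D\<close>; so \<open>D\<close>
  contains no atom. Then \<open>(1 + \<epsilon>) * w <= v\<close> holds on atoms and frontier, and
  hence at \<open>x0\<close>, where \<open>v\<close> is spanned by such points.\<close>

lemma ma_solution_comparison:
 assumes "ma_solution \<Omega> N a \<sigma> v" "ma_solution \<Omega> N a \<sigma> w" and x0: "x0 \<in> \<Omega>"
 shows "w x0 <= v x0"
proof (rule ccontr)
 interpret V: ma_solution \<Omega> N a \<sigma> v by fact
 interpret W: ma_solution \<Omega> N a \<sigma> w by fact
 assume "\<not> w x0 <= v x0"
 then have lt: "v x0 < w x0" by simp
 \<comment> \<open>Since \<open>w x0 < 0\<close>, stretching lowers \<open>w\<close>; this
   \<epsilon> lowers it exactly to the mean of \<open>w x0\<close> and \<open>v x0\<close>.\<close>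
 define \<epsilon> where "\<epsilon> = (w x0 - v x0)/(2*(- w x0))"
 have w0: "w x0 < 0" using W.v_neg[OF x0] .
 have \<epsilon>: "\<epsilon> > 0" unfolding \<epsilon>_def using lt w0 by (intro divide_pos_pos) auto
 have "\<epsilon>*(- w x0) = (w x0 - v x0)/2" using w0 by (simp add: \<epsilon>_def)
 then have x0D: "v x0 < (1 + \<epsilon>)*w x0" using lt by (simp add: algebra_simps)
 define D where "D = {x \<in> \<Omega>. v x < (1 + \<epsilon>)*w x}"
 have D\<Omega>: "D \<subseteq> \<Omega>" by (auto simp: D_def)
 have contv: "continuous_on \<Omega> v" "continuous_on \<Omega> w"
  by (rule continuous_on_subset[OF V.cont_v closure_subset], rule continuous_on_subset[OF W.cont_v closure_subset])
 have oD: "open D"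
 proof -
  have "continuous_on \<Omega> (%x. v x - (1 + \<epsilon>)*w x)" by (intro continuous_intros contv)
  then have "open (\<Omega> \<inter> (%x. v x - (1 + \<epsilon>)*w x) -` {..<0})"
   using V.open_\<Omega> by (rule continuous_open_preimage) auto
  also have "\<Omega> \<inter> (%x. v x - (1 + \<epsilon>)*w x) -` {..<0} = D" by (auto simp: D_def)
  finally show ?thesis .
 qed
 \<comment> \<open>The summand 0 gives the map the affine form under which Lebesgue measure
   transforms.\<close>
 have incl: "(%p. (1 + \<epsilon>) *R p + 0) ` (\<Union>x\<in>D. W.sub x) \<subseteq> (\<Union>x\<in>D. V.sub x)"
 proof (rule image_subsetI)
  fix p assume "p \<in> (\<Union>x\<in>D. W.sub x)"
  then obtain x where x: "x \<in> D" "p \<in> W.sub x" by blast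
  define P where "P = (1 + \<epsilon>) *R p"
  note p = P_def x
  have xO: "x \<in> \<Omega>" using p(2) D\<Omega> by blast
  have xcl: "x \<in> closure \<Omega>" using xO closure_subset by blast
  have "continuous_on (closure \<Omega>) (%y. v y - P\<bullet>y)" by (intro continuous_intros V.cont_v)
  moreover have "closure \<Omega> ~= {}" using xcl by (metis empty_iff)
  ultimately obtain y0 where y0': "y0 \<in> closure \<Omega>" "\<forall>y\<in>closure \<Omega>. v y0 - P\<bullet>y0 <= v y - P\<bullet>y"
   using continuous_attains_inf[OF V.compact_closure_\<Omega>, of "%y. v y - P\<bullet>y"] by (auto elim: bexE)
  note y0 = y0'(1) bspec[OF y0'(2)]
  have y0D: "y0 \<in> D"
  proof (rule ccontr)
   assume "y0 \<notin> D"
   then have "(1 + \<epsilon>)*w y0 <= v y0" using V.closure_\<Omega>_cases[OF y0(1)] V.bdry W.bdry by (auto simp: D_def)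
   moreover have "(1 + \<epsilon>)*(w x + p\<bullet>(y0 - x)) <= (1 + \<epsilon>)*w y0"
    using W.sub_closure[OF p(3) y0(1)] \<epsilon> by (intro mult_left_mono) auto
   moreover have "v y0 - P\<bullet>y0 <= v x - P\<bullet>x" by (rule y0(2)[OF xcl])
   moreover have "v x < (1 + \<epsilon>)*w x" using p(2) by (simp add: D_def)
   moreover have "(1 + \<epsilon>)*(w x + p\<bullet>(y0 - x)) = (1 + \<epsilon>)*w x + P\<bullet>y0 - P\<bullet>x"
    by (simp add: p(1) inner_diff_right algebra_simps)
   ultimately show False by linarith
  qed
  have "P \<in> V.sub y0"
  proof (rule V.subI)
   show "y0 \<in> \<Omega>" using y0D D\<Omega> by blast
   fix y assume "y \<in> \<Omega>"
   then have "v y0 - P\<bullet>y0 <= v y - P\<bullet>y" using y0(2) closure_subset by blast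
   then show "v y0 + P\<bullet>(y - y0) <= v y" by (simp add: inner_diff_right)
  qed
  then have "(1 + \<epsilon>) *R p + 0 \<in> V.sub y0" by (simp add: P_def)
  then show "(1 + \<epsilon>) *R p + 0 \<in> (\<Union>x\<in>D. V.sub x)" by (rule UN_I[OF y0D])
 qed
 define m where "m = dirac_sum N a \<sigma> D"
 have "emeasure lebesgue ((%p. (1 + \<epsilon>) *R p + 0) ` (\<Union>x\<in>D. W.sub x)) <= emeasure lebesgue (\<Union>x\<in>D. V.sub x)"
  by (rule emeasure_mono[OF incl V.sub_image_sets[OF oD D\<Omega>]])
 then have "ennreal (\<bar>1 + \<epsilon>\<bar>^2)*m <= m" unfolding V.emeasure_sub_image[OF oD D\<Omega>] m_def
  by (subst (asm) emeasure_lebesgue_affine) (simp add: W.emeasure_sub_image[OF oD D\<Omega>])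
 \<comment> \<open>Only for a finite mass does (1 + \<epsilon>)^2 m <= m force m = 0.\<close>
 moreover have mfin: "m < top"
  unfolding m_def dirac_sum_def by (auto simp: less_top[symmetric] ennreal_mult_eq_top_iff indicator_def)
 ultimately have m0: "m = 0"
 proof -
  obtain c where c: "m = ennreal c" "c >= 0" using mfin by (cases m) auto
  have "ennreal ((1 + \<epsilon>)^2*c) <= ennreal c"
   using \<open>ennreal (\<bar>1 + \<epsilon>\<bar> ^ 2) * m <= m\<close> c by (simp add: ennreal_mult[symmetric])
  then have "(1 + \<epsilon>)^2*c <= c" using c by (simp add: ennreal_le_iff)
  then have "(2*\<epsilon> + \<epsilon>^2)*c <= 0" by (simp add: power2_eq_square algebra_simps)
  moreover have "2*\<epsilon> + \<epsilon>^2 > 0" using \<epsilon> by (simp add: add_pos_pos)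
  ultimately have "c = 0" using c(2) by (simp add: mult_le_0_iff)
  then show ?thesis using c by simp
 qed
 have noV: "u \<notin> D" if u: "u \<in> V.vertices" for u
 proof
  assume "u \<in> D"
  obtain i where i: "i \<in> {1..N}" "u = a i" using u by (auto simp: V.vertices_def)
  have "\<forall>j\<in>{1..N}. ennreal (\<sigma> j)*indicator D (a j) = 0"
   using m0 unfolding m_def dirac_sum_def by (subst (asm) sum_eq_0_iff) auto
  then have "ennreal (\<sigma> i)*indicator D (a i) = 0" using i(1) by blast
  then show False using \<open>u \<in> D\<close> i V.\<sigma>_pos[OF i(1)] by simp
 qed
 obtain q where q: "q \<in> V.sub x0" using V.sub_nonempty[OF x0] by blast
 let ?E = "V.contact x0 q \<inter> (V.vertices \<union> frontier \<Omega>)"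
 have Ecl: "?E \<subseteq> closure \<Omega>" by (auto simp: V.contact_def)
 have hcl: "convex hull ?E \<subseteq> closure \<Omega>"
  using Ecl by (rule hull_minimal) (rule convex_closure[OF V.convex_\<Omega>])
 have cw: "convex_on (convex hull ?E) (%y. (1 + \<epsilon>)*w y + (- (q\<bullet>y)))"
 proof (rule convex_on_add)
  show "convex_on (convex hull ?E) (%y. (1 + \<epsilon>)*w y)"
   using \<epsilon> convex_on_subset[OF W.convex_v_closure hcl] by (intro convex_on_cmul) auto
  show "convex_on (convex hull ?E) (%y. - (q\<bullet>y))" by (rule convex_onI) (auto simp: inner_simps algebra_simps)
 qed
 have "\<forall>y\<in>convex hull ?E. (1 + \<epsilon>)*w y + (- (q\<bullet>y)) <= v x0 - q\<bullet>x0"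
 proof (rule convex_on_convex_hull_bound[OF cw], intro ballI)
  fix y assume y: "y \<in> ?E"
  have "(1 + \<epsilon>)*w y <= v y" using y noV[of y] V.bdry W.bdry V.vertices_props(2) by (auto simp: D_def)
  also have "v y = v x0 + q\<bullet>(y - x0)" using y by (simp add: V.contact_def)
  finally show "(1 + \<epsilon>)*w y + (- (q\<bullet>y)) <= v x0 - q\<bullet>x0" by (simp add: inner_diff_right)
 qed
 then have "(1 + \<epsilon>)*w x0 <= v x0" using V.contact_hull[OF x0 q] by fastforce
 then show False using x0D by simp
qed

lemma ma_solution_unique: assumes "ma_solution \<Omega> N a \<sigma> v" "ma_solution \<Omega> N a \<sigma> w" "x \<in> \<Omega>"
 shows "w x = v x" using ma_solution_comparison[OF assms] ma_solution_comparison[OF assms(2,1,3)] by simp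

section \<open>One-dimensional profile and cut-off\<close>

definition clamp1 :: "real => real" where
 "clamp1 t = max (-1) (min 1 t)"

definition linear_ext :: "(real => real) => (real => real) => real => real" where
 "linear_ext p p' t = p (clamp1 t) + (t - clamp1 t)*p' (clamp1 t)"

lemma DERIV_glue_at:
 fixes f p q :: "real => real" assumes p: "(p has_real_derivative d) (at a)" and q: "(q has_real_derivative d) (at a)"
  and e: "e > 0" "!!t. a - e < t ==> t <= a ==> f t = p t" "!!t. a <= t ==> t < a + e ==> f t = q t"
 shows "(f has_real_derivative d) (at a)" unfolding DERIV_def
proof (rule filterlim_split_at_real)
 have pq: "f a = p a" "f a = q a" using e(1) e(2)[of a] e(3)[of a] by auto
 have "((%h. (p (a + h) - p a)/h) \<longlongrightarrow> d) (at_left 0)"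
  using p unfolding DERIV_def by (rule filterlim_mono) (auto simp: at_le)
 moreover have "\<forall>\<^sub>F h in at_left 0. (p (a + h) - p a)/h = (f (a + h) - f a)/h"
  unfolding eventually_at_left_field using e pq by (intro exI[of _ "- e"]) auto
 ultimately show "((%h. (f (a + h) - f a)/h) \<longlongrightarrow> d) (at_left 0)" by (rule Lim_transform_eventually)
 have "((%h. (q (a + h) - q a)/h) \<longlongrightarrow> d) (at_right 0)"
  using q unfolding DERIV_def by (rule filterlim_mono) (auto simp: at_le)
 moreover have "\<forall>\<^sub>F h in at_right 0. (q (a + h) - q a)/h = (f (a + h) - f a)/h"
  unfolding eventually_at_right_field using e pq by (intro exI[of _ e]) auto
 ultimately show "((%h. (f (a + h) - f a)/h) \<longlongrightarrow> d) (at_right 0)" by (rule Lim_transform_eventually)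
qed

lemma DERIV_linear_ext: assumes p: "!!t. (p has_real_derivative p' t) (at t)"
 shows "(linear_ext p p' has_real_derivative p' (clamp1 t)) (at t)"
proof -
 define r where "r t = p (-1) + (t + 1)*p' (-1)" for t
 define q where "q t = p 1 + (t - 1)*p' 1" for t
 have r: "(r has_real_derivative p' (-1)) (at t)" and q: "(q has_real_derivative p' 1) (at t)" for t
  unfolding r_def q_def by (auto intro!: derivative_eq_intros)
 have f: "t <= -1 ==> linear_ext p p' t = r t" "1 <= t ==> linear_ext p p' t = q t"
  "-1 <= t ==> t <= 1 ==> linear_ext p p' t = p t" for t by (auto simp: linear_ext_def clamp1_def r_def q_def max_def min_def)
 have c: "t <= -1 ==> clamp1 t = -1" "1 <= t ==> clamp1 t = 1" "-1 <= t ==> t <= 1 ==> clamp1 t = t" for t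
  by (auto simp: clamp1_def)
 consider "t < -1" | "t = -1" | "-1 < t" "t < 1" | "t = 1" | "t > 1" by linarith
 then show ?thesis
 proof cases
  case 1
  have "(linear_ext p p' has_real_derivative p' (-1)) (at t)"
   by (rule has_field_derivative_transform_within_open[OF r, of "{..<-1}"]) (use 1 f in auto)
  then show ?thesis using 1 c by simp
 next
  case 2
  show ?thesis unfolding 2 c(1)[OF order_refl] by (rule DERIV_glue_at[OF r p, of 1]) (use f in auto)
 next
  case 3
  have "(linear_ext p p' has_real_derivative p' t) (at t)"
   by (rule has_field_derivative_transform_within_open[OF p, of "{-1<..<1}"]) (use 3 f in auto)
  then show ?thesis using 3 c by simp
 next
  case 4
  show ?thesis unfolding 4 c(2)[OF order_refl] by (rule DERIV_glue_at[OF p q, of 1]) (use f in auto)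
 next
  case 5
  have "(linear_ext p p' has_real_derivative p' 1) (at t)"
   by (rule has_field_derivative_transform_within_open[OF q, of "{1<..}"]) (use 5 f in auto)
  then show ?thesis using 5 c by simp
 qed
qed

lemma clamp1_lipschitz: "\<bar>clamp1 s - clamp1 t\<bar> <= \<bar>s - t\<bar>" by (auto simp: clamp1_def max_def min_def)

lemma clamp1_bounds: "-1 <= clamp1 t" "clamp1 t <= 1" by (auto simp: clamp1_def)

lemma continuous_bounded_unit_interval:
 fixes q :: "real => real" assumes "continuous_on UNIV q"
 obtains K where "K > 0" "!!t. -1 <= t ==> t <= 1 ==> \<bar>q t\<bar> <= K"
proof -
 have "continuous_on {-1..1} q" using assms continuous_on_subset by blast
 then have "bounded (q ` {-1..1})" by (intro compact_imp_bounded compact_continuous_image) auto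
 then obtain K where "K > 0" "\<forall>y\<in>q ` {-1..1}. norm y <= K" unfolding bounded_pos by blast
 then show thesis by (intro that[of K]) auto
qed

lemma clamp1_compose_lipschitz_bounded: assumes p: "!!t. (p has_real_derivative p' t) (at t)" and cont: "continuous_on UNIV p'"
 shows "\<exists>K>0. K-lipschitz_on UNIV (%t. p (clamp1 t)) \<and> (\<forall>t. \<bar>p (clamp1 t)\<bar> <= K)"
proof -
 obtain A where A: "A > 0" "!!t. -1 <= t ==> t <= 1 ==> \<bar>p' t\<bar> <= A"
  using continuous_bounded_unit_interval[OF cont] by blast
 have "continuous_on UNIV p" by (rule DERIV_continuous_on) (rule has_field_derivative_at_within[OF p])
 then obtain B where B: "B > 0" "!!t. -1 <= t ==> t <= 1 ==> \<bar>p t\<bar> <= B"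
  using continuous_bounded_unit_interval by blast
 have lip: "\<bar>p x - p y\<bar> <= A*\<bar>x - y\<bar>" if "x \<in> {-1..1}" "y \<in> {-1..1}" for x y
 proof -
  have "norm (p x - p y) <= A*norm (x - y)"
  proof (rule field_differentiable_bound[of "{-1..1}" p p' A])
   show "(p has_field_derivative p' z) (at z within {-1..1})" for z using p by (rule has_field_derivative_at_within)
  qed (use A that in auto)
  then show ?thesis by simp
 qed
 have "(A + B)-lipschitz_on UNIV (%t. p (clamp1 t))"
 proof (rule lipschitz_onI)
  fix s t :: real
  have "\<bar>p (clamp1 s) - p (clamp1 t)\<bar> <= A*\<bar>clamp1 s - clamp1 t\<bar>" using clamp1_bounds by (intro lip) auto
  also have "\<dots> <= (A + B)*\<bar>s - t\<bar>" using A B clamp1_lipschitz by (intro mult_mono) auto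
  finally show "dist (p (clamp1 s)) (p (clamp1 t)) <= (A + B)*dist s t" by (simp add: dist_real_def)
 qed (use A B in simp)
 moreover have "\<bar>p (clamp1 t)\<bar> <= A + B" for t using B(2)[of "clamp1 t"] clamp1_bounds[of t] A by simp
 ultimately show ?thesis using A B by (intro exI[of _ "A + B"]) auto
qed

text \<open>The ridge profile replaces \<open>\<bar>t\<bar>\<close> on \<open>[-1, 1]\<close>. Its constant \<open>k\<close> is chosen such that the slopes
 have mean square one there, so that no in-plane displacement is left outside.\<close>

definition pk :: real where "pk = (- 14 + sqrt 756)/8"

text \<open>The quadratic equation is \<open>psi0 1 = 0\<close> with denominators cleared.\<close>

lemma pk_eq: "4*pk^2 + 14*pk = 35"
proof -
 have "8*((- 14 + x)/8) + 14 = x" for x :: real by (simp add: diff_divide_distrib)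
 then have "8*pk + 14 = sqrt 756" unfolding pk_def .
 then have "(8*pk + 14)^2 = 756" by simp
 then have "64*pk^2 + 224*pk + 196 = 756" by (simp add: power2_eq_square algebra_simps)
 then show ?thesis by simp
qed

text \<open>Even quartics with value and slope 1 at 1 form a one-parameter family; \<open>pk\<close>
  selects a member.\<close>

definition prof0 :: "real => real" where
 "prof0 t = (1 + pk)*t^2/2 - pk*t^4/4 + (1/2 - pk/4)"
definition dprof0 :: "real => real" where
 "dprof0 t = (1 + pk)*t - pk*t^3"
text \<open>The odd primitive of half the slope defect 1 - \<phi>'^2. By the choice of
  \<open>pk\<close> it vanishes at both ends, so the transversal displacement is confined to the
  strip.\<close>

definition psi0 :: "real => real" where
 "psi0 t = t/2 - (1 + pk)^2/6*t^3 + pk*(1 + pk)/5*t^5 - pk^2/14*t^7"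
text \<open>The value for which the shear of the in-plane displacement cancels the product of the
  slopes along and across the ridge.\<close>

definition dgam0 :: "real => real" where
 "dgam0 t = psi0 t - t*((1 - (dprof0 t)^2)/2) + (prof0 t - t*dprof0 t)*dprof0 t"
text \<open>The primitive of \<open>dgam0\<close>, integrated term by term. It is even, so the
  single shift in \<open>gam0\<close> makes it vanish at both ends.\<close>

definition gam1 :: "real => real" where
 "gam1 t = (1/2 - pk/4)*(1 + pk)/2*t^2
   + ((1 + pk)^2/3 - (1/2 - pk/4)*pk - (1 + pk)^2/2)/4*t^4
   + (- 4*(pk*(1 + pk)/5) + 5*pk*(1 + pk)/4)/6*t^6
   + (3*pk^2/7 - 3*pk^2/4)/8*t^8"
definition gam0 :: "real => real" where "gam0 t = gam1 t - gam1 1"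

definition prof :: "real => real" where "prof = linear_ext prof0 dprof0"
definition dprof :: "real => real" where "dprof t = dprof0 (clamp1 t)"
definition psi :: "real => real" where "psi t = psi0 (clamp1 t)"
definition gam :: "real => real" where "gam t = gam0 (clamp1 t)"
definition dgam :: "real => real" where "dgam t = dgam0 (clamp1 t)"
text \<open>The derivative of \<delta> \<phi>(y/\<delta>) with respect to \<delta>, at t =
  y/\<delta>.\<close>

definition pexc :: "real => real" where "pexc t = prof0 (clamp1 t) - clamp1 t*dprof0 (clamp1 t)"

lemma prof0_deriv: "(prof0 has_real_derivative dprof0 t) (at t)"
 unfolding prof0_def dprof0_def by (auto intro!: derivative_eq_intros simp: field_simps)

lemma psi0_deriv: "(psi0 has_real_derivative (1 - (dprof0 t)^2)/2) (at t)" unfolding psi0_def dprof0_def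
 by (rule derivative_eq_intros refl | simp)+ (simp add: power2_eq_square power_numeral_reduce algebra_simps)

lemma gam0_deriv: "(gam0 has_real_derivative dgam0 t) (at t)"
 unfolding gam0_def gam1_def dgam0_def psi0_def dprof0_def prof0_def
 by (rule derivative_eq_intros refl | simp)+ (simp add: power2_eq_square power_numeral_reduce field_simps)

lemma profile_end_values:
 "dprof0 1 = 1" "dprof0 (-1) = -1" "prof0 1 = 1" "prof0 (-1) = 1" "psi0 1 = 0" "psi0 (-1) = 0"
 "gam0 1 = 0" "gam0 (-1) = 0" "dgam0 1 = 0" "dgam0 (-1) = 0"
proof -
 have k: "pk^2 = (35 - 14*pk)/4" using pk_eq by simp
 show 1: "dprof0 1 = 1" "dprof0 (-1) = -1" "prof0 1 = 1" "prof0 (-1) = 1" by (simp_all add: dprof0_def prof0_def field_simps)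
 have "psi0 1 = (105 - 35*(1 + 2*pk + pk^2) + 42*(pk + pk^2) - 15*pk^2)/210"
  by (simp add: psi0_def power2_eq_square field_simps)
 also have "\<dots> = 0" unfolding k by (simp add: field_simps)
 finally show 2: "psi0 1 = 0" .
 moreover have "psi0 (-1) = - psi0 1" by (simp add: psi0_def)
 ultimately show 3: "psi0 (-1) = 0" by simp
 show "gam0 1 = 0" "gam0 (-1) = 0" by (simp_all add: gam0_def gam1_def)
 show "dgam0 1 = 0" "dgam0 (-1) = 0" by (simp_all add: dgam0_def 1 2 3)
qed

lemma prof_deriv: "(prof has_real_derivative dprof t) (at t)"
 unfolding prof_def dprof_def by (rule DERIV_linear_ext[OF prof0_deriv])

lemma clamp1_cases: "(clamp1 t = t \<and> \<bar>t\<bar> <= 1) \<or> (clamp1 t = 1 \<and> t >= 1) \<or> (clamp1 t = -1 \<and> t <= -1)"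
 by (auto simp: clamp1_def)

text \<open>\<open>psi0\<close> and its derivative vanish at both ends, so constant and tangential
  continuation agree.\<close>

lemma psi_deriv: "(psi has_real_derivative (1 - (dprof t)^2)/2) (at t)"
proof -
 have "linear_ext psi0 (%t. (1 - (dprof0 t)^2)/2) = psi"
 proof
  fix s show "linear_ext psi0 (%t. (1 - (dprof0 t)^2)/2) s = psi s"
   using clamp1_cases[of s] by (auto simp: linear_ext_def psi_def profile_end_values)
 qed
 then show ?thesis using DERIV_linear_ext[OF psi0_deriv, of t] by (simp add: dprof_def)
qed

lemma prof_outside: assumes "\<bar>t\<bar> >= 1" shows "prof t = \<bar>t\<bar>" "\<bar>dprof t\<bar> = 1" "psi t = 0" "gam t = 0" "pexc t = 0"
proof -
 have "(clamp1 t = 1 \<and> t >= 1) \<or> (clamp1 t = -1 \<and> t <= -1)" using assms by (auto simp: clamp1_def)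
 then show "prof t = \<bar>t\<bar>" "\<bar>dprof t\<bar> = 1" "psi t = 0" "gam t = 0" "pexc t = 0"
  by (auto simp: prof_def linear_ext_def dprof_def psi_def gam_def pexc_def profile_end_values)
qed

lemma pexc_eq: "pexc t = prof t - t*dprof t"
 using clamp1_cases[of t] by (auto simp: pexc_def prof_def linear_ext_def dprof_def algebra_simps)

lemma gam_deriv: "(gam has_real_derivative dgam t) (at t)"
proof -
 have "linear_ext gam0 dgam0 = gam"
 proof
  fix s show "linear_ext gam0 dgam0 s = gam s"
   using clamp1_cases[of s] by (auto simp: linear_ext_def gam_def profile_end_values)
 qed
 then show ?thesis using DERIV_linear_ext[OF gam0_deriv, of t] by (simp add: dgam_def)
qed

lemma dgam_eq: "dgam t = psi t - t*((1 - (dprof t)^2)/2) + pexc t*dprof t" using clamp1_cases[of t]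
 by (auto simp: dgam_def dgam0_def psi_def dprof_def pexc_def profile_end_values)

text \<open>Each quantity factors through \<open>clamp1\<close>, since a factor t only multiplies
  terms that vanish outside [-1, 1]; continuity on a compact interval then gives the bounds.\<close>

lemma profile_bounds:
 obtains K where "K > 0" "K-lipschitz_on UNIV dprof" "K-lipschitz_on UNIV pexc"
  "!!t. \<bar>dprof t\<bar> <= K" "!!t. \<bar>pexc t\<bar> <= K" "!!t. \<bar>psi t\<bar> <= K" "!!t. \<bar>gam t\<bar> <= K" "!!t. \<bar>dgam t\<bar> <= K"
  "!!t. \<bar>t*dgam t\<bar> <= K" "!!t. \<bar>t*((1 - (dprof t)^2)/2)\<bar> <= K" "!!t. \<bar>prof t - \<bar>t\<bar>\<bar> <= K"
proof -
 have d1: "(dprof0 has_real_derivative (1 + pk) - 3*pk*t^2) (at t)" for t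
  unfolding dprof0_def by (auto intro!: derivative_eq_intros)
 obtain K1 where K1: "K1 > 0" "K1-lipschitz_on UNIV dprof" "!!t. \<bar>dprof t\<bar> <= K1"
 proof -
  have "continuous_on UNIV (%t. (1 + pk) - 3*pk*t^2)" by (intro continuous_intros)
  from clamp1_compose_lipschitz_bounded[OF d1 this] show ?thesis using that unfolding dprof_def[abs_def] by blast
 qed
 have d2: "((%t. prof0 t - t*dprof0 t) has_real_derivative dprof0 t - (dprof0 t + t*((1 + pk) - 3*pk*t^2))) (at t)" for t
  by (auto intro!: derivative_eq_intros prof0_deriv d1)
 have c1: "continuous_on UNIV dprof0" unfolding dprof0_def[abs_def] by (intro continuous_intros)
 obtain K2 where K2: "K2 > 0" "K2-lipschitz_on UNIV pexc" "!!t. \<bar>pexc t\<bar> <= K2"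
 proof -
  have "continuous_on UNIV (%t. dprof0 t - (dprof0 t + t*((1 + pk) - 3*pk*t^2)))"
   by (intro continuous_intros c1)
  from clamp1_compose_lipschitz_bounded[OF d2 this] show ?thesis using that unfolding pexc_def[abs_def] by blast
 qed
 obtain K3 where K3: "K3 > 0" "!!t. \<bar>psi t\<bar> <= K3"
 proof -
  have "continuous_on UNIV (%t. (1 - (dprof0 t)^2)/2)" by (intro continuous_intros c1) simp
  from clamp1_compose_lipschitz_bounded[OF psi0_deriv this] show ?thesis using that unfolding psi_def[abs_def] by blast
 qed
 have c2: "continuous_on UNIV psi0" unfolding psi0_def[abs_def] by (intro continuous_intros) simp_all
 have c3: "continuous_on UNIV prof0" unfolding prof0_def[abs_def] by (intro continuous_intros) simp_all
 have c4: "continuous_on UNIV dgam0" unfolding dgam0_def[abs_def] by (intro continuous_intros c1 c2 c3) simp_all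
 obtain K4 where K4: "K4 > 0" "!!t. \<bar>gam t\<bar> <= K4"
  using clamp1_compose_lipschitz_bounded[OF gam0_deriv c4] unfolding gam_def[abs_def] by blast
 have bd: "\<exists>K>0. \<forall>t. \<bar>q (clamp1 t)\<bar> <= K" if cont: "continuous_on UNIV q" for q :: "real => real"
 proof -
  obtain A where "A > 0" "!!t. -1 <= t ==> t <= 1 ==> \<bar>q t\<bar> <= A"
   using continuous_bounded_unit_interval[OF cont] by blast
  then show ?thesis using clamp1_bounds by (intro exI[of _ A]) simp
 qed
 obtain K5 where K5: "K5 > 0" "!!t. \<bar>dgam t\<bar> <= K5" using bd[OF c4] unfolding dgam_def[abs_def] by blast
 obtain K6 where K6: "K6 > 0" "!!t. \<bar>(%t. t*dgam0 t) (clamp1 t)\<bar> <= K6"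
 proof -
  have "continuous_on UNIV (%t. t*dgam0 t)" by (intro continuous_intros c4)
  from bd[OF this] show ?thesis using that by blast
 qed
 obtain K7 where K7: "K7 > 0" "!!t. \<bar>(%t. t*((1 - (dprof0 t)^2)/2)) (clamp1 t)\<bar> <= K7"
 proof -
  have "continuous_on UNIV (%t. t*((1 - (dprof0 t)^2)/2))" by (intro continuous_intros c1) simp
  from bd[OF this] show ?thesis using that by blast
 qed
 obtain K8 where K8: "K8 > 0" "!!t. \<bar>(%t. prof0 t - \<bar>t\<bar>) (clamp1 t)\<bar> <= K8"
 proof -
  have "continuous_on UNIV (%t. prof0 t - \<bar>t\<bar>)" by (intro continuous_intros c3)
  from bd[OF this] show ?thesis using that by blast
 qed
 have e6: "t*dgam t = clamp1 t*dgam0 (clamp1 t)" for t using clamp1_cases[of t] by (auto simp: dgam_def profile_end_values)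
 have e7: "t*((1 - (dprof t)^2)/2) = clamp1 t*((1 - (dprof0 (clamp1 t))^2)/2)" for t
  using clamp1_cases[of t] by (auto simp: dprof_def profile_end_values)
 have e8: "prof t - \<bar>t\<bar> = prof0 (clamp1 t) - \<bar>clamp1 t\<bar>" for t
  using clamp1_cases[of t] by (auto simp: prof_def linear_ext_def profile_end_values)
 define K where "K = K1 + K2 + K3 + K4 + K5 + K6 + K7 + K8"
 show thesis
 proof (rule that[of K])
  show "K > 0" using K1 K2 K3 K4 K5 K6 K7 K8 by (simp add: K_def)
  show "K-lipschitz_on UNIV dprof" "K-lipschitz_on UNIV pexc"
   using K1(1,2) K2(1,2) K3(1) K4(1) K5(1) K6(1) K7(1) K8(1) by (auto simp: K_def intro: lipschitz_on_le)
  fix t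
  have pos: "K1 > 0" "K2 > 0" "K3 > 0" "K4 > 0" "K5 > 0" "K6 > 0" "K7 > 0" "K8 > 0" using K1 K2 K3 K4 K5 K6 K7 K8 by auto
  show "\<bar>dprof t\<bar> <= K" using K1(3)[of t] pos by (simp add: K_def)
  show "\<bar>pexc t\<bar> <= K" using K2(3)[of t] pos by (simp add: K_def)
  show "\<bar>psi t\<bar> <= K" using K3(2)[of t] pos by (simp add: K_def)
  show "\<bar>gam t\<bar> <= K" using K4(2)[of t] pos by (simp add: K_def)
  show "\<bar>dgam t\<bar> <= K" using K5(2)[of t] pos by (simp add: K_def)
  show "\<bar>t*dgam t\<bar> <= K" unfolding e6 using K6(2)[of t] pos by (simp add: K_def)
  show "\<bar>t*((1 - (dprof t)^2)/2)\<bar> <= K" unfolding e7 using K7(2)[of t] pos by (simp add: K_def)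
  show "\<bar>prof t - \<bar>t\<bar>\<bar> <= K" unfolding e8 using K8(2)[of t] pos by (simp add: K_def)
 qed
qed

text \<open>The cubic that falls from 1 to 0 on [-1, 1] with slope 0 at both ends.\<close>

definition cut0 :: "real => real" where "cut0 t = (2 - 3*t + t^3)/4"
definition dcut0 :: "real => real" where "dcut0 t = (- 3 + 3*t^2)/4"
text \<open>The transition takes place on [1, 4]; for the argument |x - w|^2/(4 r^2) this means 2r
  <= |x - w| <= 4r.\<close>

definition cut :: "real => real" where "cut t = cut0 (clamp1 ((2*t - 5)/3))"
definition dcut :: "real => real" where "dcut t = 2/3*dcut0 (clamp1 ((2*t - 5)/3))"

lemma cut_deriv: "(cut has_real_derivative dcut t) (at t)"
proof -
 have d: "(cut0 has_real_derivative dcut0 t) (at t)" for t unfolding cut0_def dcut0_def by (auto intro!: derivative_eq_intros)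
 have "linear_ext cut0 dcut0 = (%s. cut0 (clamp1 s))"
 proof
  fix s show "linear_ext cut0 dcut0 s = cut0 (clamp1 s)" using clamp1_cases[of s] by (auto simp: linear_ext_def dcut0_def)
 qed
 then have c: "((%s. cut0 (clamp1 s)) has_real_derivative dcut0 (clamp1 s)) (at s)" for s
  using DERIV_linear_ext[OF d, of s] by simp
 have "((%t. (2*t - 5)/3) has_real_derivative 2/3) (at t)" by (auto intro!: derivative_eq_intros)
 from DERIV_chain2[OF c this] show ?thesis unfolding cut_def[abs_def] dcut_def by (simp add: mult.commute)
qed

lemma cut_values: "t <= 1 ==> cut t = 1" "t >= 4 ==> cut t = 0" "0 <= cut t" "cut t <= 1"
proof -
 show "t <= 1 ==> cut t = 1" "t >= 4 ==> cut t = 0" by (auto simp: cut_def cut0_def clamp1_def)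
 define c where "c = clamp1 ((2*t - 5)/3)"
 have c: "-1 <= c" "c <= 1" using clamp1_bounds by (auto simp: c_def)
 have "4*cut0 c = (1 - c)^2*(2 + c)" by (simp add: cut0_def power2_eq_square power3_eq_cube field_simps)
 moreover have "(1 - c)^2*(2 + c) >= 0" using c by simp
 ultimately show "0 <= cut t" by (simp add: cut_def c_def)
 have "4 - 4*cut0 c = (1 + c)^2*(2 - c)" by (simp add: cut0_def power2_eq_square power3_eq_cube field_simps)
 moreover have "(1 + c)^2*(2 - c) >= 0" using c by simp
 ultimately show "cut t <= 1" by (simp add: cut_def c_def)
qed

lemma dcut_bounds:
 obtains K where "K > 0" "K-lipschitz_on UNIV dcut" "!!t. \<bar>dcut t\<bar> <= K"
proof -
 have d: "(dcut0 has_real_derivative 3/2*t) (at t)" for t unfolding dcut0_def by (auto intro!: derivative_eq_intros)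
 obtain K where K: "K > 0" "K-lipschitz_on UNIV (%t. dcut0 (clamp1 t))" "!!t. \<bar>dcut0 (clamp1 t)\<bar> <= K"
 proof -
  have "continuous_on UNIV (%t::real. 3/2*t)" by (intro continuous_intros)
  from clamp1_compose_lipschitz_bounded[OF d this] show ?thesis using that by blast
 qed
 show thesis
 proof (rule that[of K])
  show "K-lipschitz_on UNIV dcut"
  proof (rule lipschitz_onI)
   fix s t :: real
   have "\<bar>dcut0 (clamp1 ((2 * s - 5)/3)) - dcut0 (clamp1 ((2*t - 5)/3))\<bar> <= K*\<bar>(2 * s - 5)/3 - (2*t - 5)/3\<bar>"
    using lipschitz_onD[OF K(2), of "(2 * s - 5)/3" "(2*t - 5)/3"] by (simp add: dist_real_def)
   also have "\<bar>(2 * s - 5)/3 - (2*t - 5)/3\<bar> = 2/3*\<bar>s - t\<bar>" by (simp add: abs_if field_simps)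
   finally have 1: "\<bar>dcut0 (clamp1 ((2 * s - 5)/3)) - dcut0 (clamp1 ((2*t - 5)/3))\<bar> <= K*(2/3*\<bar>s - t\<bar>)" .
   have "\<bar>dcut s - dcut t\<bar> = 2/3*\<bar>dcut0 (clamp1 ((2 * s - 5)/3)) - dcut0 (clamp1 ((2*t - 5)/3))\<bar>"
    unfolding dcut_def by (simp only: right_diff_distrib[symmetric] abs_mult)
   also have "\<dots> <= 2/3*(K*(2/3*\<bar>s - t\<bar>))" using 1 by (intro mult_left_mono) simp_all
   also have "\<dots> <= K*\<bar>s - t\<bar>" using K(1) by simp
   finally show "dist (dcut s) (dcut t) <= K*dist s t" by (simp add: dist_real_def)
  qed (use K in simp)
  show "\<bar>dcut t\<bar> <= K" for t using K(1) K(3)[of "(2*t - 5)/3"] unfolding dcut_def abs_mult by simp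
 qed (use K in simp)
qed

section \<open>Deformation near a single ridge\<close>

lemma has_derivative_compose_real: assumes "(g has_derivative g') (at x)" "(\<phi> has_real_derivative d) (at (g x))"
 shows "((%x. \<phi> (g x)) has_derivative (%h. d*g' h)) (at x)"
 using has_derivative_compose[OF assms(1) assms(2)[unfolded has_field_derivative_def]] .

lemma norm_inner_le: "norm g <= M ==> norm (g\<bullet>h) <= M*norm h"
 using Cauchy_Schwarz_ineq2[of g h] mult_right_mono[of "norm g" M "norm h"] by simp

lemma tensor_mult_vec: "tensor a b *v h = (b\<bullet>h) *R a"
 by (simp add: vec_eq_iff forall_2 matrix_vector_mult_def tensor_def inner_vec_def sum_2 algebra_simps)

lemma norm_tensor: "norm (tensor a b) = norm a*norm b"
proof -
 have "(norm (tensor a b))^2 = (norm a*norm b)^2"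
  unfolding norm_matrix_sq power_mult_distrib norm_vec_sq[of a] norm_vec_sq[of b]
  by (simp add: tensor_def sum_2 power_mult_distrib algebra_simps)
 then show ?thesis by (simp add: power2_eq_iff_nonneg)
qed

lemma norm_transpose_real: "norm (transpose (A :: real^2^2)) = norm A"
proof -
 have "(norm (transpose A))^2 = (norm A)^2" unfolding norm_matrix_sq by (simp add: transpose_def sum_2 algebra_simps)
 then show ?thesis by (simp add: power2_eq_iff_nonneg)
qed

text \<open>Meant for a ridge of length \<open>L\<close> that starts at \<open>w\<close> in
  direction \<tau>: \<open>m\<close> is the mean of the slopes on its two sides, \<kappa> half their
  jump, and \<open>\<eta>^3\<close> will be \<open>h\<close>.\<close>

locale ridge_model =
 fixes w \<tau> m :: "real^2" and L \<eta> \<kappa> :: real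
 assumes \<tau>: "norm \<tau> = 1" and L: "L > 0" and \<eta>: "\<eta> > 0"
begin

definition n :: "real^2" where "n = perp \<tau>"
definition S :: "real^2 => real" where "S x = (x - w)\<bullet>\<tau>"
definition Y :: "real^2 => real" where "Y x = (x - w)\<bullet>n"
definition W :: "real => real" where "W s = s*(L - s)"
text \<open>The truncation makes the width continuous on the whole line and changes nothing along
  the ridge.\<close>

definition del :: "real => real" where "del s = \<eta>*(max 0 (W s)) powr (2/3)"
definition del1 :: "real => real" where "del1 s = \<eta>*(2/3)*W s powr (-1/3)*(L - 2 * s)"
definition del2 :: "real => real" where
 "del2 s = - \<eta>*((2/9)*W s powr (-4/3)*(L - 2 * s)^2 + (4/3)*W s powr (-1/3))"
definition T :: "real^2 => real" where "T x = Y x/del (S x)"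
definition f :: "real^2 => real" where "f x = del (S x)*prof (T x)"
definition gf :: "real^2 => real^2" where
 "gf x = (del1 (S x)*pexc (T x)) *R \<tau> + dprof (T x) *R n"
text \<open>Longitudinal and transversal displacement for a unit half-jump; the pairs \<alpha>,
  \<beta> are the components of their gradients along \<tau> and \<open>n\<close>.\<close>

definition u1 :: "real^2 => real" where "u1 x = - (del (S x)*del1 (S x)*gam (T x))"
definition u2 :: "real^2 => real" where "u2 x = del (S x)*psi (T x)"
definition \<alpha>1 :: "real^2 => real" where
 "\<alpha>1 x = - (((del1 (S x))^2 + del (S x)*del2 (S x))*gam (T x) - (del1 (S x))^2*(T x*dgam (T x)))"
definition \<beta>1 :: "real^2 => real" where "\<beta>1 x = - (del1 (S x)*dgam (T x))"
definition \<alpha>2 :: "real^2 => real" where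
 "\<alpha>2 x = del1 (S x)*(psi (T x) - T x*((1 - (dprof (T x))^2)/2))"
definition \<beta>2 :: "real^2 => real" where "\<beta>2 x = (1 - (dprof (T x))^2)/2"

definition Zr :: "real^2 => real" where "Zr x = m\<bullet>(x - w) + \<kappa>*f x"
definition gr :: "real^2 => real^2" where "gr x = m + \<kappa> *R gf x"
text \<open>The last term removes the strain that comes from the products of the mean slope
  \<open>m\<close> with the change of the gradient.\<close>

definition zeta :: "real^2 => real^2" where
 "zeta x = \<kappa>^2 *R (u1 x *R \<tau> + u2 x *R n) - (\<kappa>*(f x - \<bar>Y x\<bar>)) *R m"
definition Uz :: "real^2 => real^2^2" where
 "Uz x = \<kappa>^2 *R (tensor \<tau> (\<alpha>1 x *R \<tau> + \<beta>1 x *R n) + tensor n (\<alpha>2 x *R \<tau> + \<beta>2 x *R n))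
   - \<kappa> *R tensor m (gf x - sgn (Y x) *R n)"

lemma \<tau>\<tau>: "\<tau>\<bullet>\<tau> = 1" using \<tau> by (simp add: dot_square_norm)
lemma norm_n: "norm n = 1" by (simp add: n_def norm_perp \<tau>)
lemma n\<tau>: "n\<bullet>n = 1" "n\<bullet>\<tau> = 0" "\<tau>\<bullet>n = 0"
 by (simp_all add: n_def perp_inner \<tau>\<tau>)

lemma decomposition: "x = w + S x *R \<tau> + Y x *R n"
proof -
 have "x - w = S x *R \<tau> + Y x *R n"
  unfolding S_def Y_def n_def by (rule orthonormal_decomposition[OF \<tau>])
 then show ?thesis by (simp add: algebra_simps)
qed

lemma W_pos: "0 < s ==> s < L ==> W s > 0" by (simp add: W_def)

lemma del_pos: "0 < s ==> s < L ==> del s > 0" using W_pos[of s] \<eta> by (simp add: del_def)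

lemma continuous_del: "continuous_on UNIV del" unfolding del_def W_def by (intro continuous_intros continuous_on_powr') auto

lemma W_deriv: "(W has_real_derivative (L - 2 * s)) (at s)" unfolding W_def by (auto intro!: derivative_eq_intros)

lemma W_powr_deriv:
 assumes "0 < s" "s < L" shows "((%s. W s powr a) has_real_derivative a*W s powr (a - 1)*(L - 2 * s)) (at s)"
 using DERIV_chain2[OF has_real_derivative_powr[OF W_pos[OF assms]] W_deriv] .

lemma del_deriv: assumes "0 < s" "s < L" shows "(del has_real_derivative del1 s) (at s)"
proof -
 have "((%s. \<eta>*W s powr (2/3)) has_real_derivative \<eta>*((2/3)*W s powr (2/3 - 1)*(L - 2 * s))) (at s)"
  by (intro DERIV_cmult W_powr_deriv assms)
 then have "((%s. \<eta>*W s powr (2/3)) has_real_derivative del1 s) (at s)" by (simp add: del1_def mult.assoc)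
 then show ?thesis by (rule has_field_derivative_transform_within_open[where S = "{0<..<L}"])
   (use assms W_pos in \<open>auto simp: del_def max_def less_imp_le\<close>)
qed

lemma del1_deriv: assumes "0 < s" "s < L" shows "(del1 has_real_derivative del2 s) (at s)"
proof -
 have "((%s. W s powr (-1/3)*(L - 2 * s)) has_real_derivative
   ((-1/3)*W s powr (-1/3 - 1)*(L - 2 * s))*(L - 2 * s) + (- 2)*W s powr (-1/3)) (at s)"
  by (rule DERIV_mult'[THEN DERIV_cong, OF W_powr_deriv[OF assms]])
   (auto intro!: derivative_eq_intros simp: algebra_simps)
 from DERIV_cmult[OF this, of "\<eta>*(2/3)"]
 have "((%s. \<eta>*(2/3)*(W s powr (-1/3)*(L - 2 * s))) has_real_derivative del2 s) (at s)"
  by (rule DERIV_cong) (simp add: del2_def power2_eq_square field_simps)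
 then show ?thesis unfolding del1_def[abs_def] by (simp add: mult.assoc)
qed

lemma S_deriv: "(S has_derivative (%h. h\<bullet>\<tau>)) (at x)"
 unfolding S_def[abs_def] by (auto intro!: derivative_eq_intros)

lemma Y_deriv: "(Y has_derivative (%h. h\<bullet>n)) (at x)"
 unfolding Y_def[abs_def] by (auto intro!: derivative_eq_intros)

context
 fixes x assumes s: "0 < S x" "S x < L"
begin

lemma dpos: "del (S x) > 0" using del_pos[OF s] .

lemma delS_deriv: "((%x. del (S x)) has_derivative (%h. del1 (S x)*(h\<bullet>\<tau>))) (at x)"
 by (rule has_derivative_compose_real[OF S_deriv del_deriv[OF s]])

lemma del1S_deriv: "((%x. del1 (S x)) has_derivative (%h. del2 (S x)*(h\<bullet>\<tau>))) (at x)"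
 by (rule has_derivative_compose_real[OF S_deriv del1_deriv[OF s]])

lemma T_deriv: "(T has_derivative (%h. (h\<bullet>n)/del (S x) - (T x*del1 (S x)/del (S x))*(h\<bullet>\<tau>))) (at x)"
 unfolding T_def[abs_def] by (rule has_derivative_eq_rhs[OF has_derivative_divide[OF Y_deriv delS_deriv]])
  (use dpos in \<open>auto simp: fun_eq_iff T_def field_simps\<close>)

lemma f_deriv: "(f has_derivative (%h. gf x\<bullet>h)) (at x)" unfolding f_def[abs_def]
 by (rule has_derivative_eq_rhs[OF has_derivative_mult[OF delS_deriv has_derivative_compose_real[OF T_deriv prof_deriv]]])
  (use dpos in \<open>auto simp: fun_eq_iff gf_def pexc_eq inner_simps inner_commute field_simps\<close>)

lemma u2_deriv: "(u2 has_derivative (%h. (\<alpha>2 x *R \<tau> + \<beta>2 x *R n)\<bullet>h)) (at x)"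
 unfolding u2_def[abs_def]
 by (rule has_derivative_eq_rhs[OF has_derivative_mult[OF delS_deriv has_derivative_compose_real[OF T_deriv psi_deriv]]])
  (use dpos in \<open>auto simp: fun_eq_iff \<alpha>2_def \<beta>2_def inner_simps inner_commute field_simps\<close>)

lemma u1_deriv: "(u1 has_derivative (%h. (\<alpha>1 x *R \<tau> + \<beta>1 x *R n)\<bullet>h)) (at x)"
 unfolding u1_def[abs_def]
 by (rule has_derivative_eq_rhs[OF has_derivative_minus[OF has_derivative_mult[OF has_derivative_mult[OF delS_deriv del1S_deriv]
     has_derivative_compose_real[OF T_deriv gam_deriv]]]])
  (use dpos in \<open>auto simp: fun_eq_iff \<alpha>1_def \<beta>1_def inner_simps inner_commute field_simps power2_eq_square\<close>)

lemma Zr_deriv: "(Zr has_derivative (%h. gr x\<bullet>h)) (at x)" unfolding Zr_def[abs_def]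
 by (rule derivative_eq_intros f_deriv refl)+ (auto simp: gr_def inner_simps)

lemma absY_deriv: assumes "Y x ~= 0" shows "((%x. \<bar>Y x\<bar>) has_derivative (%h. (sgn (Y x) *R n)\<bullet>h)) (at x)"
proof -
 have "(abs has_real_derivative sgn (Y x)) (at (Y x))"
 proof (cases "Y x > 0")
  case True
  have "((%t::real. t) has_real_derivative sgn (Y x)) (at (Y x))" using True by (auto intro!: derivative_eq_intros)
  then show ?thesis by (rule has_field_derivative_transform_within_open[where S = "{0<..}"]) (use True in auto)
 next
  case False
  have "((%t::real. - t) has_real_derivative sgn (Y x)) (at (Y x))"
   using False assms by (auto intro!: derivative_eq_intros)
  then show ?thesis by (rule has_field_derivative_transform_within_open[where S = "{..<0}"]) (use False assms in auto)
 qed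
 from has_derivative_compose_real[OF Y_deriv this] show ?thesis by (simp add: inner_commute)
qed

lemma zeta_deriv: assumes "Y x ~= 0" shows "(zeta has_derivative (%h. Uz x *v h)) (at x)"
proof -
 have "(zeta has_derivative (%h. \<kappa>^2 *R (((\<alpha>1 x *R \<tau> + \<beta>1 x *R n)\<bullet>h) *R \<tau> + ((\<alpha>2 x *R \<tau> + \<beta>2 x *R n)\<bullet>h) *R n)
   - (\<kappa>*(gf x\<bullet>h - (sgn (Y x) *R n)\<bullet>h)) *R m)) (at x)" unfolding zeta_def[abs_def]
  by (intro has_derivative_diff has_derivative_scaleR_right has_derivative_scaleR_left has_derivative_add
    has_derivative_mult_right u1_deriv u2_deriv f_deriv absY_deriv assms)
 then show ?thesis by (rule has_derivative_eq_rhs)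
   (simp add: fun_eq_iff Uz_def matrix_vector_mult_add_rdistrib matrix_vector_mult_diff_rdistrib scaleR_matrix_vector_assoc[symmetric] tensor_mult_vec inner_diff_left)
qed

text \<open>\<beta>2 cancels the strain across the ridge, the choice of \<open>dgam\<close> cancels
  the shear, and the term along \<open>m\<close> the mixed products; only the component along the
  ridge survives.\<close>

lemma strain_identity: assumes "Y x ~= 0" shows "Uz x + transpose (Uz x) + tensor (gr x) (gr x)
   - tensor (m + (\<kappa> * sgn (Y x)) *R n) (m + (\<kappa> * sgn (Y x)) *R n)
  = (\<kappa>^2*(2*\<alpha>1 x + (del1 (S x)*pexc (T x))^2)) *R tensor \<tau> \<tau>"
proof -
 define p where "p = del1 (S x)*pexc (T x)"
 define q where "q = dprof (T x)"
 define \<sigma> where "\<sigma> = sgn (Y x)"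
 have \<sigma>2: "\<sigma>*\<sigma> = 1" using assms by (simp add: \<sigma>_def sgn_if)
 have b2: "\<beta>2 x = (1 - q*q)/2" by (simp add: \<beta>2_def q_def power2_eq_square)
 have a2: "\<alpha>2 x = - \<beta>1 x - p*q" by (simp add: \<alpha>2_def \<beta>1_def p_def q_def dgam_eq algebra_simps)
 have g: "gf x = p *R \<tau> + q *R n" by (simp add: gf_def p_def q_def)
 show ?thesis unfolding p_def[symmetric] \<sigma>_def[symmetric]
 proof (simp add: vec_eq_iff Uz_def gr_def tensor_def transpose_def g a2 b2 \<sigma>_def[symmetric], intro allI)
  fix i j
  have "\<sigma>*\<sigma>*(\<kappa>^2*(n $ i*n $ j)) = \<kappa>^2*(n $ i*n $ j)" using \<sigma>2 by simp
  then show "\<kappa>^2*(\<tau> $ i*(\<alpha>1 x*\<tau> $ j + \<beta>1 x*n $ j) + n $ i*((- \<beta>1 x - p*q)*\<tau> $ j + (1 - q*q)*n $ j/2)) -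
      \<kappa>*(m $ i*(p*\<tau> $ j + q*n $ j - \<sigma>*n $ j)) +
      (\<kappa>^2*(\<tau> $ j*(\<alpha>1 x*\<tau> $ i + \<beta>1 x*n $ i) + n $ j*((- \<beta>1 x - p*q)*\<tau> $ i + (1 - q*q)*n $ i/2)) -
      \<kappa>*(m $ j*(p*\<tau> $ i + q*n $ i - \<sigma>*n $ i))) +
      (m $ i + \<kappa>*(p*\<tau> $ i + q*n $ i))*(m $ j + \<kappa>*(p*\<tau> $ j + q*n $ j)) -
      (m $ i + \<kappa>*\<sigma>*n $ i)*(m $ j + \<kappa>*\<sigma>*n $ j) =
      \<kappa>^2*(2*\<alpha>1 x + p^2)*(\<tau> $ i*\<tau> $ j)" by (simp add: power2_eq_square field_simps)
 qed
qed

context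
 fixes K assumes K: "K > 0" "K-lipschitz_on UNIV dprof" "K-lipschitz_on UNIV pexc"
  "!!t. \<bar>dprof t\<bar> <= K" "!!t. \<bar>pexc t\<bar> <= K" "!!t. \<bar>psi t\<bar> <= K" "!!t. \<bar>gam t\<bar> <= K" "!!t. \<bar>dgam t\<bar> <= K"
  "!!t. \<bar>t*dgam t\<bar> <= K" "!!t. \<bar>t*((1 - (dprof t)^2)/2)\<bar> <= K" "!!t. \<bar>prof t - \<bar>t\<bar>\<bar> <= K"
 assumes d1: "\<bar>del1 (S x)\<bar> <= 1" and d2: "del (S x)*\<bar>del2 (S x)\<bar> <= 1"
begin

lemma abs_\<alpha>1: "\<bar>\<alpha>1 x\<bar> <= 2*K*((del1 (S x))^2 + del (S x)*\<bar>del2 (S x)\<bar>)"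
proof -
 let ?A = "(del1 (S x))^2" and ?B = "del (S x)*del2 (S x)"
 have 1: "\<bar>(?A + ?B)*gam (T x)\<bar> <= (?A + \<bar>?B\<bar>)*K"
  unfolding abs_mult[of "?A + ?B"] using K(7)[of "T x"] abs_triangle_ineq[of ?A ?B] by (intro mult_mono) auto
 have 2: "\<bar>?A*(T x*dgam (T x))\<bar> <= ?A*K" unfolding abs_mult[of ?A] using K(9) by (intro mult_mono) auto
 have "\<bar>\<alpha>1 x\<bar> <= (?A + \<bar>?B\<bar>)*K + ?A*K" unfolding \<alpha>1_def using 1 2 by linarith
 also have "\<dots> <= 2*K*(?A + \<bar>?B\<bar>)" using K(1) by (simp add: algebra_simps)
 also have "\<bar>?B\<bar> = del (S x)*\<bar>del2 (S x)\<bar>" using dpos by (simp add: abs_mult)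
 finally show ?thesis .
qed

lemma d1sq: "(del1 (S x))^2 <= 1" using d1 by (simp add: abs_square_le_1)

lemma derivative_bounds:
 "\<bar>\<alpha>1 x\<bar> <= 4*K" (is ?A) "\<bar>\<beta>1 x\<bar> <= K" (is ?B) "\<bar>\<alpha>2 x\<bar> <= 2*K" (is ?C) "\<bar>\<beta>2 x\<bar> <= 1 + K^2" (is ?D) "norm (gf x) <= 2*K"
proof -
 have "2*K*((del1 (S x))^2 + del (S x)*\<bar>del2 (S x)\<bar>) <= 2*K*2"
  using d1sq d2 K(1) by (intro mult_left_mono) auto
 then show ?A using abs_\<alpha>1 by simp
 have "\<bar>del1 (S x)\<bar>*\<bar>dgam (T x)\<bar> <= 1*K" using d1 K(8) by (intro mult_mono) auto
 then show ?B by (simp add: \<beta>1_def abs_mult)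
 have "\<bar>psi (T x) - T x*((1 - (dprof (T x))^2)/2)\<bar> <= 2*K" using K(6)[of "T x"] K(10)[of "T x"] by linarith
 then have "\<bar>del1 (S x)\<bar>*\<bar>psi (T x) - T x*((1 - (dprof (T x))^2)/2)\<bar> <= 1*(2*K)"
  using d1 by (intro mult_mono) auto
 then show ?C by (simp add: \<alpha>2_def abs_mult)
 have "(dprof (T x))^2 <= K^2" using power_mono[OF K(4)[of "T x"], of 2] by simp
 then show ?D
 proof -
  have aux: "0 <= q ==> q <= k ==> \<bar>(1 - q)/2\<bar> <= 1 + k" for q k :: real by (auto simp: abs_le_iff)
  show ?thesis unfolding \<beta>2_def by (rule aux) (use \<open>(dprof (T x))^2 <= K^2\<close> in auto)
 qed
 have "norm (gf x) <= \<bar>del1 (S x)*pexc (T x)\<bar> + \<bar>dprof (T x)\<bar>"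
  unfolding gf_def using norm_triangle_ineq[of "(del1 (S x)*pexc (T x)) *R \<tau>" "dprof (T x) *R n"] \<tau> norm_n by simp
 also have "\<bar>del1 (S x)*pexc (T x)\<bar> <= 1*K" unfolding abs_mult using d1 K(5) by (intro mult_mono) auto
 finally show "norm (gf x) <= 2*K" using K(4)[of "T x"] by simp
qed

lemma strain_bound: assumes "Y x ~= 0" shows "norm (Uz x + transpose (Uz x) + tensor (gr x) (gr x)
   - tensor (m + (\<kappa> * sgn (Y x)) *R n) (m + (\<kappa> * sgn (Y x)) *R n))
  <= \<kappa>^2*(4*K + K^2)*((del1 (S x))^2 + del (S x)*\<bar>del2 (S x)\<bar>)"
proof -
 let ?D = "(del1 (S x))^2 + del (S x)*\<bar>del2 (S x)\<bar>"
 have "\<bar>2*\<alpha>1 x + (del1 (S x)*pexc (T x))^2\<bar> <= 4*K * ?D + K^2 * ?D"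
 proof -
  have "(del1 (S x)*pexc (T x))^2 = (del1 (S x))^2*(pexc (T x))^2" by (rule power_mult_distrib)
  also have "\<dots> <= (del1 (S x))^2*K^2" using power_mono[OF K(5)[of "T x"], of 2] by (intro mult_left_mono) auto
  also have "\<dots> <= ?D*K^2" using dpos by (intro mult_right_mono) auto
  finally have 1: "(del1 (S x)*pexc (T x))^2 <= K^2 * ?D" by (simp add: mult.commute)
  have 2: "\<bar>2*\<alpha>1 x\<bar> <= 4*K * ?D" using abs_\<alpha>1 by simp
  show ?thesis using 1 2 zero_le_power2[of "del1 (S x)*pexc (T x)"] by linarith
 qed
 then have "\<kappa>^2*\<bar>2*\<alpha>1 x + (del1 (S x)*pexc (T x))^2\<bar> <= \<kappa>^2*(4*K * ?D + K^2 * ?D)"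
  by (intro mult_left_mono) auto
 then show ?thesis unfolding strain_identity[OF assms] norm_scaleR norm_tensor \<tau> abs_mult[of "\<kappa>^2"] by (simp add: distrib_right mult.assoc)
qed

text \<open>Across the strip the profile varies on the scale of its width, so one more derivative
  costs \<open>1/del\<close>. The bound on \<open>T\<close> controls the derivative of
  \<open>T\<close> along the ridge; 14 = 2*4 + 2 + 4.\<close>

lemma lip_at_gf: assumes t: "\<bar>T x\<bar> < 2" shows "lip_at gf x (14*K/del (S x))"
proof -
 let ?d = "del (S x)"
 have lT: "lip_at T x (4 / ?d)"
 proof (rule lip_at_has_derivative[OF T_deriv, of "3 / ?d"])
  fix h :: "real^2"
  have "\<bar>T x*del1 (S x)\<bar> <= 2*1" unfolding abs_mult using t d1 by (intro mult_mono) auto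
  then have 1: "\<bar>T x*del1 (S x)\<bar>*\<bar>h\<bullet>\<tau>\<bar> <= 2*norm h"
   using Cauchy_Schwarz_ineq2[of h \<tau>] \<tau> by (intro mult_mono) auto
  have 2: "\<bar>h\<bullet>n\<bar> <= norm h" using Cauchy_Schwarz_ineq2[of h n] norm_n by simp
  have "(h\<bullet>n) / ?d - T x*del1 (S x) / ?d*(h\<bullet>\<tau>) = (h\<bullet>n - T x*del1 (S x)*(h\<bullet>\<tau>)) / ?d"
   by (simp add: diff_divide_distrib)
  also have "\<bar>\<dots>\<bar> <= (3*norm h) / ?d"
  proof -
   have "\<bar>h\<bullet>n - T x*del1 (S x)*(h\<bullet>\<tau>)\<bar> <= 3*norm h"
    using abs_triangle_ineq4[of "h\<bullet>n" "T x*del1 (S x)*(h\<bullet>\<tau>)"] 1 2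
    unfolding abs_mult[of "T x*del1 (S x)"] by linarith
   then show ?thesis using dpos by (simp add: divide_right_mono)
  qed
  finally show "norm ((h\<bullet>n) / ?d - T x*del1 (S x) / ?d*(h\<bullet>\<tau>)) <= 3 / ?d*norm h" by simp
 qed (use dpos in \<open>simp add: divide_strict_right_mono\<close>)
 have lp: "lip_at (%x. dprof (T x)) x (K*(4 / ?d))" "lip_at (%x. pexc (T x)) x (K*(4 / ?d))"
  using lip_at_compose[OF lT lip_at_lipschitz_on[OF K(2)]] lip_at_compose[OF lT lip_at_lipschitz_on[OF K(3)]] K(1) by auto
 have ld: "lip_at (%x. del1 (S x)) x (2 / ?d)"
 proof (rule lip_at_has_derivative[OF del1S_deriv, of "1 / ?d"])
  fix h :: "real^2"
  have "\<bar>del2 (S x)\<bar> <= 1 / ?d" using d2 dpos by (simp add: le_divide_eq mult.commute)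
  then have "\<bar>del2 (S x)\<bar>*\<bar>h\<bullet>\<tau>\<bar> <= 1 / ?d*norm h"
   using Cauchy_Schwarz_ineq2[of h \<tau>] \<tau> dpos by (intro mult_mono) auto
  then show "norm (del2 (S x)*(h\<bullet>\<tau>)) <= 1 / ?d*norm h" by (simp add: abs_mult)
 qed (use dpos in \<open>simp add: divide_strict_right_mono\<close>)
 have "lip_at (%x. del1 (S x)*pexc (T x)) x (2*(K*(4 / ?d)) + (2 / ?d)*K)"
  using d1 K(1,5) dpos by (intro lip_at_mult ld lp) auto
 from lip_at_add[OF lip_at_scaleR_const[OF this, of \<tau>] lip_at_scaleR_const[OF lp(1), of n]]
 have "lip_at gf x (2*(K*(4 / ?d)) + (2 / ?d)*K + K*(4 / ?d))" unfolding gf_def[abs_def] by (simp add: \<tau> norm_n)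
 then show ?thesis by (rule lip_at_mono) (simp add: field_simps)
qed

lemma lip_at_zeta: "lip_at zeta x (\<kappa>^2*(10*K + K^2 + 3) + \<bar>\<kappa>\<bar>*(2*K + 3)*norm m)"
proof -
 have l1: "lip_at u1 x (5*K + 1)"
 proof (rule lip_at_has_derivative[OF u1_deriv, of "5*K"])
  fix h
  have "norm (\<alpha>1 x *R \<tau> + \<beta>1 x *R n) <= 5*K"
   using norm_triangle_ineq[of "\<alpha>1 x *R \<tau>" "\<beta>1 x *R n"] derivative_bounds \<tau> norm_n by simp
  then show "norm ((\<alpha>1 x *R \<tau> + \<beta>1 x *R n)\<bullet>h) <= 5*K*norm h"
   by (rule norm_inner_le)
 qed simp
 have l2: "lip_at u2 x (2*K + K^2 + 2)"
 proof (rule lip_at_has_derivative[OF u2_deriv, of "2*K + K^2 + 1"])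
  fix h
  have "norm (\<alpha>2 x *R \<tau> + \<beta>2 x *R n) <= 2*K + K^2 + 1"
   using norm_triangle_ineq[of "\<alpha>2 x *R \<tau>" "\<beta>2 x *R n"] derivative_bounds \<tau> norm_n by simp
  then show "norm ((\<alpha>2 x *R \<tau> + \<beta>2 x *R n)\<bullet>h) <= (2*K + K^2 + 1)*norm h"
   by (rule norm_inner_le)
 qed simp
 have lf: "lip_at f x (2*K + 1)"
 proof (rule lip_at_has_derivative[OF f_deriv, of "2*K"])
  fix h show "norm (gf x\<bullet>h) <= 2*K*norm h" by (rule norm_inner_le[OF derivative_bounds(5)])
 qed simp
 have lY: "lip_at Y x 2"
 proof (rule lip_at_has_derivative[OF Y_deriv, of 1])
  fix h show "norm (h\<bullet>n) <= 1*norm h" using Cauchy_Schwarz_ineq2[of h n] norm_n by simp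
 qed simp
 have "lip_at (%x. \<bar>Y x\<bar>) x 2" using lY unfolding lip_at_def by eventually_elim (smt (verit) real_norm_def)
 from lip_at_diff[OF lf this] have l3: "lip_at (%x. \<kappa>*(f x - \<bar>Y x\<bar>)) x (\<bar>\<kappa>\<bar>*(2*K + 3))"
  using lip_at_cmult[of "%x. f x - \<bar>Y x\<bar>" x "2*K + 1 + 2" \<kappa>] by (simp add: add.assoc)
 have "lip_at (%x. u1 x *R \<tau> + u2 x *R n) x ((5*K + 1) + (2*K + K^2 + 2))"
  using lip_at_add[OF lip_at_scaleR_const[OF l1, of \<tau>] lip_at_scaleR_const[OF l2, of n]] by (simp add: \<tau> norm_n)
 from lip_at_diff[OF lip_at_cmult[OF this, of "\<kappa>^2"] lip_at_scaleR_const[OF l3, of m]]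
 have "lip_at zeta x (\<kappa>^2*((5*K + 1) + (2*K + K^2 + 2)) + \<bar>\<kappa>\<bar>*(2*K + 3)*norm m)"
  unfolding zeta_def[abs_def] by simp
 then show ?thesis by (rule lip_at_mono) (use K(1) in \<open>auto intro!: mult_left_mono\<close>)
qed

lemma value_bounds: "\<bar>f x - \<bar>Y x\<bar>\<bar> <= K*del (S x)" (is ?A) "norm (zeta x) <= (2*K*\<kappa>^2 + \<bar>\<kappa>\<bar>*K*norm m)*del (S x)" (is ?B)
proof -
 have "\<bar>Y x\<bar> = del (S x)*\<bar>T x\<bar>" using dpos by (simp add: T_def abs_mult)
 then have "f x - \<bar>Y x\<bar> = del (S x)*(prof (T x) - \<bar>T x\<bar>)" by (simp add: f_def right_diff_distrib)
 then show 1: ?A using K(11)[of "T x"] dpos by (simp add: abs_mult mult.commute mult_left_mono)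
 have "\<bar>del1 (S x)\<bar>*\<bar>gam (T x)\<bar> <= 1*K" using d1 K(7) by (intro mult_mono) auto
 then have 2: "\<bar>u1 x\<bar> <= K*del (S x)"
  using dpos by (simp add: u1_def abs_mult mult.assoc mult.commute[of K] mult_left_mono)
 have 3: "\<bar>u2 x\<bar> <= K*del (S x)"
  using dpos K(6)[of "T x"] by (simp add: u2_def abs_mult mult.commute[of K] mult_left_mono)
 have "norm (zeta x) <= \<kappa>^2*(\<bar>u1 x\<bar> + \<bar>u2 x\<bar>) + \<bar>\<kappa>\<bar>*\<bar>f x - \<bar>Y x\<bar>\<bar>*norm m"
 proof -
  have "norm (u1 x *R \<tau> + u2 x *R n) <= \<bar>u1 x\<bar> + \<bar>u2 x\<bar>"
   using norm_triangle_ineq[of "u1 x *R \<tau>" "u2 x *R n"] \<tau> norm_n by simp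
  then have "norm (\<kappa>^2 *R (u1 x *R \<tau> + u2 x *R n)) <= \<kappa>^2*(\<bar>u1 x\<bar> + \<bar>u2 x\<bar>)" by (simp add: mult_left_mono)
  then show ?thesis unfolding zeta_def
   using norm_triangle_ineq4[of "\<kappa>^2 *R (u1 x *R \<tau> + u2 x *R n)" "(\<kappa>*(f x - \<bar>Y x\<bar>)) *R m"]
   by (simp add: abs_mult)
 qed
 also have "\<dots> <= \<kappa>^2*(K*del (S x) + K*del (S x)) + \<bar>\<kappa>\<bar>*(K*del (S x))*norm m"
  using 1 2 3 by (intro add_mono mult_left_mono mult_right_mono) auto
 also have "\<dots> = (2*K*\<kappa>^2 + \<bar>\<kappa>\<bar>*K*norm m)*del (S x)" by (simp add: algebra_simps)
 finally show ?B .
qed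

end

lemma outside: assumes "del (S x) <= \<bar>Y x\<bar>"
 shows "f x = \<bar>Y x\<bar>" "zeta x = 0" "Zr x = m\<bullet>(x - w) + \<kappa>*\<bar>Y x\<bar>" (is ?C)
proof -
 have T1: "\<bar>T x\<bar> >= 1" using assms dpos by (simp add: T_def abs_divide)
 have "del (S x)*\<bar>T x\<bar> = \<bar>Y x\<bar>" using dpos by (simp add: T_def abs_divide)
 then show f: "f x = \<bar>Y x\<bar>" using prof_outside[OF T1] by (simp add: f_def)
 show "zeta x = 0" using prof_outside[OF T1] f by (simp add: zeta_def u1_def u2_def)
 show ?C by (simp add: Zr_def f)
qed

end

text \<open>All terms have the homogeneity of \<open>W s powr (-2/3)\<close>, once
  \<open>W s <= L^2\<close> absorbs the contribution of the second derivative of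
  \<open>W\<close>.\<close>

lemma W_bounds: assumes "0 < s" "s < L" shows "(del1 s)^2 + del s*\<bar>del2 s\<bar> <= 3*\<eta>^2*L^2*W s powr (-2/3)"
proof -
 have W0: "W s > 0" using W_pos[OF assms] .
 have Ls: "\<bar>L - 2 * s\<bar> <= L" using assms by auto
 have L2: "(L - 2 * s)^2 <= L^2" using power_mono[OF Ls, of 2] by simp
 have WL: "W s <= L^2" unfolding W_def power2_eq_square using assms by (intro mult_mono) auto
 define P where "P = W s powr (-2/3)"
 have P0: "P > 0" using W0 by (simp add: P_def)
 have p1: "W s powr (-1/3)*W s powr (-1/3) = P" by (simp add: P_def powr_add[symmetric])
 have p2: "W s powr (2/3)*W s powr (-4/3) = P" by (simp add: P_def powr_add[symmetric])
 have p3: "W s powr (2/3)*W s powr (-1/3) = W s*P"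
 proof -
  have "W s*P = W s powr 1*W s powr (-2/3)" using W0 by (simp add: P_def)
  also have "\<dots> = W s powr (1/3)" by (simp only: powr_add[symmetric]) simp
  finally show ?thesis by (simp add: powr_add[symmetric])
 qed
 have "(del1 s)^2 = \<eta>^2*(4/9)*(W s powr (-1/3)*W s powr (-1/3))*(L - 2 * s)^2"
  by (simp add: del1_def power2_eq_square)
 also have "\<dots> = \<eta>^2*(4/9)*P*(L - 2 * s)^2" unfolding p1 ..
 also have "\<dots> <= \<eta>^2*(4/9)*P*L^2" using L2 P0 by (intro mult_left_mono) auto
 finally have 1: "(del1 s)^2 <= 4/9*(\<eta>^2*L^2*P)" by (simp add: mult_ac)
 have "\<bar>del2 s\<bar> = \<eta>*((2/9)*W s powr (-4/3)*(L - 2 * s)^2 + (4/3)*W s powr (-1/3))"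
  using \<eta> by (simp add: del2_def abs_mult)
 then have "del s*\<bar>del2 s\<bar> = \<eta>^2*((2/9)*(W s powr (2/3)*W s powr (-4/3))*(L - 2 * s)^2
   + (4/3)*(W s powr (2/3)*W s powr (-1/3)))" using W0 by (simp add: del_def power2_eq_square algebra_simps)
 also have "\<dots> = \<eta>^2*((2/9)*P*(L - 2 * s)^2 + (4/3)*(W s*P))" unfolding p2 p3 ..
 also have "\<dots> <= \<eta>^2*((2/9)*P*L^2 + (4/3)*(L^2*P))"
  using L2 WL P0 by (intro mult_left_mono add_mono mult_right_mono) auto
 finally have 2: "del s*\<bar>del2 s\<bar> <= 14/9*(\<eta>^2*L^2*P)" by (simp add: algebra_simps)
 have "0 <= \<eta>^2*L^2*P" using P0 by simp
 then show ?thesis using 1 2 unfolding P_def[symmetric] by linarith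
qed

end

context ridge_model
begin

text \<open>Open and twice as wide as \<open>Core\<close>, outside of which nothing is changed; the
  last condition keeps it inside the rhombus of opening \<open>c\<close>.\<close>

definition Strip :: "real => (real^2) set" where
 "Strip c = {x. 0 < S x \<and> S x < L \<and> \<bar>Y x\<bar> < 2*del (S x) \<and> 2*del (S x) < c*min (S x) (L - S x)}"
definition Core :: "(real^2) set" where "Core = {x. 0 <= S x \<and> S x <= L \<and> \<bar>Y x\<bar> <= del (S x)}"
text \<open>Where \<open>W\<close> is above \<open>thr c * \<eta>^3\<close>, the three terms
  guarantee, in this order, bounded derivatives of the width, a strip inside the rhombus, and a
  width of at least \<open>\<eta>^3\<close>.\<close>

definition thr :: "real => real" where "thr c = (3*L^2) powr (3/2) + (2*L/c)^3 + 1"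
text \<open>Up to the factor \<open>\<eta>^3\<close>, the distance from the ends beyond which points
  of the strip are above the threshold: one term for the position along the ridge, one for the
  width.\<close>

definition rad :: "real => real" where "rad c = 2*thr c/L + 2*thr c powr (2/3)"

lemma continuous_SY: "continuous_on UNIV S" "continuous_on UNIV Y" "continuous_on UNIV (%x. del (S x))" (is ?C)
proof -
 show 1: "continuous_on UNIV S" "continuous_on UNIV Y" unfolding S_def[abs_def] Y_def[abs_def] by (intro continuous_intros)+
 show ?C using continuous_on_compose[OF 1(1), of del] continuous_on_subset[OF continuous_del] by (auto simp: o_def)
qed

lemma open_Strip: "open (Strip c)" unfolding Strip_def
 by (intro open_Collect_conj open_Collect_less continuous_intros continuous_SY)

lemma closed_Core: "closed Core" unfolding Core_def
 by (intro closed_Collect_conj closed_Collect_le continuous_intros continuous_SY)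

lemma powr_cubes: assumes "(t::real) > 0" shows "(t^3) powr (2/3) = t^2" (is ?A) "(t^3) powr (1/3) = t"
proof -
 have "t^3 = t powr 3" using assms by (simp add: powr_numeral)
 then show ?A "(t^3) powr (1/3) = t"
  unfolding \<open>t ^ 3 = t powr 3\<close> powr_powr using assms by (simp_all add: powr_numeral)
qed

lemma thr_ge: assumes "c > 0" shows "thr c >= 1" "(3*L^2) powr (3/2) <= thr c" (is ?B) "(2*L/c)^3 < thr c"
proof -
 have "0 <= (2*L/c)^3" using assms L by simp
 then show "thr c >= 1" ?B unfolding thr_def by (smt (verit) powr_ge_zero)+
 show "(2*L/c)^3 < thr c" unfolding thr_def using powr_ge_zero[of "3*L^2" "3/2"] by linarith
qed

text \<open>The lower bound for \<open>W\<close> is used after taking the powers 2/3 and 1/3, which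
  undo the exponents in \<open>thr\<close> and the cube of \<eta>.\<close>

lemma above_threshold: assumes c: "c > 0" and s: "0 < s" "s < L" and W: "W s >= thr c*\<eta>^3"
 shows "\<bar>del1 s\<bar> <= 1" "del s*\<bar>del2 s\<bar> <= 1" (is ?B) "2*del s < c*min s (L - s)" (is ?C) "del s >= \<eta>^3"
proof -
 have W0: "W s > 0" using W_pos[OF s] .
 have e3: "\<eta>^3 > 0" using \<eta> by simp
 have ds: "del s = \<eta>*W s powr (2/3)" using W0 by (simp add: del_def)
 have "(3*L^2) powr (3/2)*\<eta>^3 <= W s"
  using W thr_ge(2)[OF c] e3 mult_right_mono[of "(3*L^2) powr (3/2)" "thr c" "\<eta>^3"] by linarith
 then have "((3*L^2) powr (3/2)*\<eta>^3) powr (2/3) <= W s powr (2/3)" using \<eta> by (intro powr_mono2) auto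
 then have A: "3*L^2*\<eta>^2 <= W s powr (2/3)"
 proof -
  have "((3*L^2) powr (3/2)) powr (2/3) = 3*L^2" using L by (simp add: powr_powr)
  then show ?thesis using \<open>_ <= W s powr (2/3)\<close> powr_cubes(1)[OF \<eta>] \<eta> by (simp only: powr_mult)
 qed
 have "3*\<eta>^2*L^2*W s powr (-2/3) = (3*L^2*\<eta>^2)/W s powr (2/3)"
  using powr_minus_divide[of "W s" "2/3"] by (simp add: mult_ac)
 also have "\<dots> <= 1" using A W0 by simp
 finally have B: "(del1 s)^2 + del s*\<bar>del2 s\<bar> <= 1" using W_bounds[OF s] by linarith
 have dp: "0 <= del s*\<bar>del2 s\<bar>" using del_pos[OF s] by simp
 then have "(del1 s)^2 <= 1" using B by linarith
 then show "\<bar>del1 s\<bar> <= 1" by (simp add: abs_square_le_1)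
 show ?B using B zero_le_power2[of "del1 s"] by linarith
 have "(2*L/c)^3*\<eta>^3 < W s"
  using W thr_ge(3)[OF c] e3 mult_strict_right_mono[of "(2*L/c)^3" "thr c" "\<eta>^3"] by linarith
 then have "(2*L/c*\<eta>)^3 < W s" by (simp only: power_mult_distrib)
 then have "((2*L/c*\<eta>)^3) powr (1/3) < W s powr (1/3)" using \<eta> L c by (intro powr_less_mono2) auto
 moreover have "2*L/c*\<eta> > 0" using \<eta> L c by simp
 ultimately have 1: "2*L/c*\<eta> < W s powr (1/3)" using powr_cubes(2) by metis
 have "W s = W s powr (1/3)*W s powr (2/3)" using W0 by (simp add: powr_add[symmetric])
 then have "2*L/c*\<eta>*W s powr (2/3) < W s" using mult_strict_right_mono[OF 1, of "W s powr (2/3)"] W0 by simp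
 then have "2*L*del s < c*W s" using c by (simp add: ds field_simps)
 moreover have "W s <= L*min s (L - s)" using s by (auto simp: W_def min_def mult.commute intro!: mult_mono)
 ultimately have "2*L*del s < c*(L*min s (L - s))" using c by (smt (verit) mult_left_mono)
 then have "L*(2*del s) < L*(c*min s (L - s))" by (simp add: mult_ac)
 then show ?C using L by (simp only: mult_less_cancel_left_pos)
 have "1*\<eta>^3 <= W s" using W mult_right_mono[OF thr_ge(1)[OF c], of "\<eta>^3"] e3 by linarith
 then have "(\<eta>^3) powr (2/3) <= W s powr (2/3)" using \<eta> by (intro powr_mono2) auto
 then have "\<eta>*\<eta>^2 <= \<eta>*W s powr (2/3)" using \<eta> powr_cubes(1) by simp
 then show "del s >= \<eta>^3" unfolding ds by (simp add: power3_eq_cube power2_eq_square)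
qed

lemma norm_from_ends: "norm (x - w) <= \<bar>S x\<bar> + \<bar>Y x\<bar>" (is ?A) "norm (x - (w + L *R \<tau>)) <= \<bar>L - S x\<bar> + \<bar>Y x\<bar>" (is ?B)
proof -
 have "x - w = S x *R \<tau> + Y x *R n" using decomposition[of x] by (simp add: algebra_simps)
 then show ?A using norm_triangle_ineq[of "S x *R \<tau>" "Y x *R n"] by (simp add: \<tau> norm_n)
 have "x - (w + L *R \<tau>) = (S x - L) *R \<tau> + Y x *R n"
  using \<open>x - w = _\<close> by (simp add: algebra_simps)
 then show ?B
  using norm_triangle_ineq[of "(S x - L) *R \<tau>" "Y x *R n"] by (simp add: \<tau> norm_n abs_minus_commute)
qed

lemma far_above_threshold: assumes c: "c > 0" and s: "0 <= S x" "S x <= L" and y: "\<bar>Y x\<bar> <= 2*del (S x)"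
  and far: "norm (x - w) >= rad c*\<eta>^3" "norm (x - (w + L *R \<tau>)) >= rad c*\<eta>^3"
 shows "W (S x) >= thr c*\<eta>^3"
proof (rule ccontr)
 assume "\<not> ?thesis"
 then have lt: "W (S x) < thr c*\<eta>^3" by simp
 have W0: "0 <= W (S x)" using s by (simp add: W_def)
 have e3: "\<eta>^3 > 0" using \<eta> by simp
 have "W (S x) powr (2/3) <= (thr c*\<eta>^3) powr (2/3)" using lt W0 by (intro powr_mono2) auto
 also have "\<dots> = thr c powr (2/3)*\<eta>^2" using thr_ge(1)[OF c] \<eta> by (simp add: powr_mult powr_cubes)
 finally have "\<eta>*W (S x) powr (2/3) <= \<eta>*(thr c powr (2/3)*\<eta>^2)" using \<eta> by simp
 then have d: "del (S x) <= thr c powr (2/3)*\<eta>^3"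
  using W0 by (simp add: del_def power3_eq_cube power2_eq_square mult_ac)
 have "min (S x) (L - S x)*(L/2) <= W (S x)"
  using mult_left_mono[of "L/2" "L - S x" "S x"] mult_left_mono[of "L/2" "S x" "L - S x"] s
  by (auto simp: W_def min_def mult.commute[of "S x" "L - S x"])
 then have "min (S x) (L - S x)*(L/2) < thr c*\<eta>^3" using lt by linarith
 then have m: "min (S x) (L - S x) < 2*thr c/L*\<eta>^3" using L by (simp add: field_simps)
 have "min (norm (x - w)) (norm (x - (w + L *R \<tau>))) <= min (S x) (L - S x) + \<bar>Y x\<bar>"
  using norm_from_ends[of x] s by (auto simp: min_def)
 also have "\<dots> < 2*thr c/L*\<eta>^3 + 2*(thr c powr (2/3)*\<eta>^3)" using m y d by linarith
 also have "\<dots> = rad c*\<eta>^3" by (simp add: rad_def algebra_simps)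
 finally show False using far by linarith
qed

lemma Strip_outside_Core:
 assumes "x \<in> Strip c" "x \<notin> Core" shows "Zr x = m\<bullet>(x - w) + \<kappa>*\<bar>Y x\<bar>" (is ?A) "zeta x = 0"
proof -
 have "0 < S x" "S x < L" "del (S x) <= \<bar>Y x\<bar>" using assms by (auto simp: Strip_def Core_def)
 from outside[OF this] show ?A "zeta x = 0" by auto
qed

lemma Core_far_Strip: assumes c: "c > 0" and x: "x \<in> Core"
  and far: "norm (x - w) >= rad c*\<eta>^3" "norm (x - (w + L *R \<tau>)) >= rad c*\<eta>^3"
 shows "x \<in> Strip c"
proof -
 have s: "0 <= S x" "S x <= L" "\<bar>Y x\<bar> <= del (S x)" using x by (auto simp: Core_def)
 have d0: "0 <= del (S x)" using \<eta> by (simp add: del_def)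
 have W: "W (S x) >= thr c*\<eta>^3" by (rule far_above_threshold[OF c s(1,2) _ far]) (use s(3) d0 in linarith)
 have "0 < thr c*\<eta>^3" using thr_ge(1)[OF c] \<eta> by simp
 then have "W (S x) ~= 0" using W by linarith
 then have "S x ~= 0" "S x ~= L" by (auto simp: W_def)
 then have s': "0 < S x" "S x < L" using s by auto
 show ?thesis unfolding Strip_def using s' s(3) above_threshold(3)[OF c s' W] del_pos[OF s'] by auto
qed

definition Cs :: "real => real" where
 "Cs K = 1 + norm m + 14*K*\<bar>\<kappa>\<bar> + (\<kappa>^2*(10*K + K^2 + 3) + \<bar>\<kappa>\<bar>*(2*K + 3)*norm m)
  + (2*K*\<kappa>^2 + \<bar>\<kappa>\<bar>*K*norm m) + 3*L^2*(\<kappa>^2*(4*K + K^2))"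

lemma Strip_bounds: assumes c: "c > 0" and x: "x \<in> Strip c"
  and far: "norm (x - w) >= rad c*\<eta>^3" "norm (x - (w + L *R \<tau>)) >= rad c*\<eta>^3"
  and K: "K > 0" "K-lipschitz_on UNIV dprof" "K-lipschitz_on UNIV pexc"
  "!!t. \<bar>dprof t\<bar> <= K" "!!t. \<bar>pexc t\<bar> <= K" "!!t. \<bar>psi t\<bar> <= K" "!!t. \<bar>gam t\<bar> <= K" "!!t. \<bar>dgam t\<bar> <= K"
  "!!t. \<bar>t*dgam t\<bar> <= K" "!!t. \<bar>t*((1 - (dprof t)^2)/2)\<bar> <= K" "!!t. \<bar>prof t - \<bar>t\<bar>\<bar> <= K"
 shows "(Zr has_derivative (%h. gr x\<bullet>h)) (at x)" (is ?A) "norm (gr x) <= Cs K" "lip_at gr x (Cs K/del (S x))" (is ?C)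
  "lip_at zeta x (Cs K)" "\<bar>\<kappa>*f x - \<kappa>*\<bar>Y x\<bar>\<bar> <= Cs K*del (S x)" (is ?E) "norm (zeta x) <= Cs K*del (S x)" (is ?F)
  "del (S x) >= \<eta>^3"
  "Y x ~= 0 ==> (zeta has_derivative (%h. Uz x *v h)) (at x)"
  "Y x ~= 0 ==> norm (Uz x + transpose (Uz x) + tensor (gr x) (gr x)
   - tensor (m + (\<kappa> * sgn (Y x)) *R n) (m + (\<kappa> * sgn (Y x)) *R n)) <= Cs K*(\<eta>^2*W (S x) powr (-2/3))"
proof -
 have s: "0 < S x" "S x < L" and y: "\<bar>Y x\<bar> < 2*del (S x)" using x by (auto simp: Strip_def)
 have W: "W (S x) >= thr c*\<eta>^3" by (rule far_above_threshold[OF c _ _ _ far]) (use s y in auto)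
 have dp: "del (S x) > 0" using del_pos[OF s] .
 note V = above_threshold[OF c s W]
 have nn: "0 <= norm m" "0 <= 14*K*\<bar>\<kappa>\<bar>" "0 <= \<kappa>^2*(10*K + K^2 + 3) + \<bar>\<kappa>\<bar>*(2*K + 3)*norm m"
  "0 <= 2*K*\<kappa>^2 + \<bar>\<kappa>\<bar>*K*norm m" "0 <= 3*L^2*(\<kappa>^2*(4*K + K^2))" using K(1) by auto
 show ?A by (rule Zr_deriv[OF s])
 have "norm (gr x) <= norm m + \<bar>\<kappa>\<bar>*norm (gf x)"
  unfolding gr_def using norm_triangle_ineq[of m "\<kappa> *R gf x"] by simp
 also have "\<dots> <= norm m + \<bar>\<kappa>\<bar>*(2*K)" using derivative_bounds(5)[OF s K V(1,2)] by (intro add_left_mono mult_left_mono) auto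
 also have "\<dots> <= norm m + 14*K*\<bar>\<kappa>\<bar>" using K(1) by (simp add: mult.commute)
 also have "\<dots> <= Cs K" using nn unfolding Cs_def by linarith
 finally show "norm (gr x) <= Cs K" .
 have T2: "\<bar>T x\<bar> < 2" using y dp by (simp add: T_def abs_divide divide_less_eq)
 have "lip_at gr x (0 + \<bar>\<kappa>\<bar>*(14*K/del (S x)))"
  unfolding gr_def[abs_def] by (intro lip_at_add lip_at_const lip_at_cmult lip_at_gf[OF s K V(1,2) T2])
 then show ?C
 proof (rule lip_at_mono)
  have "14*K*\<bar>\<kappa>\<bar> <= Cs K" using nn unfolding Cs_def by linarith
  then show "0 + \<bar>\<kappa>\<bar>*(14*K/del (S x)) <= Cs K/del (S x)" using dp by (simp add: field_simps)
 qed
 show "lip_at zeta x (Cs K)"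
  by (rule lip_at_mono[OF lip_at_zeta[OF s K V(1,2)]]) (use nn in \<open>unfold Cs_def, linarith\<close>)
 have "\<bar>\<kappa>*f x - \<kappa>*\<bar>Y x\<bar>\<bar> = \<bar>\<kappa>\<bar>*\<bar>f x - \<bar>Y x\<bar>\<bar>" by (simp only: abs_mult[symmetric] right_diff_distrib)
 also have "\<dots> <= \<bar>\<kappa>\<bar>*(K*del (S x))" using value_bounds(1)[OF s K V(1,2)] by (rule mult_left_mono) simp
 also have "\<dots> <= (14*K*\<bar>\<kappa>\<bar>)*del (S x)" using K(1) dp by (simp add: mult_ac)
 also have "\<dots> <= Cs K*del (S x)" using nn dp unfolding Cs_def by (intro mult_right_mono) linarith+
 finally show ?E .
 have "2*K*\<kappa>^2 + \<bar>\<kappa>\<bar>*K*norm m <= Cs K" using nn unfolding Cs_def by linarith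
 then show ?F
  using value_bounds(2)[OF s K V(1,2)] mult_right_mono[of _ "Cs K" "del (S x)"] dp by (meson less_imp_le order_trans)
 show "del (S x) >= \<eta>^3" by (rule V(4))
 assume Y: "Y x ~= 0"
 show "(zeta has_derivative (%h. Uz x *v h)) (at x)" by (rule zeta_deriv[OF s Y])
 have "norm (Uz x + transpose (Uz x) + tensor (gr x) (gr x)
   - tensor (m + (\<kappa> * sgn (Y x)) *R n) (m + (\<kappa> * sgn (Y x)) *R n))
   <= \<kappa>^2*(4*K + K^2)*(3*\<eta>^2*L^2*W (S x) powr (-2/3))"
  by (rule order_trans[OF strain_bound[OF s K V(1,2) Y] mult_left_mono[OF W_bounds[OF s]]]) (use K(1) in auto)
 also have "\<dots> = 3*L^2*(\<kappa>^2*(4*K + K^2))*(\<eta>^2*W (S x) powr (-2/3))" by (simp add: mult_ac)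
 also have "\<dots> <= Cs K*(\<eta>^2*W (S x) powr (-2/3))"
  using nn unfolding Cs_def by (intro mult_right_mono) (linarith, simp)
 finally show "norm (Uz x + transpose (Uz x) + tensor (gr x) (gr x)
   - tensor (m + (\<kappa> * sgn (Y x)) *R n) (m + (\<kappa> * sgn (Y x)) *R n)) <= Cs K*(\<eta>^2*W (S x) powr (-2/3))" .
qed

lemma del_small: assumes x: "x \<in> Strip c" and t: "norm (x - w) <= t \<or> norm (x - (w + L *R \<tau>)) <= t"
 shows "del (S x) <= \<eta>*(L*t) powr (2/3)"
proof -
 have s: "0 < S x" "S x < L" using x by (auto simp: Strip_def)
 have "S x <= norm (x - w)" using Cauchy_Schwarz_ineq2[of "x - w" \<tau>] by (simp add: S_def \<tau>)
 moreover have "L - S x <= norm (x - (w + L *R \<tau>))"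
  using Cauchy_Schwarz_ineq2[of "x - (w + L *R \<tau>)" \<tau>] by (simp add: S_def \<tau> \<tau>\<tau> inner_diff_left inner_add_left)
 ultimately have "S x <= t \<or> L - S x <= t" using t by linarith
 then have "W (S x) <= L*t"
  using mult_mono[of "S x" t "L - S x" L] mult_mono[of "L - S x" t "S x" L] s by (auto simp: W_def mult.commute)
 then show ?thesis using W_pos[OF s] \<eta> by (simp add: del_def powr_mono2)
qed

lemma Strip_fat: assumes "x \<in> Strip c" shows "x \<in> fat c w (w + L *R \<tau>)"
proof -
 have s: "0 < S x" "S x < L" and y: "\<bar>Y x\<bar> < c*min (S x) (L - S x)" using assms by (auto simp: Strip_def)
 define z where "z = w + S x *R \<tau>"
 have z: "z \<in> open_segment w (w + L *R \<tau>)"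
  unfolding in_segment z_def using s L \<tau> by (auto intro!: exI[of _ "S x/L"] simp: algebra_simps)
 have "x - z = Y x *R n" using decomposition[of x] by (simp add: z_def algebra_simps)
 then have 1: "norm (x - z) = \<bar>Y x\<bar>" by (simp add: norm_n)
 have 2: "norm (z - w) = S x" using s by (simp add: z_def \<tau>)
 have "z - (w + L *R \<tau>) = (S x - L) *R \<tau>" by (simp add: z_def algebra_simps)
 then have 3: "norm (z - (w + L *R \<tau>)) = L - S x" using s by (simp add: \<tau>)
 show ?thesis unfolding fat_def using z y 1 2 3 by (auto intro!: bexI[of _ z])
qed

lemma negligible_axis: "negligible {x. Y x = 0}"
proof -
 have "{x. Y x = 0} = {x. n\<bullet>x = n\<bullet>w}" by (auto simp: Y_def inner_commute[of _ n] inner_diff_right)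
 then show ?thesis using negligible_hyperplane[of n "n\<bullet>w"] norm_n by (metis norm_zero zero_neq_one)
qed

end

section \<open>Gluing strips and discs\<close>

definition grd :: "(real^2 => real) => real^2 => real^2" where
 "grd F x = (SOME q. (F has_derivative (%h. q\<bullet>h)) (at x))"

lemma grd_eq: assumes "(F has_derivative (%h. q\<bullet>h)) (at x)" shows "grd F x = q"
proof -
 have "(F has_derivative (%h. grd F x\<bullet>h)) (at x)"
  unfolding grd_def by (rule someI[where P = "%q. (F has_derivative (%h. q\<bullet>h)) (at x)", OF assms])
 from has_derivative_unique[OF this assms] have "grd F x\<bullet>h = q\<bullet>h" for h by (rule fun_cong)
 then show ?thesis using vector_eq_rdot by blast
qed

text \<open>The difference quotients in direction \<open>h\<close> obey the bound, hence so does
  their limit.\<close>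

lemma norm_derivative_le_lip_at:
 assumes D: "(F has_derivative F') (at x)" and l: "lip_at F x M" shows "norm (F' h) <= M*norm h"
proof -
 have "((%t::real. F (x + t *R h)) has_derivative (%t. F' (t *R h))) (at 0)"
  by (rule has_derivative_compose[of "%t. x + t *R h" "%t. t *R h"])
   (use D in \<open>auto intro!: derivative_eq_intros\<close>)
 moreover have "(%t. F' (t *R h)) = (%t. t *R F' h)"
  using linear_scale[OF has_derivative_linear[OF D]] by auto
 ultimately have "((%t::real. F (x + t *R h)) has_vector_derivative F' h) (at 0)"
  by (simp add: has_vector_derivative_def)
 then have "((%t. norm (F (x + t *R h) - F x - t *R F' h)/\<bar>t\<bar>) \<longlongrightarrow> 0) (at 0)"
  by (simp add: has_vector_derivative_def has_derivative_at)
 moreover have "norm (F (x + t *R h) - F x - t *R F' h)/\<bar>t\<bar> = norm ((F (x + t *R h) - F x) /\<^sub>R t - F' h)"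
  if "t ~= 0" for t
 proof -
  have "(F (x + t *R h) - F x) /\<^sub>R t - F' h = inverse t *R (F (x + t *R h) - F x - t *R F' h)"
   using that by (simp add: scaleR_diff_right)
  then show ?thesis by (simp add: divide_inverse_commute)
 qed
 then have "\<forall>\<^sub>F t in at 0. norm (F (x + t *R h) - F x - t *R F' h)/\<bar>t\<bar> = norm ((F (x + t *R h) - F x) /\<^sub>R t - F' h)"
  using eventually_neq_at_within[of 0 0 UNIV] by (auto elim!: eventually_mono)
 ultimately have "((%t. norm ((F (x + t *R h) - F x) /\<^sub>R t - F' h)) \<longlongrightarrow> 0) (at 0)"
  by (rule Lim_transform_eventually)
 then have "((%t. (F (x + t *R h) - F x) /\<^sub>R t) \<longlongrightarrow> F' h) (at 0)"
  using tendsto_norm_zero_iff LIM_zero_iff by blast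
 then have lim: "((%t. norm ((F (x + t *R h) - F x) /\<^sub>R t)) \<longlongrightarrow> norm (F' h)) (at 0)" by (rule tendsto_norm)
 have "((%t. x + t *R h) \<longlongrightarrow> x + 0 *R h) (at 0)" by (intro tendsto_intros)
 then have "\<forall>\<^sub>F t in at 0. norm (F (x + t *R h) - F x) <= M*norm (x + t *R h - x)"
  using eventually_compose_filterlim[OF l[unfolded lip_at_def], of "%t. x + t *R h" "at 0"] by simp
 then have "\<forall>\<^sub>F t in at 0. norm ((F (x + t *R h) - F x) /\<^sub>R t) <= M*norm h"
  using eventually_neq_at_within[of 0 0 UNIV]
 proof eventually_elim
  case (elim t)
  have "norm ((F (x + t *R h) - F x) /\<^sub>R t) = inverse \<bar>t\<bar>*norm (F (x + t *R h) - F x)" by simp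
  also have "\<dots> <= inverse \<bar>t\<bar>*(M*(\<bar>t\<bar>*norm h))" using elim(1) by (intro mult_left_mono) auto
  also have "\<dots> = M*norm h" using elim(2) by simp
  finally show ?case .
 qed
 then show ?thesis by (rule tendsto_upperbound[OF lim]) simp
qed

lemma norm_matrix_le_lip_at:
 fixes U :: "real^2^2"
 assumes "(u has_derivative (%h. U *v h)) (at x)" "lip_at u x M" "M >= 0" shows "norm U <= 2*M"
proof -
 have "norm (U *v axis j 1) <= M" for j using norm_derivative_le_lip_at[OF assms(1,2), of "axis j 1"] by simp
 then have "(norm (U *v axis j 1))^2 <= M^2" for j by (intro power_mono) auto
 then have "(U $ 1 $ j)^2 + (U $ 2 $ j)^2 <= M^2" for j
  unfolding norm_vec_sq by (simp add: sum_2 matrix_vector_mul_component inner_axis)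
 then have "(norm U)^2 <= 2*M^2" unfolding norm_matrix_sq sum_2 by (smt (verit))
 also have "\<dots> <= (2*M)^2" by (simp add: power_mult_distrib)
 finally show ?thesis by (rule power2_le_imp_le) (use assms(3) in simp)
qed

lemma lip_at_1_minus: fixes F :: "'a::real_normed_vector => real" shows "lip_at F x A ==> lip_at (%y. 1 - F y) x A"
 unfolding lip_at_def by (simp add: abs_minus_commute)

text \<open>What gluing needs to know about the ridges: disjoint open strips \<open>St\<close> with
  closed cores \<open>F\<close>, out-of-plane and in-plane models \<open>Ze\<close> and
  \<open>\<zeta>e\<close> with derivatives \<open>ge\<close> and \<open>Ue\<close>, a width
  \<open>d\<close> and a strain bound \<open>D\<close>. Most estimates are demanded only at distance
  more than \<open>r\<close> from the atoms, with \<open>r\<close> of order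
  \<open>h\<close>.\<close>

locale corrugation = ma_solution +
 fixes E :: "'e set" and St F :: "'e => (real^2) set" and Ze :: "'e => real^2 => real" and ge \<zeta>e :: "'e => real^2 => real^2"
  and Ue :: "'e => real^2 => real^2^2" and d D :: "'e => real^2 => real" and r C :: real and Nul :: "(real^2) set"
 assumes finE: "finite E" and r: "r > 0" and C: "C >= 1" and Nul: "negligible Nul"
  and disj: "!!e e' x. e \<in> E ==> e' \<in> E ==> x \<in> St e ==> x \<in> St e' ==> e = e'"
  and opSt: "!!e. e \<in> E ==> open (St e)" and clF: "!!e. e \<in> E ==> closed (F e)"
  and St_\<Omega>: "!!e. e \<in> E ==> St e \<subseteq> \<Omega>"
  and F_far: "!!e x. e \<in> E ==> x \<in> F e ==> \<forall>w\<in>vertices. r < norm (x - w) ==> x \<in> St e"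
  and sing: "singular_set \<subseteq> vertices \<union> (\<Union>e\<in>E. F e)"
  and out: "!!e x. e \<in> E ==> x \<in> St e ==> x \<notin> F e ==> Ze e x = v x \<and> \<zeta>e e x = 0"
  and St_far: "!!e x. e \<in> E ==> x \<in> St e ==> \<forall>w\<in>vertices. r < norm (x - w) ==>
   (Ze e has_derivative (%h. ge e x\<bullet>h)) (at x) \<and> norm (ge e x) <= C \<and> lip_at (ge e) x (C/d e x) \<and>
   lip_at (\<zeta>e e) x C \<and> \<bar>Ze e x - v x\<bar> <= C*d e x \<and> norm (\<zeta>e e x) <= C*d e x \<and> r <= C*d e x \<and>
   (x \<notin> Nul --> (\<zeta>e e has_derivative (%h. Ue e x *v h)) (at x) \<and>
    (\<exists>p. (v has_derivative (%h. p\<bullet>h)) (at x) \<and>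
     norm (Ue e x + transpose (Ue e x) + tensor (ge e x) (ge e x) - tensor p p) <= C*D e x))"
  and d_near: "!!e x w. e \<in> E ==> x \<in> St e ==> w \<in> vertices ==> norm (x - w) < 5*r ==> d e x <= C*r"
  and slope_deriv: "!!x. x \<in> \<Omega> ==> x \<notin> singular_set ==> (v has_derivative (%h. slope x\<bullet>h)) (at x)"
  and slope_lip: "!!x. x \<in> \<Omega> ==> x \<notin> singular_set ==> lip_at slope x (C/infdist x vertices)"
  and sub_C: "!!x p. x \<in> \<Omega> ==> p \<in> sub x ==> norm p <= C"
  and sep: "!!w w'. w \<in> vertices ==> w' \<in> vertices ==> w ~= w' ==> 12*r < norm (w - w')"
  and balls: "!!w. w \<in> vertices ==> ball w (6*r) \<subseteq> \<Omega>"
  and dcutC: "C-lipschitz_on UNIV dcut" "!!t. \<bar>dcut t\<bar> <= C"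
begin

abbreviation far :: "real^2 => bool" where "far x \<equiv> \<forall>w\<in>vertices. r < norm (x - w)"
abbreviation off :: "real^2 => bool" where "off x \<equiv> \<forall>e\<in>E. x \<notin> F e"

text \<open>The choice is unambiguous because the strips are disjoint.\<close>

definition Z :: "real^2 => real" where
 "Z x = (if \<exists>e\<in>E. x \<in> St e then Ze (SOME e. e \<in> E \<and> x \<in> St e) x else v x)"
definition \<zeta> :: "real^2 => real^2" where
 "\<zeta> x = (if \<exists>e\<in>E. x \<in> St e then \<zeta>e (SOME e. e \<in> E \<and> x \<in> St e) x else 0)"
definition chi :: "real^2 => real^2 => real" where
 "chi w x = cut ((norm (x - w))^2/(4*r^2))"
definition gchi :: "real^2 => real^2 => real^2" where
 "gchi w x = dcut ((norm (x - w))^2/(4*r^2)) *R ((1/(2*r^2)) *R (x - w))"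
text \<open>Constant near each atom, where the slopes of \<open>v\<close> jump; the discs are
  disjoint, so at most one summand is active.\<close>

definition V :: "real^2 => real" where
 "V x = Z x + (\<Sum>w\<in>vertices. chi w x*(v w - Z x))"
definition u :: "real^2 => real^2" where
 "u x = (1 - (\<Sum>w\<in>vertices. chi w x)) *R \<zeta> x"

lemma Z_St: assumes "e \<in> E" "x \<in> St e" shows "Z x = Ze e x" "\<zeta> x = \<zeta>e e x"
proof -
 have "(SOME e. e \<in> E \<and> x \<in> St e) = e" by (rule some_equality) (use assms disj in auto)
 then show "Z x = Ze e x" "\<zeta> x = \<zeta>e e x" using assms by (auto simp: Z_def \<zeta>_def)
qed

lemma Z_off: assumes "off x" shows "Z x = v x" "\<zeta> x = 0"
proof -
 have "Z x = v x \<and> \<zeta> x = 0"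
 proof (cases "\<exists>e\<in>E. x \<in> St e")
  case True
  then obtain e where "e \<in> E" "x \<in> St e" by blast
  then show ?thesis using Z_St[of e x] out[of e x] assms by auto
 next
  case False
  then show ?thesis by (simp add: Z_def \<zeta>_def)
 qed
 then show "Z x = v x" "\<zeta> x = 0" by auto
qed

lemma open_far: "open {x. far x}"
proof -
 have "{x. far x} = (\<Inter>w\<in>vertices. {x. r < norm (x - w)})" by auto
 moreover have "open \<dots>" using vertices_props(1) by (intro open_INT ballI open_Collect_less continuous_intros)
 ultimately show ?thesis by simp
qed

lemma open_off: "open {x. off x}"
proof -
 have "{x. off x} = - (\<Union>e\<in>E. F e)" by auto
 moreover have "open \<dots>" by (intro open_Compl closed_UN finE ballI clF)
 ultimately show ?thesis by simp
qed

lemma F_\<Omega>: assumes "e \<in> E" "x \<in> F e" shows "x \<in> \<Omega>"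
proof (cases "far x")
 case True
 then show ?thesis using F_far[OF assms] St_\<Omega>[OF assms(1)] by blast
next
 case False
 then obtain w where w: "w \<in> vertices" "norm (x - w) <= r" by force
 then have "x \<in> ball w (6*r)" using r by (simp add: dist_norm norm_minus_commute)
 then show ?thesis using balls[OF w(1)] by blast
qed

lemma far_St: assumes e: "e \<in> E" and x: "x \<in> St e" and far: "far x"
 shows "\<forall>\<^sub>F y in nhds x. (Z has_derivative (%h. grd Z y\<bullet>h)) (at y)" (is ?A) "grd Z x = ge e x"
  "lip_at (grd Z) x (C/d e x)" (is ?C) "\<forall>\<^sub>F y in nhds x. \<zeta> y = \<zeta>e e y" (is ?D)
proof -
 have ev: "\<forall>\<^sub>F y in nhds x. y \<in> St e \<and> far y"
  using eventually_conj[OF eventually_nhds_in_open[OF opSt[OF e] x] eventually_nhds_in_open[OF open_far, of x]] far by simp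
 have D: "(Z has_derivative (%h. ge e y\<bullet>h)) (at y)" if "y \<in> St e" "far y" for y
  by (rule has_derivative_transform_within_open[OF conjunct1[OF St_far[OF e that]] opSt[OF e] that(1)]) (simp add: Z_St[OF e])
 have g: "grd Z y = ge e y" if "y \<in> St e" "far y" for y using grd_eq[OF D[OF that]] .
 show ?A using ev by eventually_elim (metis D g)
 show "grd Z x = ge e x" using g x far by blast
 show ?C by (rule lip_at_cong[of "ge e"]) (use St_far[OF e x far] ev in \<open>auto elim!: eventually_mono simp: g\<close>)
 show ?D using ev by eventually_elim (simp add: Z_St[OF e])
qed

text \<open>Away from atoms and cores \<open>Z\<close> is \<open>v\<close> on a whole neighbourhood
  that misses the singular set, so the regularity of \<open>slope\<close> applies.\<close>

lemma far_off: assumes x: "x \<in> \<Omega>" and far: "far x" and off: "off x"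
 shows "\<forall>\<^sub>F y in nhds x. (Z has_derivative (%h. grd Z y\<bullet>h)) (at y)" (is ?A) "grd Z x = slope x"
  "(v has_derivative (%h. slope x\<bullet>h)) (at x)" (is ?C)
  "lip_at (grd Z) x (C/infdist x vertices)" (is ?D) "\<forall>\<^sub>F y in nhds x. \<zeta> y = 0" (is ?E)
proof -
 define O' where "O' = \<Omega> \<inter> {y. far y} \<inter> {y. off y}"
 have O': "open O'" unfolding O'_def by (intro open_Int open_\<Omega> open_far open_off)
 have xO: "x \<in> O'" using assms by (simp add: O'_def)
 have ev: "\<forall>\<^sub>F y in nhds x. y \<in> O'" by (rule eventually_nhds_in_open[OF O' xO])
 have ns: "y \<notin> singular_set" if "y \<in> O'" for y
 proof -
  have "y \<notin> vertices" using that r by (auto simp: O'_def)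
  then show ?thesis using sing that by (auto simp: O'_def)
 qed
 have D: "(Z has_derivative (%h. slope y\<bullet>h)) (at y)" if "y \<in> O'" for y
 proof (rule has_derivative_transform_within_open[OF _ O' that])
  show "(v has_derivative (%h. slope y\<bullet>h)) (at y)" using slope_deriv ns[OF that] that by (auto simp: O'_def)
 qed (simp add: O'_def Z_off)
 have g: "grd Z y = slope y" if "y \<in> O'" for y using grd_eq[OF D[OF that]] .
 show ?A using ev by eventually_elim (metis D g)
 show "grd Z x = slope x" using g[OF xO] .
 show ?C using slope_deriv ns[OF xO] x by auto
 show ?D
  by (rule lip_at_cong[of slope]) (use slope_lip[OF x ns[OF xO]] ev in \<open>auto elim!: eventually_mono simp: g\<close>)
 show ?E using ev by eventually_elim (simp add: Z_off O'_def)
qed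

lemma far_cases: assumes "far x" shows "(\<exists>e\<in>E. x \<in> St e) \<or> off x" using F_far assms by blast

lemma infdist_far: assumes "far x" shows "r <= infdist x vertices" unfolding infdist_notempty[OF vertices_props(3)]
 by (rule cINF_greatest[OF vertices_props(3)]) (use assms in \<open>auto simp: dist_norm less_imp_le\<close>)

text \<open>On a strip \<open>r <= C*d\<close>, and off the cores \<open>r\<close> is at most the
  distance to the atoms; so both curvature bounds are at most \<open>C^2/r\<close>.\<close>

lemma far_regularity: assumes x: "x \<in> \<Omega>" and far: "far x"
 shows "\<forall>\<^sub>F y in nhds x. (Z has_derivative (%h. grd Z y\<bullet>h)) (at y)" (is ?A) "norm (grd Z x) <= C"
  "lip_at (grd Z) x (C^2/r)" (is ?C) "lip_at \<zeta> x C"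
  "w \<in> vertices ==> norm (x - w) < 5*r ==> \<bar>Z x - v x\<bar> <= C^2*r \<and> norm (\<zeta> x) <= C^2*r"
proof -
 have "(\<forall>\<^sub>F y in nhds x. (Z has_derivative (%h. grd Z y\<bullet>h)) (at y)) \<and> norm (grd Z x) <= C \<and>
  lip_at (grd Z) x (C^2/r) \<and> lip_at \<zeta> x C \<and>
  (w \<in> vertices --> norm (x - w) < 5*r --> \<bar>Z x - v x\<bar> <= C^2*r \<and> norm (\<zeta> x) <= C^2*r)"
  using far_cases[OF far]
 proof
  assume "\<exists>e\<in>E. x \<in> St e"
  then obtain e where e: "e \<in> E" "x \<in> St e" by blast
  note S = St_far[OF e far] and f = far_St[OF e far]
  have rd: "r <= C*d e x" using S by blast
  have "0 < C*d e x" using rd r by linarith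
  then have dp: "d e x > 0" using C by (simp add: zero_less_mult_iff)
  have "C/d e x = C^2/(C*d e x)" using C by (simp add: power2_eq_square)
  also have "\<dots> <= C^2/r" using rd dp r C by (intro divide_left_mono) auto
  finally have "C/d e x <= C^2/r" .
  then have 1: ?C using lip_at_mono[OF f(3)] by blast
  have 2: "lip_at \<zeta> x C" by (rule lip_at_cong[of "\<zeta>e e"]) (use S f(4) in \<open>auto elim!: eventually_mono\<close>)
  have 3: "C*d e x <= C^2*r" if "w \<in> vertices" "norm (x - w) < 5*r"
   using mult_left_mono[OF d_near[OF e that], of C] C by (simp add: power2_eq_square mult.assoc)
  from S have s: "\<bar>Ze e x - v x\<bar> <= C*d e x" "norm (\<zeta>e e x) <= C*d e x" "norm (ge e x) <= C" by blast+
  have "\<bar>Z x - v x\<bar> <= C^2*r \<and> norm (\<zeta> x) <= C^2*r" if "w \<in> vertices" "norm (x - w) < 5*r"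
   using 3[OF that] s(1,2) unfolding Z_St[OF e] by linarith
  then show ?thesis using f(1) 1 2 s(3) unfolding f(2) by blast
 next
  assume o: "off x"
  note f = far_off[OF x far o]
  have i: "r <= infdist x vertices" by (rule infdist_far[OF far])
  have "C/infdist x vertices <= C/r" using i r C by (intro divide_left_mono) auto
  also have "\<dots> <= C^2/r" using r C by (intro divide_right_mono) (auto simp: power2_eq_square)
  finally have 1: ?C using lip_at_mono[OF f(4)] by blast
  have 2: "lip_at \<zeta> x C"
   by (rule lip_at_cong[of "%_. 0"]) (use lip_at_mono[OF lip_at_const, of C] C f(5) in \<open>auto elim!: eventually_mono\<close>)
  have "0 <= C^2*r" using r by simp
  then show ?thesis using f(1,2) 1 2 Z_off[OF o] sub_C[OF x slope_sub[OF x]] by simp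
 qed
 then show ?A "norm (grd Z x) <= C"
  ?C "lip_at \<zeta> x C"
  "w \<in> vertices ==> norm (x - w) < 5*r ==> \<bar>Z x - v x\<bar> <= C^2*r \<and> norm (\<zeta> x) <= C^2*r" by blast+
qed

lemma chi_0: "4*r <= norm (x - w) ==> chi w x = 0"
proof -
 assume "4*r <= norm (x - w)"
 then have "(4*r)^2 <= (norm (x - w))^2" using r by (intro power_mono) auto
 then show ?thesis unfolding chi_def using r by (intro cut_values(2)) (simp add: field_simps power_mult_distrib)
qed

lemma chi_1: "norm (x - w) <= 2*r ==> chi w x = 1"
proof -
 assume "norm (x - w) <= 2*r"
 then have "(norm (x - w))^2 <= (2*r)^2" by (intro power_mono) auto
 then show ?thesis unfolding chi_def using r by (intro cut_values(1)) (simp add: field_simps power_mult_distrib)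
qed

lemma other_vertex_far:
 assumes "w \<in> vertices" "norm (x - w) < 5*r" "w' \<in> vertices" "w' ~= w" shows "4*r <= norm (x - w')"
proof -
 have "12*r < norm (w - w')" using sep[of w w'] assms by auto
 also have "\<dots> = norm ((x - w') - (x - w))" by simp
 also have "\<dots> <= norm (x - w') + norm (x - w)" by (rule norm_triangle_ineq4)
 finally show ?thesis using assms(2) r by linarith
qed

lemma annulus_far: "w \<in> vertices ==> r < norm (x - w) ==> norm (x - w) < 5*r ==> far x"
 using other_vertex_far[of w x] r by force

lemma VU_near: assumes w: "w \<in> vertices" and x: "norm (x - w) < 5*r"
 shows "V x = Z x + chi w x*(v w - Z x)" (is ?A) "u x = (1 - chi w x) *R \<zeta> x" (is ?B)
proof -
 have 0: "chi w' x = 0" if "w' \<in> vertices - {w}" for w' by (rule chi_0, rule other_vertex_far[OF w x]) (use that in auto)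
 have "(\<Sum>w\<in>vertices. chi w x*(v w - Z x)) = chi w x*(v w - Z x)"
  using sum.remove[OF vertices_props(1) w, of "%w. chi w x*(v w - Z x)"] 0 by simp
 then show ?A by (simp add: V_def)
 have "(\<Sum>w\<in>vertices. chi w x) = chi w x" using sum.remove[OF vertices_props(1) w, of "%w. chi w x"] 0 by simp
 then show ?B by (simp add: u_def)
qed

lemma VU_away: assumes "\<forall>w\<in>vertices. 4*r <= norm (x - w)" shows "V x = Z x" "u x = \<zeta> x"
 using assms chi_0 by (auto simp: V_def u_def)

lemma quad_deriv:
 "((%x. (norm (x - w))^2/(4*r^2)) has_derivative (%h. ((1/(2*r^2)) *R (x - w))\<bullet>h)) (at x)"
proof -
 have "((%x. (x - w)\<bullet>(x - w)) has_derivative (%h. 2*((x - w)\<bullet>h))) (at x)"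
  by (auto intro!: derivative_eq_intros simp: inner_commute)
 from has_derivative_mult_right[OF this, of "1/(4*r^2)"] show ?thesis unfolding power2_norm_eq_inner by simp
qed

lemma chi_deriv: "(chi w has_derivative (%h. gchi w x\<bullet>h)) (at x)"
 using has_derivative_compose_real[OF quad_deriv cut_deriv] unfolding chi_def[abs_def] by (simp add: gchi_def)

lemma norm_gchi: assumes "norm (x - w) < 5*r" shows "norm (gchi w x) < 3*C/r"
proof -
 have "norm (gchi w x) <= C*(1/(2*r^2)*norm (x - w))"
  unfolding gchi_def norm_scaleR using dcutC(2) r C by (intro mult_mono) auto
 also have "\<dots> <= C*(1/(2*r^2)*(5*r))" using assms r C by (intro mult_left_mono) auto
 also have "\<dots> = 5/2*(C/r)" using r by (simp add: field_simps power2_eq_square)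
 also have "\<dots> < 3*(C/r)" using r C by (intro mult_strict_right_mono) auto
 finally show ?thesis by simp
qed

lemma lip_chi: assumes "norm (x - w) < 5*r" shows "lip_at (chi w) x (3*C/r)"
proof (rule lip_at_has_derivative[OF chi_deriv, of _ _ "norm (gchi w x)"])
 show "norm (gchi w x\<bullet>h) <= norm (gchi w x)*norm h" for h using Cauchy_Schwarz_ineq2 by simp
qed (rule norm_gchi[OF assms])

lemma lip_gchi: assumes x: "norm (x - w) < 5*r" shows "lip_at (gchi w) x (9*C/r^2)"
proof -
 have "lip_at (%x. (norm (x - w))^2/(4*r^2)) x (3/r)"
 proof (rule lip_at_has_derivative[OF quad_deriv])
  show "norm (((1/(2*r^2)) *R (x - w))\<bullet>h) <= (5/2/r)*norm h" for h
  proof -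
   have "norm ((1/(2*r^2)) *R (x - w)) <= 1/(2*r^2)*(5*r)"
    unfolding norm_scaleR using x r by (intro mult_mono) auto
   also have "\<dots> = 5/2/r" using r by (simp add: field_simps power2_eq_square)
   finally show ?thesis by (rule norm_inner_le)
  qed
  show "5/2/r < 3/r" by (rule divide_strict_right_mono) (use r in auto)
 qed
 from lip_at_compose[OF this lip_at_lipschitz_on[OF dcutC(1)]]
 have l1: "lip_at (%x. dcut ((norm (x - w))^2/(4*r^2))) x (C*(3/r))" using C by simp
 have l2: "lip_at (%x. (1/(2*r^2)) *R (x - w)) x (1/(2*r^2))"
  unfolding lip_at_def by (simp add: scaleR_diff_right[symmetric] abs_mult)
 have n2: "norm ((1/(2*r^2)) *R (x - w)) <= 5/2/r"
 proof -
  have "norm ((1/(2*r^2)) *R (x - w)) <= 1/(2*r^2)*(5*r)"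
   unfolding norm_scaleR using x r by (intro mult_mono) auto
  also have "\<dots> = 5/2/r" using r by (simp add: field_simps power2_eq_square)
  finally show ?thesis .
 qed
 have "lip_at (gchi w) x ((C + 1)*(1/(2*r^2)) + C*(3/r)*(5/2/r))" unfolding gchi_def[abs_def]
  by (rule lip_at_scaleR[OF l1 l2 le_less_trans[OF dcutC(2)] n2]) (use r C in auto)
 then show ?thesis
 proof (rule lip_at_mono)
  have "(C + 1)*(1/(2*r^2)) + C*(3/r)*(5/2/r) = (8*C + 1/2)/r^2"
   using r by (simp add: field_simps power2_eq_square)
  also have "\<dots> <= 9*C/r^2" using C by (intro divide_right_mono) auto
  finally show "(C + 1)*(1/(2*r^2)) + C*(3/r)*(5/2/r) <= 9*C/r^2" .
 qed
qed

lemma v_lip: "x \<in> \<Omega> ==> y \<in> \<Omega> ==> \<bar>v x - v y\<bar> <= C*norm (x - y)"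
 by (rule lipschitz_if_slopes_bounded[OF sub_C])

lemma C_powers: "C <= C^2" "C^2 <= C^3" "C^3 <= C^6" "C^2 <= C^6" "1 <= C^2" "1 <= C^3"
proof -
 show "C <= C^2" using power_increasing[of 1 2 C] C by simp
 show "C^2 <= C^3" "C^3 <= C^6" "C^2 <= C^6" by (intro power_increasing C; simp)+
 show "1 <= C^2" "1 <= C^3" by (intro one_le_power C)+
qed

lemma lip_Z: assumes x: "x \<in> \<Omega>" and far: "far x" shows "lip_at Z x (2*C)"
proof -
 have "(Z has_derivative (%h. grd Z x\<bullet>h)) (at x)" using eventually_nhds_x_imp_x[OF far_regularity(1)[OF assms]] .
 then show ?thesis
 proof (rule lip_at_has_derivative)
  show "norm (grd Z x\<bullet>h) <= C*norm h" for h by (rule norm_inner_le[OF far_regularity(2)[OF assms]])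
 qed (use C in simp)
qed

text \<open>Derivatives of the cut-off cost 1/r and 1/r^2, but \<open>v w - Z\<close> and \<zeta>
  are of order \<open>r\<close> there; so the slope stays bounded and its Lipschitz constant is of
  order 1/r.\<close>

lemma transition: assumes w: "w \<in> vertices" and x: "r < norm (x - w)" "norm (x - w) < 5*r"
 shows "\<forall>\<^sub>F y in nhds x. (V has_derivative (%h. grd V y\<bullet>h)) (at y)" (is ?A) "norm (grd V x) <= 19*C^3" (is ?B)
  "lip_at (grd V) x (75*C^3/r)" (is ?C) "lip_at u x (6*C^3)"
proof -
 define O' where "O' = {y. r < norm (y - w)} \<inter> ball w (5*r)"
 have O': "open O'" unfolding O'_def by (intro open_Int open_ball open_Collect_less continuous_intros)
 have mem: "y \<in> O' \<longleftrightarrow> r < norm (y - w) \<and> norm (y - w) < 5*r" for y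
  by (simp add: O'_def dist_norm norm_minus_commute)
 have xO: "x \<in> O'" using x mem by simp
 have O\<Omega>: "y \<in> \<Omega>" if "y \<in> O'" for y
  using that balls[OF w] r by (force simp: mem dist_norm norm_minus_commute)
 have Ofar: "far y" if "y \<in> O'" for y using that annulus_far[OF w] by (simp add: mem)
 define G where "G y = (1 - chi w y) *R grd Z y + (v w - Z y) *R gchi w y" for y
 have ev: "\<forall>\<^sub>F y in nhds x. y \<in> O'" by (rule eventually_nhds_in_open[OF O' xO])
 have V: "V y = Z y + chi w y*(v w - Z y)" "u y = (1 - chi w y) *R \<zeta> y" if "y \<in> O'" for y
  using VU_near[OF w] that by (auto simp: mem)
 have D: "(V has_derivative (%h. G y\<bullet>h)) (at y)" if "y \<in> O'" for y
 proof (rule has_derivative_transform_within_open[OF _ O' that])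
  have dZ: "(Z has_derivative (%h. grd Z y\<bullet>h)) (at y)"
   using eventually_nhds_x_imp_x[OF far_regularity(1)[OF O\<Omega>[OF that] Ofar[OF that]]] .
  show "((%y. Z y + chi w y*(v w - Z y)) has_derivative (%h. G y\<bullet>h)) (at y)"
   by (rule has_derivative_eq_rhs[OF has_derivative_add[OF dZ has_derivative_mult[OF chi_deriv has_derivative_diff[OF has_derivative_const dZ]]]])
    (simp add: fun_eq_iff G_def inner_add_left algebra_simps)
 qed (simp add: V)
 have g: "grd V y = G y" if "y \<in> O'" for y using grd_eq[OF D[OF that]] .
 show ?A using ev by eventually_elim (metis D g)
 have x\<Omega>: "x \<in> \<Omega>" and xf: "far x" using O\<Omega>[OF xO] Ofar[OF xO] by auto
 note R = far_regularity[OF x\<Omega> xf]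
 have w\<Omega>: "w \<in> \<Omega>" using w vertices_props by auto
 have c01: "0 <= chi w x" "chi w x <= 1" using cut_values(3,4) by (auto simp: chi_def)
 then have c1: "\<bar>1 - chi w x\<bar> < 2" by simp
 have vz: "\<bar>v w - Z x\<bar> <= 6*C^2*r"
 proof -
  have "\<bar>v w - v x\<bar> <= C*(5*r)"
   by (rule order_trans[OF v_lip[OF w\<Omega> x\<Omega>]]) (use x C in \<open>simp add: norm_minus_commute\<close>)
  also have "\<dots> <= 5*(C^2*r)" using mult_right_mono[OF C_powers(1), of r] r by simp
  finally show ?thesis using conjunct1[OF R(5)[OF w x(2)]] by linarith
 qed
 have gb: "norm (gchi w x) <= 3*C/r" using norm_gchi[OF x(2)] by simp
 have "norm (G x) <= \<bar>1 - chi w x\<bar>*norm (grd Z x) + \<bar>v w - Z x\<bar>*norm (gchi w x)"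
  unfolding G_def using norm_triangle_ineq[of "(1 - chi w x) *R grd Z x"] by (metis norm_scaleR)
 also have "\<dots> <= 1*C + (6*C^2*r)*(3*C/r)" using c01 R(2) vz gb r C by (intro add_mono mult_mono) auto
 also have "\<dots> = C + 18*C^3" using r by (simp add: power2_eq_square power3_eq_cube)
 also have "\<dots> <= 19*C^3" using C_powers(1,2) by linarith
 finally show ?B using g[OF xO] by simp
 have l1: "lip_at (%y. (1 - chi w y) *R grd Z y) x (2*(C^2/r) + 3*C/r*C)"
  by (rule lip_at_scaleR[OF lip_at_1_minus[OF lip_chi[OF x(2)]] R(3) c1 R(2)]) (use r C in auto)
 have lz: "lip_at (%y. v w - Z y) x (2*C)" using lip_at_diff[OF lip_at_const[of "v w"] lip_Z[OF x\<Omega> xf]] by simp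
 have l2: "lip_at (%y. (v w - Z y) *R gchi w y) x (7*C^2*r*(9*C/r^2) + 2*C*(3*C/r))"
 proof (rule lip_at_scaleR[OF lz lip_gchi[OF x(2)] _ gb])
  have "0 < C^2*r" using r C by simp
  then show "\<bar>v w - Z x\<bar> < 7*C^2*r" using vz by linarith
 qed (use r C in auto)
 have "lip_at G x (2*(C^2/r) + 3*C/r*C + (7*C^2*r*(9*C/r^2) + 2*C*(3*C/r)))"
  unfolding G_def[abs_def] by (rule lip_at_add[OF l1 l2])
 then have "lip_at G x (75*C^3/r)"
 proof (rule lip_at_mono)
  have "2*(C^2/r) + 3*C/r*C + (7*C^2*r*(9*C/r^2) + 2*C*(3*C/r)) = (11*C^2 + 63*C^3)/r"
   using r by (simp add: field_simps power2_eq_square power3_eq_cube)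
  also have "\<dots> <= 75*C^3/r" using C_powers r by (intro divide_right_mono) auto
  finally show "2*(C^2/r) + 3*C/r*C + (7*C^2*r*(9*C/r^2) + 2*C*(3*C/r)) <= 75*C^3/r" .
 qed
 then show ?C by (rule lip_at_cong) (use ev in \<open>auto elim!: eventually_mono simp: g\<close>)
 have "lip_at (%y. (1 - chi w y) *R \<zeta> y) x (2*C + 3*C/r*(C^2*r))"
  by (rule lip_at_scaleR[OF lip_at_1_minus[OF lip_chi[OF x(2)]] R(4) c1]) (use R(5)[OF w x(2)] r C in auto)
 then have "lip_at (%y. (1 - chi w y) *R \<zeta> y) x (6*C^3)"
 proof (rule lip_at_mono)
  have "2*C + 3*C/r*(C^2*r) = 2*C + 3*C^3" using r by (simp add: power2_eq_square power3_eq_cube)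
  then show "2*C + 3*C/r*(C^2*r) <= 6*C^3" using C_powers by linarith
 qed
 then show "lip_at u x (6*C^3)" by (rule lip_at_cong) (use ev in \<open>auto elim!: eventually_mono simp: V\<close>)
qed

lemma core: assumes w: "w \<in> vertices" and x: "norm (x - w) < 2*r"
 shows "\<forall>\<^sub>F y in nhds x. (V has_derivative (%h. grd V y\<bullet>h)) (at y)" (is ?A) "grd V x = 0"
  "lip_at (grd V) x 0" "\<forall>\<^sub>F y in nhds x. u y = 0" (is ?D)
proof -
 have mem: "y \<in> ball w (2*r) \<longleftrightarrow> norm (y - w) < 2*r" for y by (simp add: dist_norm norm_minus_commute)
 have ev: "\<forall>\<^sub>F y in nhds x. y \<in> ball w (2*r)" by (rule eventually_nhds_in_open) (use x mem in auto)
 have V: "V y = v w" "u y = 0" if "y \<in> ball w (2*r)" for y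
 proof -
  have "norm (y - w) < 5*r" "norm (y - w) <= 2*r" using that r unfolding mem by linarith+
  then show "V y = v w" "u y = 0" using VU_near[OF w] chi_1 by simp_all
 qed
 have D: "(V has_derivative (%h. 0\<bullet>h)) (at y)" if "y \<in> ball w (2*r)" for y
  by (rule has_derivative_transform_within_open[OF _ open_ball that, of "%_. v w"]) (auto simp: V)
 have g: "grd V y = 0" if "y \<in> ball w (2*r)" for y using grd_eq[OF D[OF that]] .
 show ?A using ev by eventually_elim (metis D g)
 show "grd V x = 0" using g mem x by simp
 show "lip_at (grd V) x 0"
  by (rule lip_at_cong[OF lip_at_const[of 0]]) (use ev in \<open>auto elim!: eventually_mono simp: g\<close>)
 show ?D using ev by eventually_elim (simp add: V)
qed

lemma away: assumes x: "x \<in> \<Omega>" "\<forall>w\<in>vertices. 4*r < norm (x - w)"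
 shows "\<forall>\<^sub>F y in nhds x. V y = Z y" (is ?A) "\<forall>\<^sub>F y in nhds x. u y = \<zeta> y" (is ?B)
  "\<forall>\<^sub>F y in nhds x. (V has_derivative (%h. grd V y\<bullet>h)) (at y)" (is ?C)
  "\<forall>\<^sub>F y in nhds x. grd V y = grd Z y" (is ?D)
proof -
 have "{x. \<forall>w\<in>vertices. 4*r < norm (x - w)} = (\<Inter>w\<in>vertices. {x. 4*r < norm (x - w)})" by auto
 moreover have "open (\<Inter>w\<in>vertices. {x. 4*r < norm (x - w)})"
  using vertices_props(1) by (intro open_INT ballI open_Collect_less continuous_intros)
 ultimately have "open {x. \<forall>w\<in>vertices. 4*r < norm (x - w)}" by simp
 from eventually_nhds_in_open[OF this, of x]
 have ev: "\<forall>\<^sub>F y in nhds x. \<forall>w\<in>vertices. 4*r <= norm (y - w)"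
  using x(2) by (auto elim!: eventually_mono intro: less_imp_le)
 then show 1: ?A by eventually_elim (rule VU_away)
 show ?B using ev by eventually_elim (rule VU_away)
 have far: "far x" using x(2) r by force
 have "\<forall>\<^sub>F y in nhds x. \<forall>\<^sub>F z in nhds y. V z = Z z" using 1 by (simp add: eventually_eventually)
 with far_regularity(1)[OF x(1) far]
 have D: "\<forall>\<^sub>F y in nhds x. (V has_derivative (%h. grd Z y\<bullet>h)) (at y)"
 proof eventually_elim
  case (elim y)
  from elim(2) obtain T where T: "open T" "y \<in> T" "\<forall>z\<in>T. V z = Z z" unfolding eventually_nhds by blast
  show ?case by (rule has_derivative_transform_within_open[OF elim(1) T(1,2)]) (use T(3) in simp)
 qed
 then show ?D by eventually_elim (rule grd_eq)
 with D show ?C by eventually_elim simp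
qed

end

section \<open>The global deformation and its energy density\<close>

context corrugation
begin

definition near :: "real^2 => bool" where "near x \<longleftrightarrow> (\<exists>w\<in>vertices. norm (x - w) < 5*r)"

text \<open>Inside the discs a crude constant suffices, since their area is of order h^2. In the sum
  at most one term is nonzero, as the strips are disjoint.\<close>

definition Sb :: "real^2 => real" where
 "Sb x = (if near x then 400*C^6 else \<Sum>e\<in>E. indicator (St e) x*(C*\<bar>D e x\<bar>))"
definition Mb :: "real^2 => real" where
 "Mb x = (if near x then 75*C^3/r else C/infdist x vertices + (\<Sum>e\<in>E. indicator (St e) x*(C/d e x)))"

lemma d_pos: assumes "e \<in> E" "x \<in> St e" "far x" shows "d e x > 0"
proof -
 have "0 < C*d e x" using St_far[OF assms] r by linarith
 then show ?thesis using C by (simp add: zero_less_mult_iff)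
qed

lemma region_cases: assumes "x \<in> \<Omega>"
 obtains w where "w \<in> vertices" "norm (x - w) < 2*r"
 | w where "w \<in> vertices" "r < norm (x - w)" "norm (x - w) < 5*r"
 | "\<not> near x" "\<forall>w\<in>vertices. 4*r < norm (x - w)" "far x"
proof (cases "near x")
 case True
 then show ?thesis using that(1,2) r unfolding near_def by (metis linorder_not_less mult_2 less_add_same_cancel1 order_less_le_trans)
next
 case False
 then have "\<forall>w\<in>vertices. 5*r <= norm (x - w)" by (auto simp: near_def not_less)
 then have "\<forall>w\<in>vertices. 4*r < norm (x - w)" "far x" using r by force+
 with False that(3) show ?thesis by blast
qed

lemma V_regular: assumes x: "x \<in> \<Omega>"
 shows "(V has_derivative (%h. grd V x\<bullet>h)) (at x)" (is ?A) "norm (grd V x) <= 19*C^3" (is ?B) "lip_at (grd V) x (Mb x)"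
  "lip_at (grd V) x (75*C^3/r)" (is ?D) "lip_at u x (6*C^3)"
proof -
 have "(V has_derivative (%h. grd V x\<bullet>h)) (at x) \<and> norm (grd V x) <= 19*C^3 \<and> lip_at (grd V) x (Mb x) \<and>
  lip_at (grd V) x (75*C^3/r) \<and> lip_at u x (6*C^3)" using x
 proof (cases rule: region_cases)
  case (1 w)
  note c = core[OF 1]
  have m: "Mb x = 75*C^3/r" using 1 r by (auto simp: Mb_def near_def)
  have "lip_at u x 0" by (rule lip_at_cong[OF lip_at_const[of 0]]) (use c(4) in \<open>auto elim!: eventually_mono\<close>)
  then have "lip_at u x (6*C^3)" by (rule lip_at_mono) (use C in simp)
  moreover have ?D by (rule lip_at_mono[OF c(3)]) (use C r in simp)
  ultimately show ?thesis using eventually_nhds_x_imp_x[OF c(1)] c(2) C unfolding m by simp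
 next
  case (2 w)
  note c = transition[OF 2]
  have m: "Mb x = 75*C^3/r" using 2 r by (auto simp: Mb_def near_def)
  show ?thesis using eventually_nhds_x_imp_x[OF c(1)] c(2-4) unfolding m by simp
 next
  case 3
  note c = away[OF x 3(2)] and R = far_regularity[OF x 3(3)]
  have g: "grd V x = grd Z x" by (rule eventually_nhds_x_imp_x[OF c(4)])
  have ev: "\<forall>\<^sub>F y in nhds x. grd Z y = grd V y" using c(4) by eventually_elim simp
  have gC: ?B using R(2) C_powers unfolding g by linarith
  have ll: ?D
  proof (rule lip_at_mono[OF lip_at_cong[OF R(3) ev]])
   have "C^2 <= 75*C^3" using C_powers by linarith
   then show "C^2/r <= 75*C^3/r" using r by (intro divide_right_mono) auto
  qed
  have "lip_at u x C" by (rule lip_at_cong[OF R(4)]) (use c(2) in \<open>eventually_elim, simp\<close>)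
  then have lu: "lip_at u x (6*C^3)" by (rule lip_at_mono) (use C_powers in linarith)
  have i0: "0 <= C/infdist x vertices" by (rule divide_nonneg_nonneg) (use C infdist_nonneg in auto)
  have s0: "0 <= (\<Sum>e\<in>E. indicator (St e) x*(C/d e x))"
   by (rule sum_nonneg) (use d_pos[OF _ _ 3(3)] C in \<open>auto simp: indicator_def intro!: divide_nonneg_pos\<close>)
  have "lip_at (grd Z) x (Mb x)" using far_cases[OF 3(3)]
  proof
   assume "\<exists>e\<in>E. x \<in> St e"
   then obtain e where e: "e \<in> E" "x \<in> St e" by blast
   have "C/d e x = indicator (St e) x*(C/d e x)" using e by simp
   also have "\<dots> <= (\<Sum>e\<in>E. indicator (St e) x*(C/d e x))"
    by (rule member_le_sum[OF e(1) _ finE]) (use d_pos[OF _ _ 3(3)] C in \<open>auto simp: indicator_def intro!: divide_nonneg_pos\<close>)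
   also have "\<dots> <= Mb x" using 3(1) i0 by (simp add: Mb_def)
   finally show ?thesis using lip_at_mono[OF far_St(3)[OF e 3(3)]] by blast
  next
   assume o: "off x"
   have "C/infdist x vertices <= Mb x" using 3(1) s0 by (simp add: Mb_def)
   then show ?thesis using lip_at_mono[OF far_off(4)[OF x 3(3) o]] by blast
  qed
  from lip_at_cong[OF this ev] show ?thesis using eventually_nhds_x_imp_x[OF c(3)] gC ll lu by blast
 qed
 then show ?A ?B "lip_at (grd V) x (Mb x)"
  ?D "lip_at u x (6*C^3)" by blast+
qed

lemma lipschitz_VU:
 "(20*C^3)-lipschitz_on \<Omega> V" (is ?A) "(75*C^3/r)-lipschitz_on \<Omega> (grd V)" (is ?B) "(6*C^3)-lipschitz_on \<Omega> u" (is ?C)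
 "C-lipschitz_on \<Omega> v"
proof -
 have C3: "C^3 > 0" using C by simp
 have "lip_at V x (20*C^3)" if "x \<in> \<Omega>" for x
 proof (rule lip_at_has_derivative[OF V_regular(1)[OF that]])
  show "norm (grd V x\<bullet>h) <= (19*C^3)*norm h" for h by (rule norm_inner_le[OF V_regular(2)[OF that]])
 qed (use C3 in simp)
 then show ?A using C3 by (intro lipschitz_on_if_lip_at convex_\<Omega>) auto
 show ?B using C3 r by (intro lipschitz_on_if_lip_at[OF convex_\<Omega> V_regular(4)]) auto
 show ?C using C3 by (intro lipschitz_on_if_lip_at[OF convex_\<Omega> V_regular(5)]) auto
 show "C-lipschitz_on \<Omega> v" by (rule lipschitz_onI) (use v_lip C in \<open>auto simp: dist_norm\<close>)
qed

text \<open>Cores and discs keep away from the frontier, so \<open>V\<close> coincides with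
  \<open>v\<close> near each boundary point.\<close>

lemma V_boundary: "continuous_on (closure \<Omega>) V" (is ?A) "!!x. x \<in> frontier \<Omega> ==> V x = 0"
proof -
 define O' where "O' = {x. off x} \<inter> (\<Inter>w\<in>vertices. - cball w (4*r))"
 have O': "open O'" unfolding O'_def using vertices_props(1) by (intro open_Int open_off open_INT ballI) (auto simp: open_Compl)
 have V: "V x = v x" if "x \<in> O'" for x
 proof -
  have "4*r <= norm (x - w)" if "w \<in> vertices" for w
   using \<open>x \<in> O'\<close> that by (force simp: O'_def dist_norm norm_minus_commute)
  then show ?thesis using VU_away(1)[of x] Z_off(1)[of x] that by (simp add: O'_def)
 qed
 have fr: "x \<in> O'" if "x \<in> frontier \<Omega>" for x
 proof -
  have n: "x \<notin> \<Omega>" by (rule frontier_not_in[OF that])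
  then have "off x" using F_\<Omega> by blast
  moreover have "x \<notin> cball w (4*r)" if "w \<in> vertices" for w
  proof
   assume "x \<in> cball w (4*r)"
   then have "x \<in> ball w (6*r)" using r by simp
   then show False using balls[OF that] n by blast
  qed
  ultimately show ?thesis by (simp add: O'_def)
 qed
 show "V x = 0" if "x \<in> frontier \<Omega>" for x using V[OF fr[OF that]] bdry[OF that] by simp
 show ?A unfolding continuous_on_eq_continuous_within
 proof
  fix x assume "x \<in> closure \<Omega>"
  then consider "x \<in> \<Omega>" | "x \<in> frontier \<Omega>" using closure_Un_frontier by blast
  then show "continuous (at x within closure \<Omega>) V"
  proof cases
   case 1
   then show ?thesis using has_derivative_continuous[OF V_regular(1)] continuous_at_imp_continuous_at_within by blast
  next
   case 2
   have "continuous (at x within closure \<Omega>) v"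
    using cont_v \<open>x \<in> closure \<Omega>\<close> continuous_on_eq_continuous_within by blast
   then have "(v \<longlongrightarrow> V x) (at x within closure \<Omega>)" using V[OF fr[OF 2]] by (simp add: continuous_within)
   moreover have "\<forall>\<^sub>F y in at x within closure \<Omega>. v y = V y" using eventually_nhds_in_open[OF O' fr[OF 2]]
    by (auto simp: eventually_at_filter V elim!: eventually_mono)
   ultimately show ?thesis unfolding continuous_within by (rule Lim_transform_eventually)
  qed
 qed
qed

lemma strain_at: assumes x: "x \<in> \<Omega>" "x \<notin> Nul" "x \<notin> singular_set"
 shows "\<exists>U. (u has_derivative (%h. U *v h)) (at x) \<and>
  norm (U + transpose U + tensor (grd V x) (grd V x) - tensor (slope x) (slope x)) <= Sb x"
proof -
 have mat: "(F has_derivative (%h. matrix F' *v h)) (at y)" if "(F has_derivative F') (at y)" for F :: "real^2 => real^2" and F' y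
  by (rule has_derivative_eq_rhs[OF that matrix_vector_mul(2)[OF has_derivative_linear[OF that], symmetric]])
 have St_\<zeta>: "(\<zeta> has_derivative (%h. Ue e x *v h)) (at x)" if "e \<in> E" "x \<in> St e" "far x" for e
  by (rule has_derivative_transform_within_open[OF _ opSt[OF that(1)] that(2)])
   (use St_far[OF that] x(2) Z_St[OF that(1)] in auto)
 have off_\<zeta>: "(\<zeta> has_derivative (%h. 0 *v h)) (at x)" if fo: "far x" "off x"
 proof -
  obtain T where T: "open T" "x \<in> T" "\<forall>y\<in>T. \<zeta> y = 0" using far_off(5)[OF x(1) fo] unfolding eventually_nhds by blast
  show ?thesis by (rule has_derivative_transform_within_open[OF _ T(1,2), of "%_. 0"]) (use T(3) in auto)
 qed
 have near_case: ?thesis if D: "(u has_derivative F') (at x)" and n: "near x" for F'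
 proof -
  note Dm = mat[OF D]
  have U: "norm (matrix F') <= 2*(6*C^3)" by (rule norm_matrix_le_lip_at[OF Dm V_regular(5)[OF x(1)]]) (use C in simp)
  have g: "norm (grd V x)*norm (grd V x) <= (19*C^3)*(19*C^3)"
   by (intro mult_mono V_regular(2)[OF x(1)]) (use C in auto)
  have s: "norm (slope x)*norm (slope x) <= C*C" by (intro mult_mono sub_C[OF x(1) slope_sub[OF x(1)]]) (use C in auto)
  have "norm (matrix F' + transpose (matrix F') + tensor (grd V x) (grd V x) - tensor (slope x) (slope x))
   <= norm (matrix F') + norm (transpose (matrix F')) + norm (tensor (grd V x) (grd V x)) + norm (tensor (slope x) (slope x))"
   using norm_triangle_ineq[of "matrix F'" "transpose (matrix F')"]
    norm_triangle_ineq[of "matrix F' + transpose (matrix F')" "tensor (grd V x) (grd V x)"]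
    norm_triangle_ineq4[of "matrix F' + transpose (matrix F') + tensor (grd V x) (grd V x)" "tensor (slope x) (slope x)"]
   by linarith
  \<comment> \<open>24 = 2 * 12 from the displacement gradient and its transpose, 361 = 19^2 from
    the gradient of \<open>V\<close>.\<close>
  also have "\<dots> <= 24*C^3 + 361*C^6 + C^2"
   using U g s unfolding norm_transpose_real norm_tensor by (simp add: power2_eq_square power3_eq_cube eval_nat_numeral algebra_simps)
  also have "\<dots> <= 400*C^6" using C_powers by linarith
  finally show ?thesis using Dm n by (auto simp: Sb_def)
 qed
 show ?thesis using x(1)
 proof (cases rule: region_cases)
  case (1 w)
  obtain T where T: "open T" "x \<in> T" "\<forall>y\<in>T. u y = 0" using core(4)[OF 1] unfolding eventually_nhds by blast
  have "(u has_derivative (%h. 0)) (at x)"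
   by (rule has_derivative_transform_within_open[OF _ T(1,2), of "%_. 0"]) (use T(3) in auto)
  moreover have "near x" unfolding near_def by (rule bexI[OF _ 1(1)]) (use 1(2) r in linarith)
  ultimately show ?thesis by (rule near_case)
 next
  case (2 w)
  have far: "far x" by (rule annulus_far[OF 2])
  obtain U where U: "(\<zeta> has_derivative (%h. U *v h)) (at x)" using far_cases[OF far] St_\<zeta> off_\<zeta> far by blast
  have mem: "y \<in> ball w (5*r) \<longleftrightarrow> norm (y - w) < 5*r" for y by (simp add: dist_norm norm_minus_commute)
  have "((%y. (1 - chi w y) *R \<zeta> y) has_derivative (%h. (1 - chi w x) *R (U *v h) + (0 - gchi w x\<bullet>h) *R \<zeta> x)) (at x)"
   by (intro has_derivative_scaleR has_derivative_diff has_derivative_const chi_deriv U)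
  then have "(u has_derivative (%h. (1 - chi w x) *R (U *v h) + (0 - gchi w x\<bullet>h) *R \<zeta> x)) (at x)"
   by (rule has_derivative_transform_within_open[OF _ open_ball]) (use 2 mem VU_near(2)[OF 2(1)] in auto)
  then show ?thesis by (rule near_case) (use 2 in \<open>auto simp: near_def\<close>)
 next
  case 3
  obtain T where T: "open T" "x \<in> T" "\<forall>y\<in>T. u y = \<zeta> y" using away(2)[OF x(1) 3(2)] unfolding eventually_nhds by blast
  have g: "grd V x = grd Z x" using eventually_nhds_x_imp_x[OF away(4)[OF x(1) 3(2)]] .
  have tr: "(u has_derivative F') (at x)" if "(\<zeta> has_derivative F') (at x)" for F'
   by (rule has_derivative_transform_within_open[OF that T(1,2)]) (use T(3) in auto)
  have s0: "0 <= Sb x" using C by (auto simp: Sb_def intro!: sum_nonneg)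
  from far_cases[OF 3(3)] show ?thesis
  proof
   assume "\<exists>e\<in>E. x \<in> St e"
   then obtain e where e: "e \<in> E" "x \<in> St e" by blast
   obtain p where p: "(v has_derivative (%h. p\<bullet>h)) (at x)"
    "norm (Ue e x + transpose (Ue e x) + tensor (ge e x) (ge e x) - tensor p p) <= C*D e x"
    using St_far[OF e 3(3)] x(2) by blast
   have "p = slope x" using grd_eq[OF p(1)] grd_eq[OF slope_deriv[OF x(1,3)]] by simp
   moreover have "C*D e x <= Sb x"
   proof -
    have "C*D e x <= indicator (St e) x*(C*\<bar>D e x\<bar>)" using e C by (simp add: mult_left_mono)
    also have "\<dots> <= (\<Sum>e\<in>E. indicator (St e) x*(C*\<bar>D e x\<bar>))"
     by (rule member_le_sum[OF e(1) _ finE]) (use C in auto)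
    finally show ?thesis using 3(1) by (simp add: Sb_def)
   qed
   ultimately show ?thesis using tr[OF St_\<zeta>[OF e 3(3)]] p(2) far_St(2)[OF e 3(3)] g by (intro exI[of _ "Ue e x"]) auto
  next
   assume o: "off x"
   have t0: "transpose (0 :: real^2^2) = 0" by (simp add: transpose_def vec_eq_iff)
   show ?thesis using tr[OF off_\<zeta>[OF 3(3) o]] far_off(2)[OF x(1) 3(3) o] g s0 by (intro exI[of _ 0]) (simp add: t0)
  qed
 qed
qed

definition "dens h x = (Sb x)^2 + h^2*(4*(Mb x)^2)"

theorem corrugation_energy:
 "u \<in> W12 \<Omega>" "V \<in> W2inf \<Omega>"
 "energy \<Omega> v h u V <= (\<integral>\<^sup>+x\<in>\<Omega>. ennreal (dens h x) \<partial>lebesgue)"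
proof -
 show "u \<in> W12 \<Omega>" by (rule W12_lipschitz[OF open_\<Omega> bounded_\<Omega> lipschitz_VU(3)])
 define U where "U x = (SOME U. (u has_derivative (%h. U *v h)) (at x) \<and>
  norm (U + transpose U + tensor (grd V x) (grd V x) - tensor (slope x) (slope x)) <= Sb x)" for x
 have U: "(u has_derivative (%h. U x *v h)) (at x) \<and>
  norm (U x + transpose (U x) + tensor (grd V x) (grd V x) - tensor (slope x) (slope x)) <= Sb x"
  if "x \<in> \<Omega>" "x \<notin> Nul" "x \<notin> singular_set" for x
  unfolding U_def by (rule someI_ex[OF strain_at[OF that]])
 have "Nul \<union> singular_set \<in> null_sets lebesgue"
  using negligible_Un[OF Nul negligible_singular_set] by (simp add: negligible_iff_null_sets)
 from AE_not_in[OF this] have ae: "AE x in lebesgue. x \<notin> Nul \<and> x \<notin> singular_set" by simp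
 have 1: "AE x\<in>\<Omega> in lebesgue. (v has_derivative (%h. slope x\<bullet>h)) (at x)"
  using ae by eventually_elim (use slope_deriv in blast)
 have 2: "AE x\<in>\<Omega> in lebesgue. (u has_derivative (%h. U x *v h)) (at x)"
  using ae by eventually_elim (use U in blast)
 have 3: "AE x in lebesgue. x \<in> \<Omega> -->
   norm (U x + transpose (U x) + tensor (grd V x) (grd V x) - tensor (slope x) (slope x)) <= Sb x"
  using ae by eventually_elim (use U in blast)
 note E = energy_le_of_classical_bounds[OF open_\<Omega> bounded_\<Omega> lipschitz_VU(4) 1 lipschitz_VU(1) V_regular(1) lipschitz_VU(2) V_regular(3)
   lipschitz_VU(3) 2 3]
 show "V \<in> W2inf \<Omega>" by (rule E(1))
 show "energy \<Omega> v h u V <= (\<integral>\<^sup>+x\<in>\<Omega>. ennreal (dens h x) \<partial>lebesgue)"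
  unfolding dens_def by (rule E(2))
qed

end

section \<open>Dyadic coverings and integrals\<close>

text \<open>Takes the first dyadic scale that does not exceed \<open>t\<close>.\<close>

lemma dyadic_index:
 fixes t D :: real assumes "0 < t" "t < D" shows "\<exists>k. D/2*(1/2)^k <= t \<and> t < 2*(D/2*(1/2)^k)"
proof -
 have "0 < t/D" using assms by simp
 then obtain k0 where "(1/2)^k0 < t/D" using real_arch_pow_inv[of "t/D" "1/2"] by auto
 then have "D*(1/2)^k0 <= t" using assms by (simp add: field_simps)
 moreover have "D/2*(1/2)^k0 <= D*(1/2)^k0" using assms by (intro mult_right_mono) auto
 ultimately have ex: "\<exists>k. D/2*(1/2)^k <= t" using order_trans by blast
 define k where "k = (LEAST k. D/2*(1/2)^k <= t)"
 have 1: "D/2*(1/2)^k <= t" unfolding k_def by (rule LeastI_ex[OF ex])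
 have "t < 2*(D/2*(1/2)^k)"
 proof (cases k)
  case 0
  then show ?thesis using assms by simp
 next
  case (Suc j)
  then have "j < k" by simp
  then have "\<not> D/2*(1/2)^j <= t" unfolding k_def by (rule not_less_Least)
  then show ?thesis using Suc by simp
 qed
 with 1 show ?thesis by blast
qed

lemma powr_half_power: "((1/2 :: real)^k) powr a = ((1/2) powr a)^k" by (induction k) (simp, simp only: power_Suc powr_mult)

text \<open>Replaces integration in adapted coordinates: constants on dyadic families of sets bound
  the integrand, and constant times area decays geometrically. Overlaps of the sets are
  harmless.\<close>

lemma dyadic_nn_integral:
 fixes g :: "real^2 => ennreal" and A :: "'i => nat => (real^2) set"
 assumes I: "finite I" and A: "!!i k. i \<in> I ==> A i k \<in> sets lebesgue"
  and m: "!!i k. i \<in> I ==> emeasure lebesgue (A i k) <= ennreal (m i k)"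
  and c: "!!i k. i \<in> I ==> 0 <= c i k" "!!i k. i \<in> I ==> 0 <= m i k" "!!i k. i \<in> I ==> c i k*m i k <= B i*q^k"
  and q: "0 <= q" "q < 1"
  and g: "AE x\<in>T in lebesgue. (\<exists>i\<in>I. \<exists>k. x \<in> A i k \<and> g x <= ennreal (c i k))"
 shows "(\<integral>\<^sup>+x\<in>T. g x \<partial>lebesgue) <= ennreal ((\<Sum>i\<in>I. B i)/(1 - q))"
proof -
 have B0: "0 <= B i" if "i \<in> I" for i
 proof -
  have "0 <= c i 0*m i 0" using c that by simp
  then show ?thesis using c(3)[OF that, of 0] by simp
 qed
 let ?f = "%i k x. ennreal (c i k)*indicator (A i k) x :: ennreal"
 have "(\<integral>\<^sup>+x\<in>T. g x \<partial>lebesgue) <= (\<integral>\<^sup>+x. (\<Sum>i\<in>I. \<Sum>k. ?f i k x) \<partial>lebesgue)"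
 proof (rule nn_integral_mono_AE)
  show "AE x in lebesgue. g x*indicator T x <= (\<Sum>i\<in>I. \<Sum>k. ?f i k x)" using g
  proof eventually_elim
   case (elim x)
   show ?case
   proof (cases "x \<in> T")
    case True
    then obtain i k where ik: "i \<in> I" "x \<in> A i k" "g x <= ennreal (c i k)" using elim by blast
    have "g x*indicator T x <= ?f i k x" using ik True by simp
    also have "\<dots> = (\<Sum>k\<in>{k}. ?f i k x)"
     by (simp only: sum.insert finite.emptyI empty_iff sum.empty not_False_eq_True add_0_right)
    also have "\<dots> <= (\<Sum>k. ?f i k x)" by (rule sum_le_suminf) (auto intro: summableI)
    also have "\<dots> <= (\<Sum>i\<in>I. \<Sum>k. ?f i k x)" by (rule member_le_sum[OF ik(1) _ I]) simp
    finally show ?thesis .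
   qed simp
  qed
 qed
 also have "\<dots> = (\<Sum>i\<in>I. \<integral>\<^sup>+x. (\<Sum>k. ?f i k x) \<partial>lebesgue)"
  using A by (intro nn_integral_sum borel_measurable_suminf_order borel_measurable_times_ennreal borel_measurable_const borel_measurable_indicator)
 also have "\<dots> <= (\<Sum>i\<in>I. ennreal (B i/(1 - q)))"
 proof (rule sum_mono)
  fix i assume i: "i \<in> I"
  have "(\<integral>\<^sup>+x. (\<Sum>k. ?f i k x) \<partial>lebesgue) = (\<Sum>k. \<integral>\<^sup>+x. ?f i k x \<partial>lebesgue)"
   using A[OF i] by (intro nn_integral_suminf borel_measurable_times_ennreal borel_measurable_const borel_measurable_indicator)
  also have "\<dots> <= (\<Sum>k. ennreal (B i*q^k))"
  proof (rule suminf_le)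
   fix k
   have "(\<integral>\<^sup>+x. ?f i k x \<partial>lebesgue) = ennreal (c i k)*emeasure lebesgue (A i k)"
    using A[OF i] by (rule nn_integral_cmult_indicator)
   also have "\<dots> <= ennreal (c i k)*ennreal (m i k)" by (rule mult_left_mono[OF m[OF i]]) simp
   also have "\<dots> = ennreal (c i k*m i k)" using c i by (simp add: ennreal_mult)
   also have "\<dots> <= ennreal (B i*q^k)" by (rule ennreal_leI[OF c(3)[OF i]])
   finally show "(\<integral>\<^sup>+x. ?f i k x \<partial>lebesgue) <= ennreal (B i*q^k)" .
  qed (auto intro: summableI)
  also have "\<dots> = ennreal (B i/(1 - q))"
  proof (rule suminf_ennreal_eq)
   show "0 <= B i*q^k" for k using B0[OF i] q by simp
   show "(%k. B i*q^k) sums (B i/(1 - q))" using sums_mult[OF geometric_sums[of q], of "B i"] q by simp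
  qed
  finally show "(\<integral>\<^sup>+x. (\<Sum>k. ?f i k x) \<partial>lebesgue) <= ennreal (B i/(1 - q))" .
 qed
 also have "\<dots> = ennreal ((\<Sum>i\<in>I. B i)/(1 - q))" using B0 q by (simp add: sum_ennreal sum_divide_distrib)
 finally show ?thesis .
qed

text \<open>An orthogonal map followed by a translation takes an axis-parallel box to
  \<open>R\<close>.\<close>

lemma emeasure_rectangle:
 fixes w \<tau> :: "real^2" assumes \<tau>: "norm \<tau> = 1" and ab: "a <= b" "0 <= \<beta>"
 defines "R \<equiv> {x. a <= (x - w)\<bullet>\<tau> \<and> (x - w)\<bullet>\<tau> <= b \<and> \<bar>(x - w)\<bullet>perp \<tau>\<bar> <= \<beta>}"
 shows "R \<in> sets lebesgue" "emeasure lebesgue R <= ennreal (2*(b - a)*\<beta>)" (is ?B)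
proof -
 have \<tau>\<tau>: "\<tau>\<bullet>\<tau> = 1" using \<tau> by (simp add: dot_square_norm)
 define f where "f y = (y $ 1) *R \<tau> + (y $ 2) *R perp \<tau>" for y :: "real^2"
 have lf: "linear f" unfolding f_def by (rule linearI) (simp_all add: algebra_simps)
 have ip: "f x\<bullet>\<tau> = x $ 1" "f x\<bullet>perp \<tau> = x $ 2" for x
  by (simp_all add: f_def inner_add_left perp_inner \<tau>\<tau>)
 have "f x\<bullet>f y = x\<bullet>y" for x y
 proof -
  have "f x\<bullet>f y = y $ 1*(f x\<bullet>\<tau>) + y $ 2*(f x\<bullet>perp \<tau>)"
   unfolding f_def[of y] inner_add_right inner_scaleR_right ..
  then show ?thesis unfolding ip by (simp add: inner_vec_def sum_2 mult.commute)
 qed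
 then have of: "orthogonal_transformation f" using lf by (simp add: orthogonal_transformation_def)
 define p q :: "real^2" where "p = (\<chi> i. if i = 1 then a else - \<beta>)" and "q = (\<chi> i. if i = 1 then b else \<beta>)"
 have mem: "y \<in> cbox p q \<longleftrightarrow> a <= y $ 1 \<and> y $ 1 <= b \<and> \<bar>y $ 2\<bar> <= \<beta>" for y
  by (auto simp: mem_box_cart forall_2 p_def q_def)
 have "p \<in> cbox p q" unfolding mem using ab by (simp add: p_def)
 then have ne: "cbox p q ~= {}" by blast
 have cont: "measure lebesgue (cbox p q) = 2*(b - a)*\<beta>"
  using content_cbox_cart[OF ne] by (simp add: p_def q_def UNIV_2)
 have fm: "f ` cbox p q \<in> lmeasurable" by (rule measurable_orthogonal_image[OF of]) simp
 have em: "emeasure lebesgue (f ` cbox p q) = ennreal (2*(b - a)*\<beta>)"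
  using emeasure_eq_measure2[OF fm] measure_orthogonal_image[OF of, of "cbox p q"] cont by simp
 have R: "R = (%x. 1 *R x + w) ` (f ` cbox p q)"
 proof (rule set_eqI)
  fix x
  have "x - w = f (\<chi> i. if i = 1 then (x - w)\<bullet>\<tau> else (x - w)\<bullet>perp \<tau>)"
   unfolding f_def using orthonormal_decomposition[OF \<tau>, of "x - w"] by simp
  then have *: "x = 1 *R f (\<chi> i. if i = 1 then (x - w)\<bullet>\<tau> else (x - w)\<bullet>perp \<tau>) + w" by (simp add: algebra_simps)
  show "x \<in> R \<longleftrightarrow> x \<in> (%x. 1 *R x + w) ` (f ` cbox p q)"
  proof
   assume "x \<in> R"
   then have "(\<chi> i. if i = 1 then (x - w)\<bullet>\<tau> else (x - w)\<bullet>perp \<tau>) \<in> cbox p q" by (simp add: mem R_def)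
   then show "x \<in> (%x. 1 *R x + w) ` (f ` cbox p q)" using * by blast
  next
   assume "x \<in> (%x. 1 *R x + w) ` (f ` cbox p q)"
   then obtain y where "y \<in> cbox p q" "x - w = f y" by auto
   then show "x \<in> R" by (simp add: R_def mem ip)
  qed
 qed
 show ?B unfolding R emeasure_lebesgue_affine em by simp
 have "closed R" unfolding R_def by (intro closed_Collect_conj closed_Collect_le continuous_intros)
 then show "R \<in> sets lebesgue" by simp
qed

lemma emeasure_ball_le: assumes "\<rho> >= 0" shows "emeasure lebesgue (ball (w :: real^2) \<rho>) <= ennreal (4*\<rho>^2)"
proof -
 define e where "e = (axis 1 1 :: real^2)"
 have e: "norm e = 1" by (simp add: e_def)
 define R where "R = {x. - \<rho> <= (x - w)\<bullet>e \<and> (x - w)\<bullet>e <= \<rho> \<and> \<bar>(x - w)\<bullet>perp e\<bar> <= \<rho>}"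
 have R: "R \<in> sets lebesgue" "emeasure lebesgue R <= ennreal (2*(\<rho> - - \<rho>)*\<rho>)"
  unfolding R_def using assms by (intro emeasure_rectangle e; simp)+
 have "ball w \<rho> \<subseteq> R"
 proof
  fix x assume "x \<in> ball w \<rho>"
  then have "norm (x - w) < \<rho>" by (simp add: dist_norm norm_minus_commute)
  then show "x \<in> R" using Cauchy_Schwarz_ineq2[of "x - w" e] Cauchy_Schwarz_ineq2[of "x - w" "perp e"] e
   unfolding R_def abs_le_iff by (simp add: norm_perp)
 qed
 from order_trans[OF emeasure_mono[OF this R(1)] R(2)] show ?thesis by (simp add: power2_eq_square mult.assoc)
qed

text \<open>The dyadic form of the integrability of |x - w|^(-5/3) in the plane: on the scale t,
  value times area is of order t^(-5/3) t^2 = t^(1/3).\<close>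

lemma radial_cover:
 fixes w :: "real^2" and D \<Gamma> :: real assumes D: "D > 0" and \<Gamma>: "\<Gamma> >= 0"
 defines "t \<equiv> %k :: nat. D/2*(1/2)^k"
 shows "ball w (2*t k) \<in> sets lebesgue" (is ?A) "emeasure lebesgue (ball w (2*t k)) <= ennreal (16*(t k)^2)" (is ?B)
  "\<Gamma>*t k powr (-5/3)*(16*(t k)^2) <= (16*\<Gamma>*(D/2) powr (1/3))*((1/2) powr (1/3))^k" (is ?C)
  "x ~= w ==> norm (x - w) < D ==> \<exists>k. x \<in> ball w (2*t k) \<and> \<Gamma>*norm (x - w) powr (-5/3) <= \<Gamma>*t k powr (-5/3)"
proof -
 have tp: "t k > 0" for k using D by (simp add: t_def)
 show ?A by simp
 show ?B using emeasure_ball_le[of "2*t k" w] tp[of k] by (simp add: power_mult_distrib)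
 have "t k powr (-5/3)*(t k)^2 = t k powr (-5/3)*t k powr 2" using tp[of k] by (simp add: powr_numeral)
 also have "\<dots> = t k powr (1/3)" by (simp add: powr_add[symmetric])
 also have "\<dots> = (D/2) powr (1/3)*((1/2) powr (1/3))^k"
  unfolding t_def using D by (simp only: powr_mult powr_half_power)
 finally show ?C by (simp add: mult_ac)
 assume x: "x ~= w" "norm (x - w) < D"
 then obtain k where k: "t k <= norm (x - w)" "norm (x - w) < 2*t k"
  using dyadic_index[of "norm (x - w)" D] unfolding t_def by auto
 have "norm (x - w) powr (-5/3) <= t k powr (-5/3)" using k tp[of k] by (intro powr_mono2') auto
 then show "\<exists>k. x \<in> ball w (2*t k) \<and> \<Gamma>*norm (x - w) powr (-5/3) <= \<Gamma>*t k powr (-5/3)"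
  using k \<Gamma> by (intro exI[of _ k]) (simp add: dist_norm norm_minus_commute mult_left_mono)
qed

context ridge_model
begin

definition tk :: "nat => real" where "tk k = L/2*(1/2)^k"
text \<open>Two rectangles, one at each end, which together contain the part of the strip whose
  distance along the ridge from the nearer end is about \<open>tk k\<close>.\<close>

definition Ak :: "nat => (real^2) set" where
 "Ak k = {x. 0 <= (x - w)\<bullet>\<tau> \<and> (x - w)\<bullet>\<tau> <= 2*tk k \<and> \<bar>(x - w)\<bullet>perp \<tau>\<bar> <= 2*(\<eta>*(2*L*tk k) powr (2/3))}
  \<union> {x. L - 2*tk k <= (x - w)\<bullet>\<tau> \<and> (x - w)\<bullet>\<tau> <= L \<and> \<bar>(x - w)\<bullet>perp \<tau>\<bar> <= 2*(\<eta>*(2*L*tk k) powr (2/3))}"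
definition mk :: "nat => real" where "mk k = 16*tk k*(\<eta>*(2*L*tk k) powr (2/3))"
definition strip_const :: real where
 "strip_const = 16*(L/2) powr (-4/3)*(2*L) powr (2/3)*(L/2) powr (1/3)"

text \<open>The dyadic form of the integral of W^(-4/3) over the strip: on the scale t, value,
  length and width multiply to t^(-4/3) t t^(2/3) = t^(1/3), and the width contributes the factor
  \<eta>.\<close>

lemma strip_cover: assumes \<Gamma>: "\<Gamma> >= 0"
 shows "Ak k \<in> sets lebesgue" "emeasure lebesgue (Ak k) <= ennreal (mk k)" (is ?B) "0 <= mk k"
  "\<Gamma>*(L/2*tk k) powr (-4/3)*mk k <= (\<Gamma>*\<eta> * strip_const)*((1/2) powr (1/3))^k" (is ?D)
  "x \<in> Strip c ==> \<exists>k. x \<in> Ak k \<and> \<Gamma>*W (S x) powr (-4/3) <= \<Gamma>*(L/2*tk k) powr (-4/3)"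
proof -
 have tp: "tk k > 0" for k using L by (simp add: tk_def)
 define \<beta> where "\<beta> = 2*(\<eta>*(2*L*tk k) powr (2/3))"
 have \<beta>: "\<beta> >= 0" using \<eta> by (simp add: \<beta>_def)
 define R1 where "R1 = {x. 0 <= (x - w)\<bullet>\<tau> \<and> (x - w)\<bullet>\<tau> <= 2*tk k \<and> \<bar>(x - w)\<bullet>perp \<tau>\<bar> <= \<beta>}"
 define R2 where "R2 = {x. L - 2*tk k <= (x - w)\<bullet>\<tau> \<and> (x - w)\<bullet>\<tau> <= L \<and> \<bar>(x - w)\<bullet>perp \<tau>\<bar> <= \<beta>}"
 have R1: "R1 \<in> sets lebesgue" "emeasure lebesgue R1 <= ennreal (2*(2*tk k - 0)*\<beta>)"
  unfolding R1_def using tp[of k] \<beta> by (intro emeasure_rectangle \<tau>; simp)+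
 have R2: "R2 \<in> sets lebesgue" "emeasure lebesgue R2 <= ennreal (2*(L - (L - 2*tk k))*\<beta>)"
  unfolding R2_def using tp[of k] \<beta> by (intro emeasure_rectangle \<tau>; simp)+
 have A: "Ak k = R1 \<union> R2" by (simp only: Ak_def R1_def R2_def \<beta>_def)
 show "Ak k \<in> sets lebesgue" unfolding A using R1 R2 by simp
 have "emeasure lebesgue (Ak k) <= emeasure lebesgue R1 + emeasure lebesgue R2"
  unfolding A by (rule emeasure_subadditive[OF R1(1) R2(1)])
 also have "\<dots> <= ennreal (4*tk k*\<beta>) + ennreal (4*tk k*\<beta>)" using R1(2) R2(2) by (intro add_mono) auto
 also have "\<dots> = ennreal (mk k)"
 proof -
  have "ennreal (4*tk k*\<beta>) + ennreal (4*tk k*\<beta>) = ennreal (4*tk k*\<beta> + 4*tk k*\<beta>)"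
   using tp[of k] \<beta> by (intro ennreal_plus[symmetric]) auto
  also have "4*tk k*\<beta> + 4*tk k*\<beta> = mk k" by (simp add: mk_def \<beta>_def)
  finally show ?thesis .
 qed
 finally show ?B .
 show "0 <= mk k" using tp[of k] \<eta> by (simp add: mk_def)
 have e: "tk k powr (-4/3)*tk k*tk k powr (2/3) = tk k powr (1/3)"
 proof -
  have "tk k powr (-4/3)*tk k powr 1*tk k powr (2/3) = tk k powr (1/3)" by (simp only: powr_add[symmetric]) simp
  then show ?thesis using tp[of k] by simp
 qed
 have tq: "tk k powr (1/3) = (L/2) powr (1/3)*((1/2) powr (1/3))^k"
  unfolding tk_def using L by (simp only: powr_mult powr_half_power)
 have "\<Gamma>*(L/2*tk k) powr (-4/3)*mk k =
   \<Gamma>*\<eta>*(16*(L/2) powr (-4/3)*(2*L) powr (2/3))*(tk k powr (-4/3)*tk k*tk k powr (2/3))"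
  unfolding mk_def powr_mult[of "L/2" "tk k"] powr_mult[of "2*L" "tk k"] by (simp only: mult_ac)
 also have "\<dots> = (\<Gamma>*\<eta> * strip_const)*((1/2) powr (1/3))^k" unfolding e tq strip_const_def by (simp only: mult_ac)
 finally show ?D by (rule eq_refl)
 assume "x \<in> Strip c"
 then have s: "0 < S x" "S x < L" and y: "\<bar>Y x\<bar> < 2*del (S x)" by (auto simp: Strip_def)
 define \<mu> where "\<mu> = min (S x) (L - S x)"
 have \<mu>: "0 < \<mu>" "\<mu> < L" using s by (auto simp: \<mu>_def)
 obtain j where j: "tk j <= \<mu>" "\<mu> < 2*tk j" using dyadic_index[OF \<mu>] unfolding tk_def by blast
 have W1: "L/2*\<mu> <= W (S x)"
  using mult_left_mono[of "L/2" "L - S x" "S x"] mult_left_mono[of "L/2" "S x" "L - S x"] s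
  by (auto simp: \<mu>_def W_def min_def mult.commute)
 have W2: "W (S x) <= L*\<mu>" using mult_left_mono[of "L - S x" L "S x"] mult_left_mono[of "S x" L "L - S x"] s
  by (auto simp: \<mu>_def W_def min_def mult.commute)
 have "L/2*tk j <= W (S x)" using W1 mult_left_mono[OF j(1), of "L/2"] L by linarith
 then have "W (S x) powr (-4/3) <= (L/2*tk j) powr (-4/3)" using L tp[of j] by (intro powr_mono2') auto
 then have 1: "\<Gamma>*W (S x) powr (-4/3) <= \<Gamma>*(L/2*tk j) powr (-4/3)" using \<Gamma> by (rule mult_left_mono)
 have "W (S x) <= 2*L*tk j" using W2 mult_left_mono[of \<mu> "2*tk j" L] j(2) L by linarith
 then have "W (S x) powr (2/3) <= (2*L*tk j) powr (2/3)" using W_pos[OF s] by (intro powr_mono2) auto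
 then have "del (S x) <= \<eta>*(2*L*tk j) powr (2/3)" using W_pos[OF s] \<eta> by (simp add: del_def)
 then have "\<bar>Y x\<bar> <= 2*(\<eta>*(2*L*tk j) powr (2/3))" using y by linarith
 then have "x \<in> Ak j" using s j(2) by (auto simp: Ak_def \<mu>_def min_def S_def Y_def n_def split: if_splits)
 with 1 show "\<exists>k. x \<in> Ak k \<and> \<Gamma>*W (S x) powr (-4/3) <= \<Gamma>*(L/2*tk k) powr (-4/3)" by blast
qed

end

context corrugation
begin

text \<open>In a strip the density is bounded by the sum of a radial term and a term of the strip;
  charging the larger of the two leaves a single regime at each point.\<close>

lemma density_cases: assumes x: "x \<in> \<Omega>"
 shows "(\<exists>w\<in>vertices. norm (x - w) < 5*r \<and> dens h x = (400*C^6)^2 + 4*(75*C^3)^2*(h/r)^2) \<or>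
  (\<exists>w\<in>vertices. 5*r <= norm (x - w) \<and> dens h x <= 16*C^2*h^2/(norm (x - w))^2) \<or>
  (\<exists>e\<in>E. x \<in> St e \<and> far x \<and> dens h x <= 2*C^2*(D e x)^2 + 16*C^2*h^2/(d e x)^2)"
proof (cases "near x")
 case True
 then obtain w where "w \<in> vertices" "norm (x - w) < 5*r" by (auto simp: near_def)
 moreover have "dens h x = (400*C^6)^2 + 4*(75*C^3)^2*(h/r)^2"
  using True by (simp add: dens_def Sb_def Mb_def power_divide power_mult_distrib)
 ultimately show ?thesis by blast
next
 case False
 then have n5: "\<forall>w\<in>vertices. 5*r <= norm (x - w)" by (auto simp: near_def not_less)
 then have far: "far x" using r by force
 obtain w where w: "w \<in> vertices" "infdist x vertices = norm (x - w)"
  using infdist_attains_inf[OF finite_imp_closed[OF vertices_props(1)] vertices_props(3), of x] by (auto simp: dist_norm)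
 define i where "i = norm (x - w)"
 have i: "i >= 5*r" using n5 w(1) by (simp add: i_def)
 show ?thesis
 proof (cases "\<exists>e\<in>E. x \<in> St e")
  case True
  then obtain e where e: "e \<in> E" "x \<in> St e" by blast
  have sm: "(\<Sum>e\<in>E. indicator (St e) x*f e) = f e" for f :: "'e => real"
  proof -
   have "(\<Sum>e'\<in>E. indicator (St e') x*f e') = (\<Sum>e'\<in>E. if e' = e then f e else 0)"
    by (rule sum.cong) (use e disj in \<open>auto simp: indicator_def\<close>)
   then show ?thesis using finE e(1) by simp
  qed
  have dp: "d e x > 0" by (rule d_pos[OF e far])
  have S: "Sb x = C*\<bar>D e x\<bar>" and M: "Mb x = C/i + C/d e x"
   unfolding Sb_def Mb_def if_not_P[OF False] sm w(2) i_def by (rule refl)+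
  have "(Mb x)^2 <= 2*(C/i)^2 + 2*(C/d e x)^2"
   unfolding M using zero_le_power2[of "C/i - C/d e x"] by (simp add: power2_sum power2_diff)
  then have "h^2*(4*(Mb x)^2) <= h^2*(4*(2*(C/i)^2 + 2*(C/d e x)^2))" by (intro mult_left_mono) auto
  also have "\<dots> = 8*C^2*h^2/i^2 + 8*C^2*h^2/(d e x)^2" by (simp add: power_divide algebra_simps)
  finally have le: "dens h x <= 8*C^2*h^2/i^2 + (C^2*(D e x)^2 + 8*C^2*h^2/(d e x)^2)"
   unfolding S dens_def by (simp add: power_mult_distrib)
  show ?thesis
  proof (cases "8*C^2*h^2/i^2 <= C^2*(D e x)^2 + 8*C^2*h^2/(d e x)^2")
   case True
   have "dens h x <= 2*(C^2*(D e x)^2 + 8*C^2*h^2/(d e x)^2)"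
    unfolding mult_2 by (rule order_trans[OF le add_right_mono[OF True]])
   also have "\<dots> = 2*C^2*(D e x)^2 + 16*C^2*h^2/(d e x)^2" by (simp add: algebra_simps)
   finally show ?thesis using e far by blast
  next
   case False
   then have le': "C^2*(D e x)^2 + 8*C^2*h^2/(d e x)^2 <= 8*C^2*h^2/i^2" by simp
   have "dens h x <= 2*(8*C^2*h^2/i^2)" unfolding mult_2 by (rule order_trans[OF le add_left_mono[OF le']])
   also have "\<dots> = 16*C^2*h^2/(norm (x - w))^2" by (simp add: i_def)
   finally show ?thesis using w(1) n5 by blast
  qed
 next
  case no: False
  then have "Sb x = 0" "Mb x = C/i" using False by (simp_all add: Sb_def Mb_def w(2) i_def)
  then have "dens h x = 4*C^2*h^2/i^2" by (simp add: dens_def power_divide)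
  also have "\<dots> <= 16*C^2*h^2/i^2" by (intro divide_right_mono mult_right_mono) auto
  finally show ?thesis using w(1) n5 unfolding i_def by blast
 qed
qed

end

section \<open>Assembling all ridges of the solution\<close>

definition len :: "(real^2) \<times> (real^2) => real" where "len e = norm (snd e - fst e)"
definition dir :: "(real^2) \<times> (real^2) => real^2" where "dir e = (1/len e) *R (snd e - fst e)"

lemma edge_frame: assumes "fst e ~= snd e" shows "len e > 0" "norm (dir e) = 1" "snd e = fst e + len e *R dir e"
 using assms by (auto simp: len_def dir_def)

definition (in ma_solution) rhombic :: "(real^2) \<times> (real^2) => real^2 => real => real => bool" where
 "rhombic e m \<kappa> c \<longleftrightarrow> (\<forall>x. 0 <= (x - fst e)\<bullet>dir e --> (x - fst e)\<bullet>dir e <= len e -->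
   \<bar>(x - fst e)\<bullet>perp (dir e)\<bar> <= c*min ((x - fst e)\<bullet>dir e) (len e - (x - fst e)\<bullet>dir e) -->
   x \<in> \<Omega> \<and> v x = v (fst e) + m\<bullet>(x - fst e) + \<kappa>*\<bar>(x - fst e)\<bullet>perp (dir e)\<bar>)"

text \<open>Collects everything that does not depend on \<open>h\<close>, so that all constants
  defined from it are uniform in \<open>h\<close>.\<close>

locale ridge_system = ma_solution +
 fixes E :: "((real^2) \<times> (real^2)) set" and mm :: "(real^2) \<times> (real^2) => real^2"
  and kk :: "(real^2) \<times> (real^2) => real" and c K \<Lambda> Kc Cr :: real
 assumes finE: "finite E" and E_ridge: "!!e. e \<in> E ==> ridge (fst e) (snd e)"
  and E_all: "!!w w'. ridge w w' ==> (w, w') \<in> E \<or> (w', w) \<in> E" and c: "c > 0"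
  and rhombus: "!!e. e \<in> E ==> rhombic e (mm e) (kk e) c"
  and fat_disj: "!!e e'. e \<in> E ==> e' \<in> E ==> e ~= e' ==> fat c (fst e) (snd e) \<inter> fat c (fst e') (snd e') = {}"
  and K: "K > 0" "K-lipschitz_on UNIV dprof" "K-lipschitz_on UNIV pexc"
   "!!t. \<bar>dprof t\<bar> <= K" "!!t. \<bar>pexc t\<bar> <= K" "!!t. \<bar>psi t\<bar> <= K" "!!t. \<bar>gam t\<bar> <= K" "!!t. \<bar>dgam t\<bar> <= K"
   "!!t. \<bar>t*dgam t\<bar> <= K" "!!t. \<bar>t*((1 - (dprof t)^2)/2)\<bar> <= K" "!!t. \<bar>prof t - \<bar>t\<bar>\<bar> <= K"
  and \<Lambda>: "\<Lambda> > 0" "!!x p. x \<in> \<Omega> ==> p \<in> sub x ==> norm p <= \<Lambda>"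
  and Kc: "Kc > 0" "Kc-lipschitz_on UNIV dcut" "!!t. \<bar>dcut t\<bar> <= Kc"
  and Cr: "Cr > 0" "!!x. x \<in> \<Omega> ==> x \<notin> singular_set ==> (v has_derivative (%h. slope x\<bullet>h)) (at x)"
   "!!x. x \<in> \<Omega> ==> x \<notin> singular_set ==> lip_at slope x (Cr/infdist x vertices)"
begin

text \<open>Sums instead of maxima: one number dominates the requirements of all ridges. The cut-off
  uses the radius \<open>rho * \<eta>^3\<close>.\<close>

definition rho :: real where "rho = 1 + (\<Sum>e\<in>E. ridge_model.rad (len e) c)"
definition CC :: real where
 "CC = 1 + \<Lambda> + Kc + Cr + rho + (\<Sum>e\<in>E. ridge_model.Cs (mm e) (len e) (kk e) K) + (\<Sum>e\<in>E. (5*len e*rho) powr (2/3))"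

lemma edge: assumes "e \<in> E" shows "fst e \<in> vertices" "snd e \<in> vertices" "fst e ~= snd e"
 using E_ridge[OF assms] by (auto simp: ridge_def)

lemma rm: assumes "e \<in> E" "\<eta> > 0" shows "ridge_model (dir e) (len e) \<eta>"
 using edge_frame[OF edge(3)[OF assms(1)]] assms(2) by unfold_locales auto

lemma rad_nonneg: assumes "e \<in> E" shows "0 <= ridge_model.rad (len e) c"
proof -
 interpret R: ridge_model "fst e" "dir e" "mm e" "len e" 1 "kk e" by (rule rm[OF assms]) simp
 show ?thesis using R.thr_ge(1)[OF c] R.L by (auto simp: R.rad_def)
qed

lemma Cs_nonneg: assumes "e \<in> E" shows "0 <= ridge_model.Cs (mm e) (len e) (kk e) K"
proof -
 interpret R: ridge_model "fst e" "dir e" "mm e" "len e" 1 "kk e" by (rule rm[OF assms]) simp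
 show ?thesis using K(1) by (auto simp: R.Cs_def)
qed

lemma rho: "rho >= 1" "e \<in> E ==> ridge_model.rad (len e) c <= rho"
proof -
 show "rho >= 1" using sum_nonneg[of E "%e. ridge_model.rad (len e) c"] rad_nonneg by (simp add: rho_def)
 show "ridge_model.rad (len e) c <= rho" if "e \<in> E"
  using member_le_sum[OF that _ finE, of "%e. ridge_model.rad (len e) c"] rad_nonneg by (simp add: rho_def)
qed

lemma CC: "CC >= 1" "\<Lambda> <= CC" "Kc <= CC" "Cr <= CC" "rho <= CC" "e \<in> E ==> ridge_model.Cs (mm e) (len e) (kk e) K <= CC"
 "e \<in> E ==> (5*len e*rho) powr (2/3) <= CC"
proof -
 have 1: "0 <= (\<Sum>e\<in>E. ridge_model.Cs (mm e) (len e) (kk e) K)" by (rule sum_nonneg) (rule Cs_nonneg)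
 have 2: "0 <= (\<Sum>e\<in>E. (5*len e*rho) powr (2/3))" by (rule sum_nonneg) simp
 show "CC >= 1" "\<Lambda> <= CC" "Kc <= CC" "Cr <= CC" "rho <= CC"
  unfolding CC_def using 1 2 \<Lambda>(1) Kc(1) Cr(1) rho(1) by linarith+
 assume e: "e \<in> E"
 have 3: "ridge_model.Cs (mm e) (len e) (kk e) K <= (\<Sum>e\<in>E. ridge_model.Cs (mm e) (len e) (kk e) K)"
  by (rule member_le_sum[OF e _ finE]) (use Cs_nonneg in blast)
 have 4: "(5*len e*rho) powr (2/3) <= (\<Sum>e\<in>E. (5*len e*rho) powr (2/3))"
  by (rule member_le_sum[OF e _ finE]) simp
 show "ridge_model.Cs (mm e) (len e) (kk e) K <= CC" "(5*len e*rho) powr (2/3) <= CC"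
  unfolding CC_def using 1 2 3 4 \<Lambda>(1) Kc(1) Cr(1) rho(1) by linarith+
qed

text \<open>The first term converts the constant density on discs of radius
  \<open>5 * rho * \<eta>^3\<close> into the weight |x - w|^(-5/3); the second serves the radial
  regime.\<close>

definition "\<Gamma>0 = ((400*CC^6)^2 + 4*(75*CC^3)^2)*(5*rho) powr (5/3) + 16*CC^2"

definition "energy_const D = ((\<Sum>w\<in>vertices. 16*\<Gamma>0*(D/2) powr (1/3)) + (\<Sum>e\<in>E. 18*CC^2*ridge_model.strip_const (len e)))
  / (1 - (1/2) powr (1/3))"

end

text \<open>The conditions express that \<eta> is small: the discs are disjoint and inside \<Omega>,
  and a strip stays away from the discs of all atoms that are not its ends.\<close>

locale small_ridge_system = ridge_system +
 fixes \<eta> :: real assumes \<eta>: "\<eta> > 0"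
  and sm1: "!!w w'. w \<in> vertices ==> w' \<in> vertices ==> w ~= w' ==> 12*(rho*\<eta>^3) < norm (w - w')"
  and sm2: "!!w. w \<in> vertices ==> ball w (6*(rho*\<eta>^3)) \<subseteq> \<Omega>"
  and sm3: "!!e u z. e \<in> E ==> u \<in> vertices ==> u ~= fst e ==> u ~= snd e ==> z \<in> closed_segment (fst e) (snd e) ==>
   5*(rho*\<eta>^3) + 2*(\<eta>*((len e)^2) powr (2/3)) <= norm (u - z)"
begin

definition "St e = ridge_model.Strip (fst e) (dir e) (len e) \<eta> c"
definition "Fc e = ridge_model.Core (fst e) (dir e) (len e) \<eta>"
definition "Ze e x = v (fst e) + ridge_model.Zr (fst e) (dir e) (mm e) (len e) \<eta> (kk e) x"
definition "ge e = ridge_model.gr (fst e) (dir e) (mm e) (len e) \<eta> (kk e)"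
definition "ze e = ridge_model.zeta (fst e) (dir e) (mm e) (len e) \<eta> (kk e)"
definition "Ue e = ridge_model.Uz (fst e) (dir e) (mm e) (len e) \<eta> (kk e)"
definition "de e x = ridge_model.del (len e) \<eta> (ridge_model.S (fst e) (dir e) x)"
definition "De e x = \<eta>^2*ridge_model.W (len e) (ridge_model.S (fst e) (dir e) x) powr (-2/3)"
definition "Nul = (\<Union>e\<in>E. {x. ridge_model.Y (fst e) (dir e) x = 0})"

lemma r_pos: "rho*\<eta>^3 > 0" using rho(1) \<eta> by simp

lemma edge_props: assumes e: "e \<in> E"
 shows "open (St e)" "closed (Fc e)" "St e \<subseteq> \<Omega>" "St e \<subseteq> fat c (fst e) (snd e)" (is ?D)
  "open_segment (fst e) (snd e) \<subseteq> Fc e" (is ?E)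
  "x \<in> Fc e ==> \<forall>w\<in>vertices. rho*\<eta>^3 < norm (x - w) ==> x \<in> St e"
  "x \<in> St e ==> x \<notin> Fc e ==> Ze e x = v x \<and> ze e x = 0"
  "x \<in> St e ==> u \<in> vertices ==> norm (x - u) < 5*(rho*\<eta>^3) ==> de e x <= CC*(rho*\<eta>^3)"
  "negligible {x. ridge_model.Y (fst e) (dir e) x = 0}"
proof -
 interpret R: ridge_model "fst e" "dir e" "mm e" "len e" \<eta> "kk e" by (rule rm[OF e \<eta>])
 note fr = edge_frame[OF edge(3)[OF e]]
 show "open (St e)" unfolding St_def by (rule R.open_Strip)
 show "closed (Fc e)" unfolding Fc_def by (rule R.closed_Core)
 have rh: "x \<in> \<Omega> \<and> v x = v (fst e) + mm e\<bullet>(x - fst e) + kk e*\<bar>R.Y x\<bar>" if "x \<in> St e" for x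
 proof -
  have "0 < R.S x" "R.S x < len e" "\<bar>R.Y x\<bar> <= c*min (R.S x) (len e - R.S x)"
   using that by (auto simp: St_def R.Strip_def)
  then show ?thesis using rhombus[OF e, unfolded rhombic_def, rule_format, of x] unfolding R.S_def R.Y_def R.n_def by auto
 qed
 then show "St e \<subseteq> \<Omega>" by blast
 show ?D using R.Strip_fat[of _ c] unfolding St_def fr(3)[symmetric] by blast
 show ?E
 proof
  fix x assume "x \<in> open_segment (fst e) (snd e)"
  then obtain t where t: "0 < t" "t < 1" "x = (1 - t) *R fst e + t *R snd e" unfolding in_segment by blast
  have "x - fst e = (t*len e) *R dir e" unfolding t(3) fr(3) by (simp add: algebra_simps)
  then have "R.S x = t*len e" "R.Y x = 0" by (simp_all add: R.S_def R.Y_def R.\<tau>\<tau> R.n\<tau>)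
  moreover have "0 <= R.del (t*len e)" using \<eta> by (simp add: R.del_def)
  ultimately show "x \<in> Fc e" using t R.L by (simp add: Fc_def R.Core_def)
 qed
 have far: "norm (x - fst e) >= R.rad c*\<eta>^3" "norm (x - (fst e + len e *R dir e)) >= R.rad c*\<eta>^3"
  if "\<forall>w\<in>vertices. rho*\<eta>^3 < norm (x - w)" for x
 proof -
  have "R.rad c*\<eta>^3 <= rho*\<eta>^3" using rho(2)[OF e] \<eta> by (intro mult_right_mono) auto
  moreover have "rho*\<eta>^3 < norm (x - fst e)" "rho*\<eta>^3 < norm (x - snd e)" using that edge[OF e] by auto
  ultimately show "norm (x - fst e) >= R.rad c*\<eta>^3" "norm (x - (fst e + len e *R dir e)) >= R.rad c*\<eta>^3"
   unfolding fr(3)[symmetric] by linarith+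
 qed
 show "x \<in> Fc e ==> \<forall>w\<in>vertices. rho*\<eta>^3 < norm (x - w) ==> x \<in> St e"
  unfolding Fc_def St_def by (rule R.Core_far_Strip[OF c _ far])
 show "Ze e x = v x \<and> ze e x = 0" if "x \<in> St e" "x \<notin> Fc e"
  using R.Strip_outside_Core[of x c] that rh[OF that(1)] by (simp add: Ze_def ze_def St_def Fc_def)
 show "negligible {x. R.Y x = 0}" by (rule R.negligible_axis)
 assume x: "x \<in> St e" and u: "u \<in> vertices" and near: "norm (x - u) < 5*(rho*\<eta>^3)"
 have s: "0 < R.S x" "R.S x < len e" and y: "\<bar>R.Y x\<bar> < 2 * R.del (R.S x)" using x by (auto simp: St_def R.Strip_def)
 \<comment> \<open>A point of the strip is closer than \<open>2 * del\<close> to the edge, so by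
   \<open>sm3\<close> it is close to no atom other than the two ends.\<close>
 have ends: "u = fst e \<or> u = snd e"
 proof (rule ccontr)
  assume "\<not> (u = fst e \<or> u = snd e)"
  then have ne: "u ~= fst e" "u ~= snd e" by auto
  define z where "z = fst e + R.S x *R dir e"
  have "z = (1 - R.S x/len e) *R fst e + (R.S x/len e) *R snd e"
   unfolding z_def fr(3) using fr(1) by (simp add: algebra_simps)
  then have zs: "z \<in> closed_segment (fst e) (snd e)" unfolding in_segment using s by (intro exI[of _ "R.S x/len e"]) simp
  have "x - z = R.Y x *R R.n" using R.decomposition[of x] by (simp add: z_def algebra_simps)
  then have "norm (x - z) = \<bar>R.Y x\<bar>" by (simp add: R.norm_n)
  moreover have "R.del (R.S x) <= \<eta>*((len e)^2) powr (2/3)"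
  proof -
   have "R.W (R.S x) <= (len e)^2" unfolding R.W_def power2_eq_square using s by (intro mult_mono) auto
   then show ?thesis using R.W_pos[OF s] \<eta> by (simp add: R.del_def powr_mono2)
  qed
  ultimately have "norm (u - z) < 5*(rho*\<eta>^3) + 2*(\<eta>*((len e)^2) powr (2/3))"
   using norm_triangle_ineq[of "u - x" "x - z"] near y by (simp add: norm_minus_commute)
  then show False using sm3[OF e u ne zs] by linarith
 qed
 define t where "t = 5*(rho*\<eta>^3)"
 have "R.del (R.S x) <= \<eta>*(len e*t) powr (2/3)"
  by (rule R.del_small[of x c]) (use x ends near in \<open>auto simp: St_def t_def fr(3)[symmetric]\<close>)
 also have "(len e*t) powr (2/3) = (5*len e*rho) powr (2/3)*\<eta>^2"
 proof -
  have "len e*t = (5*len e*rho)*\<eta>^3" by (simp add: t_def)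
  then show ?thesis by (simp only: powr_mult R.powr_cubes(1)[OF \<eta>])
 qed
 also have "\<eta>*((5*len e*rho) powr (2/3)*\<eta>^2) <= \<eta>*(CC*\<eta>^2)"
  using CC(7)[OF e] \<eta> by (intro mult_left_mono mult_right_mono) auto
 also have "\<dots> = CC*(1*\<eta>^3)" by (simp add: power2_eq_square power3_eq_cube)
 also have "\<dots> <= CC*(rho*\<eta>^3)" using CC(1) rho(1) \<eta> by (intro mult_left_mono mult_right_mono) auto
 finally show "de e x <= CC*(rho*\<eta>^3)" by (simp add: de_def)
qed

lemma edge_bounds:
 assumes e: "e \<in> E" and x: "x \<in> St e" and far: "\<forall>w\<in>vertices. rho*\<eta>^3 < norm (x - w)"
 shows "(Ze e has_derivative (%h. ge e x\<bullet>h)) (at x) \<and> norm (ge e x) <= CC \<and> lip_at (ge e) x (CC/de e x) \<and>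
   lip_at (ze e) x CC \<and> \<bar>Ze e x - v x\<bar> <= CC*de e x \<and> norm (ze e x) <= CC*de e x \<and> rho*\<eta>^3 <= CC*de e x \<and>
   (x \<notin> Nul --> (ze e has_derivative (%h. Ue e x *v h)) (at x) \<and>
    (\<exists>p. (v has_derivative (%h. p\<bullet>h)) (at x) \<and>
     norm (Ue e x + transpose (Ue e x) + tensor (ge e x) (ge e x) - tensor p p) <= CC*De e x))"
proof -
 interpret R: ridge_model "fst e" "dir e" "mm e" "len e" \<eta> "kk e" by (rule rm[OF e \<eta>])
 note fr = edge_frame[OF edge(3)[OF e]]
 have xs: "x \<in> R.Strip c" using x by (simp add: St_def)
 have s: "0 < R.S x" "R.S x < len e" using xs by (auto simp: R.Strip_def)
 have "R.rad c*\<eta>^3 <= rho*\<eta>^3" using rho(2)[OF e] \<eta> by (intro mult_right_mono) auto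
 moreover have "rho*\<eta>^3 < norm (x - fst e)" "rho*\<eta>^3 < norm (x - snd e)" using far edge[OF e] by auto
 ultimately have f: "norm (x - fst e) >= R.rad c*\<eta>^3" "norm (x - (fst e + len e *R dir e)) >= R.rad c*\<eta>^3"
  unfolding fr(3)[symmetric] by linarith+
 note B = R.Strip_bounds[OF c xs f K]
 have C: "R.Cs K <= CC" by (rule CC(6)[OF e])
 have dp: "R.del (R.S x) > 0" by (rule R.del_pos[OF s])
 have Cd: "R.Cs K * R.del (R.S x) <= CC * R.del (R.S x)" using C dp by (intro mult_right_mono) auto
 have rh: "v y = v (fst e) + mm e\<bullet>(y - fst e) + kk e*\<bar>R.Y y\<bar>" if "y \<in> St e" for y
 proof -
  have "0 < R.S y" "R.S y < len e" "\<bar>R.Y y\<bar> <= c*min (R.S y) (len e - R.S y)"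
   using that by (auto simp: St_def R.Strip_def)
  then show ?thesis using rhombus[OF e, unfolded rhombic_def, rule_format, of y] unfolding R.S_def R.Y_def R.n_def by auto
 qed
 have 1: "(Ze e has_derivative (%h. ge e x\<bullet>h)) (at x)" unfolding Ze_def[abs_def] ge_def
  by (rule has_derivative_eq_rhs[OF has_derivative_add[OF has_derivative_const B(1)]]) simp
 have 2: "norm (ge e x) <= CC" unfolding ge_def using B(2) C by linarith
 have 3: "lip_at (ge e) x (CC/de e x)"
  unfolding ge_def de_def by (rule lip_at_mono[OF B(3) divide_right_mono[OF C]]) (use dp in simp)
 have 4: "lip_at (ze e) x CC" unfolding ze_def by (rule lip_at_mono[OF B(4) C])
 have 5: "\<bar>Ze e x - v x\<bar> <= CC*de e x" using B(5) Cd rh[OF x] by (simp add: Ze_def de_def R.Zr_def)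
 have 6: "norm (ze e x) <= CC*de e x" using B(6) Cd by (simp add: ze_def de_def)
 have 7: "rho*\<eta>^3 <= CC*de e x" unfolding de_def using CC(1,5) B(7) \<eta> rho(1) by (intro mult_mono) auto
 have 8: "(ze e has_derivative (%h. Ue e x *v h)) (at x) \<and>
    (\<exists>p. (v has_derivative (%h. p\<bullet>h)) (at x) \<and>
     norm (Ue e x + transpose (Ue e x) + tensor (ge e x) (ge e x) - tensor p p) <= CC*De e x)" if "x \<notin> Nul"
 proof -
  have Y: "R.Y x ~= 0" using that e by (auto simp: Nul_def)
  have a: "(ze e has_derivative (%h. Ue e x *v h)) (at x)" unfolding ze_def Ue_def by (rule B(8)[OF Y])
  let ?p = "mm e + (kk e * sgn (R.Y x)) *R R.n"
  have "((%y. v (fst e) + mm e\<bullet>(y - fst e) + kk e*\<bar>R.Y y\<bar>) has_derivative (%h. 0 + mm e\<bullet>(h - 0) + kk e*((sgn (R.Y x) *R R.n)\<bullet>h))) (at x)"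
   by (intro has_derivative_add has_derivative_const has_derivative_inner_right has_derivative_diff has_derivative_ident
     has_derivative_mult_right R.absY_deriv[OF s Y])
  then have "((%y. v (fst e) + mm e\<bullet>(y - fst e) + kk e*\<bar>R.Y y\<bar>) has_derivative (%h. ?p\<bullet>h)) (at x)"
   by (rule has_derivative_eq_rhs) (simp add: fun_eq_iff inner_add_left)
  then have "(v has_derivative (%h. ?p\<bullet>h)) (at x)"
   by (rule has_derivative_transform_within_open[OF _ edge_props(1)[OF e] x]) (simp add: rh)
  moreover have "norm (Ue e x + transpose (Ue e x) + tensor (ge e x) (ge e x) - tensor ?p ?p) <= CC*De e x"
   unfolding Ue_def ge_def De_def by (rule order_trans[OF B(9)[OF Y] mult_right_mono[OF C]]) simp
  ultimately show ?thesis using a by blast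
 qed
 show ?thesis using 1 2 3 4 5 6 7 8 by blast
qed

sublocale corrugation \<Omega> N a \<sigma> v E St Fc Ze ge ze Ue de De "rho*\<eta>^3" CC Nul
proof (intro corrugation.intro corrugation_axioms.intro ma_solution_axioms)
 show "negligible Nul" unfolding Nul_def using finE edge_props(9) by (intro negligible_Union) auto
 show "e = e'" if "e \<in> E" "e' \<in> E" "x \<in> St e" "x \<in> St e'" for e e' x
  using fat_disj[OF that(1,2)] edge_props(4)[OF that(1)] edge_props(4)[OF that(2)] that(3,4) by blast
 show "singular_set \<subseteq> vertices \<union> (\<Union>e\<in>E. Fc e)"
 proof -
  have "open_segment w w' \<subseteq> (\<Union>e\<in>E. Fc e)" if "ridge w w'" for w w'
   using E_all[OF that] edge_props(5)[of "(w, w')"] edge_props(5)[of "(w', w)"] by (auto simp: open_segment_commute[of w w'])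
  then show ?thesis unfolding singular_set_eq ridges_def by blast
 qed
 show "lip_at slope x (CC/infdist x vertices)" if "x \<in> \<Omega>" "x \<notin> singular_set" for x
  by (rule lip_at_mono[OF Cr(3)[OF that] divide_right_mono[OF CC(4) infdist_nonneg]])
 show "norm p <= CC" if "x \<in> \<Omega>" "p \<in> sub x" for x p using \<Lambda>(2)[OF that] CC(2) by linarith
 show "CC-lipschitz_on UNIV dcut" by (rule lipschitz_on_mono[OF Kc(2)]) (use CC in auto)
 show "\<bar>dcut t\<bar> <= CC" for t using Kc(3)[of t] CC(3) by linarith
qed (fact finE r_pos CC(1) edge_props Cr sm1 sm2 edge_bounds)+

lemma powr_fifths: "\<eta>^5 = (\<eta>^3) powr (5/3)"
proof -
 have "\<eta>^3 = \<eta> powr 3" using \<eta> by (simp add: powr_numeral)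
 then have "(\<eta>^3) powr (5/3) = \<eta> powr 5" by (simp add: powr_powr)
 then show ?thesis using \<eta> by (simp add: powr_numeral)
qed

text \<open>Discs and radial regime share one weight: h^2/|x|^2 <= h^(5/3) |x|^(-5/3) as long as h
  <= |x|. This loses nothing against the energy of the strips, and unlike |x|^(-2) the weight is
  integrable at the atoms.\<close>

lemma density_bound: assumes x: "x \<in> \<Omega>" "x \<notin> vertices"
 shows "(\<exists>w\<in>vertices. dens (\<eta>^3) x <= \<Gamma>0*\<eta>^5*norm (x - w) powr (-5/3)) \<or>
  (\<exists>e\<in>E. x \<in> St e \<and> dens (\<eta>^3) x
   <= 18*CC^2*\<eta>^4*ridge_model.W (len e) (ridge_model.S (fst e) (dir e) x) powr (-4/3))"
proof -
 let ?f = "dens (\<eta>^3) x"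
 let ?r = "rho*\<eta>^3"
 have e3: "\<eta>^3 > 0" using \<eta> by simp
 define N0 where "N0 = (400*CC^6)^2 + 4*(75*CC^3)^2"
 have N0: "0 <= N0" by (simp add: N0_def)
 have G0: "\<Gamma>0 = N0*(5*rho) powr (5/3) + 16*CC^2" by (simp add: \<Gamma>0_def N0_def)
 have nw: "norm (x - w) > 0" if "w \<in> vertices" for w using x(2) that by auto
 consider (near) w where "w \<in> vertices" "norm (x - w) < 5 * ?r" "?f = (400*CC^6)^2 + 4*(75*CC^3)^2*(\<eta>^3 / ?r)^2"
  | (radial) w where "w \<in> vertices" "5 * ?r <= norm (x - w)" "?f <= 16*CC^2*(\<eta>^3)^2/(norm (x - w))^2"
  | (strip) e where "e \<in> E" "x \<in> St e" "?f <= 2*CC^2*(De e x)^2 + 16*CC^2*(\<eta>^3)^2/(de e x)^2"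
  using density_cases[OF x(1), of "\<eta>^3"] by blast
 then show ?thesis
 proof cases
  case near
  have "\<eta>^3 / ?r <= 1" using rho(1) e3 by simp
  then have "(\<eta>^3 / ?r)^2 <= 1" using rho(1) e3 by (intro power_le_one) auto
  then have "?f <= N0" unfolding near(3) N0_def by (intro add_left_mono mult_left_le) auto
  also have "N0 <= N0*((5 * ?r) powr (5/3)*norm (x - w) powr (-5/3))"
  proof -
   have "1 = norm (x - w) powr (5/3)*norm (x - w) powr (-5/3)" using nw[OF near(1)] by (simp add: powr_add[symmetric])
   also have "\<dots> <= (5 * ?r) powr (5/3)*norm (x - w) powr (-5/3)"
    using near(2) by (intro mult_right_mono powr_mono2) auto
   finally show ?thesis using mult_left_mono[OF _ N0] by fastforce
  qed
  also have "(5 * ?r) powr (5/3) = (5*rho) powr (5/3)*\<eta>^5"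
   unfolding powr_fifths by (simp add: powr_mult[symmetric] mult.assoc)
  also have "N0*((5*rho) powr (5/3)*\<eta>^5*norm (x - w) powr (-5/3))
    = (N0*(5*rho) powr (5/3))*(\<eta>^5*norm (x - w) powr (-5/3))" by (simp only: mult_ac)
  also have "\<dots> <= \<Gamma>0*(\<eta>^5*norm (x - w) powr (-5/3))" unfolding G0 using \<eta> by (intro mult_right_mono) auto
  finally show ?thesis using near(1) by (auto simp: mult.assoc)
 next
  case radial
  let ?n = "norm (x - w)"
  have n0: "?n > 0" by (rule nw[OF radial(1)])
  have "\<eta>^3 <= ?n" using radial(2) mult_right_mono[OF rho(1), of "\<eta>^3"] e3 by linarith
  then have "(\<eta>^3) powr (1/3) <= ?n powr (1/3)" using e3 by (intro powr_mono2) auto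
  have n2: "?n^2 = ?n powr (5/3) * ?n powr (1/3)" using n0 by (simp add: powr_add[symmetric] powr_numeral)
  have h2: "(\<eta>^3)^2 = \<eta>^5*(\<eta>^3) powr (1/3)"
  proof -
   have "(\<eta>^3)^2 = (\<eta>^3) powr (5/3)*(\<eta>^3) powr (1/3)" using e3 by (simp add: powr_add[symmetric] powr_numeral)
   then show ?thesis by (simp add: powr_fifths)
  qed
  have "(\<eta>^3)^2 / ?n^2 <= \<eta>^5 * ?n powr (1/3) / ?n^2"
   unfolding h2 using \<open>(\<eta> ^ 3) powr (1/3) <= ?n powr (1/3)\<close> \<eta> by (intro divide_right_mono mult_left_mono) auto
  also have "\<dots> = \<eta>^5 * ?n powr (-5/3)" unfolding n2 using n0 powr_minus_divide[of ?n "5/3"] by simp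
  finally have "16*CC^2*((\<eta>^3)^2 / ?n^2) <= 16*CC^2*(\<eta>^5 * ?n powr (-5/3))" by (intro mult_left_mono) auto
  also have "\<dots> <= \<Gamma>0*(\<eta>^5 * ?n powr (-5/3))" unfolding G0 using \<eta> N0 by (intro mult_right_mono) auto
  finally show ?thesis using radial(1,3) by (intro disjI1 bexI[of _ w]) (auto simp: mult.assoc)
 next
  case (strip e)
  interpret R: ridge_model "fst e" "dir e" "mm e" "len e" \<eta> "kk e" by (rule rm[OF strip(1) \<eta>])
  have s: "0 < R.S x" "R.S x < len e" using strip(2) by (auto simp: St_def R.Strip_def)
  define w where "w = R.W (R.S x)"
  have w: "w > 0" using R.W_pos[OF s] by (simp add: w_def)
  have "(w powr (-2/3))^2 = w powr (-4/3)" by (simp add: power2_eq_square powr_add[symmetric])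
  then have D: "(De e x)^2 = \<eta>^4*w powr (-4/3)"
   by (simp add: De_def w_def[symmetric] power_mult_distrib power_mult[symmetric])
  have "(w powr (2/3))^2 = w powr (4/3)" by (simp add: power2_eq_square powr_add[symmetric])
  then have "(de e x)^2 = \<eta>^2*w powr (4/3)" using w by (simp add: de_def R.del_def w_def[symmetric] power_mult_distrib)
  then have "(\<eta>^3)^2/(de e x)^2 = (\<eta>^2*\<eta>^4)/(\<eta>^2*w powr (4/3))"
   by (simp add: power_mult[symmetric] power_add[symmetric])
  also have "\<dots> = \<eta>^4/w powr (4/3)" by (rule nonzero_mult_divide_mult_cancel_left) (use \<eta> in simp)
  also have "\<dots> = \<eta>^4*w powr (-4/3)" using powr_minus_divide[of w "4/3"] by simp
  finally have d: "16*CC^2*(\<eta>^3)^2/(de e x)^2 = 16*CC^2*(\<eta>^4*w powr (-4/3))"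
   by (metis times_divide_eq_right)
  have "?f <= 2*CC^2*(\<eta>^4*w powr (-4/3)) + 16*CC^2*(\<eta>^4*w powr (-4/3))" using strip(3) unfolding D d .
  also have "\<dots> = 18*CC^2*\<eta>^4*w powr (-4/3)" by (simp add: mult.assoc)
  finally have "?f <= 18*CC^2*\<eta>^4*w powr (-4/3)" .
  then show ?thesis using strip(1,2) by (auto simp: w_def)
 qed
qed

lemma energy_bound: assumes D: "D > 0" "!!x w. x \<in> \<Omega> ==> w \<in> vertices ==> norm (x - w) < D"
 shows "energy \<Omega> v (\<eta>^3) u V <= ennreal (energy_const D*(\<eta>^3) powr (5/3))"
proof -
 define t where "t k = D/2*(1/2)^k" for k :: nat
 \<comment> \<open>The sum type indexes atoms by \<open>Inl\<close> and ridges by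
   \<open>Inr\<close>, so that one dyadic sum treats both.\<close>
 define A :: "(real^2) + ((real^2) \<times> (real^2)) => nat => (real^2) set" where
  "A = case_sum (%w k. ball w (2*t k)) (%e. ridge_model.Ak (fst e) (dir e) (len e) \<eta>)"
 define m :: "(real^2) + ((real^2) \<times> (real^2)) => nat => real" where
  "m = case_sum (%w k. 16*(t k)^2) (%e. ridge_model.mk (len e) \<eta>)"
 define \<Gamma> where "\<Gamma> = \<Gamma>0*\<eta>^5"
 define \<Gamma>' where "\<Gamma>' = 18*CC^2*\<eta>^4"
 have G: "\<Gamma> >= 0" "\<Gamma>' >= 0" using \<eta> by (auto simp: \<Gamma>_def \<Gamma>'_def \<Gamma>0_def)
 define cf :: "(real^2) + ((real^2) \<times> (real^2)) => nat => real" where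
  "cf = case_sum (%w k. \<Gamma>*t k powr (-5/3)) (%e k. \<Gamma>' * (len e/2*ridge_model.tk (len e) k) powr (-4/3))"
 define B :: "(real^2) + ((real^2) \<times> (real^2)) => real" where
  "B = case_sum (%w. 16*\<Gamma>*(D/2) powr (1/3)) (%e. \<Gamma>' * \<eta>*ridge_model.strip_const (len e))"
 define q :: real where "q = (1/2) powr (1/3)"
 define I where "I = Inl ` vertices \<union> Inr ` E"
 note rc = radial_cover[OF D(1) G(1), folded t_def]
 have sc: "A (Inr e) k \<in> sets lebesgue" "emeasure lebesgue (A (Inr e) k) <= ennreal (m (Inr e) k)" "0 <= m (Inr e) k"
  "cf (Inr e) k*m (Inr e) k <= B (Inr e)*q^k"
  "x \<in> St e ==> \<exists>k. x \<in> A (Inr e) k \<and> \<Gamma>' * ridge_model.W (len e) (ridge_model.S (fst e) (dir e) x) powr (-4/3) <= cf (Inr e) k"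
  if "e \<in> E" for e k x
 proof -
  interpret R: ridge_model "fst e" "dir e" "mm e" "len e" \<eta> "kk e" by (rule rm[OF that \<eta>])
  show "A (Inr e) k \<in> sets lebesgue" "emeasure lebesgue (A (Inr e) k) <= ennreal (m (Inr e) k)" "0 <= m (Inr e) k"
   "cf (Inr e) k*m (Inr e) k <= B (Inr e)*q^k"
   "x \<in> St e ==> \<exists>k. x \<in> A (Inr e) k \<and> \<Gamma>' * R.W (R.S x) powr (-4/3) <= cf (Inr e) k"
   using R.strip_cover[OF G(2)] by (simp_all only: A_def m_def cf_def B_def q_def St_def sum.case)
 qed
 have q: "0 <= q" "q < 1" using powr_less_mono2[of "1/3" "1/2" 1] by (auto simp: q_def)
 have "(\<integral>\<^sup>+x\<in>\<Omega>. ennreal (dens (\<eta>^3) x) \<partial>lebesgue) <= ennreal ((\<Sum>i\<in>I. B i)/(1 - q))"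
 proof (rule dyadic_nn_integral[where A = A and m = m and c = cf])
  show "finite I" using vertices_props(1) finE by (simp add: I_def)
  show "A i k \<in> sets lebesgue" "emeasure lebesgue (A i k) <= ennreal (m i k)" "0 <= cf i k" "0 <= m i k"
   "cf i k*m i k <= B i*q^k" if "i \<in> I" for i k
   using that sc rc G unfolding I_def by (auto simp: A_def m_def cf_def B_def q_def)
  have "vertices \<in> null_sets lebesgue" using negligible_finite[OF vertices_props(1)] by (simp add: negligible_iff_null_sets)
  from AE_not_in[OF this]
  show "AE x\<in>\<Omega> in lebesgue. (\<exists>i\<in>I. \<exists>k. x \<in> A i k \<and> ennreal (dens (\<eta>^3) x) <= ennreal (cf i k))"
  proof eventually_elim
   case (elim x)
   show ?case
   proof
    assume x: "x \<in> \<Omega>"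
    show "\<exists>i\<in>I. \<exists>k. x \<in> A i k \<and> ennreal (dens (\<eta>^3) x) <= ennreal (cf i k)"
     using density_bound[OF x elim]
    proof (elim disjE bexE conjE)
     fix w assume w: "w \<in> vertices" and le: "dens (\<eta>^3) x <= \<Gamma>0*\<eta>^5*norm (x - w) powr (-5/3)"
     obtain k where k: "x \<in> ball w (2*t k)" "\<Gamma>*norm (x - w) powr (-5/3) <= \<Gamma>*t k powr (-5/3)"
      using rc(4)[of x w] D(2)[OF x w] elim w by blast
     show ?thesis
     proof (intro bexI[of _ "Inl w"] exI[of _ k] conjI ennreal_leI)
      show "x \<in> A (Inl w) k" using k(1) by (simp add: A_def)
      show "dens (\<eta>^3) x <= cf (Inl w) k" using le k(2) by (simp add: cf_def \<Gamma>_def)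
     qed (use w in \<open>simp add: I_def\<close>)
    next
     fix e assume e: "e \<in> E" "x \<in> St e" and le: "dens (\<eta>^3) x
      <= 18*CC^2*\<eta>^4*ridge_model.W (len e) (ridge_model.S (fst e) (dir e) x) powr (-4/3)"
     obtain k where k: "x \<in> A (Inr e) k" "\<Gamma>' * ridge_model.W (len e) (ridge_model.S (fst e) (dir e) x) powr (-4/3) <= cf (Inr e) k"
      using sc(5)[OF e] by blast
     show ?thesis
     proof (intro bexI[of _ "Inr e"] exI[of _ k] conjI ennreal_leI k(1))
      show "dens (\<eta>^3) x <= cf (Inr e) k" using le k(2) unfolding \<Gamma>'_def by linarith
     qed (use e in \<open>simp add: I_def\<close>)
    qed
   qed
  qed
 qed (use q in auto)
 also have "(\<Sum>i\<in>I. B i)/(1 - q) = energy_const D*\<eta>^5"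
 proof -
  have "(\<Sum>i\<in>I. B i) = (\<Sum>w\<in>vertices. B (Inl w)) + (\<Sum>e\<in>E. B (Inr e))"
   unfolding I_def using vertices_props(1) finE by (subst sum.union_disjoint) (auto simp: sum.reindex)
  also have "\<dots> = (\<Sum>w\<in>vertices. 16*\<Gamma>0*(D/2) powr (1/3))*\<eta>^5 + (\<Sum>e\<in>E. 18*CC^2*ridge_model.strip_const (len e))*\<eta>^5"
   unfolding sum_distrib_right by (simp add: B_def \<Gamma>_def \<Gamma>'_def mult_ac eval_nat_numeral)
  finally show ?thesis unfolding energy_const_def q_def by (simp add: distrib_right add_divide_distrib)
 qed
 finally show ?thesis using corrugation_energy(3)[of "\<eta>^3"] unfolding powr_fifths by (rule order_trans[rotated])
qed

end

lemma finite_uniform_pos: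
 fixes P :: "'a => real => bool" assumes "finite A" and ex: "!!x. x \<in> A ==> \<exists>c>0. P x c"
  and mono: "!!x c c'. P x c ==> 0 < c' ==> c' <= c ==> P x c'" shows "\<exists>c>0. \<forall>x\<in>A. P x c"
proof -
 obtain f where f: "!!x. x \<in> A ==> f x > 0 \<and> P x (f x)" using ex by metis
 have fin: "finite (insert 1 (f ` A))" using assms(1) by simp
 have "Min (insert 1 (f ` A)) > 0" using fin f by (subst Min_gr_iff) auto
 moreover have "P x (Min (insert 1 (f ` A)))" if "x \<in> A" for x
  by (rule mono[of x "f x"]) (use f[OF that] fin that \<open>Min _ > 0\<close> in auto)
 ultimately show ?thesis by blast
qed

context ma_solution
begin

lemma rhombic_mono: assumes P: "rhombic e m \<kappa> c" and c: "c' <= c" shows "rhombic e m \<kappa> c'" unfolding rhombic_def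
proof (intro allI impI)
 fix x assume h: "0 <= (x - fst e)\<bullet>dir e" "(x - fst e)\<bullet>dir e <= len e"
  "\<bar>(x - fst e)\<bullet>perp (dir e)\<bar> <= c' * min ((x - fst e)\<bullet>dir e) (len e - (x - fst e)\<bullet>dir e)"
 have "c' * min ((x - fst e)\<bullet>dir e) (len e - (x - fst e)\<bullet>dir e) <= c*min ((x - fst e)\<bullet>dir e) (len e - (x - fst e)\<bullet>dir e)"
  using c h(1,2) by (intro mult_right_mono) auto
 then show "x \<in> \<Omega> \<and> v x = v (fst e) + m\<bullet>(x - fst e) + \<kappa>*\<bar>(x - fst e)\<bullet>perp (dir e)\<bar>"
  using P h unfolding rhombic_def by (meson order_trans)
qed

lemma ridge_rhombic: assumes "ridge (fst e) (snd e)" shows "\<exists>m \<kappa>. \<exists>c>0. rhombic e m \<kappa> c"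
proof -
 obtain p q where R: "fst e \<in> vertices" "snd e \<in> vertices" "fst e ~= snd e" "p \<in> sub (fst e)" "p \<in> sub (snd e)"
  "q \<in> sub (fst e)" "q \<in> sub (snd e)" using assms by (auto simp: ridge_def)
 note fr = edge_frame[OF R(3)]
 have d: "snd e - fst e = len e *R dir e" using fr(3) by (metis add_diff_cancel_left')
 show ?thesis
 proof (rule edge_rhombus[OF R d fr(1,2)])
  fix m \<kappa> c
  assume c: "c > 0" and E: "!!s y. 0 <= s ==> s <= len e ==> \<bar>y\<bar> <= c*min s (len e - s) ==>
    fst e + s *R dir e + y *R perp (dir e) \<in> \<Omega> \<and>
    v (fst e + s *R dir e + y *R perp (dir e)) = v (fst e) + m\<bullet>(s *R dir e + y *R perp (dir e)) + \<kappa>*\<bar>y\<bar>"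
  have o: "((x - fst e)\<bullet>dir e) *R dir e + ((x - fst e)\<bullet>perp (dir e)) *R perp (dir e) = x - fst e" for x
   by (rule orthonormal_decomposition[OF fr(2), symmetric])
  have "rhombic e m \<kappa> c" unfolding rhombic_def
  proof (intro allI impI)
   fix x assume h: "0 <= (x - fst e)\<bullet>dir e" "(x - fst e)\<bullet>dir e <= len e"
    "\<bar>(x - fst e)\<bullet>perp (dir e)\<bar> <= c*min ((x - fst e)\<bullet>dir e) (len e - (x - fst e)\<bullet>dir e)"
   show "x \<in> \<Omega> \<and> v x = v (fst e) + m\<bullet>(x - fst e) + \<kappa>*\<bar>(x - fst e)\<bullet>perp (dir e)\<bar>"
    using E[OF h] unfolding add.assoc o by simp
  qed
  then show ?thesis using c by blast
 qed
qed

lemma ridge_system_exists: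
 assumes r: "r > 0" "!!b. b \<in> frontier \<Omega> ==> \<exists>\<nu>. norm \<nu> = 1 \<and> cball (b - r *R \<nu>) r \<subseteq> closure \<Omega>"
 shows "\<exists>E mm kk c K \<Lambda> Kc Cr. ridge_system \<Omega> N a \<sigma> v E mm kk c K \<Lambda> Kc Cr"
proof -
 \<comment> \<open>The order of the indices picks one orientation of each ridge; with both, the
   strips of a ridge and of its reversal would overlap.\<close>
 define E where "E = {(a i, a j) | i j. i \<in> {1..N} \<and> j \<in> {1..N} \<and> i < j \<and> ridge (a i) (a j)}"
 have "E \<subseteq> vertices \<times> vertices" by (auto simp: E_def vertices_def)
 from finite_subset[OF this finite_cartesian_product[OF vertices_props(1,1)]] have finE: "finite E" .
 have E_ridge: "ridge (fst e) (snd e)" if "e \<in> E" for e using that by (auto simp: E_def)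
 have E_all: "(w, w') \<in> E \<or> (w', w) \<in> E" if R: "ridge w w'" for w w'
 proof -
  have "w \<in> vertices" "w' \<in> vertices" "w ~= w'" using R by (auto simp: ridge_def)
  moreover obtain i where "i \<in> {1..N}" "w = a i" using \<open>w \<in> vertices\<close> unfolding vertices_def by blast
  moreover obtain j where "j \<in> {1..N}" "w' = a j" using \<open>w' \<in> vertices\<close> unfolding vertices_def by blast
  ultimately have ij: "i \<in> {1..N}" "j \<in> {1..N}" "w = a i" "w' = a j" "i ~= j" by auto
  have R': "ridge w' w" using R ridge_commute by blast
  show ?thesis
  proof (cases "i < j")
   case True
   then show ?thesis unfolding E_def using ij R by blast
  next
   case False
   then have "j < i" using ij(5) by simp
   then show ?thesis unfolding E_def using ij R' by blast
  qed
 qed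
 have pairs: "{fst e, snd e} ~= {fst e', snd e'}" if ee: "e \<in> E" "e' \<in> E" "e ~= e'" for e e'
 proof
  assume eq: "{fst e, snd e} = {fst e', snd e'}"
  obtain i j where ij: "e = (a i, a j)" "i \<in> {1..N}" "j \<in> {1..N}" "i < j" using ee(1) by (auto simp: E_def)
  obtain i' j' where ij': "e' = (a i', a j')" "i' \<in> {1..N}" "j' \<in> {1..N}" "i' < j'" using ee(2) by (auto simp: E_def)
  have "(a i = a i' \<and> a j = a j') \<or> (a i = a j' \<and> a j = a i')" using eq ij(1) ij'(1) by (simp add: doubleton_eq_iff)
  then have "(i = i' \<and> j = j') \<or> (i = j' \<and> j = i')" using inj_a ij ij' by (auto dest: inj_onD)
  then show False using ee(3) ij ij' by auto
 qed
 have "\<forall>e\<in>E. \<exists>t. \<exists>c>0. rhombic e (fst t) (snd t) c" using ridge_rhombic[OF E_ridge] by simp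
 from bchoice[OF this] obtain g where g: "\<forall>e\<in>E. \<exists>c>0. rhombic e (fst (g e)) (snd (g e)) c" by blast
 have "\<exists>c>0. \<forall>e\<in>E. rhombic e (fst (g e)) (snd (g e)) c"
  by (rule finite_uniform_pos[OF finE]) (use g rhombic_mono in blast)+
 then obtain c1 where c1: "c1 > 0" "!!e. e \<in> E ==> rhombic e (fst (g e)) (snd (g e)) c1" by blast
 define Q where "Q ee c \<longleftrightarrow> (fst ee ~= snd ee -->
   fat c (fst (fst ee)) (snd (fst ee)) \<inter> fat c (fst (snd ee)) (snd (snd ee)) = {})" for ee :: "((real^2) \<times> (real^2)) \<times> (real^2) \<times> (real^2)" and c :: real
 have "\<exists>c>0. \<forall>ee\<in>E \<times> E. Q ee c"
 proof (rule finite_uniform_pos)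
  show "finite (E \<times> E)" using finE by simp
  show "\<exists>c>0. Q ee c" if "ee \<in> E \<times> E" for ee
  proof (cases "fst ee = snd ee")
   case True
   then show ?thesis by (intro exI[of _ 1]) (simp add: Q_def)
  next
   case False
   have "fst ee \<in> E" "snd ee \<in> E" using that by auto
   from ridges_fat_disjoint[OF E_ridge[OF this(1)] E_ridge[OF this(2)] pairs[OF this False]]
   show ?thesis unfolding Q_def by blast
  qed
  show "Q ee c'" if "Q ee c" "0 < c'" "c' <= c" for ee c c' using that fat_mono[OF that(3)] unfolding Q_def by blast
 qed
 then obtain c2 where c2: "c2 > 0" "!!ee. ee \<in> E \<times> E ==> Q ee c2" by blast
 define c where "c = min c1 c2"
 have c: "c > 0" "c <= c1" "c <= c2" using c1(1) c2(1) by (auto simp: c_def)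
 obtain K where K: "K > 0" "K-lipschitz_on UNIV dprof" "K-lipschitz_on UNIV pexc"
  "!!t. \<bar>dprof t\<bar> <= K" "!!t. \<bar>pexc t\<bar> <= K" "!!t. \<bar>psi t\<bar> <= K" "!!t. \<bar>gam t\<bar> <= K" "!!t. \<bar>dgam t\<bar> <= K"
  "!!t. \<bar>t*dgam t\<bar> <= K" "!!t. \<bar>t*((1 - (dprof t)^2)/2)\<bar> <= K" "!!t. \<bar>prof t - \<bar>t\<bar>\<bar> <= K"
  using profile_bounds by blast
 obtain \<Lambda> where \<Lambda>: "\<Lambda> > 0" "!!x p. x \<in> \<Omega> ==> p \<in> sub x ==> norm p <= \<Lambda>" using slope_bound by blast
 obtain Kc where Kc: "Kc > 0" "Kc-lipschitz_on UNIV dcut" "!!t. \<bar>dcut t\<bar> <= Kc" using dcut_bounds by blast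
 obtain Cr where Cr: "Cr > 0" "!!x. x \<in> \<Omega> ==> x \<notin> singular_set ==> (v has_derivative (%w. slope x\<bullet>w)) (at x)"
  "!!x. x \<in> \<Omega> ==> x \<notin> singular_set ==> lip_at slope x (Cr/infdist x vertices)"
  using slope_regularity[OF r] by blast
 have "ridge_system \<Omega> N a \<sigma> v E (%e. fst (g e)) (%e. snd (g e)) c K \<Lambda> Kc Cr"
 proof (intro ridge_system.intro ridge_system_axioms.intro ma_solution_axioms)
  show "rhombic e (fst (g e)) (snd (g e)) c" if "e \<in> E" for e by (rule rhombic_mono[OF c1(2)[OF that] c(2)])
  show "fat c (fst e) (snd e) \<inter> fat c (fst e') (snd e') = {}" if "e \<in> E" "e' \<in> E" "e ~= e'" for e e'
   using c2(2)[of "(e, e')"] that fat_mono[OF c(3), of "fst e" "snd e"] fat_mono[OF c(3), of "fst e'" "snd e'"]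
   unfolding Q_def by auto
 qed (fact finE E_ridge E_all c(1) K \<Lambda> Kc Cr)+
 then show ?thesis by blast
qed

end

context ridge_system
begin

text \<open>All left-hand sides tend to 0 with \<eta>. The right-hand sides are positive because
  atoms are distinct, lie in the open set \<Omega>, and are never inside a ridge.\<close>

lemma eventually_small: "\<forall>\<^sub>F \<eta> in at_right 0. small_ridge_system \<Omega> N a \<sigma> v E mm kk c K \<Lambda> Kc Cr \<eta>"
proof -
 have lim: "((%\<eta>. k*(rho*\<eta>^3) + 2*(\<eta>*b)) \<longlongrightarrow> 0) (at_right 0)" for k b :: real
 proof -
  have "((%\<eta>. k*(rho*\<eta>^3) + 2*(\<eta>*b)) \<longlongrightarrow> k*(rho*0^3) + 2*(0*b)) (at_right 0)"
   by (intro tendsto_intros)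
  then show ?thesis by simp
 qed
 have small: "\<forall>\<^sub>F \<eta> in at_right 0. k*(rho*\<eta>^3) + 2*(\<eta>*b) < \<delta>" if "\<delta> > 0" for k b \<delta> :: real
  using order_tendstoD(2)[OF lim that] .
 have 1: "\<forall>\<^sub>F \<eta> in at_right 0. \<forall>w\<in>vertices. \<forall>w'\<in>vertices. w ~= w' --> 12*(rho*\<eta>^3) < norm (w - w')"
 proof (intro eventually_ball_finite vertices_props(1) ballI)
  fix w w' assume "w \<in> vertices" "w' \<in> vertices"
  show "\<forall>\<^sub>F \<eta> in at_right 0. w ~= w' --> 12*(rho*\<eta>^3) < norm (w - w')"
   using small[of "norm (w - w')" 12 0] by (cases "w = w'") auto
 qed
 obtain \<delta> where \<delta>: "\<delta> > 0" "!!w. w \<in> vertices ==> cball w \<delta> \<subseteq> \<Omega>" using vertex_radius by blast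
 have 2: "\<forall>\<^sub>F \<eta> in at_right 0. 6*(rho*\<eta>^3) < \<delta>" using small[OF \<delta>(1), of 6 0] by simp
 have 3: "\<forall>\<^sub>F \<eta> in at_right 0. \<forall>e\<in>E. \<forall>u\<in>vertices. u ~= fst e --> u ~= snd e -->
   5*(rho*\<eta>^3) + 2*(\<eta>*((len e)^2) powr (2/3)) < infdist u (closed_segment (fst e) (snd e))"
 proof (intro eventually_ball_finite finE vertices_props(1) ballI)
  fix e u assume e: "e \<in> E" and u: "u \<in> vertices"
  show "\<forall>\<^sub>F \<eta> in at_right 0. u ~= fst e --> u ~= snd e -->
   5*(rho*\<eta>^3) + 2*(\<eta>*((len e)^2) powr (2/3)) < infdist u (closed_segment (fst e) (snd e))"
  proof (cases "u = fst e \<or> u = snd e")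
   case False
   then have "u \<notin> closed_segment (fst e) (snd e)"
    using vertex_not_in_ridge[OF E_ridge[OF e] u] by (simp add: open_segment_def)
   then have "0 < infdist u (closed_segment (fst e) (snd e))" by (intro infdist_pos_not_in_closed) auto
   from small[OF this, of 5 "((len e)^2) powr (2/3)"] show ?thesis by (rule eventually_mono) simp
  qed auto
 qed
 have 4: "\<forall>\<^sub>F \<eta> in at_right (0 :: real). 0 < \<eta>" by (rule eventually_at_right_less)
 show ?thesis using 1 2 3 4
 proof eventually_elim
  case (elim \<eta>)
  show ?case
  proof (intro small_ridge_system.intro small_ridge_system_axioms.intro ridge_system_axioms)
   show "ball w (6*(rho*\<eta>^3)) \<subseteq> \<Omega>" if "w \<in> vertices" for w
    using \<delta>(2)[OF that] elim(2) by (meson ball_subset_cball less_imp_le order_trans subset_ball)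
   show "5*(rho*\<eta>^3) + 2*(\<eta>*((len e)^2) powr (2/3)) <= norm (u - z)"
    if "e \<in> E" "u \<in> vertices" "u ~= fst e" "u ~= snd e" "z \<in> closed_segment (fst e) (snd e)" for e u z
   proof -
    have "5*(rho*\<eta>^3) + 2*(\<eta>*((len e)^2) powr (2/3)) < infdist u (closed_segment (fst e) (snd e))"
     using elim(3) that by blast
    also have "\<dots> <= dist u z" by (rule infdist_le[OF that(5)])
    finally show ?thesis by (simp add: dist_norm)
   qed
  qed (use elim in auto)
 qed
qed

end

section \<open>Competitors and conclusion\<close>

definition bounded_competitor :: "(real^2) set => (real^2 => real) => real => real => bool" where
 "bounded_competitor \<Omega> v0 h B \<longleftrightarrow> (\<exists>u\<in>W12 \<Omega>. \<exists>v\<in>W2inf \<Omega>. continuous_on (closure \<Omega>) v \<and> (\<forall>x\<in>frontier \<Omega>. v x = 0) \<and>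
   energy \<Omega> v0 h u v <= ennreal B)"

lemma (in ma_solution) construction:
 assumes r: "r > 0" "!!b. b \<in> frontier \<Omega> ==> \<exists>\<nu>. norm \<nu> = 1 \<and> cball (b - r *R \<nu>) r \<subseteq> closure \<Omega>"
 obtains C h0 where "h0 > 0"
  "!!h. 0 < h ==> h < h0 ==> bounded_competitor \<Omega> v h (C*h powr (5/3))"
proof -
 obtain E mm kk c K \<Lambda> Kc Cr where "ridge_system \<Omega> N a \<sigma> v E mm kk c K \<Lambda> Kc Cr" using ridge_system_exists[OF r] by blast
 then interpret R: ridge_system \<Omega> N a \<sigma> v E mm kk c K \<Lambda> Kc Cr .
 obtain \<eta>0 where \<eta>0: "\<eta>0 > 0" "!!\<eta>. 0 < \<eta> ==> \<eta> < \<eta>0 ==> small_ridge_system \<Omega> N a \<sigma> v E mm kk c K \<Lambda> Kc Cr \<eta>"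
  using R.eventually_small unfolding eventually_at_right_field by blast
 obtain B where B: "B > 0" "!!x. x \<in> \<Omega> ==> norm x <= B" using bounded_\<Omega> unfolding bounded_pos by blast
 have D: "norm (x - w) < 2*B + 1" if "x \<in> \<Omega>" "w \<in> vertices" for x w
  using norm_triangle_ineq4[of x w] B(2)[of x] B(2)[of w] that vertices_props(2) by force
 show thesis
 proof (rule that)
  show "\<eta>0^3 > 0" using \<eta>0(1) by simp
  fix h :: real assume h: "0 < h" "h < \<eta>0^3"
  \<comment> \<open>With the cube root the cut-off radius becomes \<open>rho * h\<close>, and the
    condition \<open>\<eta> < \<eta>0\<close> reads \<open>h < \<eta>0^3\<close>.\<close>
  define \<eta> where "\<eta> = root 3 h"
  have \<eta>: "\<eta>^3 = h" "\<eta> > 0" using h by (auto simp: \<eta>_def)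
  then have "\<eta> < \<eta>0" using h(2) \<eta>0(1) by (metis less_imp_le power_less_imp_less_base)
  from \<eta>0(2)[OF \<eta>(2) this] interpret S: small_ridge_system \<Omega> N a \<sigma> v E mm kk c K \<Lambda> Kc Cr \<eta> .
  have "energy \<Omega> v (\<eta>^3) S.u S.V <= ennreal (R.energy_const (2*B + 1)*(\<eta>^3) powr (5/3))"
   by (rule S.energy_bound) (use B(1) D in auto)
  then have "energy \<Omega> v h S.u S.V <= ennreal (R.energy_const (2*B + 1)*h powr (5/3))" unfolding \<eta>(1) .
  then show "bounded_competitor \<Omega> v h (R.energy_const (2*B + 1)*h powr (5/3))"
   unfolding bounded_competitor_def using S.corrugation_energy(1,2) S.V_boundary by blast
 qed
qed

lemma has_weak_partial_cong:
 assumes "!!x. x \<in> \<Omega> ==> f x = g x" shows "has_weak_partial \<Omega> i f = has_weak_partial \<Omega> i g"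
proof -
 have "has_weak_partial \<Omega> i g k" if "has_weak_partial \<Omega> i f k" "!!x. x \<in> \<Omega> ==> f x = g x" for f g k
 proof -
  have "locally_integrable \<Omega> g" unfolding locally_integrable_def
  proof (intro allI impI)
   fix K assume K: "compact K" "K \<subseteq> \<Omega>"
   then have "set_integrable lebesgue K f" using that(1) by (simp add: has_weak_partial_def locally_integrable_def)
   moreover have "(%x. indicat_real K x *R f x) = (%x. indicat_real K x *R g x)"
    using that(2) K(2) by (auto simp: indicator_def fun_eq_iff)
   ultimately show "set_integrable lebesgue K g" by (simp add: set_integrable_def)
  qed
  moreover have "(LINT x:\<Omega>|lebesgue. f x*k x) = (LINT x:\<Omega>|lebesgue. g x*k x)" for k
   unfolding set_lebesgue_integral_def
   by (rule Bochner_Integration.integral_cong) (use that(2) in \<open>auto simp: indicator_def\<close>)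
  ultimately show ?thesis using that(1) by (simp add: has_weak_partial_def)
 qed
 then show ?thesis using assms by (intro ext iffI) metis+
qed

text \<open>Weak derivatives are chosen from a predicate that sees only the values in \<Omega>, so
  the chosen gradients are equal as functions.\<close>

lemma energy_cong: assumes "!!x. x \<in> \<Omega> ==> v0 x = v1 x" shows "energy \<Omega> v0 h u v = energy \<Omega> v1 h u v"
proof -
 have "grad \<Omega> v0 = grad \<Omega> v1"
  unfolding grad_def[abs_def] weak_partial_def using has_weak_partial_cong[of \<Omega> v0 v1, OF assms] by simp
 then show ?thesis by (simp add: energy_def)
qed

text \<open>The trial state for \<open>h\<close> bounded away from 0: it has no bending energy, and
  its strain is the tensor square of a bounded gradient.\<close>

lemma energy_zero_competitor: assumes \<Omega>: "open \<Omega>" "bounded \<Omega>" and v0: "L0-lipschitz_on \<Omega> v0"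
  "AE x\<in>\<Omega> in lebesgue. (v0 has_derivative (%w. G0 x\<bullet>w)) (at x)"
  and \<Lambda>: "AE x\<in>\<Omega> in lebesgue. norm (G0 x) <= \<Lambda>"
 shows "(%x. 0) \<in> W12 \<Omega>" (is ?A) "(%x. 0) \<in> W2inf \<Omega>" (is ?B) "energy \<Omega> v0 h (%x. 0) (%x. 0) <= ennreal (\<Lambda>^4*measure lebesgue \<Omega>)" (is ?C)
proof -
 have l0: "0-lipschitz_on \<Omega> (%x. 0 :: real)" "0-lipschitz_on \<Omega> (%x. 0 :: real^2)" by (auto intro: lipschitz_on_constant)
 show ?A by (rule W12_lipschitz[OF \<Omega> l0(2)])
 have S: "AE x in lebesgue. x \<in> \<Omega> -->
   norm (0 + transpose (0 :: real^2^2) + tensor 0 0 - tensor (G0 x) (G0 x)) <= \<Lambda>^2" using \<Lambda>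
 proof eventually_elim
  case (elim x)
  have z: "0 + transpose (0 :: real^2^2) + tensor 0 0 - tensor (G0 x) (G0 x) = - tensor (G0 x) (G0 x)"
   by (simp add: transpose_def tensor_def vec_eq_iff)
  show ?case
  proof
   assume "x \<in> \<Omega>"
   then have "norm (G0 x) <= \<Lambda>" using elim by blast
   then show "norm (0 + transpose (0 :: real^2^2) + tensor 0 0 - tensor (G0 x) (G0 x)) <= \<Lambda>^2"
    unfolding z norm_minus_cancel norm_tensor power2_eq_square by (intro mult_mono) (auto intro: order_trans[OF norm_ge_zero])
  qed
 qed
 have e: "!!x. x \<in> \<Omega> ==> ((%x. 0 :: real) has_derivative (%w. (0 :: real^2)\<bullet>w)) (at x)"
  "!!x. x \<in> \<Omega> ==> lip_at (%x :: real^2. 0 :: real^2) x 0"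
  "AE x\<in>\<Omega> in lebesgue. ((%x. 0 :: real^2) has_derivative (%w. (0 :: real^2^2) *v w)) (at x)"
  by (simp_all add: lip_at_const)
 note E = energy_le_of_classical_bounds[where G = "%_. 0" and U = "%_. 0" and M = "%_. 0" and S = "%_. \<Lambda>^2",
   OF \<Omega> v0 l0(1) e(1) l0(2) e(2) l0(2) e(3) S]
 show ?B by (rule E(1))
 have "energy \<Omega> v0 h (%x. 0) (%x. 0) <= (\<integral>\<^sup>+x\<in>\<Omega>. ennreal ((\<Lambda>^2)^2 + h^2*(4*0^2)) \<partial>lebesgue)"
  by (rule E(2))
 also have "\<dots> = ennreal (\<Lambda>^4)*emeasure lebesgue \<Omega>"
  using \<Omega>(1) by (simp add: nn_integral_cmult_indicator power_mult[symmetric])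
 also have "\<dots> = ennreal (\<Lambda>^4*measure lebesgue \<Omega>)"
  using emeasure_eq_measure2[OF lmeasurable_open[OF \<Omega>(2,1)]] by (simp add: ennreal_mult)
 finally show ?C .
qed

theorem proposition3p2:
  fixes \<Omega> :: "(real ^ 2) set" and N :: nat and a :: "nat \<Rightarrow> real ^ 2" and \<sigma> :: "nat \<Rightarrow> real"
  assumes "convex \<Omega>" and "open \<Omega>" and "bounded \<Omega>" and "C11_boundary \<Omega>"
    and "\<And>i. i \<in> {1..N} \<Longrightarrow> a i \<in> \<Omega>" and "inj_on a {1..N}"
    and "\<And>i. i \<in> {1..N} \<Longrightarrow> \<sigma> i > 0"
  shows "\<exists>C>0. \<forall>v0. monge_ampere_solution \<Omega> (dirac_sum N a \<sigma>) v0 \<longrightarrow>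
           (\<forall>h>0. \<exists>u\<in>W12 \<Omega>. \<exists>v\<in>W2inf \<Omega>.
              continuous_on (closure \<Omega>) v \<and> (\<forall>x\<in>frontier \<Omega>. v x = 0) \<and>
              energy \<Omega> v0 h u v \<le> ennreal (C * h powr (5/3)))"
proof -
 have "\<exists>C>0. \<forall>v0. monge_ampere_solution \<Omega> (dirac_sum N a \<sigma>) v0 -->
   (\<forall>h>0. bounded_competitor \<Omega> v0 h (C*h powr (5/3)))"
 \<comment> \<open>The constant has to be fixed before \<open>v0\<close>, so it is taken from one
   solution \<open>v1\<close>; if there is none, nothing is claimed.\<close>
 proof (cases "\<exists>v1. monge_ampere_solution \<Omega> (dirac_sum N a \<sigma>) v1")
  case False
  then show ?thesis by (intro exI[of _ 1]) auto
 next
  case True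
  then obtain v1 where v1: "monge_ampere_solution \<Omega> (dirac_sum N a \<sigma>) v1" by blast
  show ?thesis
  \<comment> \<open>Without atoms \<open>v0\<close> vanishes in \<Omega>, and the zero state has
    energy 0.\<close>
  proof (cases "N = 0")
   case True
   show ?thesis
   proof (intro exI[of _ 1] conjI allI impI)
    fix v0 and h :: real assume v0: "monge_ampere_solution \<Omega> (dirac_sum N a \<sigma>) v0"
    interpret D: dirichlet_solution \<Omega> N a \<sigma> v0 by unfold_locales (use assms v0 in auto)
    have l: "0-lipschitz_on \<Omega> (%x :: real^2. 0 :: real)" by (auto intro: lipschitz_on_constant)
    have "AE x\<in>\<Omega> in lebesgue. ((%x. 0) has_derivative (%w. (0 :: real^2)\<bullet>w)) (at x)" by simp
    moreover have "AE x\<in>\<Omega> in lebesgue. norm (0 :: real^2) <= 0" by simp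
    ultimately have Z: "(%x. 0) \<in> W12 \<Omega>" "(%x. 0) \<in> W2inf \<Omega>" "energy \<Omega> (%x. 0) h (%x. 0) (%x. 0) <= ennreal (0^4*measure lebesgue \<Omega>)"
     by (rule energy_zero_competitor[OF assms(2,3) l])+
    then have 0: "(%x. 0) \<in> W12 \<Omega>" "(%x. 0) \<in> W2inf \<Omega>" "energy \<Omega> (%x. 0) h (%x. 0) (%x. 0) <= 0" by simp_all
    have "energy \<Omega> v0 h (%x. 0) (%x. 0) <= 0"
     using 0(3) energy_cong[of \<Omega> v0 "%x. 0"] D.zero_if_no_atoms[OF True] by simp
    then have "energy \<Omega> v0 h (%x. 0) (%x. 0) <= ennreal (1*h powr (5/3))" by simp
    then show "bounded_competitor \<Omega> v0 h (1*h powr (5/3))"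
     using 0(1,2) unfolding bounded_competitor_def by (intro bexI[of _ "%x. 0"]) auto
   qed simp
  next
   case False
   interpret M: ma_solution \<Omega> N a \<sigma> v1 by unfold_locales (use assms v1 False in auto)
   obtain r where r: "r > 0" "!!b. b \<in> frontier \<Omega> ==> \<exists>\<nu>. norm \<nu> = 1 \<and> cball (b - r *R \<nu>) r \<subseteq> closure \<Omega>"
    using C11_interior_ball[OF assms(4,2,3)] by blast
   obtain C1 h0 where h0: "h0 > 0" and small: "!!h. 0 < h ==> h < h0 ==> bounded_competitor \<Omega> v1 h (C1*h powr (5/3))"
   proof (rule M.construction[OF r])
    fix C h0 :: real
    assume "h0 > 0" and "!!h. 0 < h ==> h < h0 ==> bounded_competitor \<Omega> v1 h (C*h powr (5/3))"
    then show thesis by (rule that)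
   qed
   obtain \<Lambda> where \<Lambda>: "\<Lambda> > 0" "!!x p. x \<in> \<Omega> ==> p \<in> subdifferential \<Omega> v1 x ==> norm p <= \<Lambda>" using M.slope_bound by blast
   obtain Cr where deriv: "!!x. x \<in> \<Omega> ==> x \<notin> M.singular_set ==> (v1 has_derivative (%w. M.slope x\<bullet>w)) (at x)"
    using M.slope_regularity[OF r] by blast
   have "M.singular_set \<in> null_sets lebesgue" using M.negligible_singular_set by (simp add: negligible_iff_null_sets)
   from AE_not_in[OF this] have ae: "AE x\<in>\<Omega> in lebesgue. (v1 has_derivative (%w. M.slope x\<bullet>w)) (at x)"
    by eventually_elim (use deriv in blast)
   have lip: "\<Lambda>-lipschitz_on \<Omega> v1"
    using M.lipschitz_if_slopes_bounded[OF \<Lambda>(2)] \<Lambda>(1) by (intro lipschitz_onI) (auto simp: dist_norm)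
   have bd: "AE x\<in>\<Omega> in lebesgue. norm (M.slope x) <= \<Lambda>" using \<Lambda>(2) M.slope_sub by simp
   define A where "A = \<Lambda>^4*measure lebesgue \<Omega>"
   note zero = energy_zero_competitor[OF assms(2,3) lip ae bd, folded A_def]
   have A: "A >= 0" using \<Lambda>(1) by (simp add: A_def)
   \<comment> \<open>The last term serves \<open>h >= h0\<close>, where the zero state costs at most
     \<open>A = A / h0 powr (5/3) * h0 powr (5/3)\<close>; the 1 keeps \<open>C\<close>
     positive.\<close>
   define C where "C = 1 + \<bar>C1\<bar> + A/h0 powr (5/3)"
   have "0 <= A/h0 powr (5/3)" using A by simp
   then have C: "C > 0" "C1 <= C" "A/h0 powr (5/3) <= C" unfolding C_def by linarith+
   show ?thesis
   proof (intro exI[of _ C] conjI allI impI C(1))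
    fix v0 and h :: real assume v0: "monge_ampere_solution \<Omega> (dirac_sum N a \<sigma>) v0" and h: "h > 0"
    have "ma_solution \<Omega> N a \<sigma> v0" by unfold_locales (use assms v0 False in auto)
    \<comment> \<open>By uniqueness \<open>v0\<close> and \<open>v1\<close> agree in \<Omega> and
      have the same energies, so the constant found for \<open>v1\<close> serves for every
      \<open>v0\<close>.\<close>
    from energy_cong[OF ma_solution_unique[OF M.ma_solution_axioms this]] have eq: "bounded_competitor \<Omega> v0 h B = bounded_competitor \<Omega> v1 h B" for B
     by (simp add: bounded_competitor_def)
    show "bounded_competitor \<Omega> v0 h (C*h powr (5/3))" unfolding eq
    proof (cases "h < h0")
     case True
     have "ennreal (C1*h powr (5/3)) <= ennreal (C*h powr (5/3))" using C(2) by (intro ennreal_leI mult_right_mono) auto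
     then show "bounded_competitor \<Omega> v1 h (C*h powr (5/3))"
      using small[OF h True] unfolding bounded_competitor_def by (meson order_trans)
    next
     case False
     have "A = A/h0 powr (5/3)*h0 powr (5/3)" using h0 by simp
     also have "\<dots> <= C*h powr (5/3)" using C False h0 by (intro mult_mono powr_mono2) auto
     finally have "energy \<Omega> v1 h (%x. 0) (%x. 0) <= ennreal (C*h powr (5/3))"
      using zero(3)[of h] by (meson ennreal_leI order_trans)
     then show "bounded_competitor \<Omega> v1 h (C*h powr (5/3))"
      using zero(1,2) unfolding bounded_competitor_def by (intro bexI[of _ "%x. 0"]) auto
    qed
   qed
  qed
 qed
 then show ?thesis unfolding bounded_competitor_def .
qed

end
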